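(* Let $X$ be a complex manifold and let $\mathscr{E}$ be a short exact sequence $$0\longrightarrow F\xrightarrow{\ i\ }E\xrightarrow{\ p\ }H\longrightarrow 0$$ of holomorphic vector bundles over $X$, equipped with Hermitian metrics $h_F$, $h$ and $h_H$ respectively, where the metric $h_F$ on $F$ is the restriction of the metric $h$ on $i(F)\subset E$, and the metric $h_H$ on $H$ is defined by the $C^\infty$ isomorphism between $H$ and the orthogonal complement $i(F)^{\perp}$ of $i(F)$ in $E$. Let $A$ be the second fundamental form of $i(F)\subset E$, and let $\Theta_H$ be the curvature of the canonical connection of $(H,h_H)$. If $F$ is a line bundle, then the generating function $\tilde c_t(\mathscr{E};h)=\sum_{k=1}^{r}t^{k}\,\tilde c_k(\mathscr{E};h,h_F,h_H)$ ($r=\mathrm{rk}\,E$) of the Bott-Chern forms of $\mathscr{E}$ is given by $$\tilde{c}_t(\mathscr{E};h)=-t\,c_t(H,h_H)\,\log\left(1+\frac{\sqrt{-1}}{2\pi}\,\mathrm{tr}\left\{\left(I+\frac{\sqrt{-1}}{2\pi}\,t\,\Theta_{H}\right)^{-1}t\,A\wedge A^{*}\right\}\right).$$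
   Context: For a Hermitian holomorphic bundle $(E,h)$ of rank $r$, the canonical connection $\nabla$ has curvature $\Theta=\bar\partial(h^{-1}\partial h)$ in a local holomorphic trivialization; $c(E,h)=\det\left(I+\frac{\sqrt{-1}}{2\pi}\Theta\right)=\sum_{k=0}^r c_k(E,h)$ and $c_t(E,h)=\sum_{k=0}^{r}t^kc_k(E,h)$, with $t$ a formal variable. Let $P_F$, $P_H$ be the orthogonal projections of $E$ onto $i(F)$, $i(F)^\perp$; there is a $C^\infty$ isometric isomorphism $i^{*}\oplus p:E\simeq F\oplus H$ ($*$ denotes adjoints with respect to the metrics). The second fundamental form of $i(F)$ in $E$ is the $(1,0)$-form $A=P_H\nabla(P_F)$ with values in $\mathrm{End}(F,H)=\mathrm{Hom}(F,H)$, and $A^{*}=-P_F\nabla(P_H)$ is its adjoint, a $(0,1)$-form with values in $\mathrm{Hom}(H,F)$; thus $A\wedge A^{*}$ is an $\mathrm{End}(H)$-valued $(1,1)$-form. In a local unitary frame $e_1$ of $F$, $e_2,\dots,e_r$ of $H$ with $A(e_1)=\sum_{i\ge2}a_ie_i$, $A\wedge A^{*}$ has matrix entries $a_i\wedge\bar a_j$. Bott-Chern forms: $\tilde{\mathcal{A}}(X,\mathbb{C})=\mathcal{A}(X,\mathbb{C})/(\mathrm{Im}\,\partial+\mathrm{Im}\,\bar\partial)$, where $\mathcal{A}(X,\mathbb{C})$ is the space of sums of smooth complex forms of type $(k,k)$. The Bott-Chern forms $\tilde c_k(\mathscr{E};h,h_F,h_H)\in\tilde{\mathcal{A}}(X,\mathbb{C})$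 satisfy $$c_t(E,h)-c_t(F\oplus H,h_F\oplus h_H)=\frac{\sqrt{-1}}{2\pi}\,\bar\partial\partial\,\tilde c_t(\mathscr{E};h),$$ are functorial under pullback by holomorphic maps, and vanish when $\mathscr{E}$ splits holomorphically with $h=h_F\oplus h_H$. For metrics on $F$ and $H$ induced by $h$ as in the claim, the Bott-Chern form is given by Bott and Chern's formula $$\tilde c_t(\mathscr{E};h)=\int_0^1\frac{D_t(u)-D_t(0)}{u}\,du,\qquad D_t(u)=\sum_{k=1}^r t^kD_k(u),$$ where $D_k(u)$ is the coefficient of $\lambda$ in $\mathrm{tr}\,\Lambda^{k}\left(\frac{\sqrt{-1}}{2\pi}\Theta(u)+\lambda P_F\right)$ and $\Theta(u)$ is the curvature of the connection $\nabla_u=\nabla+(u-1)A$ on $E$, $0\le u\le1$. For a nilpotent element $a$, $-\log(1-a)=a+\frac{a^2}{2}+\cdots$ (finite sum), and $(I+\frac{\sqrt{-1}}{2\pi}t\Theta_H)^{-1}$ is the (finite) geometric series. *)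

theory Defs
  imports
    "HOL-Analysis.Analysis"
    "Jordan_Normal_Form.Determinant"
    "Jordan_Normal_Form.Gauss_Jordan_Elimination"
    "Jordan_Normal_Form.DL_Submatrix"
begin

unbundle no vec_syntax

text \<open>
  A mixed complex-valued form on a real vector space assigns to every list of vectors a complex
  number; its restriction to lists of length \<open>k\<close> is the component of degree \<open>k\<close>, a real-multilinear
  alternating map.
\<close>

definition alternating :: "('v::real_vector list \<Rightarrow> complex) \<Rightarrow> bool" where
  "alternating f \<longleftrightarrow>
     (\<forall>us vs. linear (\<lambda>v. f (us @ v # vs))) \<and> (\<forall>us v vs. f (us @ v # v # vs) = 0)"

text \<open>
  The exterior product is the signed shuffle product (without factorials, so that
  \<open>(a \<and> b)(v, w) = a(v) b(w) - a(w) b(v)\<close> for 1-forms). The recursion is the antiderivation rule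
  for the contraction with the first vector.
\<close>

fun wedge :: "('v list \<Rightarrow> complex) \<Rightarrow> ('v list \<Rightarrow> complex) \<Rightarrow> 'v list \<Rightarrow> complex" where
  "wedge f g [] = f [] * g []"
| "wedge f g (v # vs) =
     wedge (\<lambda>ws. f (v # ws)) g vs + wedge (\<lambda>ws. (-1) ^ length ws * f ws) (\<lambda>ws. g (v # ws)) vs"

lemma wedge_add_left: "wedge (\<lambda>ws. f ws + f' ws) g vs = wedge f g vs + wedge f' g vs"
  by (induction vs arbitrary: f f' g) (simp_all add: algebra_simps)

lemma wedge_add_right: "wedge f (\<lambda>ws. g ws + g' ws) vs = wedge f g vs + wedge f g' vs"
  by (induction vs arbitrary: f g g') (simp_all add: algebra_simps)

lemma wedge_mult_left: "wedge (\<lambda>ws. c * f ws) g vs = c * wedge f g vs"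
proof (induction vs arbitrary: f g)
  case (Cons v vs)
  have "wedge (\<lambda>ws. (-1) ^ length ws * (c * f ws)) (\<lambda>ws. g (v # ws)) vs =
        wedge (\<lambda>ws. c * ((-1) ^ length ws * f ws)) (\<lambda>ws. g (v # ws)) vs"
    by (simp add: mult.left_commute)
  then show ?case by (simp only: wedge.simps Cons.IH distrib_left)
qed simp

lemma wedge_mult_right: "wedge f (\<lambda>ws. c * g ws) vs = c * wedge f g vs"
  by (induction vs arbitrary: f g) (simp_all add: algebra_simps)

lemma wedge_zero_left [simp]: "wedge (\<lambda>ws. 0) g vs = 0"
  using wedge_mult_left[of 0 "\<lambda>ws. 0" g vs] by simp

lemma wedge_zero_right [simp]: "wedge f (\<lambda>ws. 0) vs = 0"
  using wedge_mult_right[of f 0 "\<lambda>ws. 0" vs] by simp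

lemma wedge_parity:
  "wedge (\<lambda>ws. (-1) ^ length ws * f ws) (\<lambda>ws. (-1) ^ length ws * g ws) vs =
     (-1) ^ length vs * wedge f g vs"
proof (induction vs arbitrary: f g)
  case (Cons v vs)
  have 1: "(\<lambda>ws. (-1) ^ length (v # ws) * f (v # ws)) =
           (\<lambda>ws. (-1) * ((-1) ^ length ws * f (v # ws)))"
    and 2: "(\<lambda>ws. (-1) ^ length (v # ws) * g (v # ws)) =
           (\<lambda>ws. (-1) * ((-1) ^ length ws * g (v # ws)))"
    by auto
  show ?case
    by (simp only: wedge.simps 1 2 wedge_mult_left wedge_mult_right Cons.IH) (simp add: algebra_simps)
qed simp

lemma wedge_assoc: "wedge (wedge f g) h vs = wedge f (wedge g h) vs"
proof (induction vs arbitrary: f g h)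
  case (Cons v vs)
  have p: "(\<lambda>ws. (-1) ^ length ws * wedge f g ws) =
      wedge (\<lambda>ws. (-1) ^ length ws * f ws) (\<lambda>ws. (-1) ^ length ws * g ws)"
    by (rule ext) (simp only: wedge_parity)
  show ?case
    by (simp only: wedge.simps p wedge_add_left wedge_add_right Cons.IH) (simp add: add.assoc)
qed simp

lemma wedge_one_left: "wedge (\<lambda>ws. if ws = [] then c else 0) g vs = c * g vs"
proof (induction vs arbitrary: g)
  case (Cons v vs)
  have "(\<lambda>ws. (-1) ^ length ws * (if ws = [] then c else 0)) = (\<lambda>ws::'a list. if ws = [] then c else 0)"
    by auto
  then show ?case using Cons.IH by simp
qed simp

lemma wedge_one_right: "wedge f (\<lambda>ws. if ws = [] then c else 0) vs = c * f vs"
  by (induction vs arbitrary: f) simp_all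

lemma wedge_commute_parity:
  assumes "\<And>ws. (-1) ^ length ws * f ws = (-1) ^ a * f ws"
    and "\<And>ws. (-1) ^ length ws * g ws = (-1) ^ b * g ws"
  shows "wedge f g vs = (-1) ^ (a * b) * wedge g f vs"
  using assms
proof (induction vs arbitrary: f g a b)
  case (Cons v vs)
  have f': "(-1) ^ length ws * f (v # ws) = (-1) ^ Suc a * f (v # ws)" for ws
    using Cons.prems(1)[of "v # ws"] by simp (metis minus_equation_iff)
  have g': "(-1) ^ length ws * g (v # ws) = (-1) ^ Suc b * g (v # ws)" for ws
    using Cons.prems(2)[of "v # ws"] by simp (metis minus_equation_iff)
  have 1: "wedge (\<lambda>ws. f (v # ws)) g vs = (-1) ^ (Suc a * b) * wedge g (\<lambda>ws. f (v # ws)) vs"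
    by (rule Cons.IH[OF f' Cons.prems(2)])
  have 2: "wedge f (\<lambda>ws. g (v # ws)) vs = (-1) ^ (a * Suc b) * wedge (\<lambda>ws. g (v # ws)) f vs"
    by (rule Cons.IH[OF Cons.prems(1) g'])
  have aa: "(-1) ^ a * (-1) ^ a = (1::complex)"
    by (simp flip: power_mult_distrib)
  have "wedge f g (v # vs) =
      (-1) ^ (Suc a * b) * wedge g (\<lambda>ws. f (v # ws)) vs +
      (-1) ^ a * ((-1) ^ (a * Suc b) * wedge (\<lambda>ws. g (v # ws)) f vs)"
    by (simp only: wedge.simps Cons.prems(1) wedge_mult_left 1 2)
  also have "\<dots> = (-1) ^ (a * b) * (wedge (\<lambda>ws. g (v # ws)) f vs +
      (-1) ^ b * wedge g (\<lambda>ws. f (v # ws)) vs)"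
    using aa by (simp add: power_add algebra_simps)
  also have "\<dots> = (-1) ^ (a * b) * wedge g f (v # vs)"
    by (simp only: wedge.simps Cons.prems(2) wedge_mult_left)
  finally show ?case .
next
  case Nil
  show ?case
    using Nil(1)[of "[]"] Nil(2)[of "[]"] by (cases "even a"; cases "even b") auto
qed

lemma alternating_linear: "alternating f \<Longrightarrow> linear (\<lambda>v. f (us @ v # vs))"
  unfolding alternating_def by blast

lemma alternating_repeat: "alternating f \<Longrightarrow> f (us @ v # v # vs) = 0"
  unfolding alternating_def by blast

lemma alternating_contract: "alternating f \<Longrightarrow> alternating (\<lambda>ws. f (v # ws))"
  using alternating_linear[of f "v # _"] alternating_repeat[of f "v # _"]
  unfolding alternating_def by simp

lemma linear_mult_const: "linear f \<Longrightarrow> linear (\<lambda>v. c * f v)" for c :: complex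
  by (rule linearI) (simp_all add: linear_add linear_scale algebra_simps)

lemma alternating_parity: "alternating f \<Longrightarrow> alternating (\<lambda>ws. (-1) ^ length ws * f ws)"
proof -
  assume f: "alternating f"
  have "linear (\<lambda>v. (-1) ^ (length us + Suc (length vs)) * f (us @ v # vs))" for us vs
    by (rule linear_mult_const[OF alternating_linear[OF f]])
  then show ?thesis using alternating_repeat[OF f] by (simp add: alternating_def)
qed

lemma wedge_linear:
  assumes "alternating f" "alternating g"
  shows "linear (\<lambda>v. wedge f g (us @ v # vs))"
  using assms
proof (induction us arbitrary: f g)
  case Nil
  have lf: "linear (\<lambda>v. f (v # ws))" and lg: "linear (\<lambda>v. g (v # ws))" for ws
    using alternating_linear[of _ "[]" ws] Nil by simp_all
  show ?case
    by (rule linearI)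
      (simp_all add: linear_add[OF lf] linear_add[OF lg] linear_scale[OF lf] linear_scale[OF lg]
        wedge_add_left wedge_add_right wedge_mult_left wedge_mult_right scaleR_conv_of_real
        algebra_simps)
next
  case (Cons u us)
  have "linear (\<lambda>v. wedge (\<lambda>ws. f (u # ws)) g (us @ v # vs))"
    "linear (\<lambda>v. wedge (\<lambda>ws. (-1) ^ length ws * f ws) (\<lambda>ws. g (u # ws)) (us @ v # vs))"
    using Cons alternating_contract alternating_parity by blast+
  then show ?case by (simp add: linear_compose_add)
qed

lemma wedge_repeat:
  assumes "alternating f" "alternating g"
  shows "wedge f g (us @ v # v # vs) = 0"
  using assms
proof (induction us arbitrary: f g)
  case Nil
  have zf: "f (v # v # ws) = 0" and zg: "g (v # v # ws) = 0" for ws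
    using alternating_repeat[of _ "[]" v ws] Nil by simp_all
  have "(\<lambda>ws. (-1) ^ length (v # ws) * f (v # ws)) = (\<lambda>ws. (-1) * ((-1) ^ length ws * f (v # ws)))"
    by auto
  then show ?case
    by (simp only: append_Nil wedge.simps zf zg wedge_mult_left) simp
next
  case (Cons u us)
  then show ?case by (simp add: alternating_contract alternating_parity)
qed

lemma alternating_wedge: "alternating f \<Longrightarrow> alternating g \<Longrightarrow> alternating (wedge f g)"
  using wedge_linear wedge_repeat unfolding alternating_def by blast

typedef (overloaded) ('v::real_vector) altform = "{f :: 'v list \<Rightarrow> complex. alternating f}"
  morphisms form_app Abs_altform
  by (rule exI[of _ "\<lambda>_. 0"]) (auto simp: alternating_def linear_iff)

setup_lifting type_definition_altform

lift_definition form_const :: "complex \<Rightarrow> 'v::real_vector altform" is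
  "\<lambda>c vs. if vs = [] then c else 0"
  by (auto simp: alternating_def linear_iff)

instantiation altform :: (real_vector) "{ring_1, real_vector}"
begin

lift_definition zero_altform :: "'a altform" is "\<lambda>_. 0"
  by (auto simp: alternating_def linear_iff)

definition one_altform :: "'a altform" where "one_altform = form_const 1"

lift_definition plus_altform :: "'a altform \<Rightarrow> 'a altform \<Rightarrow> 'a altform" is "\<lambda>f g vs. f vs + g vs"
  by (auto simp: alternating_def intro: linear_compose_add)

lift_definition uminus_altform :: "'a altform \<Rightarrow> 'a altform" is "\<lambda>f vs. - f vs"
  by (auto simp: alternating_def intro: linear_compose_neg)

lift_definition minus_altform :: "'a altform \<Rightarrow> 'a altform \<Rightarrow> 'a altform" is "\<lambda>f g vs. f vs - g vs"
  by (auto simp: alternating_def intro: linear_compose_sub)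

lift_definition times_altform :: "'a altform \<Rightarrow> 'a altform \<Rightarrow> 'a altform" is wedge
  by (rule alternating_wedge)

lift_definition scaleR_altform :: "real \<Rightarrow> 'a altform \<Rightarrow> 'a altform" is "\<lambda>c f vs. of_real c * f vs"
  by (auto simp: alternating_def intro: linear_mult_const)

instance
proof
  fix a b c :: "'a altform"
  show "a * b * c = a * (b * c)"
    by transfer (rule ext, rule wedge_assoc)
  show "(a + b) * c = a * c + b * c"
    by transfer (rule ext, rule wedge_add_left)
  show "a * (b + c) = a * b + a * c"
    by transfer (rule ext, rule wedge_add_right)
  show "1 * a = a"
    unfolding one_altform_def by transfer (rule ext, simp only: wedge_one_left mult_1)
  show "a * 1 = a"
    unfolding one_altform_def by transfer (rule ext, simp only: wedge_one_right mult_1)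
  show "(0::'a altform) \<noteq> 1"
    unfolding one_altform_def by transfer (metis zero_neq_one)
qed (transfer; simp add: fun_eq_iff algebra_simps)+

end

text \<open>Forms of even degree are central; they are the commutative ring over which determinants are
  taken and formal variables are adjoined.\<close>

typedef (overloaded) ('v::real_vector) evenform =
  "{w :: 'v altform. \<forall>vs. odd (length vs) \<longrightarrow> form_app w vs = 0}"
  morphisms of_even Abs_evenform
  by (rule exI[of _ 0]) (simp add: zero_altform.rep_eq)

setup_lifting type_definition_evenform

lemma wedge_odd:
  assumes "\<And>vs. odd (length vs) \<Longrightarrow> f vs = 0" "\<And>vs. odd (length vs) \<Longrightarrow> g vs = 0"
    and "odd (length vs)"
  shows "wedge f g vs = 0"
proof -
  have "(\<lambda>ws. (-1) ^ length ws * f ws) = f" "(\<lambda>ws. (-1) ^ length ws * g ws) = g"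
    using assms(1,2) by (auto simp: fun_eq_iff minus_one_power_iff)
  then show ?thesis using wedge_parity[of f g vs] assms(3) by simp
qed

instantiation evenform :: (real_vector) comm_ring_1
begin

lift_definition zero_evenform :: "'a evenform" is 0
  by (simp add: zero_altform.rep_eq)

lift_definition one_evenform :: "'a evenform" is 1
  by (auto simp: one_altform_def form_const.rep_eq)

lift_definition plus_evenform :: "'a evenform \<Rightarrow> 'a evenform \<Rightarrow> 'a evenform" is "(+)"
  by (simp add: plus_altform.rep_eq)

lift_definition uminus_evenform :: "'a evenform \<Rightarrow> 'a evenform" is uminus
  by (simp add: uminus_altform.rep_eq)

lift_definition minus_evenform :: "'a evenform \<Rightarrow> 'a evenform \<Rightarrow> 'a evenform" is "(-)"
  by (simp add: minus_altform.rep_eq)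

lift_definition times_evenform :: "'a evenform \<Rightarrow> 'a evenform \<Rightarrow> 'a evenform" is "(*)"
  by (auto simp: times_altform.rep_eq intro: wedge_odd)

instance
proof
  fix a b c :: "'a evenform"
  show "a * b = b * a"
  proof (transfer, transfer, rule ext)
    fix f g :: "'a list \<Rightarrow> complex" and vs
    assume "\<forall>vs. odd (length vs) \<longrightarrow> f vs = 0" "\<forall>vs. odd (length vs) \<longrightarrow> g vs = 0"
    then show "wedge f g vs = wedge g f vs"
      using wedge_commute_parity[of f 0 g 0 vs] by (simp add: minus_one_power_iff)
  qed
qed (transfer; simp add: algebra_simps)+

end


lift_definition form_deg :: "nat \<Rightarrow> 'v::real_vector altform \<Rightarrow> 'v altform" is
  "\<lambda>k f vs. if length vs = k then f vs else 0"
proof -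
  fix k and f :: "'v list \<Rightarrow> complex"
  assume f: "alternating f"
  have "linear (\<lambda>v. if length (us @ v # vs) = k then f (us @ v # vs) else 0)" for us vs
    using alternating_linear[OF f, of us vs]
    by (cases "length us + Suc (length vs) = k") (simp_all add: linear_zero)
  then show "alternating (\<lambda>vs. if length vs = k then f vs else 0)"
    using alternating_repeat[OF f] by (simp add: alternating_def)
qed

lift_definition form_even :: "'v::real_vector altform \<Rightarrow> 'v altform" is
  "\<lambda>f vs. if even (length vs) then f vs else 0"
proof -
  fix f :: "'v list \<Rightarrow> complex"
  assume f: "alternating f"
  have "linear (\<lambda>v. if even (length (us @ v # vs)) then f (us @ v # vs) else 0)" for us vs
    using alternating_linear[OF f, of us vs]
    by (cases "even (length us + Suc (length vs))") (simp_all add: linear_zero)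
  then show "alternating (\<lambda>vs. if even (length vs) then f vs else 0)"
    using alternating_repeat[OF f] by (simp add: alternating_def)
qed

lift_definition even_part :: "'v::real_vector altform \<Rightarrow> 'v evenform" is form_even
  by (simp add: form_even.rep_eq)

lift_definition even_deg :: "nat \<Rightarrow> 'v::real_vector evenform \<Rightarrow> 'v evenform" is form_deg
  by (auto simp: form_deg.rep_eq)

definition even_const :: "complex \<Rightarrow> 'v::real_vector evenform" where
  "even_const a = even_part (form_const a)"

definition form10 :: "(complex ^ 'n) altform set" where
  "form10 = {w. (\<forall>vs. length vs \<noteq> 1 \<longrightarrow> form_app w vs = 0) \<and>
                (\<forall>a v. form_app w [a *s v] = a * form_app w [v])}"

definition form01 :: "(complex ^ 'n) altform set" where
  "form01 = {w. (\<forall>vs. length vs \<noteq> 1 \<longrightarrow> form_app w vs = 0) \<and>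
                (\<forall>a v. form_app w [a *s v] = cnj a * form_app w [v])}"

definition bidegree :: "nat \<Rightarrow> nat \<Rightarrow> (complex ^ 'n) altform set" where
  "bidegree p q = span {form_const a * prod_list ws * prod_list ws' |a ws ws'.
     length ws = p \<and> set ws \<subseteq> form10 \<and> length ws' = q \<and> set ws' \<subseteq> form01}"

type_synonym ('x, 'n) chart = "'x set \<times> ('x \<Rightarrow> complex ^ 'n)"

definition in_chart :: "('x, 'n) chart \<Rightarrow> ('x \<Rightarrow> 'b) \<Rightarrow> complex ^ 'n \<Rightarrow> 'b" where
  "in_chart c f z = f (inv_into (fst c) (snd c) z)"

primrec Ck_on :: "nat \<Rightarrow> 'a::real_normed_vector set \<Rightarrow> ('a \<Rightarrow> 'b::real_normed_vector) \<Rightarrow> bool" where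
  "Ck_on 0 S f \<longleftrightarrow> continuous_on S f"
| "Ck_on (Suc k) S f \<longleftrightarrow>
     (\<forall>x\<in>S. f differentiable (at x)) \<and> (\<forall>v. Ck_on k S (\<lambda>x. frechet_derivative f (at x) v))"

definition smooth_on :: "'a::real_normed_vector set \<Rightarrow> ('a \<Rightarrow> 'b::real_normed_vector) \<Rightarrow> bool" where
  "smooth_on S f \<longleftrightarrow> (\<forall>k. Ck_on k S f)"

definition holo_on :: "(complex ^ 'n) set \<Rightarrow> (complex ^ 'n \<Rightarrow> complex) \<Rightarrow> bool" where
  "holo_on S f \<longleftrightarrow>
     (\<forall>z\<in>S. \<exists>f'. (f has_derivative f') (at z) \<and> (\<forall>a v. f' (a *s v) = a * f' v))"

definition complex_manifold ::
  "('x::{t2_space, second_countable_topology}, 'n::finite) chart set \<Rightarrow> bool" where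
  "complex_manifold \<A> \<longleftrightarrow>
     (\<Union>c\<in>\<A>. fst c) = UNIV \<and>
     (\<forall>(U, \<phi>)\<in>\<A>. open U \<and> open (\<phi> ` U) \<and> homeomorphism U (\<phi> ` U) \<phi> (inv_into U \<phi>)) \<and>
     (\<forall>(U, \<phi>)\<in>\<A>. \<forall>(V, \<psi>)\<in>\<A>. \<forall>k.
        holo_on (\<phi> ` (U \<inter> V)) (in_chart (U, \<phi>) (\<lambda>x. vec_nth (\<psi> x) k)))"

definition holo_fun :: "('x, 'n::finite) chart set \<Rightarrow> 'x set \<Rightarrow> ('x \<Rightarrow> complex) \<Rightarrow> bool" where
  "holo_fun \<A> W f \<longleftrightarrow> (\<forall>c\<in>\<A>. holo_on (snd c ` (W \<inter> fst c)) (in_chart c f))"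

definition smooth_fun :: "('x, 'n::finite) chart set \<Rightarrow> 'x set \<Rightarrow> ('x \<Rightarrow> complex) \<Rightarrow> bool" where
  "smooth_fun \<A> W f \<longleftrightarrow> (\<forall>c\<in>\<A>. smooth_on (snd c ` (W \<inter> fst c)) (in_chart c f))"

text \<open>
  In a chart \<open>c\<close> a form is a function from points of \<open>X\<close> to forms on \<open>\<complex>\<^sup>n\<close>, the tangent space being
  identified with \<open>\<complex>\<^sup>n\<close> by the coordinates of \<open>c\<close>. A form on \<open>X\<close> is a family indexed by the charts
  of the atlas that is compatible with coordinate changes.
\<close>

type_synonym ('x, 'n) gform = "('x, 'n) chart \<Rightarrow> 'x \<Rightarrow> (complex ^ 'n) altform"

definition d10 :: "(complex ^ 'n::finite \<Rightarrow> complex) \<Rightarrow> complex ^ 'n \<Rightarrow> complex ^ 'n \<Rightarrow> complex" where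
  "d10 f z v = (frechet_derivative f (at z) v - \<i> * frechet_derivative f (at z) (\<i> *s v)) / 2"

definition d01 :: "(complex ^ 'n::finite \<Rightarrow> complex) \<Rightarrow> complex ^ 'n \<Rightarrow> complex ^ 'n \<Rightarrow> complex" where
  "d01 f z v = (frechet_derivative f (at z) v + \<i> * frechet_derivative f (at z) (\<i> *s v)) / 2"

definition alt_deriv ::
  "((complex ^ 'n \<Rightarrow> complex) \<Rightarrow> complex ^ 'n \<Rightarrow> complex ^ 'n \<Rightarrow> complex) \<Rightarrow>
   ('x, 'n::finite) chart \<Rightarrow> ('x \<Rightarrow> (complex ^ 'n) altform) \<Rightarrow> 'x \<Rightarrow> (complex ^ 'n) altform" where
  "alt_deriv \<delta> c w x = Abs_altform (\<lambda>vs. \<Sum>i<length vs. (-1) ^ i *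
     \<delta> (\<lambda>z. form_app (in_chart c w z) (take i vs @ drop (Suc i) vs)) (snd c x) (vs ! i))"

definition del ::
  "('x, 'n::finite) chart \<Rightarrow> ('x \<Rightarrow> (complex ^ 'n) altform) \<Rightarrow> 'x \<Rightarrow> (complex ^ 'n) altform" where
  "del = alt_deriv d10"

definition delbar ::
  "('x, 'n::finite) chart \<Rightarrow> ('x \<Rightarrow> (complex ^ 'n) altform) \<Rightarrow> 'x \<Rightarrow> (complex ^ 'n) altform" where
  "delbar = alt_deriv d01"

definition ext_d ::
  "('x, 'n::finite) chart \<Rightarrow> ('x \<Rightarrow> (complex ^ 'n) altform) \<Rightarrow> 'x \<Rightarrow> (complex ^ 'n) altform" where
  "ext_d c w x = del c w x + delbar c w x"

definition smooth_form ::
  "('x, 'n::finite) chart set \<Rightarrow> nat \<Rightarrow> nat \<Rightarrow> ('x, 'n) gform \<Rightarrow> bool" where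
  "smooth_form \<A> p q w \<longleftrightarrow>
     (\<forall>c\<in>\<A>. \<forall>x\<in>fst c. w c x \<in> bidegree p q) \<and>
     (\<forall>c\<in>\<A>. \<forall>vs. smooth_on (snd c ` fst c) (in_chart c (\<lambda>x. form_app (w c x) vs))) \<and>
     (\<forall>c\<in>\<A>. \<forall>c'\<in>\<A>. \<forall>x\<in>fst c \<inter> fst c'. \<forall>vs. form_app (w c x) vs =
        form_app (w c' x) (map (frechet_derivative (in_chart c (snd c')) (at (snd c x))) vs))"

text \<open>
  Equality in \<open>\<A>(X,\<complex>) / (Im \<partial> + Im \<partial>\<bar>)\<close>. The elements of \<open>Im \<partial>\<close> and \<open>Im \<partial>\<bar>\<close> that are sums of forms of
  type \<open>(k,k)\<close> are the images of sums of forms of type \<open>(k-1,k)\<close> and \<open>(k,k-1)\<close>; these vanish for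
  \<open>k > n\<close>.
\<close>

definition bc_equal ::
  "('x, 'n::finite) chart set \<Rightarrow> ('x, 'n) gform \<Rightarrow> ('x, 'n) gform \<Rightarrow> bool" where
  "bc_equal \<A> a b \<longleftrightarrow> (\<exists>\<eta> \<xi>.
     (\<forall>k. smooth_form \<A> k (Suc k) (\<eta> k)) \<and> (\<forall>k. smooth_form \<A> (Suc k) k (\<xi> k)) \<and>
     (\<forall>c\<in>\<A>. \<forall>x\<in>fst c.
        a c x - b c x = (\<Sum>k<CARD('n). del c (\<eta> k c) x + delbar c (\<xi> k c) x)))"

text \<open>
  A bundle is given by the projection from its total space \<open>'e\<close> and its local trivializations
  \<open>(U, \<tau>)\<close>, where \<open>\<tau>\<close> maps each fibre over \<open>U\<close> bijectively to \<open>\<complex>\<^sup>r\<close>. The trivializations determine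
  the vector space structure of the fibres.
\<close>

type_synonym ('x, 'e) triv = "'x set \<times> ('e \<Rightarrow> complex Matrix.vec)"

record ('x, 'e) vbundle =
  vb_proj :: "'e \<Rightarrow> 'x"
  vb_rank :: nat
  vb_trivs :: "('x, 'e) triv set"

definition fiber :: "('x, 'e) vbundle \<Rightarrow> 'x \<Rightarrow> 'e set" where
  "fiber B x = {e. vb_proj B e = x}"

definition holo_mat ::
  "('x, 'n::finite) chart set \<Rightarrow> 'x set \<Rightarrow> nat \<Rightarrow> nat \<Rightarrow> ('x \<Rightarrow> complex Matrix.mat) \<Rightarrow> bool" where
  "holo_mat \<A> W m n g \<longleftrightarrow> (\<forall>x\<in>W. g x \<in> carrier_mat m n) \<and>
     (\<forall>i<m. \<forall>j<n. holo_fun \<A> W (\<lambda>x. g x $$ (i, j)))"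

definition holo_bundle ::
  "('x::topological_space, 'n::finite) chart set \<Rightarrow> ('x, 'e) vbundle \<Rightarrow> bool" where
  "holo_bundle \<A> B \<longleftrightarrow>
     (\<Union>T\<in>vb_trivs B. fst T) = UNIV \<and>
     (\<forall>(U, \<tau>)\<in>vb_trivs B. open U \<and> (\<forall>x\<in>U. bij_betw \<tau> (fiber B x) (carrier_vec (vb_rank B)))) \<and>
     (\<forall>(U, \<tau>)\<in>vb_trivs B. \<forall>(V, \<sigma>)\<in>vb_trivs B. \<exists>g.
        holo_mat \<A> (U \<inter> V) (vb_rank B) (vb_rank B) g \<and>
        (\<forall>e. vb_proj B e \<in> U \<inter> V \<longrightarrow> \<sigma> e = g (vb_proj B e) *\<^sub>v \<tau> e))"

definition holo_bundle_map ::
  "('x, 'n::finite) chart set \<Rightarrow> ('x, 'e) vbundle \<Rightarrow> ('x, 'f) vbundle \<Rightarrow> ('e \<Rightarrow> 'f) \<Rightarrow> bool" where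
  "holo_bundle_map \<A> B C f \<longleftrightarrow>
     (\<forall>e. vb_proj C (f e) = vb_proj B e) \<and>
     (\<forall>(U, \<tau>)\<in>vb_trivs B. \<forall>(V, \<sigma>)\<in>vb_trivs C. \<exists>g.
        holo_mat \<A> (U \<inter> V) (vb_rank C) (vb_rank B) g \<and>
        (\<forall>e. vb_proj B e \<in> U \<inter> V \<longrightarrow> \<sigma> (f e) = g (vb_proj B e) *\<^sub>v \<tau> e))"

definition fiber_zero :: "('x, 'e) vbundle \<Rightarrow> 'e \<Rightarrow> bool" where
  "fiber_zero B e \<longleftrightarrow> (\<forall>(U, \<tau>)\<in>vb_trivs B. vb_proj B e \<in> U \<longrightarrow> \<tau> e = 0\<^sub>v (vb_rank B))"

definition short_exact ::
  "('x, 'n::finite) chart set \<Rightarrow> ('x, 'f) vbundle \<Rightarrow> ('x, 'e) vbundle \<Rightarrow> ('x, 'q) vbundle \<Rightarrow>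
   ('f \<Rightarrow> 'e) \<Rightarrow> ('e \<Rightarrow> 'q) \<Rightarrow> bool" where
  "short_exact \<A> F E H i p \<longleftrightarrow>
     holo_bundle_map \<A> F E i \<and> holo_bundle_map \<A> E H p \<and>
     inj i \<and> surj p \<and> (\<forall>e. fiber_zero H (p e) \<longleftrightarrow> e \<in> range i)"

text \<open>Metrics are linear in the first and conjugate-linear in the second argument; \<open>h e e'\<close> is
  meaningful only for \<open>e\<close> and \<open>e'\<close> in the same fibre.\<close>

definition hermitian_metric ::
  "('x, 'n::finite) chart set \<Rightarrow> ('x, 'e) vbundle \<Rightarrow> ('e \<Rightarrow> 'e \<Rightarrow> complex) \<Rightarrow> bool" where
  "hermitian_metric \<A> B h \<longleftrightarrow>
     (\<forall>(U, \<tau>)\<in>vb_trivs B. \<exists>G.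
        (\<forall>x\<in>U. G x \<in> carrier_mat (vb_rank B) (vb_rank B)) \<and>
        (\<forall>i<vb_rank B. \<forall>j<vb_rank B. smooth_fun \<A> U (\<lambda>x. G x $$ (i, j))) \<and>
        (\<forall>x\<in>U. \<forall>e\<in>fiber B x. \<forall>e'\<in>fiber B x. h e e' = (G x *\<^sub>v \<tau> e) \<bullet>c \<tau> e')) \<and>
     (\<forall>e e'. vb_proj B e = vb_proj B e' \<longrightarrow> h e' e = cnj (h e e')) \<and>
     (\<forall>e. \<not> fiber_zero B e \<longrightarrow> Re (h e e) > 0)"

definition triv_at :: "('x, 'e) vbundle \<Rightarrow> 'x \<Rightarrow> ('x, 'e) triv" where
  "triv_at B x = (SOME T. T \<in> vb_trivs B \<and> x \<in> fst T)"

definition frame :: "('x, 'e) vbundle \<Rightarrow> ('x, 'e) triv \<Rightarrow> 'x \<Rightarrow> nat \<Rightarrow> 'e" where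
  "frame B T x j = the_inv_into (fiber B x) (snd T) (unit_vec (vb_rank B) j)"

definition hom_mat ::
  "('x, 'e) vbundle \<Rightarrow> ('x, 'e) triv \<Rightarrow> ('x, 'f) vbundle \<Rightarrow> ('x, 'f) triv \<Rightarrow> ('e \<Rightarrow> 'f) \<Rightarrow> 'x \<Rightarrow>
   (complex ^ 'n::finite) altform Matrix.mat" where
  "hom_mat B T C S f x = Matrix.mat (vb_rank C) (vb_rank B)
     (\<lambda>(i, j). form_const (vec_index (snd S (f (frame B T x j))) i))"

definition gram ::
  "('x, 'e) vbundle \<Rightarrow> ('e \<Rightarrow> 'e \<Rightarrow> complex) \<Rightarrow> ('x, 'e) triv \<Rightarrow> 'x \<Rightarrow> complex Matrix.mat" where
  "gram B h T x =
     Matrix.mat (vb_rank B) (vb_rank B) (\<lambda>(i, j). h (frame B T x j) (frame B T x i))"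

definition mat_deriv ::
  "(('x \<Rightarrow> 'a) \<Rightarrow> 'x \<Rightarrow> 'a) \<Rightarrow> ('x \<Rightarrow> 'a Matrix.mat) \<Rightarrow> 'x \<Rightarrow> 'a Matrix.mat" where
  "mat_deriv D M x = Matrix.mat (dim_row (M x)) (dim_col (M x)) (\<lambda>(i, j). D (\<lambda>y. M y $$ (i, j)) x)"

text \<open>The connection form \<open>h\<^sup>-\<^sup>1 \<partial>h\<close> of the canonical connection in a holomorphic frame. Forms with
  values in endomorphisms act on columns of coefficients.\<close>

definition chern_conn ::
  "('x, 'n::finite) chart \<Rightarrow> ('x, 'e) vbundle \<Rightarrow> ('e \<Rightarrow> 'e \<Rightarrow> complex) \<Rightarrow> ('x, 'e) triv \<Rightarrow> 'x \<Rightarrow>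
   (complex ^ 'n) altform Matrix.mat" where
  "chern_conn c B h T x = map_mat form_const (the (mat_inverse (gram B h T x))) *
     mat_deriv (del c) (\<lambda>y. map_mat form_const (gram B h T y)) x"

definition chern_curv ::
  "('x, 'n::finite) chart \<Rightarrow> ('x, 'e) vbundle \<Rightarrow> ('e \<Rightarrow> 'e \<Rightarrow> complex) \<Rightarrow> ('x, 'e) triv \<Rightarrow> 'x \<Rightarrow>
   (complex ^ 'n) altform Matrix.mat" where
  "chern_curv c B h T x = mat_deriv (delbar c) (chern_conn c B h T) x"

text \<open>For a connection \<open>d + \<theta>\<close>: the covariant derivative of the sections whose coefficients are the
  columns of \<open>M\<close>, and the curvature.\<close>

definition cov_deriv ::
  "('x, 'n::finite) chart \<Rightarrow> ('x \<Rightarrow> (complex ^ 'n) altform Matrix.mat) \<Rightarrow>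
   ('x \<Rightarrow> (complex ^ 'n) altform Matrix.mat) \<Rightarrow> 'x \<Rightarrow> (complex ^ 'n) altform Matrix.mat" where
  "cov_deriv c \<theta> M x = mat_deriv (ext_d c) M x + \<theta> x * M x"

definition conn_curv ::
  "('x, 'n::finite) chart \<Rightarrow> ('x \<Rightarrow> (complex ^ 'n) altform Matrix.mat) \<Rightarrow> 'x \<Rightarrow>
   (complex ^ 'n) altform Matrix.mat" where
  "conn_curv c \<theta> x = mat_deriv (ext_d c) \<theta> x + \<theta> x * \<theta> x"

text \<open>A subbundle of \<open>E\<close> is given as the family \<open>S\<close> of its fibres.\<close>

definition image_bundle :: "('x, 'f) vbundle \<Rightarrow> ('f \<Rightarrow> 'e) \<Rightarrow> 'x \<Rightarrow> 'e set" where
  "image_bundle F i x = i ` fiber F x"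

definition perp ::
  "('x, 'e) vbundle \<Rightarrow> ('e \<Rightarrow> 'e \<Rightarrow> complex) \<Rightarrow> ('x \<Rightarrow> 'e set) \<Rightarrow> 'x \<Rightarrow> 'e set" where
  "perp E h S x = {e \<in> fiber E x. \<forall>s\<in>S x. h e s = 0}"

definition orth_proj ::
  "('x, 'e) vbundle \<Rightarrow> ('e \<Rightarrow> 'e \<Rightarrow> complex) \<Rightarrow> ('x \<Rightarrow> 'e set) \<Rightarrow> 'e \<Rightarrow> 'e" where
  "orth_proj E h S e =
     (THE w. w \<in> S (vb_proj E e) \<and> (\<forall>s\<in>S (vb_proj E e). h w s = h e s))"

definition fiber_adjoint ::
  "('x, 'e) vbundle \<Rightarrow> ('e \<Rightarrow> 'e \<Rightarrow> complex) \<Rightarrow> ('x, 'q) vbundle \<Rightarrow> ('q \<Rightarrow> 'q \<Rightarrow> complex) \<Rightarrow>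
   ('e \<Rightarrow> 'q) \<Rightarrow> 'q \<Rightarrow> 'e" where
  "fiber_adjoint E h H h' p g =
     (THE w. w \<in> fiber E (vb_proj H g) \<and> (\<forall>v\<in>fiber E (vb_proj H g). h w v = h' g (p v)))"

definition proj_mat ::
  "('x, 'e) vbundle \<Rightarrow> ('e \<Rightarrow> 'e \<Rightarrow> complex) \<Rightarrow> ('x, 'e) triv \<Rightarrow> ('x \<Rightarrow> 'e set) \<Rightarrow> 'x \<Rightarrow>
   (complex ^ 'n::finite) altform Matrix.mat" where
  "proj_mat E h T S = hom_mat E T E T (orth_proj E h S)"

definition second_fund ::
  "('x, 'n::finite) chart \<Rightarrow> ('x, 'e) vbundle \<Rightarrow> ('e \<Rightarrow> 'e \<Rightarrow> complex) \<Rightarrow> ('x, 'e) triv \<Rightarrow>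
   ('x \<Rightarrow> 'e set) \<Rightarrow> 'x \<Rightarrow> (complex ^ 'n) altform Matrix.mat" where
  "second_fund c E h T S x =
     proj_mat E h T (perp E h S) x * cov_deriv c (chern_conn c E h T) (proj_mat E h T S) x"

definition second_fund_adj ::
  "('x, 'n::finite) chart \<Rightarrow> ('x, 'e) vbundle \<Rightarrow> ('e \<Rightarrow> 'e \<Rightarrow> complex) \<Rightarrow> ('x, 'e) triv \<Rightarrow>
   ('x \<Rightarrow> 'e set) \<Rightarrow> 'x \<Rightarrow> (complex ^ 'n) altform Matrix.mat" where
  "second_fund_adj c E h T S x =
     - (proj_mat E h T S x * cov_deriv c (chern_conn c E h T) (proj_mat E h T (perp E h S)) x)"

text \<open>\<open>A \<and> A\<^sup>*\<close> as a form with values in \<open>End H\<close>, where \<open>H\<close> is identified with the orthogonal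
  complement of \<open>F\<close> by \<open>p\<close> and its adjoint.\<close>

definition second_fund_square ::
  "('x, 'n::finite) chart \<Rightarrow> ('x, 'e) vbundle \<Rightarrow> ('e \<Rightarrow> 'e \<Rightarrow> complex) \<Rightarrow> ('x, 'e) triv \<Rightarrow>
   ('x \<Rightarrow> 'e set) \<Rightarrow> ('x, 'q) vbundle \<Rightarrow> ('q \<Rightarrow> 'q \<Rightarrow> complex) \<Rightarrow> ('x, 'q) triv \<Rightarrow> ('e \<Rightarrow> 'q) \<Rightarrow>
   'x \<Rightarrow> (complex ^ 'n) altform Matrix.mat" where
  "second_fund_square c E h T S H h' T' p x =
     hom_mat E T H T' p x * (second_fund c E h T S x * second_fund_adj c E h T S x) *
     hom_mat H T' E T (fiber_adjoint E h H h' p) x"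

definition chern_const :: complex where
  "chern_const = \<i> / (2 * of_real pi)"

text \<open>The forms below do not depend on the trivialization in which they are computed at a point.\<close>

definition total_chern ::
  "('x, 'n::finite) chart \<Rightarrow> ('x, 'e) vbundle \<Rightarrow> ('e \<Rightarrow> 'e \<Rightarrow> complex) \<Rightarrow> 'x \<Rightarrow>
   (complex ^ 'n) evenform" where
  "total_chern c B h x = Determinant.det (1\<^sub>m (vb_rank B) +
     map_mat even_part (form_const chern_const \<cdot>\<^sub>m chern_curv c B h (triv_at B x) x))"

definition chern_form ::
  "nat \<Rightarrow> ('x, 'n::finite) chart \<Rightarrow> ('x, 'e) vbundle \<Rightarrow> ('e \<Rightarrow> 'e \<Rightarrow> complex) \<Rightarrow> 'x \<Rightarrow>
   (complex ^ 'n) evenform" where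
  "chern_form k c B h x = even_deg (2 * k) (total_chern c B h x)"

definition chern_poly ::
  "('x, 'n::finite) chart \<Rightarrow> ('x, 'e) vbundle \<Rightarrow> ('e \<Rightarrow> 'e \<Rightarrow> complex) \<Rightarrow> 'x \<Rightarrow>
   (complex ^ 'n) evenform poly" where
  "chern_poly c B h x = (\<Sum>k\<le>vb_rank B. Polynomial.monom (chern_form k c B h x) k)"

definition tr_ext_power :: "nat \<Rightarrow> 'a::comm_ring_1 Matrix.mat \<Rightarrow> 'a" where
  "tr_ext_power k M =
     (\<Sum>I\<in>{I. I \<subseteq> {..<dim_row M} \<and> card I = k}. Determinant.det (submatrix M I I))"

text \<open>The curvature of \<open>\<nabla>\<^sub>u = \<nabla> + (u - 1) A\<close>.\<close>

definition curv_u ::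
  "real \<Rightarrow> ('x, 'n::finite) chart \<Rightarrow> ('x, 'e) vbundle \<Rightarrow> ('e \<Rightarrow> 'e \<Rightarrow> complex) \<Rightarrow> ('x, 'e) triv \<Rightarrow>
   ('x \<Rightarrow> 'e set) \<Rightarrow> 'x \<Rightarrow> (complex ^ 'n) altform Matrix.mat" where
  "curv_u u c E h T S = conn_curv c (\<lambda>y. chern_conn c E h T y +
     form_const (of_real (u - 1)) \<cdot>\<^sub>m second_fund c E h T S y)"

text \<open>The formal variable \<open>\<lambda>\<close> is the variable of the polynomial entries of the matrix.\<close>

definition bott_chern_D ::
  "nat \<Rightarrow> real \<Rightarrow> ('x, 'n::finite) chart \<Rightarrow> ('x, 'e) vbundle \<Rightarrow> ('e \<Rightarrow> 'e \<Rightarrow> complex) \<Rightarrow>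
   ('x \<Rightarrow> 'e set) \<Rightarrow> 'x \<Rightarrow> (complex ^ 'n) evenform" where
  "bott_chern_D k u c E h S x = poly.coeff (tr_ext_power k
     (map_mat (\<lambda>a. [:even_part a:]) (form_const chern_const \<cdot>\<^sub>m curv_u u c E h (triv_at E x) S x) +
      map_mat (\<lambda>a. [:0, even_part a:]) (proj_mat E h (triv_at E x) S x))) 1"

text \<open>
  Bott and Chern's integral formula for \<open>(E, h)\<close> with the metrics that \<open>h\<close> induces on the subbundle
  \<open>S\<close> and on the quotient, taken as the definition of the Bott-Chern form in this situation.
\<close>

definition bott_chern_form :: "nat \<Rightarrow> ('x, 'e) vbundle \<Rightarrow> ('e \<Rightarrow> 'e \<Rightarrow> complex) \<Rightarrow>
   ('x \<Rightarrow> 'e set) \<Rightarrow> ('x, 'n::finite) gform" where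
  "bott_chern_form k E h S c x = Abs_altform (\<lambda>vs. integral {0..1} (\<lambda>u.
     (form_app (of_even (bott_chern_D k u c E h S x)) vs -
      form_app (of_even (bott_chern_D k 0 c E h S x)) vs) / of_real u))"

definition bott_chern_poly ::
  "('x, 'e) vbundle \<Rightarrow> ('e \<Rightarrow> 'e \<Rightarrow> complex) \<Rightarrow> ('x \<Rightarrow> 'e set) \<Rightarrow>
   ('x, 'n::finite) chart \<Rightarrow> 'x \<Rightarrow> (complex ^ 'n) altform poly" where
  "bott_chern_poly E h S c x =
     (\<Sum>k = 1..vb_rank E. Polynomial.monom (bott_chern_form k E h S c x) k)"

definition mat_trace :: "'a::comm_monoid_add Matrix.mat \<Rightarrow> 'a" where
  "mat_trace M = (\<Sum>i<dim_row M. M $$ (i, i))"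

text \<open>The formal variable \<open>t\<close> is the variable of the polynomials; \<open>t_mat M\<close> is \<open>t M\<close>.\<close>

definition t_mat :: "'v::real_vector altform Matrix.mat \<Rightarrow> 'v evenform poly Matrix.mat" where
  "t_mat M = map_mat (\<lambda>a. Polynomial.monom (even_part a) 1) M"

text \<open>For nilpotent \<open>N\<close> and \<open>a\<close>, \<open>(I - N)\<^sup>-\<^sup>1 = I + N + N\<^sup>2 + \<dots>\<close> and
  \<open>log (1 - a) = -(a + a\<^sup>2 / 2 + \<dots>)\<close>.\<close>

definition unip_inverse :: "'a::comm_ring_1 Matrix.mat \<Rightarrow> 'a Matrix.mat" where
  "unip_inverse M = (let n = dim_row M; N = 1\<^sub>m n - M in
     Matrix.mat n n (\<lambda>(i, j). \<Sum>k<(LEAST m. N ^\<^sub>m m = 0\<^sub>m n n). (N ^\<^sub>m k) $$ (i, j)))"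

definition unip_log :: "'v::real_vector evenform poly \<Rightarrow> 'v evenform poly" where
  "unip_log y = (let a = 1 - y in
     - (\<Sum>k\<in>{1..<(LEAST m. a ^ m = 0)}. Polynomial.smult (even_const (1 / of_nat k)) (a ^ k)))"

end

theory Submission
  imports Defs "HOL-Complex_Analysis.Complex_Analysis"
begin

text \<open>
  Both sides are computed at a point of a chart, where they turn out to be the same form; equality modulo
  \<open>Im \<partial> + Im \<partial>\<bar>\<close> then holds with zero correction terms (\<open>bc_equal_pointwise\<close>). Write
  \<open>\<kappa> = \<i> / 2\<pi>\<close>, \<open>Q = A \<and> A\<^sup>*\<close>, and let \<open>g\<close> and \<open>s\<close> be the matrices of \<open>p : E \<rightarrow> H\<close> and of its adjoint, so that
  \<open>g s = 1\<close> and \<open>s g\<close> is the orthogonal projection onto \<open>F\<^sup>\<bottom> = H\<close>.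

  Curvature. In the \<open>C\<^sup>\<infinity>\<close> splitting \<open>E = F \<oplus> H\<close> the off-diagonal blocks of \<open>\<nabla>\<^sub>u\<close> are \<open>u A\<close> and \<open>- A\<^sup>*\<close>, so the
  block of its curvature on \<open>H\<close> is \<open>g \<Theta>(u) s = \<Theta>\<^sub>H - u Q\<close> (\<open>curvature_of_deformed_connection\<close>). The proof
  stays in holomorphic frames: \<open>\<partial>\<close> and \<open>\<partial>\<bar>\<close> of the relations \<open>g s = 1\<close>, \<open>\<partial>\<bar> g = 0\<close> and \<open>h s = g\<^sup>* h\<^sub>H\<close> yield
  identities in a ring of matrices of forms, from which \<open>gauss_codazzi_algebra\<close> and \<open>curvature_algebra\<close>
  deduce the claim. The differentiations require that holomorphic transition matrices are smooth, which for
  functions that are only assumed to be complex differentiable is \<open>holo_on_imp_smooth_on\<close>.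

  Rank one. Since \<open>P\<^sub>F\<close> is a projection of rank one, the coefficient of \<open>\<lambda>\<close> in \<open>tr \<Lambda>\<^sup>k (X + \<lambda> P\<^sub>F)\<close> is
  \<open>tr \<Lambda>\<^sup>k\<^sup>-\<^sup>1\<close> of the block of \<open>X\<close> on \<open>H\<close> (\<open>coeff_tr_ext_power_line\<close>). Hence \<open>D\<^sub>k(u)\<close> is the coefficient of
  \<open>t\<^sup>k\<^sup>-\<^sup>1\<close> in \<open>det (I + t \<kappa> (\<Theta>\<^sub>H - u Q))\<close> (\<open>bott_chern_D_line\<close>).

  Determinant. The entries of \<open>Q\<close> are products \<open>a\<^sub>i b\<^sub>j\<close> of 1-forms, and multiplying \<open>Q\<close> by a matrix of even
  forms preserves this shape. Because 1-forms anticommute, such a matrix \<open>M\<close> satisfies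
  \<open>det (I - M) = 1 / (1 + tr M)\<close> (\<open>det_one_minus_anti_rank_one\<close>), where commuting entries would give
  \<open>1 - tr M\<close>. With \<open>\<sigma> = \<kappa> tr ((I + t \<kappa> \<Theta>\<^sub>H)\<^sup>-\<^sup>1 t Q)\<close> it follows that
  \<open>det (I + t \<kappa> (\<Theta>\<^sub>H - u Q)) = c\<^sub>t(H) / (1 + u \<sigma>) = c\<^sub>t(H) (1 - u \<sigma> + u\<^sup>2 \<sigma>\<^sup>2 - \<dots>)\<close> (\<open>det_deformation\<close>), a
  finite sum since forms of positive degree are nilpotent.

  Integration. Subtracting the value at \<open>u = 0\<close>, dividing by \<open>u\<close> and integrating replaces \<open>(- u \<sigma>)\<^sup>j\<close> by
  \<open>(- \<sigma>)\<^sup>j / j\<close>, so the sum becomes \<open>- c\<^sub>t(H) log (1 + \<sigma>)\<close> (\<open>bott_chern_poly_line\<close>); the shift from \<open>k - 1\<close>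
  to \<open>k\<close> is the factor \<open>t\<close>.
\<close>

section \<open>Traces of exterior powers\<close>

lemma index_mult_mat_sum:
  assumes "A \<in> carrier_mat m n" "B \<in> carrier_mat n k" "i < m" "j < k"
  shows "(A * B) $$ (i, j) = (\<Sum>l<n. A $$ (i, l) * B $$ (l, j))"
  using assms by (auto simp: scalar_prod_def atLeast0LessThan intro!: sum.cong)

lemma bij_betw_pick:
  assumes "finite I"
  shows "bij_betw (pick I) {0..<card I} I"
proof -
  have "pick I ` {0..<card I} = I"
  proof
    show "pick I ` {0..<card I} \<subseteq> I"
      by (rule image_subsetI, rule pick_in_set_le, simp)
    show "I \<subseteq> pick I ` {0..<card I}"
    proof
      fix i assume i: "i \<in> I"
      have "card {a \<in> I. a < i} < card I"
        using i by (intro psubset_card_mono[OF assms]) auto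
      then show "i \<in> pick I ` {0..<card I}"
        using pick_card_in_set[OF i] by (intro image_eqI[where x = "card {a \<in> I. a < i}"]) simp_all
    qed
  qed
  moreover from this have "inj_on (pick I) {0..<card I}"
    by (intro eq_card_imp_inj_on) simp_all
  ultimately show ?thesis by (simp add: bij_betw_def)
qed

lemma det_principal_submatrix:
  fixes M :: "'a::comm_ring_1 Matrix.mat"
  assumes M: "M \<in> carrier_mat n n" and I: "I \<subseteq> {..<n}"
  shows "Determinant.det (submatrix M I I) =
    (\<Sum>p | p permutes I. signof p * (\<Prod>i\<in>I. M $$ (i, p i)))"
proof -
  have fin: "finite I" using I finite_subset by blast
  have eq: "{i. i < n \<and> i \<in> I} = I" using I by auto
  let ?f = "pick I" and ?A = "{0..<card I}"
  have bij: "bij_betw ?f ?A I" by (rule bij_betw_pick[OF fin])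
  then have inj: "inj_on ?f ?A" by (simp add: bij_betw_def)
  have car: "submatrix M I I \<in> carrier_mat (card I) (card I)"
    using M eq by (simp add: submatrix_def)
  have bp: "bij_betw (map_permutation ?A ?f) {p. p permutes ?A} {p. p permutes I}"
    using bij_betw_permutations[OF bij] bij
    by (simp add: map_permutation_def[abs_def] restrict_id_def[abs_def] bij_betw_def o_def)
  have "Determinant.det (submatrix M I I) =
      (\<Sum>p | p permutes ?A. signof p * (\<Prod>i\<in>?A. submatrix M I I $$ (i, p i)))"
    by (rule det_def'[OF car])
  also have "\<dots> = (\<Sum>p | p permutes ?A. signof (map_permutation ?A ?f p) *
      (\<Prod>i\<in>I. M $$ (i, map_permutation ?A ?f p i)))"
  proof (rule sum.cong[OF refl])
    fix p assume "p \<in> {p. p permutes ?A}"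
    then have p: "p permutes ?A" by simp
    have "(\<Prod>i\<in>I. M $$ (i, map_permutation ?A ?f p i)) =
        (\<Prod>i\<in>?A. M $$ (?f i, map_permutation ?A ?f p (?f i)))"
      by (rule prod.reindex_bij_betw[OF bij, symmetric])
    also have "\<dots> = (\<Prod>i\<in>?A. submatrix M I I $$ (i, p i))"
    proof (rule prod.cong[OF refl])
      fix i assume i: "i \<in> ?A"
      then have "p i \<in> ?A" using permutes_in_image[OF p] by blast
      then show "M $$ (?f i, map_permutation ?A ?f p (?f i)) = submatrix M I I $$ (i, p i)"
        using i M eq by (simp add: submatrix_index map_permutation_apply[OF inj])
    qed
    finally show "signof p * (\<Prod>i\<in>?A. submatrix M I I $$ (i, p i)) =
        signof (map_permutation ?A ?f p) * (\<Prod>i\<in>I. M $$ (i, map_permutation ?A ?f p i))"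
      by (simp add: sign_map_permutation[OF inj p])
  qed
  also have "\<dots> = (\<Sum>p | p permutes I. signof p * (\<Prod>i\<in>I. M $$ (i, p i)))"
    by (rule sum.reindex_bij_betw[OF bp])
  finally show ?thesis .
qed

text \<open>Expand each factor \<open>M(i, p i) + \<delta>(i, p i)\<close> of the Leibniz formula: choosing \<open>\<delta>\<close> outside \<open>I\<close> leaves the
  permutations of \<open>I\<close>, whose sum is the principal minor at \<open>I\<close>.\<close>

lemma det_one_plus:
  fixes M :: "'a::comm_ring_1 Matrix.mat"
  assumes M: "M \<in> carrier_mat n n"
  shows "Determinant.det (1\<^sub>m n + M) = (\<Sum>k\<le>n. tr_ext_power k M)"
proof -
  let ?\<delta> = "\<lambda>i j. if i = j then 1 else 0 :: 'a"
  have "Determinant.det (1\<^sub>m n + M) =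
      (\<Sum>p | p permutes {0..<n}. signof p * (\<Prod>i\<in>{0..<n}. M $$ (i, p i) + ?\<delta> i (p i)))"
  proof (subst det_def'[of _ n])
    show "1\<^sub>m n + M \<in> carrier_mat n n" using M by simp
    have "(1\<^sub>m n + M) $$ (i, p i) = M $$ (i, p i) + ?\<delta> i (p i)"
      if "p permutes {0..<n}" "i \<in> {0..<n}" for p i
      using that M permutes_in_image[OF that(1), of i] by (simp add: add.commute)
    then have "(\<Prod>i = 0..<n. (1\<^sub>m n + M) $$ (i, p i)) = (\<Prod>i\<in>{0..<n}. M $$ (i, p i) + ?\<delta> i (p i))"
      if "p permutes {0..<n}" for p
      using that by (intro prod.cong[OF refl]) blast
    then show "(\<Sum>p | p permutes {0..<n}. signof p * (\<Prod>i = 0..<n. (1\<^sub>m n + M) $$ (i, p i))) =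
      (\<Sum>p | p permutes {0..<n}. signof p * (\<Prod>i\<in>{0..<n}. M $$ (i, p i) + ?\<delta> i (p i)))"
      by (intro sum.cong[OF refl]) (simp only: mem_Collect_eq)
  qed
  also have "\<dots> = (\<Sum>p | p permutes {0..<n}. \<Sum>I\<in>Pow {0..<n}.
      signof p * ((\<Prod>i\<in>I. M $$ (i, p i)) * (\<Prod>i\<in>{0..<n} - I. ?\<delta> i (p i))))"
    by (simp add: prod_add sum_distrib_left)
  also have "\<dots> = (\<Sum>I\<in>Pow {0..<n}. \<Sum>p | p permutes {0..<n}.
      signof p * ((\<Prod>i\<in>I. M $$ (i, p i)) * (\<Prod>i\<in>{0..<n} - I. ?\<delta> i (p i))))"
    by (rule sum.swap)
  also have "\<dots> = (\<Sum>I\<in>Pow {0..<n}. Determinant.det (submatrix M I I))"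
  proof (rule sum.cong[OF refl])
    fix I assume "I \<in> Pow {0..<n}"
    then have I: "I \<subseteq> {0..<n}" by simp
    have zero: "signof p * ((\<Prod>i\<in>I. M $$ (i, p i)) * (\<Prod>i\<in>{0..<n} - I. ?\<delta> i (p i))) = 0"
      if p: "p permutes {0..<n}" and np: "\<not> p permutes I" for p
    proof -
      obtain i where i: "i \<in> {0..<n} - I" "p i \<noteq> i"
        using permutes_superset[OF p, of I] np by blast
      then have "?\<delta> i (p i) = 0" by metis
      then have "(\<Prod>i\<in>{0..<n} - I. ?\<delta> i (p i)) = 0"
        using i(1) by (intro prod_zero bexI[of _ i]) simp_all
      then show ?thesis by (simp only: mult_zero_right)
    qed
    have fixed: "(\<Prod>i\<in>{0..<n} - I. ?\<delta> i (p i)) = 1" if "p permutes I" for p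
      using permutes_not_in[OF that] by (intro prod.neutral) simp
    have "(\<Sum>p | p permutes {0..<n}.
        signof p * ((\<Prod>i\<in>I. M $$ (i, p i)) * (\<Prod>i\<in>{0..<n} - I. ?\<delta> i (p i)))) =
      (\<Sum>p | p permutes I.
        signof p * ((\<Prod>i\<in>I. M $$ (i, p i)) * (\<Prod>i\<in>{0..<n} - I. ?\<delta> i (p i))))"
    proof (rule sum.mono_neutral_right)
      show "finite {p. p permutes {0..<n}}" by (simp add: finite_permutations)
      show "{p. p permutes I} \<subseteq> {p. p permutes {0..<n}}" using permutes_subset[OF _ I] by auto
    qed (use zero in blast)
    also have "\<dots> = (\<Sum>p | p permutes I. signof p * (\<Prod>i\<in>I. M $$ (i, p i)))"
      by (rule sum.cong[OF refl]) (use fixed in auto)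
    also have "\<dots> = Determinant.det (submatrix M I I)"
      using I by (intro det_principal_submatrix[OF M, symmetric]) auto
    finally show "(\<Sum>p | p permutes {0..<n}.
        signof p * ((\<Prod>i\<in>I. M $$ (i, p i)) * (\<Prod>i\<in>{0..<n} - I. ?\<delta> i (p i)))) = \<dots>" .
  qed
  also have "\<dots> = (\<Sum>k\<le>n. \<Sum>I | I \<in> Pow {0..<n} \<and> card I = k. Determinant.det (submatrix M I I))"
    by (rule sum.group[symmetric])
      (auto intro: order.trans[OF card_mono[of "{0..<n}"]])
  also have "\<dots> = (\<Sum>k\<le>n. tr_ext_power k M)"
    using M by (auto simp: tr_ext_power_def atLeast0LessThan intro!: sum.cong)
  finally show ?thesis .
qed

lemma submatrix_smult:
  "submatrix (a \<cdot>\<^sub>m M) I J = a \<cdot>\<^sub>m submatrix M I J"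
  if "I \<subseteq> {..<dim_row M}" "J \<subseteq> {..<dim_col M}"
proof -
  have "{i. i < dim_row M \<and> i \<in> I} = I" "{j. j < dim_col M \<and> j \<in> J} = J" using that by auto
  moreover have "pick I i < dim_row M" if "i < card I" for i
    using pick_in_set_le[OF that] \<open>I \<subseteq> _\<close> by auto
  moreover have "pick J i < dim_col M" if "i < card J" for i
    using pick_in_set_le[OF that] \<open>J \<subseteq> _\<close> by auto
  ultimately show ?thesis by (auto simp: submatrix_def)
qed

lemma tr_ext_power_smult:
  assumes M: "M \<in> carrier_mat n n"
  shows "tr_ext_power k (a \<cdot>\<^sub>m M) = a ^ k * tr_ext_power k M"
proof -
  have "Determinant.det (submatrix (a \<cdot>\<^sub>m M) I I) = a ^ k * Determinant.det (submatrix M I I)"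
    if "I \<subseteq> {..<n}" "card I = k" for I
  proof -
    have "{i. i < n \<and> i \<in> I} = I" using that by auto
    then show ?thesis using that M by (simp add: submatrix_smult dim_submatrix)
  qed
  then show ?thesis
    using M by (auto simp: tr_ext_power_def sum_distrib_left intro!: sum.cong)
qed

lemma (in comm_ring_hom) hom_tr_ext_power:
  assumes M: "M \<in> carrier_mat n n"
  shows "tr_ext_power k (map_mat hom M) = hom (tr_ext_power k M)"
proof -
  have "submatrix (map_mat hom M) I I = map_mat hom (submatrix M I I)" if "I \<subseteq> {..<n}" for I
  proof -
    have "pick I i < n" if "i < card I" for i
      using pick_in_set_le[OF that] \<open>I \<subseteq> _\<close> by auto
    moreover have "{i. i < n \<and> i \<in> I} = I" using that by auto
    ultimately show ?thesis using M by (auto simp: submatrix_def)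
  qed
  then show ?thesis
    using M by (auto simp: tr_ext_power_def hom_sum intro!: sum.cong)
qed

lemma tr_ext_power_large:
  assumes "M \<in> carrier_mat n n" "k > n"
  shows "tr_ext_power k M = 0"
proof -
  have "card I \<noteq> k" if "I \<subseteq> {..<n}" for I
    using card_mono[of "{..<n}" I] that assms(2) by auto
  then have "{I. I \<subseteq> {..<n} \<and> card I = k} = {}" by auto
  moreover have "dim_row M = n" using assms by simp
  ultimately show ?thesis by (simp only: tr_ext_power_def sum.empty)
qed

text \<open>This turns statements about exterior powers into statements about one determinant.\<close>

lemma coeff_det_one_plus_t:
  fixes M :: "'a::comm_ring_1 Matrix.mat"
  assumes M: "M \<in> carrier_mat n n"
  shows "poly.coeff (Determinant.det (1\<^sub>m n + map_mat (\<lambda>a. Polynomial.monom a 1) M)) k = tr_ext_power k M"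
proof -
  interpret c: comm_ring_hom "\<lambda>a::'a. [:a:]"
    by unfold_locales (auto simp: one_pCons)
  have eq: "map_mat (\<lambda>a. Polynomial.monom a 1) M = Polynomial.monom 1 1 \<cdot>\<^sub>m map_mat (\<lambda>a. [:a:]) M"
    by (rule eq_matI) (auto simp: monom_altdef)
  have "tr_ext_power j (Polynomial.monom 1 1 \<cdot>\<^sub>m map_mat (\<lambda>a. [:a:]) M) = Polynomial.monom (tr_ext_power j M) j" for j
  proof -
    have "map_mat (\<lambda>a. [:a:]) M \<in> carrier_mat n n" using M by simp
    then have "tr_ext_power j (Polynomial.monom 1 1 \<cdot>\<^sub>m map_mat (\<lambda>a. [:a:]) M) =
        Polynomial.monom 1 1 ^ j * tr_ext_power j (map_mat (\<lambda>a. [:a:]) M)"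
      by (rule tr_ext_power_smult)
    moreover have "Polynomial.monom 1 1 ^ j * [:a:] = Polynomial.monom a j" for a :: 'a
      by (simp only: monom_power monom_0[symmetric] mult_monom) simp
    ultimately show ?thesis by (simp only: c.hom_tr_ext_power[OF M])
  qed
  then have "Determinant.det (1\<^sub>m n + map_mat (\<lambda>a. Polynomial.monom a 1) M) =
      (\<Sum>j\<le>n. Polynomial.monom (tr_ext_power j M) j)"
    unfolding eq using M by (subst det_one_plus[of _ n]) auto
  then show ?thesis
    using tr_ext_power_large[OF M] by (simp add: coeff_sum sum.delta' not_le)
qed

text \<open>\<open>det (1 + t X)\<close> is invariant under conjugation, hence so are its coefficients.\<close>

lemma tr_ext_power_similar:
  fixes X :: "'a::comm_ring_1 Matrix.mat"
  assumes X: "X \<in> carrier_mat n n" and P: "P \<in> carrier_mat n n" and Q: "Q \<in> carrier_mat n n"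
    and QP: "Q * P = 1\<^sub>m n"
  shows "tr_ext_power k (Q * X * P) = tr_ext_power k X"
proof -
  interpret c: comm_ring_hom "\<lambda>a::'a. [:a:]"
    by unfold_locales (auto simp: one_pCons)
  let ?c = "map_mat (\<lambda>a::'a. [:a:])" and ?t = "Polynomial.monom (1::'a) 1"
  have eq: "map_mat (\<lambda>a. Polynomial.monom a 1) M = ?t \<cdot>\<^sub>m ?c M" for M :: "'a Matrix.mat"
    by (rule eq_matI) (auto simp: monom_altdef)
  have qp: "?c Q * ?c P = 1\<^sub>m n"
    using c.mat_hom_mult[OF Q P] by (simp add: QP c.mat_hom_one)
  have "1\<^sub>m n + map_mat (\<lambda>a. Polynomial.monom a 1) (Q * X * P) =
      ?c Q * (1\<^sub>m n + map_mat (\<lambda>a. Polynomial.monom a 1) X) * ?c P"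
  proof -
    have "?c (Q * X * P) = ?c Q * ?c X * ?c P"
      using P Q X c.mat_hom_mult[of "Q * X" n n P n] c.mat_hom_mult[of Q n n X n] by simp
    moreover have "?c Q * (1\<^sub>m n + ?t \<cdot>\<^sub>m ?c X) * ?c P = (?c Q + ?t \<cdot>\<^sub>m (?c Q * ?c X)) * ?c P"
      using P Q X by (subst mult_add_distrib_mat[of _ n n]) (auto simp: mult_smult_distrib[of _ n n])
    moreover have "\<dots> = 1\<^sub>m n + ?t \<cdot>\<^sub>m (?c Q * ?c X * ?c P)"
      using P Q X qp
      by (subst add_mult_distrib_mat[of _ n n]) (auto simp: mult_smult_assoc_mat[of _ n n _ n])
    ultimately show ?thesis unfolding eq by simp
  qed
  moreover have "Determinant.det (?c Q) * Determinant.det (?c P) = 1"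
    using qp P Q by (metis det_mult det_one map_carrier_mat)
  then have "Determinant.det (?c Q) * d * Determinant.det (?c P) = d" for d
    by (metis mult.commute mult.left_commute mult_1)
  ultimately have "Determinant.det (1\<^sub>m n + map_mat (\<lambda>a. Polynomial.monom a 1) (Q * X * P)) =
      Determinant.det (1\<^sub>m n + map_mat (\<lambda>a. Polynomial.monom a 1) X)"
    using P Q X by (simp only: det_mult[of _ n] mult_carrier_mat[of _ n n] add_carrier_mat
      map_carrier_mat one_carrier_mat)
  then show ?thesis
    using coeff_det_one_plus_t[of "Q * X * P" n k] coeff_det_one_plus_t[OF X, of k] P Q X by simp
qed

lemma det_add_corner:
  fixes Z :: "'a::comm_ring_1 Matrix.mat"
  assumes Z: "Z \<in> carrier_mat (Suc n) (Suc n)"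
  shows "Determinant.det (Matrix.mat (Suc n) (Suc n) (\<lambda>(i, j). Z $$ (i, j) + (if i = 0 \<and> j = 0 then a else 0))) =
    Determinant.det Z + a * Determinant.det (mat_delete Z 0 0)"
proof -
  define Y where "Y = Matrix.mat (Suc n) (Suc n) (\<lambda>(i, j). Z $$ (i, j) + (if i = 0 \<and> j = 0 then a else 0))"
  have Y: "Y \<in> carrier_mat (Suc n) (Suc n)" by (simp add: Y_def)
  have "mat_delete Y 0 j = mat_delete Z 0 j" if "j < Suc n" for j
    using Z that by (auto simp: mat_delete_def Y_def)
  then have cf: "cofactor Y 0 j = cofactor Z 0 j" if "j < Suc n" for j
    using that by (simp add: cofactor_def)
  have "Determinant.det Y = (\<Sum>j<Suc n. Y $$ (0, j) * cofactor Y 0 j)"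
    by (rule laplace_expansion_row[OF Y]) simp
  also have "\<dots> = (\<Sum>j<Suc n. Z $$ (0, j) * cofactor Z 0 j + (if j = 0 then a * cofactor Z 0 0 else 0))"
    using cf by (intro sum.cong) (auto simp: Y_def algebra_simps)
  also have "\<dots> = Determinant.det Z + a * cofactor Z 0 0"
    using laplace_expansion_row[OF Z, of 0] by (simp add: sum.distrib)
  finally show ?thesis by (simp add: Y_def cofactor_def)
qed

text \<open>\<open>det (1 + t Z)\<close> is affine in the corner entry of \<open>Z\<close>, with slope \<open>t\<close> times the determinant \<open>det (1 + t Z')\<close>
  of the complementary block.\<close>

lemma tr_ext_power_add_corner:
  fixes Z :: "'a::comm_ring_1 Matrix.mat"
  assumes Z: "Z \<in> carrier_mat (Suc n) (Suc n)"
  shows "tr_ext_power (Suc k) (Matrix.mat (Suc n) (Suc n) (\<lambda>(i, j). Z $$ (i, j) + (if i = 0 \<and> j = 0 then a else 0))) =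
    tr_ext_power (Suc k) Z + a * tr_ext_power k (mat_delete Z 0 0)"
proof -
  let ?t = "map_mat (\<lambda>a::'a. Polynomial.monom a 1)"
  let ?Y = "Matrix.mat (Suc n) (Suc n) (\<lambda>(i, j). Z $$ (i, j) + (if i = 0 \<and> j = 0 then a else 0))"
  have d: "mat_delete Z 0 0 \<in> carrier_mat n n" using Z by (auto simp: mat_delete_def)
  have 1: "1\<^sub>m (Suc n) + ?t ?Y = Matrix.mat (Suc n) (Suc n) (\<lambda>(i, j). (1\<^sub>m (Suc n) + ?t Z) $$ (i, j) +
      (if i = 0 \<and> j = 0 then Polynomial.monom a 1 else 0))"
    using Z by (auto simp: add_monom)
  have 2: "mat_delete (1\<^sub>m (Suc n) + ?t Z) 0 0 = 1\<^sub>m n + ?t (mat_delete Z 0 0)"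
    using Z by (auto simp: mat_delete_def)
  have "Determinant.det (1\<^sub>m (Suc n) + ?t ?Y) = Determinant.det (1\<^sub>m (Suc n) + ?t Z) +
      Polynomial.monom a 1 * Determinant.det (1\<^sub>m n + ?t (mat_delete Z 0 0))"
    unfolding 1 2[symmetric] by (rule det_add_corner) (use Z in auto)
  then have "poly.coeff (Determinant.det (1\<^sub>m (Suc n) + ?t ?Y)) (Suc k) =
      poly.coeff (Determinant.det (1\<^sub>m (Suc n) + ?t Z)) (Suc k) +
      a * poly.coeff (Determinant.det (1\<^sub>m n + ?t (mat_delete Z 0 0))) k"
    by (simp add: coeff_monom_mult)
  then show ?thesis
    using coeff_det_one_plus_t[OF Z] coeff_det_one_plus_t[OF d] coeff_det_one_plus_t[of ?Y "Suc n"]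
    by simp
qed

text \<open>In a basis in which \<open>R\<close> is a matrix unit, \<open>\<lambda>\<close> occurs in the corner entry only.\<close>

lemma coeff_tr_ext_power_corner:
  fixes X :: "'a::comm_ring_1 Matrix.mat"
  assumes X: "X \<in> carrier_mat (Suc n) (Suc n)" and P: "P \<in> carrier_mat (Suc n) (Suc n)"
    and Q: "Q \<in> carrier_mat (Suc n) (Suc n)" and R: "R \<in> carrier_mat (Suc n) (Suc n)"
    and QP: "Q * P = 1\<^sub>m (Suc n)"
    and QRP: "Q * R * P = Matrix.mat (Suc n) (Suc n) (\<lambda>(i, j). if i = 0 \<and> j = 0 then 1 else 0)"
  shows "poly.coeff (tr_ext_power (Suc k) (map_mat (\<lambda>a. [:a:]) X + map_mat (\<lambda>a. [:0, a:]) R)) 1 =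
    tr_ext_power k (mat_delete (Q * X * P) 0 0)"
proof -
  interpret c: comm_ring_hom "\<lambda>a::'a. [:a:]"
    by unfold_locales (auto simp: one_pCons)
  let ?c = "map_mat (\<lambda>a::'a. [:a:])" and ?l = "[:0, 1::'a:]" and ?n = "Suc n"
  let ?E = "Matrix.mat ?n ?n (\<lambda>(i, j). if i = 0 \<and> j = 0 then 1 else 0 :: 'a)"
  have qp: "?c Q * ?c P = 1\<^sub>m ?n"
    using c.mat_hom_mult[OF Q P] by (simp add: QP c.mat_hom_one)
  have hom: "?c (Q * Z * P) = ?c Q * ?c Z * ?c P" if "Z \<in> carrier_mat ?n ?n" for Z
    using P Q that c.mat_hom_mult[of "Q * Z" ?n ?n P ?n] c.mat_hom_mult[of Q ?n ?n Z ?n] by simp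
  have "map_mat (\<lambda>a. [:0, a:]) R = ?l \<cdot>\<^sub>m ?c R" by (rule eq_matI) auto
  then have "?c X + map_mat (\<lambda>a. [:0, a:]) R = ?c X + ?l \<cdot>\<^sub>m ?c R" by simp
  moreover have "?c Q * (?c X + ?l \<cdot>\<^sub>m ?c R) * ?c P = (?c Q * ?c X + ?l \<cdot>\<^sub>m (?c Q * ?c R)) * ?c P"
    using P Q X R by (subst mult_add_distrib_mat[of _ ?n ?n]) (auto simp: mult_smult_distrib[of _ ?n ?n])
  moreover have "\<dots> = ?c (Q * X * P) + ?l \<cdot>\<^sub>m ?c (Q * R * P)"
    using P Q X R unfolding hom[OF X] hom[OF R]
    by (subst add_mult_distrib_mat[of _ ?n ?n]) (auto simp: mult_smult_assoc_mat[of _ ?n ?n _ ?n])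
  ultimately have eq: "?c Q * (?c X + map_mat (\<lambda>a. [:0, a:]) R) * ?c P = Matrix.mat ?n ?n (\<lambda>(i, j).
      ?c (Q * X * P) $$ (i, j) + (if i = 0 \<and> j = 0 then ?l else 0))"
    using P Q X by (auto simp: QRP)
  have car: "Q * X * P \<in> carrier_mat ?n ?n" using P Q X by (metis mult_carrier_mat)
  then have d: "mat_delete (Q * X * P) 0 0 \<in> carrier_mat n n"
    using mat_delete_carrier[OF car, of 0 0] by simp
  have "mat_delete (?c Z) 0 0 = ?c (mat_delete Z 0 0)" if "Z \<in> carrier_mat ?n ?n" for Z
    using that by (auto simp: mat_delete_def)
  from this[OF car] have "tr_ext_power (Suc k) (?c Q * (?c X + map_mat (\<lambda>a. [:0, a:]) R) * ?c P) =
      [:tr_ext_power (Suc k) (Q * X * P):] + ?l * [:tr_ext_power k (mat_delete (Q * X * P) 0 0):]"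
    unfolding eq using tr_ext_power_add_corner[of "?c (Q * X * P)" n k ?l] car
    by (simp only: c.hom_tr_ext_power[OF car] c.hom_tr_ext_power[OF d] map_carrier_mat)
  moreover have "tr_ext_power (Suc k) (?c Q * (?c X + map_mat (\<lambda>a. [:0, a:]) R) * ?c P) =
      tr_ext_power (Suc k) (?c X + map_mat (\<lambda>a. [:0, a:]) R)"
    by (rule tr_ext_power_similar[OF _ _ _ qp]) (use X P Q R in auto)
  ultimately show ?thesis by simp
qed

text \<open>For the projection \<open>f \<phi>\<close> onto the line spanned by \<open>f\<close>: the basis consisting of \<open>f\<close> and the columns of \<open>s\<close>
  makes the projection a matrix unit and \<open>g X s\<close> the complementary block of \<open>X\<close>.\<close>

lemma coeff_tr_ext_power_line:
  fixes X :: "'a::comm_ring_1 Matrix.mat"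
  assumes X: "X \<in> carrier_mat (Suc n) (Suc n)"
    and f: "f \<in> carrier_mat (Suc n) 1" and s: "s \<in> carrier_mat (Suc n) n"
    and \<phi>: "\<phi> \<in> carrier_mat 1 (Suc n)" and g: "g \<in> carrier_mat n (Suc n)"
    and inv: "\<phi> * f = 1\<^sub>m 1" "\<phi> * s = 0\<^sub>m 1 n" "g * f = 0\<^sub>m n 1" "g * s = 1\<^sub>m n"
  shows "poly.coeff (tr_ext_power (Suc k) (map_mat (\<lambda>a. [:a:]) X + map_mat (\<lambda>a. [:0, a:]) (f * \<phi>))) 1 =
    tr_ext_power k (g * X * s)"
proof -
  define P where "P = Matrix.mat (Suc n) (Suc n) (\<lambda>(i, j). case j of 0 \<Rightarrow> f $$ (i, 0) | Suc j \<Rightarrow> s $$ (i, j))"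
  define Q where "Q = Matrix.mat (Suc n) (Suc n) (\<lambda>(i, j). case i of 0 \<Rightarrow> \<phi> $$ (0, j) | Suc i \<Rightarrow> g $$ (i, j))"
  have P: "P \<in> carrier_mat (Suc n) (Suc n)" and Q: "Q \<in> carrier_mat (Suc n) (Suc n)" by (simp_all add: P_def Q_def)
  have block: "(Q * A * P) $$ (i, j) = (case (i, j) of (0, 0) \<Rightarrow> (\<phi> * A * f) $$ (0, 0) | (0, Suc j) \<Rightarrow> (\<phi> * A * s) $$ (0, j)
      | (Suc i, 0) \<Rightarrow> (g * A * f) $$ (i, 0) | (Suc i, Suc j) \<Rightarrow> (g * A * s) $$ (i, j))"
    if A: "A \<in> carrier_mat (Suc n) (Suc n)" and ij: "i < Suc n" "j < Suc n" for A i j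
  proof -
    note row = mult_carrier_mat[OF \<phi> A] mult_carrier_mat[OF g A] mult_carrier_mat[OF Q A]
    have "(Q * A) $$ (i, l) = (case i of 0 \<Rightarrow> (\<phi> * A) $$ (0, l) | Suc i \<Rightarrow> (g * A) $$ (i, l))" if "l < Suc n" for l
      unfolding index_mult_mat_sum[OF Q A ij(1) that]
      using ij(1) that by (cases i) (simp_all add: index_mult_mat_sum[OF \<phi> A] index_mult_mat_sum[OF g A] Q_def
          del: sum.lessThan_Suc index_mult_mat(1))
    then show ?thesis
      unfolding index_mult_mat_sum[OF row(3) P ij]
      using ij by (cases i; cases j) (simp_all add: index_mult_mat_sum[OF row(1) f] index_mult_mat_sum[OF row(1) s]
          index_mult_mat_sum[OF row(2) f] index_mult_mat_sum[OF row(2) s] P_def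
          del: sum.lessThan_Suc index_mult_mat(1))
  qed
  have one: "Q * P = 1\<^sub>m (Suc n)"
  proof (rule eq_matI)
    fix i j assume ij: "i < dim_row (1\<^sub>m (Suc n) :: 'a Matrix.mat)" "j < dim_col (1\<^sub>m (Suc n) :: 'a Matrix.mat)"
    have "Q * P = Q * 1\<^sub>m (Suc n) * P" by (simp only: right_mult_one_mat[OF Q])
    then show "(Q * P) $$ (i, j) = 1\<^sub>m (Suc n) $$ (i, j)"
      using ij block[OF one_carrier_mat, of i j]
      by (auto simp: right_mult_one_mat[OF \<phi>] right_mult_one_mat[OF g] inv simp del: index_mult_mat(1) split: nat.splits)
  qed (use P Q in auto)
  have R: "f * \<phi> \<in> carrier_mat (Suc n) (Suc n)" by (rule mult_carrier_mat[OF f \<phi>])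
  have L: "\<phi> * (f * \<phi>) = \<phi>" "g * (f * \<phi>) = 0\<^sub>m n (Suc n)"
    using \<phi> by (simp_all only: assoc_mult_mat[OF \<phi> f \<phi>, symmetric] assoc_mult_mat[OF g f \<phi>, symmetric] inv
        left_mult_one_mat[OF \<phi>] left_mult_zero_mat[OF \<phi>])
  have "Q * (f * \<phi>) * P = Matrix.mat (Suc n) (Suc n) (\<lambda>(i, j). if i = 0 \<and> j = 0 then 1 else 0)"
  proof (rule eq_matI)
    fix i j
    assume "i < dim_row (Matrix.mat (Suc n) (Suc n) (\<lambda>(i, j). if i = 0 \<and> j = 0 then 1 else 0) :: 'a Matrix.mat)"
      "j < dim_col (Matrix.mat (Suc n) (Suc n) (\<lambda>(i, j). if i = 0 \<and> j = 0 then 1 else 0) :: 'a Matrix.mat)"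
    then show "(Q * (f * \<phi>) * P) $$ (i, j) =
        Matrix.mat (Suc n) (Suc n) (\<lambda>(i, j). if i = 0 \<and> j = 0 then 1 else 0) $$ (i, j)"
      using block[OF R, of i j]
      by (auto simp: L inv left_mult_zero_mat[OF f] left_mult_zero_mat[OF s] simp del: index_mult_mat(1) split: nat.splits)
  qed (use P Q in auto)
  then have "poly.coeff (tr_ext_power (Suc k) (map_mat (\<lambda>a. [:a:]) X + map_mat (\<lambda>a. [:0, a:]) (f * \<phi>))) 1 =
      tr_ext_power k (mat_delete (Q * X * P) 0 0)"
    by (rule coeff_tr_ext_power_corner[OF X P Q R one])
  also have "mat_delete (Q * X * P) 0 0 = g * X * s"
  proof (rule eq_matI)
    fix i j assume "i < dim_row (g * X * s)" "j < dim_col (g * X * s)"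
    then have ij: "i < n" "j < n" using g s by auto
    have "mat_delete (Q * X * P) 0 0 $$ (i, j) = (Q * X * P) $$ (Suc i, Suc j)"
      using mat_delete_index[OF mult_carrier_mat[OF mult_carrier_mat[OF Q X] P], of 0 0 i j] ij
      by (simp add: insert_index_def del: index_mult_mat(1))
    then show "mat_delete (Q * X * P) 0 0 $$ (i, j) = (g * X * s) $$ (i, j)"
      using block[OF X, of "Suc i" "Suc j"] ij by simp
  qed (use P Q g s in auto)
  finally show ?thesis .
qed

section \<open>Products of anticommuting columns and rows\<close>

text \<open>Elimination of the first column with an invertible pivot.\<close>

lemma det_schur_corner:
  fixes M :: "'a::comm_ring_1 Matrix.mat"
  assumes M: "M \<in> carrier_mat (Suc n) (Suc n)" and b: "b * M $$ (0, 0) = 1"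
  shows "Determinant.det M = M $$ (0, 0) * Determinant.det (Matrix.mat n n (\<lambda>(i, j).
    M $$ (Suc i, Suc j) - b * M $$ (Suc i, 0) * M $$ (0, Suc j)))"
proof -
  define A where "A = Matrix.mat 1 1 (\<lambda>_. M $$ (0, 0))"
  define B where "B = Matrix.mat 1 n (\<lambda>(i, j). M $$ (0, Suc j))"
  define C where "C = Matrix.mat n 1 (\<lambda>(i, j). M $$ (Suc i, 0))"
  define D where "D = Matrix.mat n n (\<lambda>(i, j). M $$ (Suc i, Suc j))"
  define S where "S = Matrix.mat n n (\<lambda>(i, j). M $$ (Suc i, Suc j) - b * M $$ (Suc i, 0) * M $$ (0, Suc j))"
  define L where "L = four_block_mat (1\<^sub>m 1) (0\<^sub>m 1 n) ((-b) \<cdot>\<^sub>m C) (1\<^sub>m n)"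
  have car: "A \<in> carrier_mat 1 1" "B \<in> carrier_mat 1 n" "C \<in> carrier_mat n 1" "D \<in> carrier_mat n n"
    "S \<in> carrier_mat n n" by (simp_all add: A_def B_def C_def D_def S_def)
  have Meq: "M = four_block_mat A B C D"
    using M by (intro eq_matI) (auto simp: A_def B_def C_def D_def)
  have L: "L \<in> carrier_mat (Suc n) (Suc n)"
    using four_block_carrier_mat[of "1\<^sub>m 1" 1 1 "1\<^sub>m n" n n] by (simp add: L_def)
  have "Determinant.det L = 1"
  proof -
    have "L $$ (i, i) = 1" if "i < Suc n" for i using that by (auto simp: L_def)
    then have "map (\<lambda>i. L $$ (i, i)) [0..<Suc n] = map (\<lambda>i. 1) [0..<Suc n]" by simp
    then have "diag_mat L = replicate (Suc n) 1"
      using L by (simp only: diag_mat_def carrier_matD(1) map_replicate_const length_upt diff_zero)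
    moreover have "Determinant.det L = prod_list (diag_mat L)"
      by (rule det_lower_triangular[OF _ L]) (auto simp: L_def)
    ultimately show ?thesis by simp
  qed
  moreover have "L * M = four_block_mat A B (0\<^sub>m n 1) S"
  proof -
    have 1: "(-b) \<cdot>\<^sub>m C * A + 1\<^sub>m n * C = 0\<^sub>m n 1"
    proof (rule eq_matI)
      fix i j assume "i < dim_row (0\<^sub>m n 1 :: 'a Matrix.mat)" "j < dim_col (0\<^sub>m n 1 :: 'a Matrix.mat)"
      moreover have "b * M $$ (Suc i, 0) * M $$ (0, 0) = M $$ (Suc i, 0)"
        using arg_cong[OF b, of "\<lambda>x. M $$ (Suc i, 0) * x"] by (simp add: ac_simps)
      ultimately show "((-b) \<cdot>\<^sub>m C * A + 1\<^sub>m n * C) $$ (i, j) = 0\<^sub>m n 1 $$ (i, j)"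
        by (simp add: A_def C_def scalar_prod_def)
    qed (auto simp: A_def C_def)
    have 2: "(-b) \<cdot>\<^sub>m C * B + 1\<^sub>m n * D = S"
      by (intro eq_matI) (auto simp: B_def C_def D_def S_def scalar_prod_def algebra_simps)
    have 3: "1\<^sub>m 1 * A + 0\<^sub>m 1 n * C = A" "1\<^sub>m 1 * B + 0\<^sub>m 1 n * D = B"
      using car left_mult_zero_mat[OF car(3), of 1] left_mult_zero_mat[OF car(4), of 1]
      by simp_all
    show ?thesis unfolding Meq L_def
      by (subst mult_four_block_mat[where ?nr1.0=1 and ?n1.0=1 and ?n2.0=n and ?nr2.0=n and ?nc1.0=1 and ?nc2.0=n])
        (simp_all only: 1 2 3 smult_carrier_mat car one_carrier_mat zero_carrier_mat)
  qed
  moreover have "Determinant.det (four_block_mat A B (0\<^sub>m n 1) S) = Determinant.det A * Determinant.det S"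
    by (rule det_four_block_mat_lower_left_zero_col[of _ _ n]) (simp_all only: car)
  moreover have "Determinant.det A = M $$ (0, 0)"
    by (subst det_single) (auto simp: A_def)
  ultimately show ?thesis
    using det_mult[OF L M] by (simp add: S_def)
qed

text \<open>The relation holds for \<open>M(i, j) = a\<^sub>i b\<^sub>j\<close> with anticommuting \<open>a\<^sub>i\<close>, \<open>b\<^sub>j\<close>. It forces the corner entry \<open>m\<close> to
  have square zero, so \<open>1 - m\<close> can serve as a pivot, and it makes the Schur complement of \<open>1 - M\<close> equal to
  \<open>1 - (1 - m) M'\<close> for the remaining block \<open>M'\<close> of \<open>M\<close>, which is of the same kind.\<close>

lemma det_one_minus_anti_rank_one:
  fixes M :: "'a::comm_ring_1 Matrix.mat"
  assumes "M \<in> carrier_mat n n"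
    and "\<And>x::'a. x + x = 0 \<Longrightarrow> x = 0"
    and "\<And>i j k l. i < n \<Longrightarrow> j < n \<Longrightarrow> k < n \<Longrightarrow> l < n \<Longrightarrow>
      M $$ (i, j) * M $$ (k, l) = - (M $$ (i, l) * M $$ (k, j))"
  shows "Determinant.det (1\<^sub>m n - M) * (1 + mat_trace M) = 1"
  using assms(1,3)
proof (induction n arbitrary: M)
  case 0
  then have "Determinant.det (1\<^sub>m 0 - M) = 1" by (intro det_dim_zero minus_carrier_mat)
  then show ?case using 0 by (simp add: mat_trace_def)
next
  case (Suc n)
  note M = Suc.prems(1) and rel = Suc.prems(2)
  define m where "m = M $$ (0, 0)"
  (* the relation at one index only gives twice the square *)
  have "m * m + m * m = 0" using rel[of 0 0 0 0] by (simp add: m_def)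
  then have mm: "m * m = 0" by (rule assms(2))
  define M' where "M' = Matrix.mat n n (\<lambda>(i, j). M $$ (Suc i, Suc j))"
  define N where "N = (1 - m) \<cdot>\<^sub>m M'"
  have N: "N \<in> carrier_mat n n" by (simp add: N_def M'_def)
  have "Determinant.det (1\<^sub>m n - N) * (1 + mat_trace N) = 1"
  proof (rule Suc.IH[OF N])
    fix i j k l assume "i < n" "j < n" "k < n" "l < n"
    then show "N $$ (i, j) * N $$ (k, l) = - (N $$ (i, l) * N $$ (k, j))"
      using rel[of "Suc i" "Suc j" "Suc k" "Suc l"]
      by (simp add: N_def M'_def mult.left_commute mult.assoc flip: mult_minus_right)
  qed
  moreover have "Determinant.det (1\<^sub>m (Suc n) - M) = (1 - m) * Determinant.det (1\<^sub>m n - N)"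
  proof -
    (* the inverse of 1 - m is 1 + m since m * m = 0 *)
    have b: "(1 + m) * (1\<^sub>m (Suc n) - M) $$ (0, 0) = 1"
      using M mm by (simp add: m_def[symmetric] algebra_simps)
    have "Matrix.mat n n (\<lambda>(i, j). (1\<^sub>m (Suc n) - M) $$ (Suc i, Suc j) -
        (1 + m) * (1\<^sub>m (Suc n) - M) $$ (Suc i, 0) * (1\<^sub>m (Suc n) - M) $$ (0, Suc j)) = 1\<^sub>m n - N"
    proof (rule eq_matI)
      fix i j assume "i < dim_row (1\<^sub>m n - N)" "j < dim_col (1\<^sub>m n - N)"
      then have ij: "i < n" "j < n" using N by auto
      have "(1 + m) * (M $$ (Suc i, 0) * M $$ (0, Suc j)) = (1 + m) * - (M $$ (Suc i, Suc j) * m)"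
        using rel[of "Suc i" 0 0 "Suc j"] ij by (simp add: m_def)
      also have "\<dots> = - (M $$ (Suc i, Suc j) * m) - M $$ (Suc i, Suc j) * (m * m)"
        by (simp add: algebra_simps)
      finally have "(1 + m) * (M $$ (Suc i, 0) * M $$ (0, Suc j)) = - (M $$ (Suc i, Suc j) * m)"
        by (simp add: mm)
      then show "Matrix.mat n n (\<lambda>(i, j). (1\<^sub>m (Suc n) - M) $$ (Suc i, Suc j) -
        (1 + m) * (1\<^sub>m (Suc n) - M) $$ (Suc i, 0) * (1\<^sub>m (Suc n) - M) $$ (0, Suc j)) $$ (i, j) = (1\<^sub>m n - N) $$ (i, j)"
        using ij M N by (simp add: N_def M'_def algebra_simps)
    qed (use N in auto)
    then show ?thesis
      using det_schur_corner[of "1\<^sub>m (Suc n) - M" n "1 + m", OF minus_carrier_mat[OF M] b] M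
      by (simp add: m_def)
  qed
  moreover have "(1 - m) * (1 + mat_trace M) = 1 + mat_trace N"
  proof -
    have "mat_trace M = m + mat_trace M'"
      using M by (simp add: mat_trace_def M'_def m_def sum.lessThan_Suc_shift del: sum.lessThan_Suc)
    moreover have "mat_trace N = (1 - m) * mat_trace M'"
      by (simp add: mat_trace_def N_def M'_def sum_distrib_left)
    ultimately show ?thesis using mm by (simp add: algebra_simps)
  qed
  ultimately show ?case by (metis mult.assoc mult.commute)
qed

text \<open>Multiplying \<open>a\<^sub>i b\<^sub>j\<close> from the left by \<open>B\<close> replaces the column \<open>a\<close> by \<open>B a\<close>.\<close>

lemma anti_rank_one_mult:
  fixes M :: "'a::comm_ring_1 Matrix.mat"
  assumes B: "B \<in> carrier_mat n n" and M: "M \<in> carrier_mat n n"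
    and rel: "\<And>i j k l. i < n \<Longrightarrow> j < n \<Longrightarrow> k < n \<Longrightarrow> l < n \<Longrightarrow>
      M $$ (i, j) * M $$ (k, l) = - (M $$ (i, l) * M $$ (k, j))"
    and "i < n" "j < n" "k < n" "l < n"
  shows "(B * M) $$ (i, j) * (B * M) $$ (k, l) = - ((B * M) $$ (i, l) * (B * M) $$ (k, j))"
proof -
  have e: "(B * M) $$ (a, b) = (\<Sum>p<n. B $$ (a, p) * M $$ (p, b))" if "a < n" "b < n" for a b
    using that B M by (auto simp: scalar_prod_def atLeast0LessThan intro!: sum.cong)
  have "B $$ (i, p) * M $$ (p, j) * (B $$ (k, q) * M $$ (q, l)) =
      - (B $$ (i, p) * M $$ (p, l) * (B $$ (k, q) * M $$ (q, j)))" if "p < n" "q < n" for p q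
  proof -
    have "B $$ (i, p) * M $$ (p, j) * (B $$ (k, q) * M $$ (q, l)) =
        B $$ (i, p) * B $$ (k, q) * (M $$ (p, j) * M $$ (q, l))" by (simp only: ac_simps)
    also have "\<dots> = B $$ (i, p) * B $$ (k, q) * - (M $$ (p, l) * M $$ (q, j))"
      using rel[of p j q l] that assms(4-) by simp
    finally show ?thesis by (simp only: ac_simps mult_minus_right)
  qed
  then show ?thesis
    using assms(4-) by (simp add: e sum_product sum_negf[symmetric])
qed

section \<open>Smooth functions\<close>

lemma has_derivative_cong_open:
  assumes "open S" "x \<in> S" "\<And>y. y \<in> S \<Longrightarrow> f y = g y"
  shows "(f has_derivative f') (at x) \<longleftrightarrow> (g has_derivative f') (at x)"
  using has_derivative_transform_within_open[OF _ assms(1,2)] assms(3) by metis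

lemma frechet_derivative_cong_open:
  assumes "open S" "x \<in> S" "\<And>y. y \<in> S \<Longrightarrow> f y = g y"
  shows "frechet_derivative f (at x) = frechet_derivative g (at x)"
  unfolding frechet_derivative_def using has_derivative_cong_open[OF assms] by simp

lemma Ck_on_cong:
  assumes "open S" "\<And>y. y \<in> S \<Longrightarrow> f y = g y"
  shows "Ck_on k S f \<longleftrightarrow> Ck_on k S g"
  using assms(2)
proof (induction k arbitrary: f g)
  case 0
  have "continuous_on S f \<longleftrightarrow> continuous_on S g" by (rule continuous_on_cong[OF refl 0])
  then show ?case by simp
next
  case (Suc k)
  have "f differentiable (at x) \<longleftrightarrow> g differentiable (at x)" if "x \<in> S" for x
    using has_derivative_cong_open[OF assms(1) that Suc.prems] unfolding differentiable_def by simp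
  moreover have "Ck_on k S (\<lambda>x. frechet_derivative f (at x) v) \<longleftrightarrow> Ck_on k S (\<lambda>x. frechet_derivative g (at x) v)" for v
    by (rule Suc.IH, subst frechet_derivative_cong_open[OF assms(1) _ Suc.prems]) auto
  ultimately show ?case by simp
qed

lemma Ck_on_SucI:
  assumes "open S" "\<And>x. x \<in> S \<Longrightarrow> (f has_derivative f' x) (at x)"
    and "\<And>v. Ck_on k S (\<lambda>x. f' x v)"
  shows "Ck_on (Suc k) S f"
proof -
  have "frechet_derivative f (at x) v = f' x v" if "x \<in> S" for x v
    using frechet_derivative_at[OF assms(2)[OF that]] by simp
  then show ?thesis
    using assms(2,3) Ck_on_cong[OF assms(1), of "\<lambda>x. frechet_derivative f (at x) _"]
    by (auto simp: differentiable_def)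
qed

lemma Ck_on_SucD:
  assumes "Ck_on (Suc k) S f"
  shows "x \<in> S \<Longrightarrow> (f has_derivative frechet_derivative f (at x)) (at x)"
    and "Ck_on k S (\<lambda>x. frechet_derivative f (at x) v)"
  using assms by (simp_all add: frechet_derivative_works[symmetric])

lemma Ck_on_Suc_imp: "Ck_on (Suc k) S f \<Longrightarrow> Ck_on k S f"
proof (induction k arbitrary: f)
  case 0
  then show ?case
    by (auto intro!: continuous_at_imp_continuous_on dest: differentiable_imp_continuous_within)
next
  case (Suc k)
  then have "Ck_on (Suc k) S (\<lambda>x. frechet_derivative f (at x) v)" for v by simp
  from Suc.IH[OF this] Suc.prems show ?case by simp
qed

lemma Ck_on_subset: "Ck_on k T f \<Longrightarrow> S \<subseteq> T \<Longrightarrow> Ck_on k S f"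
  by (induction k arbitrary: f) (auto intro: continuous_on_subset)

lemma Ck_on_const: "Ck_on k S (\<lambda>x. c)"
  by (induction k arbitrary: c) auto

lemma Ck_on_add:
  assumes "open S" "Ck_on k S f" "Ck_on k S g"
  shows "Ck_on k S (\<lambda>x. f x + g x)"
  using assms(2,3)
proof (induction k arbitrary: f g)
  case (Suc k)
  show ?case
  proof (rule Ck_on_SucI[OF assms(1)])
    show "((\<lambda>x. f x + g x) has_derivative (\<lambda>v. frechet_derivative f (at x) v + frechet_derivative g (at x) v)) (at x)"
      if "x \<in> S" for x
      by (intro has_derivative_add Ck_on_SucD(1)[OF Suc.prems(1) that] Ck_on_SucD(1)[OF Suc.prems(2) that])
  qed (intro Suc.IH Ck_on_SucD(2) Suc.prems)
qed (auto intro: continuous_intros)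

lemma Ck_on_mult:
  fixes f g :: "'a::real_normed_vector \<Rightarrow> complex"
  assumes "open S" "Ck_on k S f" "Ck_on k S g"
  shows "Ck_on k S (\<lambda>x. f x * g x)"
  using assms(2,3)
proof (induction k arbitrary: f g)
  case (Suc k)
  show ?case
  proof (rule Ck_on_SucI[OF assms(1)])
    show "((\<lambda>x. f x * g x) has_derivative (\<lambda>v. f x * frechet_derivative g (at x) v + frechet_derivative f (at x) v * g x)) (at x)"
      if "x \<in> S" for x
      by (intro has_derivative_mult Ck_on_SucD(1)[OF Suc.prems(1) that] Ck_on_SucD(1)[OF Suc.prems(2) that])
    show "Ck_on k S (\<lambda>x. f x * frechet_derivative g (at x) v + frechet_derivative f (at x) v * g x)" for v
      by (intro Ck_on_add assms(1) Suc.IH Ck_on_SucD(2)[OF Suc.prems(1)] Ck_on_SucD(2)[OF Suc.prems(2)]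
        Ck_on_Suc_imp[OF Suc.prems(1)] Ck_on_Suc_imp[OF Suc.prems(2)])
  qed
qed (auto intro: continuous_intros)

lemma Ck_on_bounded_linear:
  assumes "bounded_linear L" "open S" "Ck_on k S f"
  shows "Ck_on k S (\<lambda>x. L (f x))"
  using assms(3)
proof (induction k arbitrary: f)
  case 0
  then show ?case using bounded_linear.continuous_on[OF assms(1)] by auto
next
  case (Suc k)
  show ?case
    by (rule Ck_on_SucI[OF assms(2) bounded_linear.has_derivative[OF assms(1) Ck_on_SucD(1)[OF Suc.prems]]])
      (auto intro: Suc.IH Ck_on_SucD(2)[OF Suc.prems])
qed

lemma Ck_on_inverse:
  fixes f :: "'a::real_normed_vector \<Rightarrow> complex"
  assumes "open S" "Ck_on k S f" "\<And>x. x \<in> S \<Longrightarrow> f x \<noteq> 0"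
  shows "Ck_on k S (\<lambda>x. inverse (f x))"
  using assms(2)
proof (induction k)
  case 0
  then show ?case using assms(3) by (auto intro: continuous_intros)
next
  case (Suc k)
  have inv: "Ck_on k S (\<lambda>x. inverse (f x))"
    by (rule Suc.IH[OF Ck_on_Suc_imp[OF Suc.prems]])
  show ?case
  proof (rule Ck_on_SucI[OF assms(1)])
    show "((\<lambda>x. inverse (f x)) has_derivative
        (\<lambda>v. - 1 * (inverse (f x) * frechet_derivative f (at x) v * inverse (f x)))) (at x)" if "x \<in> S" for x
      using Deriv.has_derivative_inverse[OF assms(3)[OF that] Ck_on_SucD(1)[OF Suc.prems that]] by simp
    show "Ck_on k S (\<lambda>x. - 1 * (inverse (f x) * frechet_derivative f (at x) v * inverse (f x)))" for v
      by (intro Ck_on_mult Ck_on_const assms(1) inv Ck_on_SucD(2) Suc.prems)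
  qed
qed

lemma smooth_on_cong:
  "open S \<Longrightarrow> (\<And>y. y \<in> S \<Longrightarrow> f y = g y) \<Longrightarrow> smooth_on S f \<longleftrightarrow> smooth_on S g"
  unfolding smooth_on_def using Ck_on_cong[of S f g] by blast

lemma smooth_on_subset: "smooth_on T f \<Longrightarrow> S \<subseteq> T \<Longrightarrow> smooth_on S f"
  unfolding smooth_on_def using Ck_on_subset by blast

lemma smooth_on_const [simp]: "smooth_on S (\<lambda>x. c)"
  unfolding smooth_on_def using Ck_on_const by blast

lemma smooth_on_add: "open S \<Longrightarrow> smooth_on S f \<Longrightarrow> smooth_on S g \<Longrightarrow> smooth_on S (\<lambda>x. f x + g x)"
  unfolding smooth_on_def using Ck_on_add by blast

lemma smooth_on_mult:
  fixes f g :: "'a::real_normed_vector \<Rightarrow> complex"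
  shows "open S \<Longrightarrow> smooth_on S f \<Longrightarrow> smooth_on S g \<Longrightarrow> smooth_on S (\<lambda>x. f x * g x)"
  unfolding smooth_on_def using Ck_on_mult by blast

lemma smooth_on_sum: "open S \<Longrightarrow> (\<And>i. i \<in> I \<Longrightarrow> smooth_on S (f i)) \<Longrightarrow> smooth_on S (\<lambda>x. \<Sum>i\<in>I. f i x)"
  by (induction I rule: infinite_finite_induct) (auto intro: smooth_on_add)

lemma smooth_on_prod:
  fixes f :: "'i \<Rightarrow> 'a::real_normed_vector \<Rightarrow> complex"
  shows "open S \<Longrightarrow> (\<And>i. i \<in> I \<Longrightarrow> smooth_on S (f i)) \<Longrightarrow> smooth_on S (\<lambda>x. \<Prod>i\<in>I. f i x)"
  by (induction I rule: infinite_finite_induct) (auto intro: smooth_on_mult)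

lemma smooth_on_cnj: "open S \<Longrightarrow> smooth_on S f \<Longrightarrow> smooth_on S (\<lambda>x. cnj (f x))"
  unfolding smooth_on_def using Ck_on_bounded_linear[OF bounded_linear_cnj] by blast

lemma smooth_on_inverse:
  fixes f :: "'a::real_normed_vector \<Rightarrow> complex"
  shows "open S \<Longrightarrow> smooth_on S f \<Longrightarrow> (\<And>x. x \<in> S \<Longrightarrow> f x \<noteq> 0) \<Longrightarrow> smooth_on S (\<lambda>x. inverse (f x))"
  unfolding smooth_on_def using Ck_on_inverse by blast

lemma smooth_on_has_derivative:
  "smooth_on S f \<Longrightarrow> x \<in> S \<Longrightarrow> (f has_derivative frechet_derivative f (at x)) (at x)"
  unfolding smooth_on_def using Ck_on_SucD(1) by blast

lemma smooth_on_differentiable: "smooth_on S f \<Longrightarrow> x \<in> S \<Longrightarrow> f differentiable (at x)"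
  using smooth_on_has_derivative differentiable_def by blast

lemma smooth_on_frechet_derivative:
  "smooth_on S f \<Longrightarrow> smooth_on S (\<lambda>x. frechet_derivative f (at x) v)"
  unfolding smooth_on_def using Ck_on_SucD(2) by blast

text \<open>The second difference of \<open>f\<close> at \<open>x\<close> along \<open>t v\<close> and \<open>t w\<close> is \<open>t\<^sup>2\<close> times the second derivative
  up to \<open>o(t\<^sup>2)\<close>; since it is symmetric in \<open>v\<close> and \<open>w\<close>, so is the second derivative.\<close>

lemma second_difference_estimate:
  fixes f :: "'a::real_normed_vector \<Rightarrow> complex"
  assumes S: "open S" "x \<in> S" and f: "\<And>y. y \<in> S \<Longrightarrow> f differentiable (at y)"
    and h: "((\<lambda>y. frechet_derivative f (at y) v) has_derivative h') (at x)" and e: "e > 0"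
  shows "\<exists>d>0. \<forall>t. 0 < t \<and> t < d \<longrightarrow>
    cmod (f (x + t *\<^sub>R v + t *\<^sub>R w) - f (x + t *\<^sub>R v) - f (x + t *\<^sub>R w) + f x - t\<^sup>2 *\<^sub>R h' w) \<le> e * t\<^sup>2"
proof -
  define h where "h = (\<lambda>y. frechet_derivative f (at y) v)"
  define C where "C = 2 * norm v + norm w + 1"
  have C: "C > 0" by (simp add: C_def add_nonneg_pos)
  obtain r where r: "r > 0" "ball x r \<subseteq> S" using S openE by blast
  have "e / C > 0" using e C by simp
  with h obtain \<delta> where \<delta>: "\<delta> > 0"
    "\<And>y. norm (y - x) < \<delta> \<Longrightarrow> norm (h y - h x - h' (y - x)) \<le> e / C * norm (y - x)"
    unfolding has_derivative_at_alt h_def by blast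
  have lin: "linear h'" using h has_derivative_linear by blast
  define d where "d = min r \<delta> / C"
  have "d > 0" using r(1) \<delta>(1) C by (simp add: d_def)
  moreover have "cmod (f (x + t *\<^sub>R v + t *\<^sub>R w) - f (x + t *\<^sub>R v) - f (x + t *\<^sub>R w) + f x - t\<^sup>2 *\<^sub>R h' w) \<le> e * t\<^sup>2"
    if t: "0 < t" "t < d" for t
  proof -
    have tC: "t * C < r" "t * C < \<delta>" using t C by (auto simp: d_def field_simps)
    have near: "norm (s *\<^sub>R v) \<le> t * norm v" "norm (s *\<^sub>R v + t *\<^sub>R w) \<le> t * (norm v + norm w)" if "0 \<le> s" "s \<le> t" for s
    proof -
      show 1: "norm (s *\<^sub>R v) \<le> t * norm v" using that by (simp add: mult_right_mono)
      show "norm (s *\<^sub>R v + t *\<^sub>R w) \<le> t * (norm v + norm w)"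
        using 1 norm_triangle_ineq[of "s *\<^sub>R v" "t *\<^sub>R w"] t by (simp add: algebra_simps)
    qed
    have le: "t * norm v \<le> t * C" "t * (norm v + norm w) \<le> t * C"
      using t by (intro mult_left_mono; simp add: C_def)+
    (* the second difference is g t - g 0, to which the mean value theorem applies; the derivative
       of g is controlled by the differentiability of h at x *)
    define g where "g = (\<lambda>s. f (x + s *\<^sub>R v + t *\<^sub>R w) - f (x + s *\<^sub>R v) - (s * t) *\<^sub>R h' w)"
    have inS: "x + s *\<^sub>R v \<in> S" "x + s *\<^sub>R v + t *\<^sub>R w \<in> S" if "0 \<le> s" "s \<le> t" for s
    proof -
      have "norm (s *\<^sub>R v) < r" "norm (s *\<^sub>R v + t *\<^sub>R w) < r"
        using near[OF that] le tC by linarith+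
      moreover have "x + u \<in> ball x r" if "norm u < r" for u using that by (simp add: dist_norm)
      ultimately have "x + s *\<^sub>R v \<in> ball x r" "x + (s *\<^sub>R v + t *\<^sub>R w) \<in> ball x r" by blast+
      then show "x + s *\<^sub>R v \<in> S" "x + s *\<^sub>R v + t *\<^sub>R w \<in> S"
        using r(2) by (auto simp: add.assoc)
    qed
    define g' where "g' = (\<lambda>s u. u *\<^sub>R (h (x + s *\<^sub>R v + t *\<^sub>R w) - h (x + s *\<^sub>R v) - t *\<^sub>R h' w))"
    have der: "(g has_derivative g' s) (at s)" if s: "0 \<le> s" "s \<le> t" for s
    proof -
      have lf: "linear (frechet_derivative f (at y))" if "y \<in> S" for y
        using f[OF that] by (rule linear_frechet_derivative)
      have "((\<lambda>s. f (x + s *\<^sub>R v + t *\<^sub>R w)) has_derivative (\<lambda>u. frechet_derivative f (at (x + s *\<^sub>R v + t *\<^sub>R w)) (u *\<^sub>R v))) (at s)"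
        by (rule has_derivative_compose[of "\<lambda>s. x + s *\<^sub>R v + t *\<^sub>R w" "\<lambda>u. u *\<^sub>R v" s UNIV f])
          (auto intro!: derivative_eq_intros frechet_derivative_works[THEN iffD1] f inS s)
      moreover have "((\<lambda>s. f (x + s *\<^sub>R v)) has_derivative (\<lambda>u. frechet_derivative f (at (x + s *\<^sub>R v)) (u *\<^sub>R v))) (at s)"
        by (rule has_derivative_compose[of "\<lambda>s. x + s *\<^sub>R v" "\<lambda>u. u *\<^sub>R v" s UNIV f])
          (auto intro!: derivative_eq_intros frechet_derivative_works[THEN iffD1] f inS s)
      moreover have "((\<lambda>s. (s * t) *\<^sub>R h' w) has_derivative (\<lambda>u. (u * t) *\<^sub>R h' w)) (at s)"
        by (auto intro!: derivative_eq_intros)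
      ultimately have "(g has_derivative (\<lambda>u. frechet_derivative f (at (x + s *\<^sub>R v + t *\<^sub>R w)) (u *\<^sub>R v) -
          frechet_derivative f (at (x + s *\<^sub>R v)) (u *\<^sub>R v) - (u * t) *\<^sub>R h' w)) (at s)"
        unfolding g_def by (intro has_derivative_diff)
      moreover have "(\<lambda>u. frechet_derivative f (at (x + s *\<^sub>R v + t *\<^sub>R w)) (u *\<^sub>R v) -
          frechet_derivative f (at (x + s *\<^sub>R v)) (u *\<^sub>R v) - (u * t) *\<^sub>R h' w) = g' s"
        unfolding g'_def h_def
        by (rule ext) (simp only: linear_scale[OF lf[OF inS(1)[OF s]]] linear_scale[OF lf[OF inS(2)[OF s]]]
            scaleR_diff_right scaleR_scaleR)
      ultimately show ?thesis by simp
    qed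
    have "\<exists>s\<in>{0<..<t}. norm (g t - g 0) \<le> norm (g' s (t - 0))"
    proof (rule mvt_general)
      show "continuous_on {0..t} g"
        using der by (intro continuous_at_imp_continuous_on ballI has_derivative_continuous) auto
    qed (use t der in auto)
    then obtain s where s: "0 < s" "s < t" "norm (g t - g 0) \<le> norm (g' s t)" by auto
    define a where "a = s *\<^sub>R v + t *\<^sub>R w"
    define b where "b = s *\<^sub>R v"
    have a: "norm a \<le> t * (norm v + norm w)" and b: "norm b \<le> t * norm v"
      using near[of s] s by (simp_all add: a_def b_def)
    have "norm (h (x + a) - h x - h' a) \<le> e / C * norm a"
      using \<delta>(2)[of "x + a"] a le tC by simp
    moreover have "norm (h (x + b) - h x - h' b) \<le> e / C * norm b"
      using \<delta>(2)[of "x + b"] b le tC by simp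
    moreover have "h (x + a) - h (x + b) - t *\<^sub>R h' w = (h (x + a) - h x - h' a) - (h (x + b) - h x - h' b)"
      by (simp add: a_def b_def linear_add[OF lin] linear_scale[OF lin])
    ultimately have "norm (h (x + a) - h (x + b) - t *\<^sub>R h' w) \<le> e / C * norm a + e / C * norm b"
      using norm_triangle_ineq4[of "h (x + a) - h x - h' a" "h (x + b) - h x - h' b"] by (simp only:)
    also have "\<dots> = e / C * (norm a + norm b)" by (simp add: algebra_simps)
    also have "\<dots> \<le> e / C * (t * C)"
    proof (rule mult_left_mono)
      have "t * (norm v + norm w) + t * norm v \<le> t * C" using t by (simp add: C_def algebra_simps)
      then show "norm a + norm b \<le> t * C" using a b by linarith
    qed (use e C in simp)
    also have "\<dots> = e * t" using C by simp
    finally have "norm (h (x + a) - h (x + b) - t *\<^sub>R h' w) \<le> e * t" .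
    then have "t * norm (h (x + a) - h (x + b) - t *\<^sub>R h' w) \<le> t * (e * t)"
      using t by (intro mult_left_mono) auto
    then have "norm (g' s t) \<le> e * t\<^sup>2"
      using t by (simp add: g'_def a_def b_def add.assoc power2_eq_square ac_simps)
    moreover have "g t - g 0 = f (x + t *\<^sub>R v + t *\<^sub>R w) - f (x + t *\<^sub>R v) - f (x + t *\<^sub>R w) + f x - t\<^sup>2 *\<^sub>R h' w"
      by (simp add: g_def power2_eq_square)
    ultimately show ?thesis using s(3) by simp
  qed
  ultimately show ?thesis by blast
qed

lemma smooth_on_symmetric_derivative:
  fixes f :: "'a::real_normed_vector \<Rightarrow> complex"
  assumes S: "open S" "x \<in> S" and f: "smooth_on S f"
  shows "frechet_derivative (\<lambda>y. frechet_derivative f (at y) v) (at x) w =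
    frechet_derivative (\<lambda>y. frechet_derivative f (at y) w) (at x) v"
proof (rule ccontr)
  define a where "a = frechet_derivative (\<lambda>y. frechet_derivative f (at y) v) (at x) w"
  define b where "b = frechet_derivative (\<lambda>y. frechet_derivative f (at y) w) (at x) v"
  assume "\<not> ?thesis"
  then have ne: "cmod (a - b) > 0" by (simp add: a_def b_def)
  define e where "e = cmod (a - b) / 3"
  have e: "e > 0" using ne by (simp add: e_def)
  note d = smooth_on_differentiable[OF f]
  note h = smooth_on_has_derivative[OF smooth_on_frechet_derivative[OF f] S(2)]
  obtain d1 where d1: "d1 > 0" "\<And>t. 0 < t \<Longrightarrow> t < d1 \<Longrightarrow>
    cmod (f (x + t *\<^sub>R v + t *\<^sub>R w) - f (x + t *\<^sub>R v) - f (x + t *\<^sub>R w) + f x - t\<^sup>2 *\<^sub>R a) \<le> e * t\<^sup>2"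
    using second_difference_estimate[OF S d h[of v] e, of w] unfolding a_def by blast
  obtain d2 where d2: "d2 > 0" "\<And>t. 0 < t \<Longrightarrow> t < d2 \<Longrightarrow>
    cmod (f (x + t *\<^sub>R w + t *\<^sub>R v) - f (x + t *\<^sub>R w) - f (x + t *\<^sub>R v) + f x - t\<^sup>2 *\<^sub>R b) \<le> e * t\<^sup>2"
    using second_difference_estimate[OF S d h[of w] e, of v] unfolding b_def by blast
  define t where "t = min d1 d2 / 2"
  have t: "0 < t" "t < d1" "t < d2" using d1(1) d2(1) by (auto simp: t_def)
  define Q where "Q = f (x + t *\<^sub>R v + t *\<^sub>R w) - f (x + t *\<^sub>R v) - f (x + t *\<^sub>R w) + f x"
  have "cmod (Q - t\<^sup>2 *\<^sub>R a) \<le> e * t\<^sup>2" using d1(2)[OF t(1,2)] by (simp add: Q_def)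
  moreover have "cmod (Q - t\<^sup>2 *\<^sub>R b) \<le> e * t\<^sup>2"
    using d2(2)[OF t(1,3)] by (simp add: Q_def algebra_simps)
  ultimately have "cmod ((Q - t\<^sup>2 *\<^sub>R b) - (Q - t\<^sup>2 *\<^sub>R a)) \<le> e * t\<^sup>2 + e * t\<^sup>2"
    using norm_triangle_ineq4[of "Q - t\<^sup>2 *\<^sub>R b" "Q - t\<^sup>2 *\<^sub>R a"] by linarith
  then have "cmod (t\<^sup>2 *\<^sub>R (a - b)) \<le> 2 * e * t\<^sup>2" by (simp add: algebra_simps)
  then have "t\<^sup>2 * cmod (a - b) \<le> t\<^sup>2 * (2 * e)" by (simp add: ac_simps)
  then have "cmod (a - b) \<le> 2 * e" using t by (simp add: mult_le_cancel_left)
  then show False using ne by (simp add: e_def)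
qed

section \<open>Holomorphic functions of several variables are smooth\<close>

lemma norm_vector_scalar_mult: "norm (a *s v) = cmod a * norm v" for v :: "complex ^ 'n::finite"
  by (simp add: norm_vec_def L2_set_def norm_mult power_mult_distrib sum_distrib_left[symmetric] real_sqrt_mult)

lemma bounded_linear_vector_scalar_mult_left: "bounded_linear (\<lambda>a. a *s v)" for v :: "complex ^ 'n::finite"
  by (rule bounded_linear_intro[where K = "norm v"])
    (auto simp: norm_vector_scalar_mult Finite_Cartesian_Product.vec_eq_iff algebra_simps)

lemma holo_onD:
  assumes "holo_on S f" "z \<in> S"
  shows "(f has_derivative frechet_derivative f (at z)) (at z)"
    and "frechet_derivative f (at z) (a *s v) = a * frechet_derivative f (at z) v"
proof -
  obtain f' where f': "(f has_derivative f') (at z)" "\<And>a v. f' (a *s v) = a * f' v"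
    using assms unfolding holo_on_def by blast
  moreover have "frechet_derivative f (at z) = f'" using frechet_derivative_at[OF f'(1)] by simp
  ultimately show "(f has_derivative frechet_derivative f (at z)) (at z)"
    "frechet_derivative f (at z) (a *s v) = a * frechet_derivative f (at z) v" by simp_all
qed

lemma holo_on_line:
  assumes f: "holo_on S f" and "z + a *s v \<in> S"
  shows "((\<lambda>a. f (z + a *s v)) has_field_derivative frechet_derivative f (at (z + a *s v)) v) (at a)"
proof -
  have "((\<lambda>a. z + a *s v) has_derivative (\<lambda>b. b *s v)) (at a)"
    using bounded_linear_imp_has_derivative[OF bounded_linear_vector_scalar_mult_left[of v], of "at a"]
    by (auto intro!: derivative_eq_intros)
  from has_derivative_compose[OF this holo_onD(1)[OF f assms(2)]] show ?thesis
    by (simp add: has_field_derivative_def holo_onD(2)[OF f assms(2)] mult_commute_abs)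
qed

text \<open>The Cauchy estimate for a directional derivative, read off from the restriction of \<open>f\<close> to a
  complex line.\<close>

lemma holo_on_Cauchy_estimate:
  assumes f: "holo_on S f" and S: "cball z r \<subseteq> S" and r: "r > 0"
    and B: "\<And>w. w \<in> cball z r \<Longrightarrow> cmod (f w) \<le> B"
  shows "cmod (frechet_derivative f (at z) v) \<le> B / r * norm v"
proof (cases "v = 0")
  case True
  have "z \<in> S" using S r by auto
  then have "linear (frechet_derivative f (at z))" using holo_onD(1)[OF f] has_derivative_linear by blast
  then show ?thesis using True linear_0 by auto
next
  case False
  define \<rho> where "\<rho> = r / norm v"
  have \<rho>: "\<rho> > 0" using r False by (simp add: \<rho>_def)
  define \<phi> where "\<phi> = (\<lambda>a. f (z + a *s v))"
  have inS: "z + a *s v \<in> cball z r" if "cmod a \<le> \<rho>" for a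
    using that False by (simp add: dist_norm norm_vector_scalar_mult \<rho>_def field_simps)
  have der: "(\<phi> has_field_derivative frechet_derivative f (at (z + a *s v)) v) (at a)" if "cmod a \<le> \<rho>" for a
    unfolding \<phi>_def by (rule holo_on_line[OF f]) (use inS[OF that] S in blast)
  have "cmod ((deriv ^^ 1) \<phi> 0) \<le> fact 1 * B / \<rho> ^ 1"
  proof (rule Cauchy_inequality[OF _ _ \<rho>])
    show "\<phi> holomorphic_on ball 0 \<rho>"
      using der less_imp_le unfolding holomorphic_on_open[OF open_ball] by (metis mem_ball_0)
    show "continuous_on (cball 0 \<rho>) \<phi>"
      using der by (intro continuous_at_imp_continuous_on ballI DERIV_isCont[where D = "frechet_derivative f (at (z + _ *s v)) v"]) auto
    show "cmod (\<phi> a) \<le> B" if "cmod (0 - a) = \<rho>" for a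
      unfolding \<phi>_def by (rule B[OF inS]) (use that in simp)
  qed
  moreover have "deriv \<phi> 0 = frechet_derivative f (at z) v"
    using DERIV_imp_deriv[OF der[of 0]] \<rho> by simp
  ultimately show ?thesis by (simp add: \<rho>_def)
qed

text \<open>Taylor's formula on a complex line, where the Cauchy inequality bounds the second derivative.\<close>

lemma holo_on_difference_quotient_estimate:
  assumes f: "holo_on S f" and S: "cball z (2 * r) \<subseteq> S" and r: "r > 0"
    and B: "\<And>w. w \<in> cball z (2 * r) \<Longrightarrow> cmod (f w) \<le> B"
    and t: "cmod t * norm v \<le> r"
  shows "cmod (f (z + t *s v) - f z - t * frechet_derivative f (at z) v) \<le> 2 * B / r\<^sup>2 * (cmod t * norm v)\<^sup>2"
proof (cases "v = 0")
  case True
  have "z \<in> S" using S r by auto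
  then have "linear (frechet_derivative f (at z))" using holo_onD(1)[OF f] has_derivative_linear by blast
  then show ?thesis using True linear_0 by auto
next
  case False
  define \<rho> where "\<rho> = r / norm v"
  have \<rho>: "\<rho> > 0" using r False by (simp add: \<rho>_def)
  define \<phi> where "\<phi> = (\<lambda>a. f (z + a *s v))"
  have inS: "z + a *s v \<in> cball z (2 * r)" if "cmod a \<le> 2 * \<rho>" for a
    using that False by (simp add: dist_norm norm_vector_scalar_mult \<rho>_def field_simps)
  have der: "(\<phi> has_field_derivative frechet_derivative f (at (z + a *s v)) v) (at a)" if "cmod a \<le> 2 * \<rho>" for a
    unfolding \<phi>_def by (rule holo_on_line[OF f]) (use inS[OF that] S in blast)
  have holo: "\<phi> holomorphic_on ball 0 (2 * \<rho>)"
    using der less_imp_le unfolding holomorphic_on_open[OF open_ball] by (metis mem_ball_0)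
  have dball: "((deriv ^^ i) \<phi> has_field_derivative (deriv ^^ Suc i) \<phi> a) (at a within cball 0 \<rho>)"
    if "a \<in> cball 0 \<rho>" for i a
  proof -
    have "(deriv ^^ i) \<phi> holomorphic_on ball 0 (2 * \<rho>)"
      by (rule holomorphic_higher_deriv[OF holo]) simp
    then have "((deriv ^^ i) \<phi> has_field_derivative deriv ((deriv ^^ i) \<phi>) a) (at a)"
      by (rule holomorphic_derivI[OF _ open_ball]) (use that \<rho> in simp)
    then show ?thesis by (simp add: has_field_derivative_at_within)
  qed
  have cauchy: "cmod ((deriv ^^ Suc 1) \<phi> a) \<le> 2 * B / \<rho>\<^sup>2" if "a \<in> cball 0 \<rho>" for a
  proof -
    have near: "cmod b \<le> 2 * \<rho>" if "cmod (a - b) \<le> \<rho>" for b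
      using norm_triangle_ineq4[of a "a - b"] that \<open>a \<in> _\<close> by simp
    have "cmod ((deriv ^^ 2) \<phi> a) \<le> fact 2 * B / \<rho> ^ 2"
    proof (rule Cauchy_inequality[OF _ _ \<rho>])
      show "\<phi> holomorphic_on ball a \<rho>"
        using der near less_imp_le unfolding holomorphic_on_open[OF open_ball] by (metis mem_ball dist_norm)
      show "continuous_on (cball a \<rho>) \<phi>"
        using der near by (intro continuous_at_imp_continuous_on ballI DERIV_isCont[where D = "frechet_derivative f (at (z + _ *s v)) v"]) (auto simp: dist_norm)
      show "cmod (\<phi> b) \<le> B" if "cmod (a - b) = \<rho>" for b
        unfolding \<phi>_def by (rule B[OF inS[OF near]]) (use that in simp)
    qed
    then show ?thesis by (simp add: numeral_2_eq_2)
  qed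
  have "cmod t \<le> \<rho>" using t False by (simp add: \<rho>_def field_simps)
  then have "cmod ((deriv ^^ 0) \<phi> t - (\<Sum>i\<le>1. (deriv ^^ i) \<phi> 0 * (t - 0) ^ i / fact i))
      \<le> 2 * B / \<rho>\<^sup>2 * cmod (t - 0) ^ Suc 1 / fact 1"
    using \<rho> by (intro complex_Taylor[where S = "cball 0 \<rho>" and f = "\<lambda>i. (deriv ^^ i) \<phi>"] dball cauchy) auto
  moreover have "deriv \<phi> 0 = frechet_derivative f (at z) v"
    using DERIV_imp_deriv[OF der[of 0]] \<rho> by simp
  ultimately have "cmod (f (z + t *s v) - (f z + t * frechet_derivative f (at z) v)) \<le> 2 * B / \<rho>\<^sup>2 * (cmod t)\<^sup>2"
    by (simp add: \<phi>_def mult.commute power2_eq_square)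
  moreover have "2 * B / \<rho>\<^sup>2 * (cmod t)\<^sup>2 = 2 * B / r\<^sup>2 * (cmod t * norm v)\<^sup>2"
    by (simp add: \<rho>_def power_divide power_mult_distrib)
  ultimately show ?thesis by (simp add: algebra_simps)
qed

text \<open>Holomorphy on \<open>S\<close> is complex differentiability at each point, with no continuity of the derivative. The
  derivative along \<open>v\<close> is therefore reached as the limit of the holomorphic difference quotients \<open>q n\<close>. They
  converge uniformly near \<open>z0\<close> by the Taylor bound, so by the Cauchy estimate their derivatives converge
  uniformly as well, and the limit may be differentiated.\<close>

lemma holo_on_frechet_derivative:
  fixes f :: "complex ^ 'n::finite \<Rightarrow> complex"
  assumes S: "open S" and f: "holo_on S f"
  shows "holo_on S (\<lambda>z. frechet_derivative f (at z) v)"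
  unfolding holo_on_def
proof
  fix z0 assume z0: "z0 \<in> S"
  obtain e where e: "e > 0" "cball z0 e \<subseteq> S" using S z0 open_contains_cball by blast
  define r where "r = e / 4"
  have r: "r > 0" "cball z0 (4 * r) \<subseteq> S" using e by (auto simp: r_def)
  have "continuous_on (cball z0 (4 * r)) f"
    using holo_onD(1)[OF f] r(2) by (intro continuous_at_imp_continuous_on ballI has_derivative_continuous) blast
  then have "bounded (f ` cball z0 (4 * r))" by (intro compact_imp_bounded compact_continuous_image) auto
  then obtain M where "\<forall>y\<in>f ` cball z0 (4 * r). cmod y \<le> M"
    unfolding bounded_iff by blast
  then have M: "\<And>w. w \<in> cball z0 (4 * r) \<Longrightarrow> cmod (f w) \<le> M" by blast
  have M0: "M \<ge> 0" using M[of z0] r norm_ge_zero[of "f z0"] by (simp del: norm_ge_zero)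
  define h where "h = (\<lambda>z. frechet_derivative f (at z) v)"
  (* the step sizes are so small that z + t n *s v stays within distance r of z *)
  define t where "t = (\<lambda>n. r / (norm v + 1) / real (Suc n))"
  have nv: "norm v + 1 > 0" by (simp add: add_nonneg_pos)
  have t: "t n > 0" for n using r nv by (simp add: t_def)
  have tv: "t n * norm v \<le> r" for n
  proof -
    have "t n \<le> r / (norm v + 1) / 1"
      unfolding t_def using r nv by (intro divide_left_mono) auto
    then have "t n \<le> r / (norm v + 1)" by simp
    then have "t n * (norm v + 1) \<le> r" using nv by (simp add: pos_le_divide_eq)
    then show ?thesis using t[of n] by (simp add: algebra_simps)
  qed
  have t0: "t \<longlonglongrightarrow> 0"
    unfolding t_def by (rule LIMSEQ_Suc[OF lim_const_over_n])
  define K where "K = 2 * M / r\<^sup>2 * (norm v)\<^sup>2"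
  have K: "K \<ge> 0" using M0 by (simp add: K_def)
  define q where "q = (\<lambda>n z. (f (z + of_real (t n) *s v) - f z) / of_real (t n))"
  have shift: "z + of_real (t n) *s v \<in> cball z0 (4 * r)" if "z \<in> cball z0 (2 * r)" for z n
  proof -
    have "norm (of_real (t n) *s v) \<le> r" using tv[of n] t[of n] by (simp add: norm_vector_scalar_mult)
    then have "dist z0 (z + of_real (t n) *s v) \<le> 2 * r + r"
      using that dist_triangle[of z0 "z + of_real (t n) *s v" z] by (simp add: dist_norm)
    then show ?thesis using r by simp
  qed
  have near: "cball z (2 * r) \<subseteq> cball z0 (4 * r)" if "z \<in> cball z0 (2 * r)" for z
    using that by (intro cball_subset_cball_iff[THEN iffD2]) (simp add: dist_commute)
  have qh: "cmod (q n z - h z) \<le> K * t n" if z: "z \<in> cball z0 (2 * r)" for n z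
  proof -
    have "cmod (f (z + of_real (t n) *s v) - f z - of_real (t n) * h z) \<le> 2 * M / r\<^sup>2 * (cmod (of_real (t n)) * norm v)\<^sup>2"
      unfolding h_def using near[OF z] r M tv[of n] t[of n]
      by (intro holo_on_difference_quotient_estimate[OF f]) auto
    also have "\<dots> = t n * (K * t n)" by (simp add: K_def power2_eq_square)
    finally have "cmod (f (z + of_real (t n) *s v) - f z - of_real (t n) * h z) / t n \<le> K * t n"
      using t[of n] by (simp add: pos_divide_le_eq mult.commute)
    moreover have "q n z - h z = (f (z + of_real (t n) *s v) - f z - of_real (t n) * h z) / of_real (t n)"
      using t[of n] by (simp add: q_def diff_divide_distrib)
    ultimately show ?thesis using t[of n] by (simp add: norm_divide)
  qed
  have qholo: "\<exists>q'. (q n has_derivative q') (at z) \<and> (\<forall>a u. q' (a *s u) = a * q' u)" if z: "z \<in> cball z0 (2 * r)" for n z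
  proof -
    define w where "w = z + of_real (t n) *s v"
    have w: "w \<in> S" "z \<in> S" using shift[OF z] z r by (auto simp: w_def)
    have "((\<lambda>z. z + of_real (t n) *s v) has_derivative (\<lambda>u. u)) (at z)"
      by (auto intro!: derivative_eq_intros)
    from has_derivative_compose[OF this, of f "frechet_derivative f (at w)"]
    have "((\<lambda>z. f (z + of_real (t n) *s v)) has_derivative (\<lambda>u. frechet_derivative f (at w) u)) (at z)"
      using holo_onD(1)[OF f w(1)] by (simp add: w_def)
    then have "(q n has_derivative (\<lambda>u. (frechet_derivative f (at w) u - frechet_derivative f (at z) u) / of_real (t n))) (at z)"
      unfolding q_def using t[of n] by (auto intro!: derivative_eq_intros holo_onD(1)[OF f w(2)])
    moreover have "(frechet_derivative f (at w) (a *s u) - frechet_derivative f (at z) (a *s u)) / of_real (t n) =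
        a * ((frechet_derivative f (at w) u - frechet_derivative f (at z) u) / of_real (t n))" for a u
      by (simp add: holo_onD(2)[OF f w(1)] holo_onD(2)[OF f w(2)] algebra_simps)
    ultimately show ?thesis by blast
  qed
  define q' where "q' = (\<lambda>n z. frechet_derivative (q n) (at z))"
  have q': "(q n has_derivative q' n z) (at z)" "q' n z (a *s u) = a * q' n z u"
    if "z \<in> cball z0 (2 * r)" for n z a u
  proof -
    have "holo_on (cball z0 (2 * r)) (q n)" using qholo by (auto simp: holo_on_def)
    then show "(q n has_derivative q' n z) (at z)" "q' n z (a *s u) = a * q' n z u"
      using holo_onD[of _ "q n" z] that by (auto simp: q'_def)
  qed
  have cauchy: "cmod (q' n z u - q' m z u) \<le> K * (t n + t m) / r * norm u" if z: "z \<in> ball z0 r" for n m z u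
  proof -
    have sub: "cball z r \<subseteq> cball z0 (2 * r)"
      using z by (intro cball_subset_cball_iff[THEN iffD2]) (simp add: dist_commute)
    have der: "((\<lambda>z. q n z - q m z) has_derivative (\<lambda>u. q' n z u - q' m z u)) (at z)" if "z \<in> cball z0 (2 * r)" for z
      by (intro has_derivative_diff q' that)
    moreover have "q' n z (a *s u) - q' m z (a *s u) = a * (q' n z u - q' m z u)"
      if "z \<in> cball z0 (2 * r)" for z a u
      by (simp only: q'(2)[OF that] right_diff_distrib)
    ultimately have "holo_on (cball z0 (2 * r)) (\<lambda>z. q n z - q m z)"
      unfolding holo_on_def by blast
    moreover have "cmod (q n w - q m w) \<le> K * (t n + t m)" if "w \<in> cball z r" for w
    proof -
      have "cmod (q n w - q m w) \<le> cmod (q n w - h w) + cmod (q m w - h w)"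
        using norm_triangle_ineq4[of "q n w - h w" "q m w - h w"] by simp
      then show ?thesis using qh[of w n] qh[of w m] that sub by (force simp: algebra_simps)
    qed
    ultimately have "cmod (frechet_derivative (\<lambda>z. q n z - q m z) (at z) u) \<le> K * (t n + t m) / r * norm u"
      using sub r(1) by (intro holo_on_Cauchy_estimate) auto
    moreover have "frechet_derivative (\<lambda>z. q n z - q m z) (at z) = (\<lambda>u. q' n z u - q' m z u)"
      using frechet_derivative_at[OF der, of z] z r sub by (auto simp: subset_eq)
    ultimately show ?thesis by simp
  qed
  have conv: "convergent (\<lambda>n. q' n z u)" if z: "z \<in> ball z0 r" for z u
  proof (rule Cauchy_convergent, rule metric_CauchyI)
    fix \<epsilon> :: real assume \<epsilon>: "\<epsilon> > 0"
    have "(\<lambda>n. K * (2 * t n) / r * norm u) \<longlonglongrightarrow> K * (2 * 0) / r * norm u"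
      using r(1) by (intro tendsto_intros t0) auto
    then have "\<forall>\<^sub>F n in sequentially. K * (2 * t n) / r * norm u < \<epsilon>"
      using \<epsilon> by (simp add: order_tendsto_iff)
    then obtain N where N: "K * (2 * t N) / r * norm u < \<epsilon>" by (auto simp: eventually_sequentially)
    have tN: "t n \<le> t N" if "n \<ge> N" for n
      unfolding t_def using that r nv by (intro divide_left_mono) (auto intro!: mult_pos_pos)
    have "cmod (q' m z u - q' n z u) < \<epsilon>" if "m \<ge> N" "n \<ge> N" for m n
    proof -
      have "cmod (q' m z u - q' n z u) \<le> K * (t m + t n) / r * norm u" by (rule cauchy[OF z])
      also have "\<dots> \<le> K * (2 * t N) / r * norm u"
        using tN[OF that(1)] tN[OF that(2)] K r
        by (intro mult_right_mono divide_right_mono mult_left_mono) auto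
      finally show ?thesis using N by simp
    qed
    then show "\<exists>N. \<forall>m\<ge>N. \<forall>n\<ge>N. dist (q' m z u) (q' n z u) < \<epsilon>"
      by (auto simp: dist_norm)
  qed
  define g' where "g' = (\<lambda>z u. lim (\<lambda>n. q' n z u))"
  have lim: "(\<lambda>n. q' n z u) \<longlonglongrightarrow> g' z u" if "z \<in> ball z0 r" for z u
    using conv[OF that] by (simp add: g'_def convergent_LIMSEQ_iff)
  have rate: "cmod (q' n z u - g' z u) \<le> K * t n / r * norm u" if z: "z \<in> ball z0 r" for n z u
  proof (rule LIMSEQ_le)
    show "(\<lambda>m. cmod (q' n z u - q' m z u)) \<longlonglongrightarrow> cmod (q' n z u - g' z u)"
      by (intro tendsto_intros lim z)
    show "(\<lambda>m. K * (t n + t m) / r * norm u) \<longlonglongrightarrow> K * t n / r * norm u"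
      using tendsto_mult_right[OF tendsto_divide[OF tendsto_mult_left[OF tendsto_add[OF tendsto_const t0]] tendsto_const], of r K "t n" "norm u"] r(1)
      by simp
  qed (use cauchy[OF z] in auto)
  have "\<exists>g. \<forall>z\<in>ball z0 r. (\<lambda>n. q n z) \<longlonglongrightarrow> g z \<and> (g has_derivative g' z) (at z within ball z0 r)"
  proof (rule has_derivative_sequence)
    show "convex (ball z0 r)" by simp
    show "(q n has_derivative q' n z) (at z within ball z0 r)" if "z \<in> ball z0 r" for n z
      using q'(1)[of z n] that r(1) by (auto intro: has_derivative_at_withinI)
    show "\<forall>\<^sub>F n in sequentially. \<forall>z\<in>ball z0 r. \<forall>u. norm (q' n z u - g' z u) \<le> \<epsilon> * norm u" if \<epsilon>: "\<epsilon> > 0" for \<epsilon>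
    proof -
      have "(\<lambda>n. K * t n / r) \<longlonglongrightarrow> K * 0 / r" using r(1) by (intro tendsto_intros t0) auto
      then have "\<forall>\<^sub>F n in sequentially. K * t n / r < \<epsilon>" using \<epsilon> by (simp add: order_tendsto_iff)
      then show ?thesis
      proof eventually_elim
        case (elim n)
        have "norm (q' n z u - g' z u) \<le> \<epsilon> * norm u" if "z \<in> ball z0 r" for z u
          using rate[OF that, of n u] mult_right_mono[OF less_imp_le[OF elim], of "norm u"] by simp
        then show ?case by blast
      qed
    qed
    show "z0 \<in> ball z0 r" using r by simp
    have "(\<lambda>n. K * t n) \<longlonglongrightarrow> K * 0" by (intro tendsto_intros t0)
    then have "(\<lambda>n. q n z0 - h z0) \<longlonglongrightarrow> 0"
      by (intro Lim_null_comparison[of "\<lambda>n. q n z0 - h z0" "\<lambda>n. K * t n"]) (use qh[of z0] r in auto)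
    then show "(\<lambda>n. q n z0) \<longlonglongrightarrow> h z0" by (simp add: LIM_zero_iff)
  qed
  then obtain g where g: "\<And>z. z \<in> ball z0 r \<Longrightarrow> (\<lambda>n. q n z) \<longlonglongrightarrow> g z"
    "\<And>z. z \<in> ball z0 r \<Longrightarrow> (g has_derivative g' z) (at z within ball z0 r)" by blast
  have "g z = h z" if z: "z \<in> ball z0 r" for z
  proof -
    have "(\<lambda>n. K * t n) \<longlonglongrightarrow> K * 0" by (intro tendsto_intros t0)
    then have "(\<lambda>n. q n z - h z) \<longlonglongrightarrow> 0"
      by (intro Lim_null_comparison[of "\<lambda>n. q n z - h z" "\<lambda>n. K * t n"]) (use qh[of z] z r in auto)
    then have "(\<lambda>n. q n z) \<longlonglongrightarrow> h z" by (rule LIM_zero_cancel)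
    then show ?thesis by (rule LIMSEQ_unique[OF g(1)[OF z]])
  qed
  moreover have z0b: "z0 \<in> ball z0 r" using r(1) by simp
  moreover have "(g has_derivative g' z0) (at z0)"
    using g(2)[OF z0b] unfolding at_within_open[OF z0b open_ball] .
  ultimately have "(h has_derivative g' z0) (at z0)"
    using has_derivative_cong_open[OF open_ball z0b, of g h] by blast
  moreover have "g' z0 (a *s u) = a * g' z0 u" for a u
  proof -
    have "(\<lambda>n. q' n z0 (a *s u)) \<longlonglongrightarrow> a * g' z0 u"
      using tendsto_mult_left[OF lim[of z0 u], of a] r(1) by (simp add: q'(2))
    moreover have "(\<lambda>n. q' n z0 (a *s u)) \<longlonglongrightarrow> g' z0 (a *s u)" using lim r(1) by simp
    ultimately show ?thesis using LIMSEQ_unique by blast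
  qed
  ultimately show "\<exists>f'. ((\<lambda>z. frechet_derivative f (at z) v) has_derivative f') (at z0) \<and> (\<forall>a u. f' (a *s u) = a * f' u)"
    unfolding h_def by blast
qed

lemma holo_on_imp_smooth_on:
  fixes f :: "complex ^ 'n::finite \<Rightarrow> complex"
  assumes "open S" "holo_on S f"
  shows "smooth_on S f"
proof -
  have "Ck_on k S f" for k
    using assms(2)
  proof (induction k arbitrary: f)
    case 0
    then show ?case
      using holo_onD(1) by (auto intro!: continuous_at_imp_continuous_on has_derivative_continuous)
  next
    case (Suc k)
    then show ?case
      using holo_onD(1)[OF Suc.prems] holo_on_frechet_derivative[OF assms(1) Suc.prems]
      by (auto simp: differentiable_def)
  qed
  then show ?thesis by (simp add: smooth_on_def)
qed

section \<open>Algebra of forms\<close>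

lemmas form_app_simps = zero_altform.rep_eq plus_altform.rep_eq uminus_altform.rep_eq
  minus_altform.rep_eq form_const.rep_eq

lemma altform_eqI: "(\<And>vs. form_app a vs = form_app b vs) \<Longrightarrow> a = b"
  by (simp add: form_app_inject[symmetric] fun_eq_iff)

lemma form_app_const_mult: "form_app (form_const a * w) vs = a * form_app w vs"
  by (simp add: times_altform.rep_eq form_const.rep_eq[abs_def] wedge_one_left)

lemma form_app_mult_const: "form_app (w * form_const a) vs = a * form_app w vs"
  by (simp add: times_altform.rep_eq form_const.rep_eq[abs_def] wedge_one_right)

lemma form_const_commute: "w * form_const a = form_const a * w"
  by (rule altform_eqI) (simp add: form_app_const_mult form_app_mult_const)

lemma form_const_0 [simp]: "form_const 0 = 0"
  and form_const_1 [simp]: "form_const 1 = 1"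
  and form_const_mult: "form_const (a * b) = form_const a * form_const b"
  and form_const_add: "form_const (a + b) = form_const a + form_const b"
  and form_const_minus: "form_const (- a) = - form_const a"
  by (rule altform_eqI; simp add: form_app_simps one_altform_def form_app_const_mult)+

lemma form_const_diff: "form_const (a - b) = form_const a - form_const b"
  using form_const_add[of a "- b"] by (simp add: form_const_minus)

interpretation form_const: ring_hom form_const
  by unfold_locales (simp_all add: form_const_mult form_const_add)

lemma altform_minus_eq_self: "w = - w \<Longrightarrow> w = 0" for w :: "'v::real_vector altform"
  by (metis eq_neg_iff_add_eq_0 scaleR_2 scaleR_eq_0_iff zero_neq_numeral)

definition homogeneous :: "nat \<Rightarrow> 'v::real_vector altform \<Rightarrow> bool" where
  "homogeneous k w \<longleftrightarrow> (\<forall>vs. length vs \<noteq> k \<longrightarrow> form_app w vs = 0)"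

lemma homogeneous_zero [simp]: "homogeneous k 0"
  and homogeneous_const [simp]: "homogeneous 0 (form_const a)"
  and homogeneous_add: "homogeneous k v \<Longrightarrow> homogeneous k w \<Longrightarrow> homogeneous k (v + w)"
  and homogeneous_uminus: "homogeneous k w \<Longrightarrow> homogeneous k (- w)"
  by (auto simp: homogeneous_def form_app_simps)

lemma homogeneous_sum: "(\<And>i. i \<in> I \<Longrightarrow> homogeneous k (f i)) \<Longrightarrow> homogeneous k (\<Sum>i\<in>I. f i)"
  by (induction I rule: infinite_finite_induct) (auto intro: homogeneous_add)

lemma wedge_homogeneous:
  assumes "\<And>ws. length ws \<noteq> a \<Longrightarrow> f ws = 0" "\<And>ws. length ws \<noteq> b \<Longrightarrow> g ws = 0" "length vs \<noteq> a + b"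
  shows "wedge f g vs = 0"
  using assms
proof (induction vs arbitrary: f g a b)
  case Nil
  then show ?case by (cases "a = 0") auto
next
  case (Cons v vs)
  have "wedge (\<lambda>ws. f (v # ws)) g vs = 0"
  proof (cases a)
    case 0
    then have "(\<lambda>ws. f (v # ws)) = (\<lambda>ws. 0)" using Cons.prems(1) by auto
    then show ?thesis by simp
  next
    case (Suc a')
    then show ?thesis using Cons.prems by (intro Cons.IH[of a' _ b]) auto
  qed
  moreover have "wedge (\<lambda>ws. (-1) ^ length ws * f ws) (\<lambda>ws. g (v # ws)) vs = 0"
  proof (cases b)
    case 0
    then have "(\<lambda>ws. g (v # ws)) = (\<lambda>ws. 0)" using Cons.prems(2) by auto
    then show ?thesis by simp
  next
    case (Suc b')
    then show ?thesis using Cons.prems by (intro Cons.IH[of a _ b']) auto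
  qed
  ultimately show ?case by simp
qed

lemma homogeneous_mult: "homogeneous a v \<Longrightarrow> homogeneous b w \<Longrightarrow> homogeneous (a + b) (v * w)"
  unfolding homogeneous_def times_altform.rep_eq by (auto intro: wedge_homogeneous)

lemma homogeneous_const_mult: "homogeneous k w \<Longrightarrow> homogeneous k (form_const a * w)"
  and homogeneous_mult_const: "homogeneous k w \<Longrightarrow> homogeneous k (w * form_const a)"
  by (auto simp: homogeneous_def form_app_const_mult form_app_mult_const)

lemma one_forms_anticommute:
  assumes "homogeneous 1 v" "homogeneous 1 w"
  shows "v * w = - (w * v)"
proof (rule altform_eqI)
  fix vs
  have "wedge (form_app v) (form_app w) vs = (-1) ^ (1 * 1) * wedge (form_app w) (form_app v) vs"
    using assms by (intro wedge_commute_parity) (metis homogeneous_def mult_zero_right)+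
  then show "form_app (v * w) vs = form_app (- (w * v)) vs"
    by (simp add: times_altform.rep_eq form_app_simps)
qed

lemma wedge_one_form:
  assumes "\<And>ws. length ws \<noteq> 1 \<Longrightarrow> f ws = 0"
  shows "wedge f g vs = (\<Sum>i<length vs. (-1) ^ i * f [vs ! i] * g (take i vs @ drop (Suc i) vs))"
proof (induction vs arbitrary: g)
  case Nil
  then show ?case using assms[of "[]"] by simp
next
  case (Cons v vs)
  have 1: "(\<lambda>ws. f (v # ws)) = (\<lambda>ws. if ws = [] then f [v] else 0)"
    using assms by (auto simp: fun_eq_iff)
  have 2: "(\<lambda>ws. (-1) ^ length ws * f ws) = (\<lambda>ws. (-1) * f ws)"
    using assms by (metis mult_zero_right power_one_right)
  show ?case
    by (simp add: 1 2 wedge_one_left wedge_mult_left[of "-1" f, simplified] Cons.IH sum.lessThan_Suc_shift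
      sum_negf del: sum.lessThan_Suc)
qed

lemma form_app_one_form_mult:
  assumes "homogeneous 1 \<eta>"
  shows "form_app (\<eta> * w) vs =
    (\<Sum>i<length vs. (-1) ^ i * form_app \<eta> [vs ! i] * form_app w (take i vs @ drop (Suc i) vs))"
  unfolding times_altform.rep_eq using assms by (intro wedge_one_form) (auto simp: homogeneous_def)

section \<open>First-order operators on forms\<close>

text \<open>\<open>d10\<close> and \<open>d01\<close> are complex combinations of the directional derivatives along \<open>v\<close> and \<open>\<i> v\<close>;
  everything below holds for all such operators at once.\<close>

definition directional :: "((complex ^ 'n::finite \<Rightarrow> complex) \<Rightarrow> complex ^ 'n \<Rightarrow> complex ^ 'n \<Rightarrow> complex) \<Rightarrow> bool" where
  "directional \<delta> \<longleftrightarrow> (\<exists>a b. \<forall>f z v. \<delta> f z v =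
     a * frechet_derivative f (at z) v + b * frechet_derivative f (at z) (\<i> *s v))"

lemma directional_d10: "directional d10"
  unfolding directional_def d10_def
  by (rule exI[of _ "1 / 2"], rule exI[of _ "- \<i> / 2"]) (simp add: field_simps)

lemma directional_d01: "directional d01"
  unfolding directional_def d01_def
  by (rule exI[of _ "1 / 2"], rule exI[of _ "\<i> / 2"]) (simp add: field_simps)

lemma directional_cong:
  assumes "directional \<delta>" "open S" "z \<in> S" "\<And>y. y \<in> S \<Longrightarrow> f y = g y"
  shows "\<delta> f z = \<delta> g z"
  using assms(1) frechet_derivative_cong_open[OF assms(2-)] by (auto simp: directional_def fun_eq_iff)

lemma directional_const: "directional \<delta> \<Longrightarrow> \<delta> (\<lambda>z. c) z v = 0"
  by (auto simp: directional_def)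

lemma directional_has_derivative:
  assumes "directional \<delta>"
  obtains a b where "\<And>f f' z v. (f has_derivative f') (at z) \<Longrightarrow> \<delta> f z v = a * f' v + b * f' (\<i> *s v)"
proof -
  obtain a b where "\<And>f z v. \<delta> f z v = a * frechet_derivative f (at z) v + b * frechet_derivative f (at z) (\<i> *s v)"
    using assms unfolding directional_def by blast
  then have "\<delta> f z v = a * f' v + b * f' (\<i> *s v)" if "(f has_derivative f') (at z)" for f f' z v
    by (simp only: frechet_derivative_at[OF that])
  then show thesis by (rule that)
qed

lemma directional_add:
  assumes "directional \<delta>" "f differentiable (at z)" "g differentiable (at z)"
  shows "\<delta> (\<lambda>z. f z + g z) z v = \<delta> f z v + \<delta> g z v"
proof -
  obtain a b where \<delta>: "\<And>f f' z v. (f has_derivative f') (at z) \<Longrightarrow> \<delta> f z v = a * f' v + b * f' (\<i> *s v)"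
    using directional_has_derivative[OF assms(1)] by blast
  obtain f' g' where f': "(f has_derivative f') (at z)" and g': "(g has_derivative g') (at z)"
    using assms(2,3) differentiable_def by blast
  show ?thesis
    by (simp add: \<delta>[OF f'] \<delta>[OF g'] \<delta>[OF has_derivative_add[OF f' g']] algebra_simps)
qed

lemma directional_mult:
  assumes "directional \<delta>" "f differentiable (at z)" "g differentiable (at z)"
  shows "\<delta> (\<lambda>z. f z * g z) z v = \<delta> f z v * g z + f z * \<delta> g z v"
proof -
  obtain a b where \<delta>: "\<And>f f' z v. (f has_derivative f') (at z) \<Longrightarrow> \<delta> f z v = a * f' v + b * f' (\<i> *s v)"
    using directional_has_derivative[OF assms(1)] by blast
  obtain f' g' where f': "(f has_derivative f') (at z)" and g': "(g has_derivative g') (at z)"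
    using assms(2,3) differentiable_def by blast
  show ?thesis
    by (simp add: \<delta>[OF f'] \<delta>[OF g'] \<delta>[OF has_derivative_mult[OF f' g']] algebra_simps)
qed

lemma directional_cmult:
  assumes "directional \<delta>" "f differentiable (at z)"
  shows "\<delta> (\<lambda>z. c * f z) z v = c * \<delta> f z v"
  using directional_mult[OF assms(1) differentiable_const assms(2)] directional_const[OF assms(1)] by simp

lemma directional_linear:
  assumes "directional \<delta>" "f differentiable (at z)"
  shows "linear (\<delta> f z)"
proof -
  obtain a b where \<delta>: "\<And>f f' z v. (f has_derivative f') (at z) \<Longrightarrow> \<delta> f z v = a * f' v + b * f' (\<i> *s v)"
    using directional_has_derivative[OF assms(1)] by blast
  obtain f' where f': "(f has_derivative f') (at z)"
    using assms(2) differentiable_def by blast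
  note lin = has_derivative_linear[OF f']
  have "\<i> *s (r *\<^sub>R u) = r *\<^sub>R (\<i> *s u)" for r and u :: "complex ^ 'a"
    by (simp add: Finite_Cartesian_Product.vec_eq_iff)
  then show ?thesis
    by (intro linearI) (simp_all add: \<delta>[OF f'] linear_add[OF lin] linear_scale[OF lin]
      vector_add_ldistrib algebra_simps scaleR_conv_of_real[where 'a = complex])
qed

lemma directional_smooth_on:
  assumes "directional \<delta>" "open S" "smooth_on S f"
  shows "smooth_on S (\<lambda>z. \<delta> f z v)"
proof -
  obtain a b where \<delta>: "\<And>f z v. \<delta> f z v = a * frechet_derivative f (at z) v + b * frechet_derivative f (at z) (\<i> *s v)"
    using assms(1) unfolding directional_def by blast
  show ?thesis unfolding \<delta>
    by (intro smooth_on_add smooth_on_mult smooth_on_const smooth_on_frechet_derivative assms)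
qed

lemma directional_commute:
  fixes \<delta> \<delta>' :: "(complex ^ 'n::finite \<Rightarrow> complex) \<Rightarrow> complex ^ 'n \<Rightarrow> complex ^ 'n \<Rightarrow> complex"
  assumes "directional \<delta>" "directional \<delta>'" and S: "open S" "z \<in> S" and f: "smooth_on S f"
  shows "\<delta> (\<lambda>z. \<delta>' f z w) z v = \<delta>' (\<lambda>z. \<delta> f z v) z w"
proof -
  let ?D = "\<lambda>f z v. frechet_derivative f (at z) v"
  obtain a b where \<delta>0: "\<And>f z v. \<delta> f z v = a * ?D f z v + b * ?D f z (\<i> *s v)"
    using assms(1) unfolding directional_def by blast
  obtain a' b' where \<delta>'0: "\<And>f z v. \<delta>' f z v = a' * ?D f z v + b' * ?D f z (\<i> *s v)"
    using assms(2) unfolding directional_def by blast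
  note d = smooth_on_differentiable[OF smooth_on_frechet_derivative[OF f] S(2)]
  have lc: "\<delta> (\<lambda>z. p * ?D f z s + q * ?D f z t) z v = p * \<delta> (\<lambda>z. ?D f z s) z v + q * \<delta> (\<lambda>z. ?D f z t) z v"
    if "directional \<delta>" for \<delta> p q s t v
    by (simp add: directional_add[OF that] directional_cmult[OF that] d differentiable_mult)
  note sym = smooth_on_symmetric_derivative[OF S f]
  have "\<delta> (\<lambda>z. \<delta>' f z w) z v = a' * \<delta> (\<lambda>z. ?D f z w) z v + b' * \<delta> (\<lambda>z. ?D f z (\<i> *s w)) z v"
    unfolding \<delta>'0 by (rule lc[OF assms(1)])
  also have "\<dots> = a * \<delta>' (\<lambda>z. ?D f z v) z w + b * \<delta>' (\<lambda>z. ?D f z (\<i> *s v)) z w"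
    unfolding \<delta>0[of "\<lambda>z. ?D f z _"] \<delta>'0[of "\<lambda>z. ?D f z _"]
      sym[of w v] sym[of "\<i> *s w" v] sym[of w "\<i> *s v"] sym[of "\<i> *s w" "\<i> *s v"]
    by (simp add: algebra_simps)
  also have "\<dots> = \<delta>' (\<lambda>z. \<delta> f z v) z w"
    unfolding \<delta>0 by (rule lc[OF assms(2), symmetric])
  finally show ?thesis .
qed

text \<open>The antisymmetrized derivative as a recursion that splits off the first vector. Contraction with that vector
  maps families of alternating forms to families of alternating forms, so that an induction over the vectors
  shows that the result is alternating; \<open>antisym_deriv_sum\<close> is the usual formula.\<close>

primrec antisym_deriv ::
  "((complex ^ 'n::finite \<Rightarrow> complex) \<Rightarrow> complex ^ 'n \<Rightarrow> complex ^ 'n \<Rightarrow> complex) \<Rightarrow> complex ^ 'n \<Rightarrow>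
   (complex ^ 'n) list \<Rightarrow> (complex ^ 'n \<Rightarrow> (complex ^ 'n) list \<Rightarrow> complex) \<Rightarrow> complex" where
  "antisym_deriv \<delta> z [] g = 0"
| "antisym_deriv \<delta> z (v # vs) g = \<delta> (\<lambda>z. g z vs) z v - antisym_deriv \<delta> z vs (\<lambda>z ws. g z (v # ws))"

lemma antisym_deriv_sum:
  "antisym_deriv \<delta> z vs g =
    (\<Sum>i<length vs. (-1) ^ i * \<delta> (\<lambda>z. g z (take i vs @ drop (Suc i) vs)) z (vs ! i))"
  by (induction vs arbitrary: g) (simp_all add: sum.lessThan_Suc_shift sum_negf del: sum.lessThan_Suc)

lemma antisym_deriv_add:
  assumes "directional \<delta>" "\<And>ws. (\<lambda>z. g z ws) differentiable (at z)" "\<And>ws. (\<lambda>z. h z ws) differentiable (at z)"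
  shows "antisym_deriv \<delta> z vs (\<lambda>z ws. g z ws + h z ws) = antisym_deriv \<delta> z vs g + antisym_deriv \<delta> z vs h"
  by (simp add: antisym_deriv_sum directional_add[OF assms] sum.distrib algebra_simps)

lemma antisym_deriv_cmult:
  assumes "directional \<delta>" "\<And>ws. (\<lambda>z. g z ws) differentiable (at z)"
  shows "antisym_deriv \<delta> z vs (\<lambda>z ws. c * g z ws) = c * antisym_deriv \<delta> z vs g"
  by (simp add: antisym_deriv_sum directional_cmult[OF assms] sum_distrib_left mult.left_commute)

lemma alternating_antisym_deriv:
  assumes \<delta>: "directional \<delta>" and "\<And>z. alternating (g z)" "\<And>ws. (\<lambda>z. g z ws) differentiable (at z)"
  shows "alternating (\<lambda>vs. antisym_deriv \<delta> z vs g)"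
proof -
  have "linear (\<lambda>v. antisym_deriv \<delta> z (us @ v # vs) g) \<and> antisym_deriv \<delta> z (us @ v # v # vs) g = 0" for us v vs
    using assms(2,3)
  proof (induction us arbitrary: g)
    case Nil
    have lin: "g z (v # ws) = g z (u # ws) + g z (u' # ws)" if "v = u + u'" for z u u' v ws
      using linear_add[OF alternating_linear[OF Nil(1)[of z], of "[]" ws], of u u'] that by simp
    have sc: "g z ((r *\<^sub>R u) # ws) = of_real r * g z (u # ws)" for r z u ws
      using linear_scale[OF alternating_linear[OF Nil(1)[of z], of "[]" ws], of r u]
      by (simp add: scaleR_conv_of_real[where 'a = complex])
    have "linear (\<lambda>v. antisym_deriv \<delta> z vs (\<lambda>z ws. g z (v # ws)))"
      by (intro linearI) (simp_all only: lin[OF refl] sc antisym_deriv_add[OF \<delta> Nil(2) Nil(2)]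
        antisym_deriv_cmult[OF \<delta> Nil(2)] scaleR_conv_of_real[where 'a = complex])
    moreover have "linear (\<delta> (\<lambda>z. g z vs) z)" by (rule directional_linear[OF \<delta> Nil(2)])
    ultimately have "linear (\<lambda>v. antisym_deriv \<delta> z ([] @ v # vs) g)"
      by (simp add: linear_compose_sub)
    moreover have "g z (v # v # ws) = 0" for z ws
      using alternating_repeat[OF Nil(1)[of z], of "[]"] by simp
    then have "antisym_deriv \<delta> z vs (\<lambda>z ws. g z (v # v # ws)) = 0"
      by (simp add: antisym_deriv_sum directional_const[OF \<delta>])
    then have "antisym_deriv \<delta> z ([] @ v # v # vs) g = 0" by simp
    ultimately show ?case by blast
  next
    case (Cons u us)
    have IH: "linear (\<lambda>v. antisym_deriv \<delta> z (us @ v # vs) (\<lambda>z ws. g z (u # ws)))"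
      "antisym_deriv \<delta> z (us @ v # v # vs) (\<lambda>z ws. g z (u # ws)) = 0"
      using Cons.IH[of "\<lambda>z ws. g z (u # ws)"] Cons.prems alternating_contract by blast+
    have add: "g z (us @ (a + b) # vs) = g z (us @ a # vs) + g z (us @ b # vs)" for a b z
      by (rule linear_add[OF alternating_linear[OF Cons.prems(1)]])
    have sc: "g z (us @ (r *\<^sub>R a) # vs) = of_real r * g z (us @ a # vs)" for r :: real and a z
      by (simp add: linear_scale[OF alternating_linear[OF Cons.prems(1)]] scaleR_conv_of_real[where 'a = complex])
    have "linear (\<lambda>v. \<delta> (\<lambda>z. g z (us @ v # vs)) z u)"
      by (intro linearI) (simp_all only: add sc directional_add[OF \<delta> Cons.prems(2) Cons.prems(2)]
        directional_cmult[OF \<delta> Cons.prems(2)] scaleR_conv_of_real[where 'a = complex])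
    with IH have "linear (\<lambda>v. antisym_deriv \<delta> z ((u # us) @ v # vs) g)"
      by (simp add: linear_compose_sub)
    moreover have "antisym_deriv \<delta> z ((u # us) @ v # v # vs) g = 0"
      using IH(2) alternating_repeat[OF Cons.prems(1)] by (simp add: directional_const[OF \<delta>])
    ultimately show ?case by blast
  qed
  then show ?thesis unfolding alternating_def by blast
qed

lemma alternating_form_app: "alternating (form_app w)"
  using form_app by auto

lemma form_app_alt_deriv:
  assumes \<delta>: "directional \<delta>"
    and w: "\<And>vs. (\<lambda>z. form_app (in_chart c w z) vs) differentiable (at (snd c x))"
  shows "form_app (alt_deriv \<delta> c w x) vs = (\<Sum>i<length vs. (-1) ^ i *
     \<delta> (\<lambda>z. form_app (in_chart c w z) (take i vs @ drop (Suc i) vs)) (snd c x) (vs ! i))"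
proof -
  have "alternating (\<lambda>vs. antisym_deriv \<delta> (snd c x) vs (\<lambda>z. form_app (in_chart c w z)))"
    by (rule alternating_antisym_deriv[OF \<delta> alternating_form_app w])
  then show ?thesis
    unfolding antisym_deriv_sum by (simp only: alt_deriv_def Abs_altform_inverse mem_Collect_eq)
qed

section \<open>Calculus of forms in a chart\<close>

text \<open>The image of \<open>W\<close> in the chart is open, so identities that hold at all points of \<open>W\<close> may be differentiated.\<close>

locale chart_region =
  fixes c :: "('x, 'n::finite) chart" and W :: "'x set"
  assumes inj_chart: "inj_on (snd c) (fst c)" and W_sub: "W \<subseteq> fst c" and open_W: "open (snd c ` W)"

definition smooth_fn_on :: "('x, 'n::finite) chart \<Rightarrow> 'x set \<Rightarrow> ('x \<Rightarrow> complex) \<Rightarrow> bool" where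
  "smooth_fn_on c W f \<longleftrightarrow> smooth_on (snd c ` W) (in_chart c f)"

definition smooth_form_on :: "('x, 'n::finite) chart \<Rightarrow> 'x set \<Rightarrow> ('x \<Rightarrow> (complex ^ 'n) altform) \<Rightarrow> bool" where
  "smooth_form_on c W w \<longleftrightarrow> (\<forall>vs. smooth_on (snd c ` W) (\<lambda>z. form_app (in_chart c w z) vs))"

lemma (in chart_region) in_chart_at [simp]: "y \<in> W \<Longrightarrow> in_chart c f (snd c y) = f y"
  using inj_chart W_sub by (simp add: in_chart_def inv_into_f_f subset_eq)

lemma (in chart_region) in_chart_cong:
  "(\<And>y. y \<in> W \<Longrightarrow> f y = g y) \<Longrightarrow> z \<in> snd c ` W \<Longrightarrow> in_chart c f z = in_chart c g z"
  by auto

lemma (in chart_region) smooth_fn_on_cong: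
  "(\<And>y. y \<in> W \<Longrightarrow> f y = g y) \<Longrightarrow> smooth_fn_on c W f \<longleftrightarrow> smooth_fn_on c W g"
  unfolding smooth_fn_on_def by (intro smooth_on_cong open_W in_chart_cong)

lemma (in chart_region) smooth_form_on_cong:
  assumes "\<And>y. y \<in> W \<Longrightarrow> w y = w' y"
  shows "smooth_form_on c W w \<longleftrightarrow> smooth_form_on c W w'"
proof -
  have "smooth_on (snd c ` W) (\<lambda>z. form_app (in_chart c w z) vs) \<longleftrightarrow>
    smooth_on (snd c ` W) (\<lambda>z. form_app (in_chart c w' z) vs)" for vs
    by (rule smooth_on_cong[OF open_W]) (simp add: in_chart_cong[OF assms])
  then show ?thesis by (simp add: smooth_form_on_def)
qed

lemma (in chart_region) smooth_fn_on_const [simp]: "smooth_fn_on c W (\<lambda>y. a)"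
  by (simp add: smooth_fn_on_def in_chart_def[abs_def])

lemma (in chart_region) smooth_fn_on_add:
  "smooth_fn_on c W f \<Longrightarrow> smooth_fn_on c W g \<Longrightarrow> smooth_fn_on c W (\<lambda>y. f y + g y)"
  unfolding smooth_fn_on_def in_chart_def by (rule smooth_on_add[OF open_W])

lemma (in chart_region) smooth_fn_on_mult:
  "smooth_fn_on c W f \<Longrightarrow> smooth_fn_on c W g \<Longrightarrow> smooth_fn_on c W (\<lambda>y. f y * g y)"
  unfolding smooth_fn_on_def in_chart_def by (rule smooth_on_mult[OF open_W])

lemma (in chart_region) smooth_fn_on_sum:
  "(\<And>i. i \<in> I \<Longrightarrow> smooth_fn_on c W (f i)) \<Longrightarrow> smooth_fn_on c W (\<lambda>y. \<Sum>i\<in>I. f i y)"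
  unfolding smooth_fn_on_def in_chart_def by (rule smooth_on_sum[OF open_W])

lemma (in chart_region) smooth_fn_on_prod:
  "(\<And>i. i \<in> I \<Longrightarrow> smooth_fn_on c W (f i)) \<Longrightarrow> smooth_fn_on c W (\<lambda>y. \<Prod>i\<in>I. f i y)"
  unfolding smooth_fn_on_def in_chart_def by (rule smooth_on_prod[OF open_W])

lemma (in chart_region) smooth_fn_on_cnj:
  "smooth_fn_on c W f \<Longrightarrow> smooth_fn_on c W (\<lambda>y. cnj (f y))"
  unfolding smooth_fn_on_def in_chart_def by (rule smooth_on_cnj[OF open_W])

lemma (in chart_region) smooth_fn_on_inverse:
  assumes "smooth_fn_on c W f" "\<And>y. y \<in> W \<Longrightarrow> f y \<noteq> 0"
  shows "smooth_fn_on c W (\<lambda>y. inverse (f y))"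
proof -
  have "in_chart c f z \<noteq> 0" if "z \<in> snd c ` W" for z using that assms(2) by auto
  then show ?thesis
    using assms(1) smooth_on_inverse[OF open_W] unfolding smooth_fn_on_def in_chart_def by blast
qed

lemma (in chart_region) smooth_form_on_const [simp]: "smooth_form_on c W (\<lambda>y. w)"
  by (simp add: smooth_form_on_def in_chart_def)

lemma (in chart_region) smooth_form_on_add:
  "smooth_form_on c W v \<Longrightarrow> smooth_form_on c W w \<Longrightarrow> smooth_form_on c W (\<lambda>y. v y + w y)"
  unfolding smooth_form_on_def in_chart_def by (auto simp: form_app_simps intro!: smooth_on_add[OF open_W])

lemma (in chart_region) smooth_form_on_const_mult:
  "smooth_fn_on c W f \<Longrightarrow> smooth_form_on c W w \<Longrightarrow> smooth_form_on c W (\<lambda>y. form_const (f y) * w y)"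
  unfolding smooth_form_on_def smooth_fn_on_def in_chart_def
  by (auto simp: form_app_const_mult intro!: smooth_on_mult[OF open_W])

lemma (in chart_region) smooth_form_on_form_const:
  "smooth_fn_on c W f \<Longrightarrow> smooth_form_on c W (\<lambda>y. form_const (f y))"
  using smooth_form_on_const_mult[of f "\<lambda>y. 1"] by simp

lemma (in chart_region) smooth_form_on_sum:
  "(\<And>i. i \<in> I \<Longrightarrow> smooth_form_on c W (f i)) \<Longrightarrow> smooth_form_on c W (\<lambda>y. \<Sum>i\<in>I. f i y)"
  by (induction I rule: infinite_finite_induct) (auto intro: smooth_form_on_add)

lemma (in chart_region) smooth_form_on_differentiable:
  "smooth_form_on c W w \<Longrightarrow> y \<in> W \<Longrightarrow> (\<lambda>z. form_app (in_chart c w z) vs) differentiable (at (snd c y))"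
  unfolding smooth_form_on_def using smooth_on_differentiable by blast

lemma (in chart_region) form_app_alt_deriv_at:
  assumes "directional \<delta>" "smooth_form_on c W w" "y \<in> W"
  shows "form_app (alt_deriv \<delta> c w y) vs = (\<Sum>i<length vs. (-1) ^ i *
     \<delta> (\<lambda>z. form_app (in_chart c w z) (take i vs @ drop (Suc i) vs)) (snd c y) (vs ! i))"
  by (rule form_app_alt_deriv[OF assms(1) smooth_form_on_differentiable[OF assms(2,3)]])

lemma (in chart_region) alt_deriv_cong:
  assumes \<delta>: "directional \<delta>" and y: "y \<in> W" and eq: "\<And>y. y \<in> W \<Longrightarrow> w y = w' y"
  shows "alt_deriv \<delta> c w y = alt_deriv \<delta> c w' y"
proof -
  have "\<delta> (\<lambda>z. form_app (in_chart c w z) vs) (snd c y) = \<delta> (\<lambda>z. form_app (in_chart c w' z) vs) (snd c y)" for vs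
    by (rule directional_cong[OF \<delta> open_W]) (use y in_chart_cong[OF eq] in auto)
  then show ?thesis by (simp add: alt_deriv_def)
qed

lemma (in chart_region) smooth_form_on_alt_deriv:
  assumes \<delta>: "directional \<delta>" and w: "smooth_form_on c W w"
  shows "smooth_form_on c W (alt_deriv \<delta> c w)"
  unfolding smooth_form_on_def
proof
  fix vs
  have "smooth_on (snd c ` W) (\<lambda>z. \<Sum>i<length vs. (-1) ^ i *
     \<delta> (\<lambda>z. form_app (in_chart c w z) (take i vs @ drop (Suc i) vs)) z (vs ! i))"
    using w unfolding smooth_form_on_def
    by (intro smooth_on_sum smooth_on_mult smooth_on_const directional_smooth_on[OF \<delta>] open_W) auto
  then show "smooth_on (snd c ` W) (\<lambda>z. form_app (in_chart c (alt_deriv \<delta> c w) z) vs)"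
    by (rule smooth_on_cong[OF open_W, THEN iffD1, rotated])
      (auto simp: form_app_alt_deriv_at[OF \<delta> w])
qed

lemma (in chart_region) alt_deriv_add:
  assumes \<delta>: "directional \<delta>" and w: "smooth_form_on c W w" "smooth_form_on c W w'" and y: "y \<in> W"
  shows "alt_deriv \<delta> c (\<lambda>y. w y + w' y) y = alt_deriv \<delta> c w y + alt_deriv \<delta> c w' y"
proof (rule altform_eqI)
  fix vs
  have "form_app (in_chart c (\<lambda>y. w y + w' y) z) us = form_app (in_chart c w z) us + form_app (in_chart c w' z) us" for us z
    by (simp add: in_chart_def form_app_simps)
  then show "form_app (alt_deriv \<delta> c (\<lambda>y. w y + w' y) y) vs = form_app (alt_deriv \<delta> c w y + alt_deriv \<delta> c w' y) vs"
    by (simp add: form_app_alt_deriv_at[OF \<delta> _ y] w smooth_form_on_add form_app_simps sum.distrib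
      directional_add[OF \<delta> smooth_form_on_differentiable[OF w(1) y] smooth_form_on_differentiable[OF w(2) y]] algebra_simps)
qed

lemma (in chart_region) alt_deriv_const [simp]:
  assumes \<delta>: "directional \<delta>" and y: "y \<in> W"
  shows "alt_deriv \<delta> c (\<lambda>y. w) y = 0"
  by (rule altform_eqI)
    (simp add: form_app_alt_deriv_at[OF \<delta> smooth_form_on_const y] in_chart_def directional_const[OF \<delta>] form_app_simps)

lemma (in chart_region) form_app_alt_deriv_form_const:
  assumes \<delta>: "directional \<delta>" and f: "smooth_fn_on c W f" and y: "y \<in> W"
  shows "form_app (alt_deriv \<delta> c (\<lambda>y. form_const (f y)) y) vs =
    (if length vs = 1 then \<delta> (in_chart c f) (snd c y) (vs ! 0) else 0)"
proof -
  have *: "form_app (in_chart c (\<lambda>y. form_const (f y)) z) us = (if us = [] then in_chart c f z else 0)" for z us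
    by (simp add: in_chart_def form_app_simps)
  have "form_app (alt_deriv \<delta> c (\<lambda>y. form_const (f y)) y) vs = (\<Sum>i<length vs. (-1) ^ i *
      (if length vs = 1 then \<delta> (in_chart c f) (snd c y) (vs ! i) else 0))"
    unfolding form_app_alt_deriv_at[OF \<delta> smooth_form_on_form_const[OF f] y]
  proof (rule sum.cong[OF refl])
    fix i assume "i \<in> {..<length vs}"
    then have "take i vs @ drop (Suc i) vs = [] \<longleftrightarrow> length vs = 1"
      by (cases vs) auto
    then show "(-1) ^ i * \<delta> (\<lambda>z. form_app (in_chart c (\<lambda>y. form_const (f y)) z) (take i vs @ drop (Suc i) vs)) (snd c y) (vs ! i) =
        (-1) ^ i * (if length vs = 1 then \<delta> (in_chart c f) (snd c y) (vs ! i) else 0)"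
      by (cases "length vs = 1") (simp_all only: * directional_const[OF \<delta>] if_True if_False simp_thms)
  qed
  then show ?thesis by simp
qed

lemma (in chart_region) homogeneous_alt_deriv_form_const:
  assumes "directional \<delta>" "smooth_fn_on c W f" "y \<in> W"
  shows "homogeneous 1 (alt_deriv \<delta> c (\<lambda>y. form_const (f y)) y)"
  by (simp add: homogeneous_def form_app_alt_deriv_form_const[OF assms])

lemma (in chart_region) homogeneous_alt_deriv:
  assumes \<delta>: "directional \<delta>" and w: "smooth_form_on c W w" and y: "y \<in> W"
    and hom: "\<And>y. y \<in> W \<Longrightarrow> homogeneous k (w y)"
  shows "homogeneous (Suc k) (alt_deriv \<delta> c w y)"
  unfolding homogeneous_def
proof (intro allI impI)
  fix vs :: "(complex ^ 'n) list" assume vs: "length vs \<noteq> Suc k"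
  have "\<delta> (\<lambda>z. form_app (in_chart c w z) us) (snd c y) (vs ! i) = 0" if "length us \<noteq> k" for us i
  proof -
    have "\<delta> (\<lambda>z. form_app (in_chart c w z) us) (snd c y) = \<delta> (\<lambda>z. 0) (snd c y)"
      by (rule directional_cong[OF \<delta> open_W]) (use y hom that in \<open>auto simp: homogeneous_def\<close>)
    then show ?thesis by (simp add: directional_const[OF \<delta>])
  qed
  moreover have "length (take i vs @ drop (Suc i) vs) \<noteq> k" if "i < length vs" for i using that vs by simp
  ultimately show "form_app (alt_deriv \<delta> c w y) vs = 0"
    unfolding form_app_alt_deriv_at[OF \<delta> w y] by (intro sum.neutral) (auto simp del: length_append)
qed

lemma (in chart_region) alt_deriv_const_mult:
  assumes \<delta>: "directional \<delta>" and f: "smooth_fn_on c W f" and w: "smooth_form_on c W w" and y: "y \<in> W"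
  shows "alt_deriv \<delta> c (\<lambda>y. form_const (f y) * w y) y =
    alt_deriv \<delta> c (\<lambda>y. form_const (f y)) y * w y + form_const (f y) * alt_deriv \<delta> c w y"
proof (rule altform_eqI)
  fix vs
  have *: "form_app (in_chart c (\<lambda>y. form_const (f y) * w y) z) us = in_chart c f z * form_app (in_chart c w z) us" for us z
    by (simp add: in_chart_def form_app_const_mult)
  have df: "in_chart c f differentiable (at (snd c y))"
    using f y smooth_on_differentiable by (auto simp: smooth_fn_on_def)
  show "form_app (alt_deriv \<delta> c (\<lambda>y. form_const (f y) * w y) y) vs = form_app (alt_deriv \<delta> c (\<lambda>y. form_const (f y)) y * w y + form_const (f y) * alt_deriv \<delta> c w y) vs"
    by (simp add: form_app_alt_deriv_at[OF \<delta> _ y] f w smooth_form_on_const_mult * form_app_simps(2)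
      directional_mult[OF \<delta> df smooth_form_on_differentiable[OF w y]] y form_app_const_mult
      form_app_one_form_mult[OF homogeneous_alt_deriv_form_const[OF \<delta> f y]]
      form_app_alt_deriv_form_const[OF \<delta> f y] sum.distrib sum_distrib_left algebra_simps)
qed

lemma (in chart_region) alt_deriv_mult_const:
  assumes \<delta>: "directional \<delta>" and f: "smooth_fn_on c W f" and w: "smooth_form_on c W w" and y: "y \<in> W"
    and hom: "homogeneous 1 (w y)"
  shows "alt_deriv \<delta> c (\<lambda>y. w y * form_const (f y)) y =
    alt_deriv \<delta> c w y * form_const (f y) - w y * alt_deriv \<delta> c (\<lambda>y. form_const (f y)) y"
  unfolding form_const_commute alt_deriv_const_mult[OF assms(1-4)]
  using one_forms_anticommute[OF hom homogeneous_alt_deriv_form_const[OF \<delta> f y]] by simp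

lemma (in chart_region) alt_deriv_sum:
  assumes \<delta>: "directional \<delta>" and w: "\<And>i. i \<in> I \<Longrightarrow> smooth_form_on c W (w i)" and y: "y \<in> W"
  shows "alt_deriv \<delta> c (\<lambda>y. \<Sum>i\<in>I. w i y) y = (\<Sum>i\<in>I. alt_deriv \<delta> c (w i) y)"
  using w
  by (induction I rule: infinite_finite_induct)
    (simp_all add: alt_deriv_const[OF \<delta> y] alt_deriv_add[OF \<delta> _ _ y] smooth_form_on_sum)

text \<open>The symmetry of second derivatives. It contains \<open>\<partial>\<partial> = 0\<close> and \<open>\<partial>\<bar>\<partial> = - \<partial>\<partial>\<bar>\<close> on functions.\<close>

lemma (in chart_region) alt_deriv_alt_deriv:
  assumes \<delta>: "directional \<delta>" and \<delta>': "directional \<delta>'" and f: "smooth_fn_on c W f" and y: "y \<in> W"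
  shows "alt_deriv \<delta> c (alt_deriv \<delta>' c (\<lambda>y. form_const (f y))) y =
    - alt_deriv \<delta>' c (alt_deriv \<delta> c (\<lambda>y. form_const (f y))) y"
proof (rule altform_eqI)
  fix vs :: "(complex ^ 'n) list"
  note sm = smooth_form_on_alt_deriv[OF _ smooth_form_on_form_const[OF f]]
  note hom = homogeneous_alt_deriv[OF _ sm y homogeneous_alt_deriv_form_const[OF _ f]]
  have app: "form_app (alt_deriv \<delta> c (alt_deriv \<delta>' c (\<lambda>y. form_const (f y))) y) [v, w] =
    \<delta> (\<lambda>z. \<delta>' (in_chart c f) z w) (snd c y) v - \<delta> (\<lambda>z. \<delta>' (in_chart c f) z v) (snd c y) w"
    if "directional \<delta>" "directional \<delta>'" for \<delta> \<delta>' v w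
  proof -
    have "\<delta> (\<lambda>z. form_app (in_chart c (alt_deriv \<delta>' c (\<lambda>y. form_const (f y))) z) [u]) (snd c y) =
        \<delta> (\<lambda>z. \<delta>' (in_chart c f) z u) (snd c y)" for u
      by (rule directional_cong[OF that(1) open_W]) (use y that in \<open>auto simp: form_app_alt_deriv_form_const[OF _ f]\<close>)
    then show ?thesis by (simp add: form_app_alt_deriv_at[OF that(1) sm[OF that(2)] y] numeral_2_eq_2)
  qed
  show "form_app (alt_deriv \<delta> c (alt_deriv \<delta>' c (\<lambda>y. form_const (f y))) y) vs =
    form_app (- alt_deriv \<delta>' c (alt_deriv \<delta> c (\<lambda>y. form_const (f y))) y) vs"
  proof (cases "length vs = 2")
    case False
    then show ?thesis
      using hom[OF \<delta> \<delta>' \<delta>'] hom[OF \<delta>' \<delta> \<delta>] by (simp add: homogeneous_def form_app_simps)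
  next
    case True
    then obtain v w where vs: "vs = [v, w]"
      by (metis (no_types, opaque_lifting) length_0_conv length_Suc_conv numeral_2_eq_2)
    have s: "smooth_on (snd c ` W) (in_chart c f)" using f by (simp add: smooth_fn_on_def)
    show ?thesis
      using directional_commute[OF \<delta> \<delta>' open_W imageI[OF y] s, of w v] directional_commute[OF \<delta> \<delta>' open_W imageI[OF y] s, of v w]
      by (simp add: vs app[OF \<delta> \<delta>'] app[OF \<delta>' \<delta>] form_app_simps)
  qed
qed

section \<open>Matrices of forms\<close>

definition smooth_mat :: "('x, 'n::finite) chart \<Rightarrow> 'x set \<Rightarrow> nat \<Rightarrow> nat \<Rightarrow>
    ('x \<Rightarrow> (complex ^ 'n) altform Matrix.mat) \<Rightarrow> bool" where
  "smooth_mat c W m n M \<longleftrightarrow> (\<forall>y\<in>W. M y \<in> carrier_mat m n) \<and>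
     (\<forall>i<m. \<forall>j<n. smooth_form_on c W (\<lambda>y. M y $$ (i, j)))"

definition smooth_fn_mat :: "('x, 'n::finite) chart \<Rightarrow> 'x set \<Rightarrow> nat \<Rightarrow> nat \<Rightarrow>
    ('x \<Rightarrow> complex Matrix.mat) \<Rightarrow> bool" where
  "smooth_fn_mat c W m n f \<longleftrightarrow> (\<forall>y\<in>W. f y \<in> carrier_mat m n) \<and>
     (\<forall>i<m. \<forall>j<n. smooth_fn_on c W (\<lambda>y. f y $$ (i, j)))"

abbreviation mat_const :: "complex Matrix.mat \<Rightarrow> 'v::real_vector altform Matrix.mat" where
  "mat_const \<equiv> map_mat form_const"

lemma mat_const_mult:
  "A \<in> carrier_mat m n \<Longrightarrow> B \<in> carrier_mat n k \<Longrightarrow> mat_const (A * B) = mat_const A * mat_const B"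
  by (rule form_const.mat_hom_mult)

lemma mat_const_one: "mat_const (1\<^sub>m n) = 1\<^sub>m n"
  by (rule form_const.mat_hom_one)

lemma smooth_mat_carrier: "smooth_mat c W m n M \<Longrightarrow> y \<in> W \<Longrightarrow> M y \<in> carrier_mat m n"
  and smooth_mat_entry: "smooth_mat c W m n M \<Longrightarrow> i < m \<Longrightarrow> j < n \<Longrightarrow> smooth_form_on c W (\<lambda>y. M y $$ (i, j))"
  by (auto simp: smooth_mat_def)

lemma smooth_fn_mat_carrier: "smooth_fn_mat c W m n f \<Longrightarrow> y \<in> W \<Longrightarrow> f y \<in> carrier_mat m n"
  and smooth_fn_mat_entry: "smooth_fn_mat c W m n f \<Longrightarrow> i < m \<Longrightarrow> j < n \<Longrightarrow> smooth_fn_on c W (\<lambda>y. f y $$ (i, j))"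
  by (auto simp: smooth_fn_mat_def)

lemmas smooth_mat_dims = carrier_matD[OF smooth_mat_carrier]

lemmas smooth_fn_mat_dims = carrier_matD[OF smooth_fn_mat_carrier]

lemma (in chart_region) smooth_fn_mat_mult:
  assumes "smooth_fn_mat c W m n f" "smooth_fn_mat c W n k g"
  shows "smooth_fn_mat c W m k (\<lambda>y. f y * g y)"
  unfolding smooth_fn_mat_def
proof (intro conjI ballI allI impI)
  show "f y * g y \<in> carrier_mat m k" if "y \<in> W" for y
    using assms that by (auto dest!: smooth_fn_mat_carrier)
  fix i j assume ij: "i < m" "j < k"
  have "smooth_fn_on c W (\<lambda>y. \<Sum>l<n. f y $$ (i, l) * g y $$ (l, j))"
    by (intro smooth_fn_on_sum smooth_fn_on_mult smooth_fn_mat_entry[OF assms(1)] smooth_fn_mat_entry[OF assms(2)])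
      (use ij in auto)
  then show "smooth_fn_on c W (\<lambda>y. (f y * g y) $$ (i, j))"
    by (rule smooth_fn_on_cong[THEN iffD1, rotated])
      (simp only: index_mult_mat_sum[OF smooth_fn_mat_carrier[OF assms(1)] smooth_fn_mat_carrier[OF assms(2)] ij])
qed

lemma (in chart_region) smooth_mat_of_fn_mat:
  assumes "smooth_fn_mat c W m n f"
  shows "smooth_mat c W m n (\<lambda>y. mat_const (f y))"
  unfolding smooth_mat_def
proof (intro conjI ballI allI impI)
  show "mat_const (f y) \<in> carrier_mat m n" if "y \<in> W" for y
    using smooth_fn_mat_carrier[OF assms that] by simp
  fix i j assume ij: "i < m" "j < n"
  show "smooth_form_on c W (\<lambda>y. mat_const (f y) $$ (i, j))"
    using smooth_form_on_form_const[OF smooth_fn_mat_entry[OF assms ij]]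
    by (rule smooth_form_on_cong[THEN iffD1, rotated]) (use ij smooth_fn_mat_dims[OF assms] in auto)
qed

lemma (in chart_region) smooth_mat_add:
  assumes "smooth_mat c W m n M" "smooth_mat c W m n N"
  shows "smooth_mat c W m n (\<lambda>y. M y + N y)"
  unfolding smooth_mat_def
proof (intro conjI ballI allI impI)
  show "M y + N y \<in> carrier_mat m n" if "y \<in> W" for y using assms that by (simp add: smooth_mat_carrier)
  fix i j assume ij: "i < m" "j < n"
  show "smooth_form_on c W (\<lambda>y. (M y + N y) $$ (i, j))"
    using smooth_form_on_add[OF smooth_mat_entry[OF assms(1) ij] smooth_mat_entry[OF assms(2) ij]]
    by (rule smooth_form_on_cong[THEN iffD1, rotated])
      (use ij smooth_mat_dims[OF assms(1)] smooth_mat_dims[OF assms(2)] in auto)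
qed

lemma (in chart_region) smooth_mat_const_mult:
  assumes "smooth_fn_mat c W m n f" "smooth_mat c W n k M"
  shows "smooth_mat c W m k (\<lambda>y. mat_const (f y) * M y)"
  unfolding smooth_mat_def
proof (intro conjI ballI allI impI)
  show "mat_const (f y) * M y \<in> carrier_mat m k" if "y \<in> W" for y
    using smooth_fn_mat_carrier[OF assms(1) that] smooth_mat_carrier[OF assms(2) that] by simp
  fix i j assume ij: "i < m" "j < k"
  have "smooth_form_on c W (\<lambda>y. \<Sum>l<n. form_const (f y $$ (i, l)) * M y $$ (l, j))"
    by (intro smooth_form_on_sum smooth_form_on_const_mult smooth_fn_mat_entry[OF assms(1)] smooth_mat_entry[OF assms(2)])
      (use ij in auto)
  then show "smooth_form_on c W (\<lambda>y. (mat_const (f y) * M y) $$ (i, j))"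
    by (rule smooth_form_on_cong[THEN iffD1, rotated])
      (use ij smooth_fn_mat_carrier[OF assms(1)] smooth_mat_carrier[OF assms(2)]
        smooth_fn_mat_dims[OF assms(1)] smooth_mat_dims[OF assms(2)] in \<open>subst index_mult_mat_sum[of _ m n _ k]; auto intro!: sum.cong\<close>)
qed

lemma (in chart_region) smooth_mat_mult_const:
  assumes "smooth_mat c W m n M" "smooth_fn_mat c W n k f"
  shows "smooth_mat c W m k (\<lambda>y. M y * mat_const (f y))"
  unfolding smooth_mat_def
proof (intro conjI ballI allI impI)
  show "M y * mat_const (f y) \<in> carrier_mat m k" if "y \<in> W" for y
    using smooth_mat_carrier[OF assms(1) that] smooth_fn_mat_carrier[OF assms(2) that] by simp
  fix i j assume ij: "i < m" "j < k"
  have "smooth_form_on c W (\<lambda>y. \<Sum>l<n. form_const (f y $$ (l, j)) * M y $$ (i, l))"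
    by (intro smooth_form_on_sum smooth_form_on_const_mult smooth_fn_mat_entry[OF assms(2)] smooth_mat_entry[OF assms(1)])
      (use ij in auto)
  then show "smooth_form_on c W (\<lambda>y. (M y * mat_const (f y)) $$ (i, j))"
    by (rule smooth_form_on_cong[THEN iffD1, rotated])
      (use ij smooth_fn_mat_carrier[OF assms(2)] smooth_mat_carrier[OF assms(1)]
        smooth_fn_mat_dims[OF assms(2)] smooth_mat_dims[OF assms(1)] in \<open>subst index_mult_mat_sum[of _ m n _ k]; auto intro!: sum.cong simp: form_const_commute\<close>)
qed

lemma (in chart_region) smooth_mat_deriv:
  assumes \<delta>: "directional \<delta>" and M: "smooth_mat c W m n M"
  shows "smooth_mat c W m n (mat_deriv (alt_deriv \<delta> c) M)"
  unfolding smooth_mat_def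
proof (intro conjI ballI allI impI)
  show "mat_deriv (alt_deriv \<delta> c) M y \<in> carrier_mat m n" if "y \<in> W" for y
    using smooth_mat_carrier[OF M that] by (auto simp: mat_deriv_def)
  fix i j assume ij: "i < m" "j < n"
  show "smooth_form_on c W (\<lambda>y. mat_deriv (alt_deriv \<delta> c) M y $$ (i, j))"
    using smooth_form_on_alt_deriv[OF \<delta> smooth_mat_entry[OF M ij]]
    by (rule smooth_form_on_cong[THEN iffD1, rotated]) (use ij smooth_mat_dims[OF M] in \<open>auto simp: mat_deriv_def\<close>)
qed

lemma mat_deriv_carrier: "M y \<in> carrier_mat m n \<Longrightarrow> mat_deriv D M y \<in> carrier_mat m n"
  by (auto simp: mat_deriv_def)

lemma (in chart_region) mat_deriv_cong:
  assumes \<delta>: "directional \<delta>" and y: "y \<in> W" and eq: "\<And>y. y \<in> W \<Longrightarrow> M y = N y"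
  shows "mat_deriv (alt_deriv \<delta> c) M y = mat_deriv (alt_deriv \<delta> c) N y"
proof -
  have "alt_deriv \<delta> c (\<lambda>y. M y $$ (i, j)) y = alt_deriv \<delta> c (\<lambda>y. N y $$ (i, j)) y" for i j
    by (rule alt_deriv_cong[OF \<delta> y]) (simp add: eq)
  then show ?thesis by (simp add: mat_deriv_def eq[OF y])
qed

lemma (in chart_region) mat_deriv_const:
  assumes \<delta>: "directional \<delta>" and y: "y \<in> W" and eq: "\<And>y. y \<in> W \<Longrightarrow> M y = K"
    and K: "K \<in> carrier_mat m n"
  shows "mat_deriv (alt_deriv \<delta> c) M y = 0\<^sub>m m n"
proof -
  have "mat_deriv (alt_deriv \<delta> c) M y = mat_deriv (alt_deriv \<delta> c) (\<lambda>y. K) y"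
    by (rule mat_deriv_cong[OF \<delta> y eq])
  also have "\<dots> = 0\<^sub>m m n"
    using K by (intro eq_matI) (auto simp: mat_deriv_def alt_deriv_const[OF \<delta> y])
  finally show ?thesis .
qed

lemma (in chart_region) mat_deriv_add:
  assumes \<delta>: "directional \<delta>" and M: "smooth_mat c W m n M" and N: "smooth_mat c W m n N" and y: "y \<in> W"
  shows "mat_deriv (alt_deriv \<delta> c) (\<lambda>y. M y + N y) y =
    mat_deriv (alt_deriv \<delta> c) M y + mat_deriv (alt_deriv \<delta> c) N y"
proof (rule eq_matI)
  note car = smooth_mat_carrier[OF M] smooth_mat_carrier[OF N] and dims = smooth_mat_dims[OF M] smooth_mat_dims[OF N]
  fix i j assume "i < dim_row (mat_deriv (alt_deriv \<delta> c) M y + mat_deriv (alt_deriv \<delta> c) N y)"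
    "j < dim_col (mat_deriv (alt_deriv \<delta> c) M y + mat_deriv (alt_deriv \<delta> c) N y)"
  then have ij: "i < m" "j < n" using car[OF y] by (auto simp: mat_deriv_def)
  have "alt_deriv \<delta> c (\<lambda>y. (M y + N y) $$ (i, j)) y = alt_deriv \<delta> c (\<lambda>y. M y $$ (i, j) + N y $$ (i, j)) y"
    by (rule alt_deriv_cong[OF \<delta> y]) (use dims ij in auto)
  also have "\<dots> = alt_deriv \<delta> c (\<lambda>y. M y $$ (i, j)) y + alt_deriv \<delta> c (\<lambda>y. N y $$ (i, j)) y"
    by (rule alt_deriv_add[OF \<delta> smooth_mat_entry[OF M ij] smooth_mat_entry[OF N ij] y])
  finally show "mat_deriv (alt_deriv \<delta> c) (\<lambda>y. M y + N y) y $$ (i, j) =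
      (mat_deriv (alt_deriv \<delta> c) M y + mat_deriv (alt_deriv \<delta> c) N y) $$ (i, j)"
    using car[OF y] ij by (simp add: mat_deriv_def)
qed (use smooth_mat_carrier[OF M y] smooth_mat_carrier[OF N y] in \<open>auto simp: mat_deriv_def\<close>)

lemma (in chart_region) mat_deriv_const_mult:
  assumes \<delta>: "directional \<delta>" and f: "smooth_fn_mat c W m n f" and M: "smooth_mat c W n k M" and y: "y \<in> W"
  shows "mat_deriv (alt_deriv \<delta> c) (\<lambda>y. mat_const (f y) * M y) y =
    mat_deriv (alt_deriv \<delta> c) (\<lambda>y. mat_const (f y)) y * M y + mat_const (f y) * mat_deriv (alt_deriv \<delta> c) M y"
    (is "?L = ?R")
proof (rule eq_matI)
  note car = smooth_fn_mat_carrier[OF f] smooth_mat_carrier[OF M]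
    and dims = smooth_fn_mat_dims[OF f] smooth_mat_dims[OF M]
  have d: "mat_deriv (alt_deriv \<delta> c) (\<lambda>y. mat_const (f y)) y \<in> carrier_mat m n"
    "mat_deriv (alt_deriv \<delta> c) M y \<in> carrier_mat n k" "mat_const (f y) \<in> carrier_mat m n" "M y \<in> carrier_mat n k"
    using car[OF y] by (auto intro: mat_deriv_carrier)
  fix i j assume "i < dim_row ?R" "j < dim_col ?R"
  then have ij: "i < m" "j < k" using d by auto
  have fe: "alt_deriv \<delta> c (\<lambda>y. mat_const (f y) $$ (i, l)) y = alt_deriv \<delta> c (\<lambda>y. form_const (f y $$ (i, l))) y"
    if "l < n" for l
    by (rule alt_deriv_cong[OF \<delta> y]) (use dims ij that in auto)
  have "alt_deriv \<delta> c (\<lambda>y. (mat_const (f y) * M y) $$ (i, j)) y =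
      alt_deriv \<delta> c (\<lambda>y. \<Sum>l<n. form_const (f y $$ (i, l)) * M y $$ (l, j)) y"
    by (rule alt_deriv_cong[OF \<delta> y]) (use car dims ij in \<open>subst index_mult_mat_sum[of _ m n _ k]; auto intro!: sum.cong\<close>)
  also have "\<dots> = (\<Sum>l<n. alt_deriv \<delta> c (\<lambda>y. form_const (f y $$ (i, l)) * M y $$ (l, j)) y)"
    by (rule alt_deriv_sum[OF \<delta> _ y])
      (use ij in \<open>auto intro!: smooth_form_on_const_mult smooth_fn_mat_entry[OF f] smooth_mat_entry[OF M]\<close>)
  also have "\<dots> = (\<Sum>l<n. alt_deriv \<delta> c (\<lambda>y. form_const (f y $$ (i, l))) y * M y $$ (l, j) +
      form_const (f y $$ (i, l)) * alt_deriv \<delta> c (\<lambda>y. M y $$ (l, j)) y)"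
    by (rule sum.cong[OF refl])
      (use ij in \<open>auto intro!: alt_deriv_const_mult[OF \<delta> smooth_fn_mat_entry[OF f] smooth_mat_entry[OF M] y]\<close>)
  also have "\<dots> = (\<Sum>l<n. mat_deriv (alt_deriv \<delta> c) (\<lambda>y. mat_const (f y)) y $$ (i, l) * M y $$ (l, j) +
      mat_const (f y) $$ (i, l) * mat_deriv (alt_deriv \<delta> c) M y $$ (l, j))"
    by (rule sum.cong[OF refl]) (use ij car(1)[OF y] car(2)[OF y] fe in \<open>simp add: mat_deriv_def\<close>)
  also have "\<dots> = ?R $$ (i, j)"
    using ij d by (simp add: index_mult_mat_sum[OF d(1,4) ij] index_mult_mat_sum[OF d(3,2) ij] sum.distrib)
  finally show "?L $$ (i, j) = ?R $$ (i, j)"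
    using d(3,4) ij by (simp add: mat_deriv_def)
qed (use smooth_fn_mat_carrier[OF f y] smooth_mat_carrier[OF M y] in \<open>auto simp: mat_deriv_def\<close>)

lemma (in chart_region) mat_deriv_mult_const:
  assumes \<delta>: "directional \<delta>" and M: "smooth_mat c W m n M" and f: "smooth_fn_mat c W n k f" and y: "y \<in> W"
    and hom: "\<And>i j. i < m \<Longrightarrow> j < n \<Longrightarrow> homogeneous 1 (M y $$ (i, j))"
  shows "mat_deriv (alt_deriv \<delta> c) (\<lambda>y. M y * mat_const (f y)) y =
    mat_deriv (alt_deriv \<delta> c) M y * mat_const (f y) - M y * mat_deriv (alt_deriv \<delta> c) (\<lambda>y. mat_const (f y)) y"
    (is "?L = ?R")
proof (rule eq_matI)
  note car = smooth_fn_mat_carrier[OF f] smooth_mat_carrier[OF M]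
    and dims = smooth_fn_mat_dims[OF f] smooth_mat_dims[OF M]
  have d: "mat_deriv (alt_deriv \<delta> c) (\<lambda>y. mat_const (f y)) y \<in> carrier_mat n k"
    "mat_deriv (alt_deriv \<delta> c) M y \<in> carrier_mat m n" "mat_const (f y) \<in> carrier_mat n k" "M y \<in> carrier_mat m n"
    using car[OF y] by (auto intro: mat_deriv_carrier)
  fix i j assume "i < dim_row ?R" "j < dim_col ?R"
  then have ij: "i < m" "j < k" using d by auto
  have fe: "alt_deriv \<delta> c (\<lambda>y. mat_const (f y) $$ (l, j)) y = alt_deriv \<delta> c (\<lambda>y. form_const (f y $$ (l, j))) y"
    if "l < n" for l
    by (rule alt_deriv_cong[OF \<delta> y]) (use dims ij that in auto)
  have "alt_deriv \<delta> c (\<lambda>y. (M y * mat_const (f y)) $$ (i, j)) y =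
      alt_deriv \<delta> c (\<lambda>y. \<Sum>l<n. M y $$ (i, l) * form_const (f y $$ (l, j))) y"
    by (rule alt_deriv_cong[OF \<delta> y]) (use car dims ij in \<open>subst index_mult_mat_sum[of _ m n _ k]; auto intro!: sum.cong\<close>)
  also have "\<dots> = (\<Sum>l<n. alt_deriv \<delta> c (\<lambda>y. M y $$ (i, l) * form_const (f y $$ (l, j))) y)"
    by (rule alt_deriv_sum[OF \<delta> _ y])
      (use ij in \<open>auto intro!: smooth_form_on_const_mult smooth_fn_mat_entry[OF f] smooth_mat_entry[OF M] simp: form_const_commute\<close>)
  also have "\<dots> = (\<Sum>l<n. alt_deriv \<delta> c (\<lambda>y. M y $$ (i, l)) y * form_const (f y $$ (l, j)) -
      M y $$ (i, l) * alt_deriv \<delta> c (\<lambda>y. form_const (f y $$ (l, j))) y)"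
    by (rule sum.cong[OF refl])
      (use ij hom in \<open>auto intro!: alt_deriv_mult_const[OF \<delta> smooth_fn_mat_entry[OF f] smooth_mat_entry[OF M] y]\<close>)
  also have "\<dots> = (\<Sum>l<n. mat_deriv (alt_deriv \<delta> c) M y $$ (i, l) * mat_const (f y) $$ (l, j) -
      M y $$ (i, l) * mat_deriv (alt_deriv \<delta> c) (\<lambda>y. mat_const (f y)) y $$ (l, j))"
    by (rule sum.cong[OF refl]) (use ij car(1)[OF y] car(2)[OF y] fe in \<open>simp add: mat_deriv_def\<close>)
  also have "\<dots> = ?R $$ (i, j)"
    using ij d by (simp add: index_mult_mat_sum[OF d(2,3) ij] index_mult_mat_sum[OF d(4,1) ij] sum_subtractf)
  finally show "?L $$ (i, j) = ?R $$ (i, j)"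
    using d(3,4) ij by (simp add: mat_deriv_def)
qed (use smooth_fn_mat_carrier[OF f y] smooth_mat_carrier[OF M y] in \<open>auto simp: mat_deriv_def\<close>)

lemma (in chart_region) mat_deriv_mat_deriv:
  assumes \<delta>: "directional \<delta>" "directional \<delta>'" and f: "smooth_fn_mat c W m n f" and y: "y \<in> W"
  shows "mat_deriv (alt_deriv \<delta> c) (mat_deriv (alt_deriv \<delta>' c) (\<lambda>y. mat_const (f y))) y =
    - mat_deriv (alt_deriv \<delta>' c) (mat_deriv (alt_deriv \<delta> c) (\<lambda>y. mat_const (f y))) y" (is "?L = ?R")
proof (rule eq_matI)
  note car = smooth_fn_mat_carrier[OF f] and dims = smooth_fn_mat_dims[OF f]
  fix i j assume "i < dim_row ?R" "j < dim_col ?R"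
  then have ij: "i < m" "j < n" using car[OF y] by (auto simp: mat_deriv_def)
  have 1: "alt_deriv \<delta> c (\<lambda>y. mat_deriv (alt_deriv \<delta>' c) (\<lambda>y. mat_const (f y)) y $$ (i, j)) y =
      alt_deriv \<delta> c (alt_deriv \<delta>' c (\<lambda>y. form_const (f y $$ (i, j)))) y"
    if "directional \<delta>" "directional \<delta>'" for \<delta> \<delta>'
  proof (rule alt_deriv_cong[OF that(1) y])
    fix y assume y: "y \<in> W"
    have "alt_deriv \<delta>' c (\<lambda>y. mat_const (f y) $$ (i, j)) y = alt_deriv \<delta>' c (\<lambda>y. form_const (f y $$ (i, j))) y"
      by (rule alt_deriv_cong[OF that(2) y]) (use dims ij in auto)
    then show "mat_deriv (alt_deriv \<delta>' c) (\<lambda>y. mat_const (f y)) y $$ (i, j) = alt_deriv \<delta>' c (\<lambda>y. form_const (f y $$ (i, j))) y"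
      using car[OF y] ij by (simp add: mat_deriv_def)
  qed
  show "?L $$ (i, j) = ?R $$ (i, j)"
    using 1[OF \<delta>] 1[OF \<delta>(2,1)] alt_deriv_alt_deriv[OF \<delta> smooth_fn_mat_entry[OF f ij] y] ij car[OF y]
    by (auto simp: mat_deriv_def)
qed (use smooth_fn_mat_carrier[OF f y] in \<open>auto simp: mat_deriv_def\<close>)

lemma altform_mat_minus_eq_self:
  fixes M :: "'v::real_vector altform Matrix.mat"
  assumes "M = - M" "M \<in> carrier_mat m n"
  shows "M = 0\<^sub>m m n"
proof (rule eq_matI)
  fix i j assume ij: "i < dim_row (0\<^sub>m m n :: 'v altform Matrix.mat)" "j < dim_col (0\<^sub>m m n :: 'v altform Matrix.mat)"
  then have "M $$ (i, j) = - M $$ (i, j)" using assms by (metis index_uminus_mat(1) carrier_matD index_zero_mat(2,3))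
  then show "M $$ (i, j) = 0\<^sub>m m n $$ (i, j)" using ij altform_minus_eq_self by auto
qed (use assms in auto)

lemma (in chart_region) homogeneous_mat_deriv_const:
  assumes \<delta>: "directional \<delta>" and f: "smooth_fn_mat c W m n f" and y: "y \<in> W" and ij: "i < m" "j < n"
  shows "homogeneous 1 (mat_deriv (alt_deriv \<delta> c) (\<lambda>y. mat_const (f y)) y $$ (i, j))"
proof -
  note car = smooth_fn_mat_carrier[OF f] and dims = smooth_fn_mat_dims[OF f]
  have "alt_deriv \<delta> c (\<lambda>y. mat_const (f y) $$ (i, j)) y = alt_deriv \<delta> c (\<lambda>y. form_const (f y $$ (i, j))) y"
    by (rule alt_deriv_cong[OF \<delta> y]) (use dims ij in auto)
  then show ?thesis
    using homogeneous_alt_deriv_form_const[OF \<delta> smooth_fn_mat_entry[OF f ij] y] ij car[OF y]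
    by (simp add: mat_deriv_def)
qed

section \<open>A common ring for rectangular matrices\<close>

instance altform :: (real_vector) real_algebra_1
proof
  fix a :: real and x y :: "'a altform"
  have "r *\<^sub>R w = form_const (of_real r) * w" for r and w :: "'a altform"
    by (rule altform_eqI) (simp add: scaleR_altform.rep_eq form_app_const_mult)
  then show "a *\<^sub>R x * y = a *\<^sub>R (x * y)" "x * a *\<^sub>R y = a *\<^sub>R (x * y)"
    by (simp_all add: mult.assoc form_const_commute[symmetric])
qed

lemma form_const_of_real: "form_const (of_real r) * w = r *\<^sub>R w"
  by (rule altform_eqI) (simp add: scaleR_altform.rep_eq form_app_const_mult)

text \<open>Matrices of all sizes, extended by zero, form one ring without unit in which the identity matrices are
  idempotents. Identities between rectangular matrices of forms can so be derived by calculation in a ring,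
  without side conditions on dimensions.\<close>

typedef (overloaded) ('a::zero) fsmat =
  "{f :: nat \<Rightarrow> nat \<Rightarrow> 'a. \<exists>N. \<forall>i j. N \<le> i \<or> N \<le> j \<longrightarrow> f i j = 0}"
  morphisms fsmat_entry Abs_fsmat
  by (rule exI[of _ "\<lambda>i j. 0"]) simp

setup_lifting type_definition_fsmat

lemma fsmat_eqI: "(\<And>i j. fsmat_entry A i j = fsmat_entry B i j) \<Longrightarrow> A = B"
  by (simp add: fsmat_entry_inject[symmetric] fun_eq_iff)

lemma fsmat_bound: "\<exists>N. \<forall>i j. N \<le> i \<or> N \<le> j \<longrightarrow> fsmat_entry A i j = 0"
  using fsmat_entry[of A] by simp

instantiation fsmat :: (real_algebra) real_algebra
begin

lift_definition zero_fsmat :: "'a fsmat" is "\<lambda>i j. 0" by simp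

lift_definition plus_fsmat :: "'a fsmat \<Rightarrow> 'a fsmat \<Rightarrow> 'a fsmat" is "\<lambda>f g i j. f i j + g i j"
proof -
  fix f g :: "nat \<Rightarrow> nat \<Rightarrow> 'a"
  assume "\<exists>N. \<forall>i j. N \<le> i \<or> N \<le> j \<longrightarrow> f i j = 0" "\<exists>N. \<forall>i j. N \<le> i \<or> N \<le> j \<longrightarrow> g i j = 0"
  then obtain M N where "\<forall>i j. M \<le> i \<or> M \<le> j \<longrightarrow> f i j = 0" "\<forall>i j. N \<le> i \<or> N \<le> j \<longrightarrow> g i j = 0"
    by blast
  then show "\<exists>N. \<forall>i j. N \<le> i \<or> N \<le> j \<longrightarrow> f i j + g i j = 0"
    by (intro exI[of _ "max M N"]) auto
qed

lift_definition uminus_fsmat :: "'a fsmat \<Rightarrow> 'a fsmat" is "\<lambda>f i j. - f i j" by auto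

definition minus_fsmat :: "'a fsmat \<Rightarrow> 'a fsmat \<Rightarrow> 'a fsmat" where "minus_fsmat A B = A + - B"

lift_definition scaleR_fsmat :: "real \<Rightarrow> 'a fsmat \<Rightarrow> 'a fsmat" is "\<lambda>r f i j. r *\<^sub>R f i j" by auto

lift_definition times_fsmat :: "'a fsmat \<Rightarrow> 'a fsmat \<Rightarrow> 'a fsmat" is
  "\<lambda>f g i j. \<Sum>k | f i k \<noteq> 0. f i k * g k j"
proof -
  fix f g :: "nat \<Rightarrow> nat \<Rightarrow> 'a"
  assume "\<exists>N. \<forall>i j. N \<le> i \<or> N \<le> j \<longrightarrow> f i j = 0" "\<exists>N. \<forall>i j. N \<le> i \<or> N \<le> j \<longrightarrow> g i j = 0"
  then obtain M N where "\<forall>i j. M \<le> i \<or> M \<le> j \<longrightarrow> f i j = 0" "\<forall>i j. N \<le> i \<or> N \<le> j \<longrightarrow> g i j = 0"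
    by blast
  then show "\<exists>N. \<forall>i j. N \<le> i \<or> N \<le> j \<longrightarrow> (\<Sum>k | f i k \<noteq> 0. f i k * g k j) = 0"
    by (intro exI[of _ "max M N"]) (auto intro!: sum.neutral)
qed

lemma fsmat_entry_times:
  assumes "\<forall>i j. N \<le> i \<or> N \<le> j \<longrightarrow> fsmat_entry A i j = 0"
  shows "fsmat_entry (A * B) i j = (\<Sum>k<N. fsmat_entry A i k * fsmat_entry B k j)"
proof -
  have "k < N" if "fsmat_entry A i k \<noteq> 0" for k using that assms by (metis not_le)
  then show ?thesis
    unfolding times_fsmat.rep_eq by (intro sum.mono_neutral_left) auto
qed

instance
proof
  fix A B C :: "'a fsmat" and r q :: real
  show "A + B + C = A + (B + C)" "A + B = B + A" "0 + A = A" "- A + A = 0" "A - B = A + - B"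
    by (rule fsmat_eqI; simp add: plus_fsmat.rep_eq zero_fsmat.rep_eq uminus_fsmat.rep_eq minus_fsmat_def add_ac)+
  show "r *\<^sub>R (A + B) = r *\<^sub>R A + r *\<^sub>R B" "(r + q) *\<^sub>R A = r *\<^sub>R A + q *\<^sub>R A"
    "r *\<^sub>R q *\<^sub>R A = (r * q) *\<^sub>R A" "1 *\<^sub>R A = A"
    by (rule fsmat_eqI; simp add: plus_fsmat.rep_eq scaleR_fsmat.rep_eq algebra_simps)+
  obtain K where K: "\<And>i j. K \<le> i \<or> K \<le> j \<Longrightarrow> fsmat_entry A i j = 0" using fsmat_bound by metis
  obtain L where L: "\<And>i j. L \<le> i \<or> L \<le> j \<Longrightarrow> fsmat_entry B i j = 0" using fsmat_bound by metis
  define N where "N = max K L"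
  have A: "\<forall>i j. N \<le> i \<or> N \<le> j \<longrightarrow> fsmat_entry A i j = 0"
    and B: "\<forall>i j. N \<le> i \<or> N \<le> j \<longrightarrow> fsmat_entry B i j = 0"
    using K L by (auto simp: N_def)
  note tA = fsmat_entry_times[of N A, OF A] and tB = fsmat_entry_times[of N B, OF B]
  have AB: "\<forall>i j. N \<le> i \<or> N \<le> j \<longrightarrow> fsmat_entry (A * B) i j = 0"
    using A B by (auto simp: tA intro!: sum.neutral)
  note tAB = fsmat_entry_times[of N "A * B", OF AB]
  have ApB: "\<forall>i j. N \<le> i \<or> N \<le> j \<longrightarrow> fsmat_entry (A + B) i j = 0"
    and rA: "\<forall>i j. N \<le> i \<or> N \<le> j \<longrightarrow> fsmat_entry (r *\<^sub>R A) i j = 0"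
    using A B by (auto simp: plus_fsmat.rep_eq scaleR_fsmat.rep_eq)
  note tApB = fsmat_entry_times[of N "A + B", OF ApB] and trA = fsmat_entry_times[of N "r *\<^sub>R A", OF rA]
  show "A * B * C = A * (B * C)"
  proof (rule fsmat_eqI)
    fix i j
    show "fsmat_entry (A * B * C) i j = fsmat_entry (A * (B * C)) i j"
      unfolding tAB tA tB sum_distrib_left sum_distrib_right mult.assoc by (rule sum.swap)
  qed
  show "(A + B) * C = A * C + B * C" "A * (B + C) = A * B + A * C"
    "r *\<^sub>R A * C = r *\<^sub>R (A * C)" "A * r *\<^sub>R C = r *\<^sub>R (A * C)"
    by (rule fsmat_eqI; simp add: plus_fsmat.rep_eq scaleR_fsmat.rep_eq tA tB tApB trA
      sum.distrib scaleR_right.sum algebra_simps)+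
qed

end

lift_definition fsmat_of :: "'a::zero Matrix.mat \<Rightarrow> 'a fsmat" is
  "\<lambda>M i j. if i < dim_row M \<and> j < dim_col M then M $$ (i, j) else 0"
  subgoal for M by (rule exI[of _ "max (dim_row M) (dim_col M)"]) auto
  done

lemma fsmat_of_mult:
  fixes A B :: "'a::real_algebra Matrix.mat"
  assumes A: "A \<in> carrier_mat m n" and B: "B \<in> carrier_mat n k"
  shows "fsmat_of (A * B) = fsmat_of A * fsmat_of B"
proof (rule fsmat_eqI)
  fix i j
  have "\<forall>i j. max m n \<le> i \<or> max m n \<le> j \<longrightarrow> fsmat_entry (fsmat_of A) i j = 0"
    using A by (auto simp: fsmat_of.rep_eq)
  from fsmat_entry_times[OF this, where B = "fsmat_of B"]
  have "fsmat_entry (fsmat_of A * fsmat_of B) i j =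
      (\<Sum>l<max m n. fsmat_entry (fsmat_of A) i l * fsmat_entry (fsmat_of B) l j)" by simp
  also have "\<dots> = (\<Sum>l<n. fsmat_entry (fsmat_of A) i l * fsmat_entry (fsmat_of B) l j)"
    using A by (intro sum.mono_neutral_right) (auto simp: fsmat_of.rep_eq)
  also have "\<dots> = fsmat_entry (fsmat_of (A * B)) i j"
  proof (cases "i < m \<and> j < k")
    case True
    then show ?thesis
      using A B index_mult_mat_sum[OF A B, of i j]
      by (simp add: fsmat_of.rep_eq del: index_mult_mat(1))
  qed (use A B in \<open>auto simp: fsmat_of.rep_eq intro!: sum.neutral\<close>)
  finally show "fsmat_entry (fsmat_of (A * B)) i j = fsmat_entry (fsmat_of A * fsmat_of B) i j" by simp
qed

lemma fsmat_of_add: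
  fixes A B :: "'a::real_algebra Matrix.mat"
  assumes "A \<in> carrier_mat m n" "B \<in> carrier_mat m n"
  shows "fsmat_of (A + B) = fsmat_of A + fsmat_of B"
  by (rule fsmat_eqI) (use assms in \<open>auto simp: fsmat_of.rep_eq plus_fsmat.rep_eq\<close>)

lemma fsmat_of_uminus: "fsmat_of (- A) = - fsmat_of A" for A :: "'a::real_algebra Matrix.mat"
  by (rule fsmat_eqI) (auto simp: fsmat_of.rep_eq uminus_fsmat.rep_eq)

lemma fsmat_entry_diff: "fsmat_entry (A - B) i j = fsmat_entry A i j - fsmat_entry B i j"
  unfolding minus_fsmat_def plus_fsmat.rep_eq uminus_fsmat.rep_eq by (rule add_uminus_conv_diff)

lemma fsmat_of_diff:
  fixes A B :: "'a::real_algebra Matrix.mat"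
  assumes "A \<in> carrier_mat m n" "B \<in> carrier_mat m n"
  shows "fsmat_of (A - B) = fsmat_of A - fsmat_of B"
  by (rule fsmat_eqI) (use assms in \<open>auto simp: fsmat_of.rep_eq fsmat_entry_diff\<close>)

lemma fsmat_of_zero: "fsmat_of (0\<^sub>m m n) = (0 :: 'a::real_algebra fsmat)"
  by (rule fsmat_eqI) (auto simp: fsmat_of.rep_eq zero_fsmat.rep_eq)

lemma fsmat_of_smult: "fsmat_of (form_const (of_real u) \<cdot>\<^sub>m A) = u *\<^sub>R fsmat_of A"
  by (rule fsmat_eqI) (auto simp: fsmat_of.rep_eq scaleR_fsmat.rep_eq form_const_of_real)

lemma fsmat_of_inject:
  assumes "A \<in> carrier_mat m n" "B \<in> carrier_mat m n" "fsmat_of A = fsmat_of B"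
  shows "A = B"
proof (rule eq_matI)
  fix i j assume ij: "i < dim_row B" "j < dim_col B"
  have "fsmat_entry (fsmat_of A) i j = fsmat_entry (fsmat_of B) i j" by (simp add: assms(3))
  then show "A $$ (i, j) = B $$ (i, j)" using ij assms(1,2) by (auto simp: fsmat_of.rep_eq)
qed (use assms in auto)

lemma fsmat_of_one_left:
  fixes A :: "'a::{real_algebra_1} Matrix.mat"
  assumes "A \<in> carrier_mat m n"
  shows "fsmat_of (1\<^sub>m m) * fsmat_of A = fsmat_of A"
  using fsmat_of_mult[OF one_carrier_mat assms] assms by simp

lemma fsmat_of_one_right:
  fixes A :: "'a::{real_algebra_1} Matrix.mat"
  assumes "A \<in> carrier_mat m n"
  shows "fsmat_of A * fsmat_of (1\<^sub>m n) = fsmat_of A"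
  using fsmat_of_mult[OF assms one_carrier_mat] assms by simp

section \<open>The Gauss equations as ring identities\<close>

text \<open>Here \<open>er\<close> and \<open>eq\<close> are the identities of \<open>E\<close> and \<open>H\<close>, \<open>g\<close> and \<open>s\<close> are the matrices of \<open>p\<close> and its adjoint,
  \<open>\<theta>\<close> and \<open>\<theta>H\<close> are the connection forms, \<open>ds\<close>, \<open>dg\<close> are derivatives by \<open>\<partial>\<close>, \<open>bs\<close> is \<open>\<partial>\<bar> s\<close>, and \<open>dP\<close>, \<open>dF\<close> are the
  exterior derivatives of the projections \<open>P\<close> onto \<open>F\<^sup>\<bottom>\<close> and \<open>F\<close> onto the subbundle. \<open>A\<close> and \<open>A'\<close> are the second
  fundamental form and its adjoint; the conclusions say that \<open>A\<close> vanishes on \<open>F\<^sup>\<bottom>\<close> and express \<open>A\<close> and \<open>A'\<close> by the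
  connection forms and first derivatives.\<close>

lemma gauss_codazzi_algebra:
  fixes g s \<theta> \<theta>H er eq :: "'a::real_algebra"
  assumes units: "er * \<theta> = \<theta>" "\<theta> * er = \<theta>" "er * bs = bs" "g * er = g" "eq * dg = dg" "eq * \<theta>H = \<theta>H"
      "ds * eq = ds" "bs * eq = bs" "s * eq = s" "er * s = s" "eq * g = g"
    and gs: "g * s = eq"
    and H1: "ds + \<theta> * s = s * \<theta>H" and H2: "g * bs = 0" and Hgs: "dg * s + g * ds = 0"
    and P: "P = s * g" and F: "F = er - s * g"
    and dP: "dP = (ds + bs) * g + s * dg" and dF: "dF = - dP"
    and A: "A = P * (dF + \<theta> * F)" and A': "A' = - (F * (dP + \<theta> * P))"
  shows "A * s = 0" and "A * A = 0"
    and "g * A = g * \<theta> - dg - \<theta>H * g" and "A' * s = - bs"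
    and "g * (A * A') * s = - ((g * \<theta> - dg) * bs)"
proof -
  have Fs: "F * s = 0" by (simp add: F left_diff_distrib mult.assoc gs units)
  have dPs: "dP * s = ds + bs + s * (dg * s)"
    by (simp add: dP distrib_left distrib_right mult.assoc gs units)
  have "P * (dP * s) = s * (g * ds + dg * s) + s * (g * bs)"
    unfolding dPs P by (simp add: distrib_left mult.assoc) (simp add: mult.assoc[symmetric] gs units)
  then have PdPs: "P * (dP * s) = 0" using Hgs by (simp add: H2 add.commute)
  show As: "A * s = 0"
    unfolding A dF by (simp add: mult.assoc left_diff_distrib right_diff_distrib Fs PdPs)
  have AP: "A * P = 0" unfolding P mult.assoc[symmetric] As by simp
  show "A * A = 0"
  proof -
    have "A * A = A * (P * (dF + \<theta> * F))" by (subst (2) A) simp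
    then show ?thesis by (simp add: mult.assoc[symmetric] AP)
  qed
  have gds: "g * ds = \<theta>H - g * (\<theta> * s)"
  proof -
    have "g * (ds + \<theta> * s) = g * s * \<theta>H" unfolding H1 by (simp add: mult.assoc)
    then have "g * ds + g * (\<theta> * s) = \<theta>H" by (simp add: gs units distrib_left)
    then show ?thesis by (simp add: eq_diff_eq)
  qed
  have gsX: "g * (s * X) = eq * X" for X by (simp add: mult.assoc[symmetric] gs)
  have gdP: "g * dP = (\<theta>H - g * (\<theta> * s)) * g + dg"
  proof -
    have "g * dP = (g * ds) * g + (g * bs) * g + g * (s * dg)"
      by (simp add: dP distrib_left distrib_right mult.assoc)
    then show ?thesis by (simp add: gds H2 gsX units)
  qed
  show gA: "g * A = g * \<theta> - dg - \<theta>H * g"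
  proof -
    have "g * A = eq * (g * (dF + \<theta> * F))"
      unfolding A P by (simp add: mult.assoc gsX)
    also have "\<dots> = g * (dF + \<theta> * F)" by (simp add: mult.assoc[symmetric] units)
    also have "\<dots> = - (g * dP) + g * (\<theta> * er) - g * (\<theta> * (s * g))"
      by (simp add: dF F distrib_left right_diff_distrib)
    also have "\<dots> = g * \<theta> - dg - \<theta>H * g"
      unfolding gdP by (simp add: units left_diff_distrib mult.assoc)
    finally show ?thesis .
  qed
  show A's: "A' * s = - bs"
  proof -
    have "A' * s = - (F * (dP * s + \<theta> * (s * (g * s))))"
      by (simp add: A' P distrib_left left_diff_distrib mult.assoc)
    also have "dP * s + \<theta> * (s * (g * s)) = s * \<theta>H + bs + s * (dg * s)"
      using H1 unfolding dPs gs units by (simp add: algebra_simps)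
    also have "F * (s * \<theta>H + bs + s * (dg * s)) = F * bs"
      by (simp add: distrib_left mult.assoc[symmetric] Fs)
    also have "\<dots> = bs" by (simp add: F left_diff_distrib mult.assoc H2 units)
    finally show ?thesis .
  qed
  have "g * (A * A') * s = (g * A) * (A' * s)" by (simp add: mult.assoc)
  also have "\<dots> = - ((g * \<theta> - dg) * bs)"
    unfolding gA A's by (simp add: left_diff_distrib mult.assoc H2)
  finally show "g * (A * A') * s = - ((g * \<theta> - dg) * bs)" .
qed

text \<open>With the notation above, the prefixes \<open>d\<close> and \<open>b\<close> denoting \<open>\<partial>\<close> and \<open>\<partial>\<bar>\<close>. For \<open>v = 0\<close> the claim is the equation
  of Gauss. The term quadratic in \<open>v\<close> vanishes because \<open>A A = 0\<close>, and the linear term \<open>dA + \<theta> A + A \<theta>\<close>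
  has the block \<open>- Q\<close> on \<open>H\<close>. Putting \<open>v = u - 1\<close> leaves \<open>- u Q\<close>.\<close>

lemma curvature_algebra:
  fixes g s \<theta> \<theta>H er eq :: "'a::real_algebra"
  assumes units: "eq * \<Theta>H = \<Theta>H" and gs: "g * s = eq"
    and H1: "ds + \<theta> * s = s * \<theta>H" and H2: "g * bs = 0"
    and H3: "d\<theta> + \<theta> * \<theta> = 0"
    and H4: "bds + (b\<theta> * s - \<theta> * bs) = bs * \<theta>H + s * \<Theta>H"
    and H5: "dg * bs + g * dbs = 0" and H6: "bds = - dbs"
    and H9: "dA * s - A * (ds + bs) = 0"
    and As: "A * s = 0" and AA: "A * A = 0" and gA: "g * A = g * \<theta> - dg - \<theta>H * g"
    and Q: "Q = - ((g * \<theta> - dg) * bs)"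
  shows "g * (d\<theta> + b\<theta> + v *\<^sub>R dA + (\<theta> + v *\<^sub>R A) * (\<theta> + v *\<^sub>R A)) * s = \<Theta>H - (v + 1) *\<^sub>R Q"
proof -
  have "g * (bds + (b\<theta> * s - \<theta> * bs)) = (g * bs) * \<theta>H + (g * s) * \<Theta>H"
    unfolding H4 by (simp add: distrib_left mult.assoc)
  then have "g * bds + g * (b\<theta> * s) - g * (\<theta> * bs) = \<Theta>H"
    by (simp add: H2 gs units distrib_left right_diff_distrib add_diff_eq)
  moreover have "g * bds = dg * bs" using H5 H6 by (metis eq_neg_iff_add_eq_0 mult_minus_right)
  (* the equation of Gauss: the curvature of E has type (1,1) and is the form written b\<theta> *)
  ultimately have R1: "g * (b\<theta> * s) = \<Theta>H - Q"
    unfolding Q by (simp add: left_diff_distrib mult.assoc algebra_simps)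
  have d\<theta>: "d\<theta> = - (\<theta> * \<theta>)" using H3 by (simp add: eq_neg_iff_add_eq_0)
  have dAs: "dA * s = A * (ds + bs)" using H9 by simp
  (* the coefficient of v; \<theta> * A drops out because A * s = 0 *)
  have "g * (dA * s + A * (\<theta> * s)) = (g * A) * (ds + \<theta> * s) + (g * A) * bs"
    unfolding dAs by (simp add: distrib_left mult.assoc)
  also have "(g * A) * (ds + \<theta> * s) = 0"
    unfolding H1 by (simp add: mult.assoc[of g] mult.assoc[of A, symmetric] As)
  also have "(g * A) * bs = - Q"
    unfolding gA Q by (simp add: left_diff_distrib mult.assoc H2)
  finally have R2: "g * (dA * s) + g * (A * (\<theta> * s)) = - Q" by (simp add: distrib_left)
  have "g * (d\<theta> + b\<theta> + v *\<^sub>R dA + (\<theta> + v *\<^sub>R A) * (\<theta> + v *\<^sub>R A)) * s =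
      g * (b\<theta> * s) + v *\<^sub>R (g * (dA * s) + g * (A * (\<theta> * s)))"
    by (simp add: d\<theta> distrib_left distrib_right mult.assoc As AA scaleR_add_right
      mult.assoc[of A A, symmetric] left_diff_distrib right_diff_distrib)
  then show ?thesis unfolding R1 R2 by (simp add: scaleR_add_left)
qed

section \<open>Quotients of Hermitian bundles in holomorphic frames\<close>

lemma smooth_fn_mat_constI [simp]: "chart_region c W \<Longrightarrow> K \<in> carrier_mat m n \<Longrightarrow> smooth_fn_mat c W m n (\<lambda>y. K)"
  using chart_region.smooth_fn_on_const by (fastforce simp: smooth_fn_mat_def)

lemma (in chart_region) smooth_fn_mat_diff:
  assumes "smooth_fn_mat c W m n f" "smooth_fn_mat c W m n g"
  shows "smooth_fn_mat c W m n (\<lambda>y. f y - g y)"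
  unfolding smooth_fn_mat_def
proof (intro conjI ballI allI impI)
  show "f y - g y \<in> carrier_mat m n" if "y \<in> W" for y
    using smooth_fn_mat_carrier[OF assms(2) that] by (rule minus_carrier_mat)
  fix i j assume ij: "i < m" "j < n"
  have "smooth_fn_on c W (\<lambda>y. f y $$ (i, j) + (- 1) * g y $$ (i, j))"
    by (intro smooth_fn_on_add smooth_fn_on_mult smooth_fn_on_const smooth_fn_mat_entry[OF assms(1)]
      smooth_fn_mat_entry[OF assms(2)] ij)
  then show "smooth_fn_on c W (\<lambda>y. (f y - g y) $$ (i, j))"
    by (rule smooth_fn_on_cong[THEN iffD1, rotated])
      (use ij smooth_fn_mat_dims[OF assms(1)] smooth_fn_mat_dims[OF assms(2)] in auto)
qed

lemma mat_deriv_ext_d: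
  "mat_deriv (ext_d c) M y = mat_deriv (alt_deriv d10 c) M y + mat_deriv (alt_deriv d01 c) M y"
  by (rule eq_matI) (auto simp: mat_deriv_def ext_d_def del_def delbar_def)

lemma mat_const_diff:
  "A \<in> carrier_mat m n \<Longrightarrow> B \<in> carrier_mat m n \<Longrightarrow> mat_const (A - B) = mat_const A - mat_const B"
  by (rule eq_matI) (auto simp: form_const_diff)

lemma mat_const_carrier: "A \<in> carrier_mat m n \<Longrightarrow> mat_const A \<in> carrier_mat m n"
  by simp

text \<open>\<open>G\<close> and \<open>GH\<close> are the Gram matrices of the metrics on \<open>E\<close> and \<open>H\<close>, with inverses \<open>Gi\<close> and \<open>GHi\<close>; \<open>g\<close> is the
  matrix of \<open>p\<close> and \<open>gt\<close> its conjugate transpose. Condition \<open>adjoint_eq\<close> says that \<open>s\<close> is the matrix of the adjoint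
  of \<open>p\<close>, and \<open>section_eq\<close> that \<open>H\<close> carries the quotient metric.\<close>

locale hermitian_quotient = chart_region c W
  for c :: "('x, 'n::finite) chart" and W :: "'x set" +
  fixes r q :: nat and G Gi GH GHi g gt s :: "'x \<Rightarrow> complex Matrix.mat"
  assumes smooth: "smooth_fn_mat c W r r G" "smooth_fn_mat c W r r Gi" "smooth_fn_mat c W q q GH"
      "smooth_fn_mat c W q q GHi" "smooth_fn_mat c W q r g" "smooth_fn_mat c W r q gt" "smooth_fn_mat c W r q s"
    and inverse: "\<And>y. y \<in> W \<Longrightarrow> Gi y * G y = 1\<^sub>m r" "\<And>y. y \<in> W \<Longrightarrow> G y * Gi y = 1\<^sub>m r"
      "\<And>y. y \<in> W \<Longrightarrow> GH y * GHi y = 1\<^sub>m q"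
    and section_eq: "\<And>y. y \<in> W \<Longrightarrow> g y * s y = 1\<^sub>m q"
    and adjoint_eq: "\<And>y. y \<in> W \<Longrightarrow> G y * s y = gt y * GH y"
    and holo: "\<And>y. y \<in> W \<Longrightarrow> mat_deriv (alt_deriv d01 c) (\<lambda>y. mat_const (g y)) y = 0\<^sub>m q r"
    and antiholo: "\<And>y. y \<in> W \<Longrightarrow> mat_deriv (alt_deriv d10 c) (\<lambda>y. mat_const (gt y)) y = 0\<^sub>m r q"
begin

definition proj_perp :: "'x \<Rightarrow> complex Matrix.mat" where
  "proj_perp y = s y * g y"

definition proj_sub :: "'x \<Rightarrow> complex Matrix.mat" where
  "proj_sub y = 1\<^sub>m r - s y * g y"

definition conn :: "'x \<Rightarrow> (complex ^ 'n) altform Matrix.mat" where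
  "conn y = mat_const (Gi y) * mat_deriv (alt_deriv d10 c) (\<lambda>y. mat_const (G y)) y"

definition conn_quot :: "'x \<Rightarrow> (complex ^ 'n) altform Matrix.mat" where
  "conn_quot y = mat_const (GHi y) * mat_deriv (alt_deriv d10 c) (\<lambda>y. mat_const (GH y)) y"

definition sff :: "'x \<Rightarrow> (complex ^ 'n) altform Matrix.mat" where
  "sff y = mat_const (proj_perp y) * cov_deriv c conn (\<lambda>y. mat_const (proj_sub y)) y"

definition sff_adj :: "'x \<Rightarrow> (complex ^ 'n) altform Matrix.mat" where
  "sff_adj y = - (mat_const (proj_sub y) * cov_deriv c conn (\<lambda>y. mat_const (proj_perp y)) y)"

abbreviation "ds \<equiv> mat_deriv (alt_deriv d10 c) (\<lambda>y. mat_const (s y))"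
abbreviation "bs \<equiv> mat_deriv (alt_deriv d01 c) (\<lambda>y. mat_const (s y))"
abbreviation "dg \<equiv> mat_deriv (alt_deriv d10 c) (\<lambda>y. mat_const (g y))"

end

lemma (in hermitian_quotient) smooth_proj:
  "smooth_fn_mat c W r r proj_perp" "smooth_fn_mat c W r r proj_sub"
  unfolding proj_perp_def[abs_def] proj_sub_def[abs_def]
  by (intro smooth_fn_mat_mult[OF smooth(7,5)] smooth_fn_mat_diff smooth_fn_mat_constI
    chart_region_axioms one_carrier_mat)+

lemma (in hermitian_quotient) smooth_mats:
  "smooth_mat c W r r conn" "smooth_mat c W q q conn_quot" "smooth_mat c W r q ds" "smooth_mat c W r q bs"
  "smooth_mat c W q r dg" "smooth_mat c W r r sff"
  "smooth_mat c W r r (cov_deriv c conn (\<lambda>y. mat_const (proj_perp y)))"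
proof -
  note d = smooth_mat_deriv[OF directional_d10 smooth_mat_of_fn_mat] smooth_mat_deriv[OF directional_d01 smooth_mat_of_fn_mat]
  show conn: "smooth_mat c W r r conn" "smooth_mat c W q q conn_quot"
    unfolding conn_def[abs_def] conn_quot_def[abs_def]
    by (rule smooth_mat_const_mult[OF smooth(2) d(1)[OF smooth(1)]],
      rule smooth_mat_const_mult[OF smooth(4) d(1)[OF smooth(3)]])
  show "smooth_mat c W r q ds" "smooth_mat c W r q bs" "smooth_mat c W q r dg"
    by (intro d smooth)+
  have cov: "smooth_mat c W r r (cov_deriv c conn (\<lambda>y. mat_const (f y)))" if "smooth_fn_mat c W r r f" for f
    unfolding cov_deriv_def[abs_def] mat_deriv_ext_d
    by (intro smooth_mat_add d that smooth_mat_mult_const[OF conn(1) that])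
  show "smooth_mat c W r r (cov_deriv c conn (\<lambda>y. mat_const (proj_perp y)))"
    by (rule cov[OF smooth_proj(1)])
  show "smooth_mat c W r r sff"
    unfolding sff_def[abs_def] by (rule smooth_mat_const_mult[OF smooth_proj(1) cov[OF smooth_proj(2)]])
qed

lemma (in hermitian_quotient) carriers:
  assumes "y \<in> W"
  shows "G y \<in> carrier_mat r r" "Gi y \<in> carrier_mat r r" "GH y \<in> carrier_mat q q" "GHi y \<in> carrier_mat q q"
    "g y \<in> carrier_mat q r" "gt y \<in> carrier_mat r q" "s y \<in> carrier_mat r q"
    "proj_perp y \<in> carrier_mat r r" "proj_sub y \<in> carrier_mat r r"
    "conn y \<in> carrier_mat r r" "conn_quot y \<in> carrier_mat q q" "ds y \<in> carrier_mat r q" "bs y \<in> carrier_mat r q"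
    "dg y \<in> carrier_mat q r" "sff y \<in> carrier_mat r r" "sff_adj y \<in> carrier_mat r r"
  using assms smooth_fn_mat_carrier[OF smooth(1)] smooth_fn_mat_carrier[OF smooth(2)] smooth_fn_mat_carrier[OF smooth(3)]
    smooth_fn_mat_carrier[OF smooth(4)] smooth_fn_mat_carrier[OF smooth(5)] smooth_fn_mat_carrier[OF smooth(6)]
    smooth_fn_mat_carrier[OF smooth(7)] smooth_fn_mat_carrier[OF smooth_proj(1)] smooth_fn_mat_carrier[OF smooth_proj(2)]
    smooth_mats[THEN smooth_mat_carrier, OF assms]
    mult_carrier_mat[OF mat_const_carrier[OF smooth_fn_mat_carrier[OF smooth_proj(2) assms]]
      smooth_mats(7)[THEN smooth_mat_carrier, OF assms]]
  by (simp_all only: sff_adj_def uminus_carrier_iff_mat)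

lemma (in chart_region) mat_deriv_const_carrier:
  assumes "smooth_fn_mat c W m k f" "y \<in> W"
  shows "mat_deriv (alt_deriv \<delta> c) (\<lambda>y. mat_const (f y)) y \<in> carrier_mat m k"
  by (rule mat_deriv_carrier) (use smooth_fn_mat_carrier[OF assms] in simp)

lemma mat_const_mult_one_form:
  assumes "A \<in> carrier_mat m n" "M \<in> carrier_mat n k" "\<And>i j. i < n \<Longrightarrow> j < k \<Longrightarrow> homogeneous d (M $$ (i, j))"
    "i < m" "j < k"
  shows "homogeneous d ((mat_const A * M) $$ (i, j))"
  using assms by (subst index_mult_mat_sum[of _ m n _ k]) (auto intro!: homogeneous_sum homogeneous_const_mult)

lemma mat_one_form_mult_const:
  assumes "M \<in> carrier_mat m n" "A \<in> carrier_mat n k" "\<And>i j. i < m \<Longrightarrow> j < n \<Longrightarrow> homogeneous d (M $$ (i, j))"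
    "i < m" "j < k"
  shows "homogeneous d ((M * mat_const A) $$ (i, j))"
  using assms by (subst index_mult_mat_sum[of _ m n _ k]) (auto intro!: homogeneous_sum homogeneous_mult_const)

lemma (in hermitian_quotient) homogeneous_conn:
  assumes "y \<in> W" "i < r" "j < r"
  shows "homogeneous 1 (conn y $$ (i, j))"
  unfolding conn_def
  by (rule mat_const_mult_one_form[OF carriers(2)[OF assms(1)] mat_deriv_const_carrier[OF smooth(1) assms(1)]
    homogeneous_mat_deriv_const[OF directional_d10 smooth(1) assms(1)] assms(2,3)])

lemma (in hermitian_quotient) homogeneous_conn_quot:
  assumes "y \<in> W" "i < q" "j < q"
  shows "homogeneous 1 (conn_quot y $$ (i, j))"
  unfolding conn_quot_def
  by (rule mat_const_mult_one_form[OF carriers(4)[OF assms(1)] mat_deriv_const_carrier[OF smooth(3) assms(1)]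
    homogeneous_mat_deriv_const[OF directional_d10 smooth(3) assms(1)] assms(2,3)])

lemma (in hermitian_quotient) homogeneous_cov_deriv:
  assumes y: "y \<in> W" and f: "smooth_fn_mat c W r r f" and ij: "i < r" "j < r"
  shows "homogeneous 1 (cov_deriv c conn (\<lambda>y. mat_const (f y)) y $$ (i, j))"
proof -
  note car = smooth_fn_mat_carrier[OF f y]
  have d: "mat_deriv (alt_deriv \<delta> c) (\<lambda>y. mat_const (f y)) y \<in> carrier_mat r r" for \<delta>
    by (rule mat_deriv_carrier) (use car in simp)
  have "homogeneous 1 ((conn y * mat_const (f y)) $$ (i, j))"
    by (rule mat_one_form_mult_const[OF carriers(10)[OF y] car homogeneous_conn[OF y] ij])
  then show ?thesis
    using homogeneous_mat_deriv_const[OF directional_d10 f y ij] homogeneous_mat_deriv_const[OF directional_d01 f y ij]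
      d[of d10] d[of d01] carriers(10)[OF y] car ij
    by (simp add: cov_deriv_def mat_deriv_ext_d homogeneous_add del: index_mult_mat(1))
qed

lemma (in hermitian_quotient) homogeneous_sff:
  assumes "y \<in> W" "i < r" "j < r"
  shows "homogeneous 1 (sff y $$ (i, j))" "homogeneous 1 (sff_adj y $$ (i, j))"
proof -
  have car: "cov_deriv c conn (\<lambda>y. mat_const (f y)) y \<in> carrier_mat r r" if "smooth_fn_mat c W r r f" for f
    using smooth_fn_mat_carrier[OF that assms(1)] carriers(10)[OF assms(1)]
    by (auto simp: cov_deriv_def mat_deriv_ext_d intro!: add_carrier_mat mat_deriv_carrier)
  show "homogeneous 1 (sff y $$ (i, j))"
    unfolding sff_def
    by (rule mat_const_mult_one_form[OF carriers(8)[OF assms(1)] car[OF smooth_proj(2)]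
      homogeneous_cov_deriv[OF assms(1) smooth_proj(2)] assms(2,3)])
  have "homogeneous 1 ((mat_const (proj_sub y) * cov_deriv c conn (\<lambda>y. mat_const (proj_perp y)) y) $$ (i, j))"
    by (rule mat_const_mult_one_form[OF carriers(9)[OF assms(1)] car[OF smooth_proj(1)]
      homogeneous_cov_deriv[OF assms(1) smooth_proj(1)] assms(2,3)])
  then show "homogeneous 1 (sff_adj y $$ (i, j))"
    using carriers(9)[OF assms(1)] car[OF smooth_proj(1)] assms
    by (simp add: sff_adj_def homogeneous_uminus del: index_mult_mat(1))
qed

lemma (in hermitian_quotient) fsmat_units:
  assumes y: "y \<in> W"
  shows "fsmat_of (mat_const (g y)) * fsmat_of (mat_const (s y)) = fsmat_of (1\<^sub>m q :: (complex ^ 'n) altform Matrix.mat)"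
    and "fsmat_of (mat_const (proj_perp y)) = fsmat_of (mat_const (s y)) * fsmat_of (mat_const (g y) :: (complex ^ 'n) altform Matrix.mat)"
    and "fsmat_of (mat_const (proj_sub y)) = fsmat_of (1\<^sub>m r :: (complex ^ 'n) altform Matrix.mat) -
      fsmat_of (mat_const (s y)) * fsmat_of (mat_const (g y))"
proof -
  note c = carriers[OF y]
  note cc = c(5)[THEN mat_const_carrier] c(7)[THEN mat_const_carrier]
  show "fsmat_of (mat_const (g y)) * fsmat_of (mat_const (s y)) = fsmat_of (1\<^sub>m q :: (complex ^ 'n) altform Matrix.mat)"
    by (simp only: fsmat_of_mult[OF cc, symmetric] mat_const_mult[OF c(5,7), symmetric] section_eq[OF y] mat_const_one)
  show 1: "fsmat_of (mat_const (proj_perp y)) = fsmat_of (mat_const (s y)) * fsmat_of (mat_const (g y) :: (complex ^ 'n) altform Matrix.mat)"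
    by (simp only: proj_perp_def mat_const_mult[OF c(7,5)] fsmat_of_mult[OF cc(2,1)])
  have "mat_const (proj_sub y) = 1\<^sub>m r - (mat_const (proj_perp y) :: (complex ^ 'n) altform Matrix.mat)"
    using c(8) by (simp add: proj_sub_def proj_perp_def[symmetric] mat_const_diff[of _ r r] mat_const_one)
  then show "fsmat_of (mat_const (proj_sub y)) = fsmat_of (1\<^sub>m r :: (complex ^ 'n) altform Matrix.mat) -
      fsmat_of (mat_const (s y)) * fsmat_of (mat_const (g y))"
    using c(8) by (simp only: 1[symmetric] fsmat_of_diff[OF one_carrier_mat mat_const_carrier[OF c(8)]])
qed

text \<open>The first equation says that the adjoint of \<open>p\<close> commutes with the \<open>(1,0)\<close>-parts of the canonical connections.
  It results from applying \<open>\<partial>\<close> to \<open>G s = g\<^sup>* GH\<close>, since \<open>g\<^sup>*\<close> is antiholomorphic. The next two are \<open>\<partial>\<bar>\<close> and \<open>\<partial>\<close> of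
  \<open>g s = 1\<close>, and the last two differentiate the projections.\<close>

lemma (in hermitian_quotient) first_order:
  assumes y: "y \<in> W"
  shows "fsmat_of (ds y) + fsmat_of (conn y) * fsmat_of (mat_const (s y)) = fsmat_of (mat_const (s y)) * fsmat_of (conn_quot y)"
    and "fsmat_of (mat_const (g y)) * fsmat_of (bs y) = 0"
    and "fsmat_of (dg y) * fsmat_of (mat_const (s y)) + fsmat_of (mat_const (g y)) * fsmat_of (ds y) = 0"
    and "fsmat_of (mat_deriv (ext_d c) (\<lambda>y. mat_const (proj_perp y)) y) =
      (fsmat_of (ds y) + fsmat_of (bs y)) * fsmat_of (mat_const (g y)) + fsmat_of (mat_const (s y)) * fsmat_of (dg y)"
    and "fsmat_of (mat_deriv (ext_d c) (\<lambda>y. mat_const (proj_sub y)) y) =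
      - fsmat_of (mat_deriv (ext_d c) (\<lambda>y. mat_const (proj_perp y)) y)"
proof -
  note c = carriers[OF y] and mc = mat_const_carrier and dcar = mat_deriv_const_carrier[OF _ y]
  have leib: "fsmat_of (mat_deriv (alt_deriv \<delta> c) (\<lambda>y. mat_const (f y * h y)) y) =
      fsmat_of (mat_deriv (alt_deriv \<delta> c) (\<lambda>y. mat_const (f y)) y) * fsmat_of (mat_const (h y)) +
      fsmat_of (mat_const (f y)) * fsmat_of (mat_deriv (alt_deriv \<delta> c) (\<lambda>y. mat_const (h y)) y)"
    if \<delta>: "directional \<delta>" and f: "smooth_fn_mat c W m k f" and h: "smooth_fn_mat c W k l h" for \<delta> m k l f h
  proof -
    have "mat_deriv (alt_deriv \<delta> c) (\<lambda>y. mat_const (f y * h y)) y =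
        mat_deriv (alt_deriv \<delta> c) (\<lambda>y. mat_const (f y) * mat_const (h y)) y"
      by (rule mat_deriv_cong[OF \<delta> y], rule mat_const_mult[OF smooth_fn_mat_carrier[OF f] smooth_fn_mat_carrier[OF h]])
    also have "\<dots> = mat_deriv (alt_deriv \<delta> c) (\<lambda>y. mat_const (f y)) y * mat_const (h y) +
        mat_const (f y) * mat_deriv (alt_deriv \<delta> c) (\<lambda>y. mat_const (h y)) y"
      by (rule mat_deriv_const_mult[OF \<delta> f smooth_mat_of_fn_mat[OF h] y])
    finally show ?thesis
      by (simp only: fsmat_of_add[OF mult_carrier_mat[OF dcar[OF f] smooth_fn_mat_carrier[OF h y, THEN mc]]
          mult_carrier_mat[OF smooth_fn_mat_carrier[OF f y, THEN mc] dcar[OF h]]]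
        fsmat_of_mult[OF dcar[OF f] smooth_fn_mat_carrier[OF h y, THEN mc]]
        fsmat_of_mult[OF smooth_fn_mat_carrier[OF f y, THEN mc] dcar[OF h]])
  qed
  let ?E = "fsmat_of :: (complex ^ 'n) altform Matrix.mat \<Rightarrow> _"
  let ?c = "\<lambda>M. ?E (mat_const M)" and ?d = "\<lambda>\<delta> f. ?E (mat_deriv (alt_deriv \<delta> c) (\<lambda>y. mat_const (f y)) y)"
  have gs0: "?d \<delta> (\<lambda>y. g y * s y) = 0" if "directional \<delta>" for \<delta>
    by (subst mat_deriv_const[OF that y, of _ "1\<^sub>m q" q q]) (simp_all add: section_eq mat_const_one fsmat_of_zero)
  have holo0: "?d d01 g = 0" and antiholo0: "?d d10 gt = 0"
    by (simp_all add: holo[OF y] antiholo[OF y] fsmat_of_zero)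
  show "?c (g y) * ?E (bs y) = 0"
    using leib[OF directional_d01 smooth(5,7)] gs0[OF directional_d01] holo0 by simp
  show "?E (dg y) * ?c (s y) + ?c (g y) * ?E (ds y) = 0"
    using leib[OF directional_d10 smooth(5,7)] gs0[OF directional_d10] by simp
  show P: "?E (mat_deriv (ext_d c) (\<lambda>y. mat_const (proj_perp y)) y) = (?E (ds y) + ?E (bs y)) * ?c (g y) + ?c (s y) * ?E (dg y)"
    using leib[OF directional_d10 smooth(7,5)] leib[OF directional_d01 smooth(7,5)] holo0
    by (simp add: mat_deriv_ext_d fsmat_of_add[OF dcar[OF smooth_proj(1)] dcar[OF smooth_proj(1)]] distrib_right
      proj_perp_def[symmetric])
  have "?d \<delta> proj_sub = - ?d \<delta> proj_perp" if \<delta>: "directional \<delta>" for \<delta>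
  proof -
    have "mat_deriv (alt_deriv \<delta> c) (\<lambda>y. mat_const (proj_sub y) + mat_const (proj_perp y)) y = 0\<^sub>m r r"
    proof (rule mat_deriv_const[OF \<delta> y])
      show "mat_const (proj_sub y) + mat_const (proj_perp y) = 1\<^sub>m r" if "y \<in> W" for y
        using carriers(5,7)[OF that] by (intro eq_matI) (auto simp: proj_sub_def proj_perp_def form_const_diff)
    qed simp
    then have "mat_deriv (alt_deriv \<delta> c) (\<lambda>y. mat_const (proj_sub y)) y + mat_deriv (alt_deriv \<delta> c) (\<lambda>y. mat_const (proj_perp y)) y = 0\<^sub>m r r"
      using mat_deriv_add[OF \<delta> smooth_mat_of_fn_mat[OF smooth_proj(2)] smooth_mat_of_fn_mat[OF smooth_proj(1)] y] by simp
    then have "?d \<delta> proj_sub + ?d \<delta> proj_perp = 0"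
      by (simp only: fsmat_of_add[OF dcar[OF smooth_proj(2)] dcar[OF smooth_proj(1)], symmetric] fsmat_of_zero)
    then show ?thesis by (simp add: eq_neg_iff_add_eq_0)
  qed
  from this[OF directional_d10] this[OF directional_d01]
  show "?E (mat_deriv (ext_d c) (\<lambda>y. mat_const (proj_sub y)) y) = - ?E (mat_deriv (ext_d c) (\<lambda>y. mat_const (proj_perp y)) y)"
    by (simp add: mat_deriv_ext_d fsmat_of_add[OF dcar[OF smooth_proj(1)] dcar[OF smooth_proj(1)]] fsmat_of_add[OF dcar[OF smooth_proj(2)] dcar[OF smooth_proj(2)]])
  have conn: "?E (conn y) = ?c (Gi y) * ?d d10 G" and conn_quot: "?E (conn_quot y) = ?c (GHi y) * ?d d10 GH"
    unfolding conn_def conn_quot_def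
    by (rule fsmat_of_mult[OF mc[OF c(2)] dcar[OF smooth(1)]], rule fsmat_of_mult[OF mc[OF c(4)] dcar[OF smooth(3)]])
  have GiG: "?c (Gi y) * ?c (G y) = ?E (1\<^sub>m r)" and GHGHi: "?c (GH y) * ?c (GHi y) = ?E (1\<^sub>m q)"
    by (simp_all only: fsmat_of_mult[OF mc[OF c(2)] mc[OF c(1)], symmetric] mat_const_mult[OF c(2,1), symmetric]
      fsmat_of_mult[OF mc[OF c(3)] mc[OF c(4)], symmetric] mat_const_mult[OF c(3,4), symmetric] inverse[OF y] mat_const_one)
  have "?d d10 (\<lambda>y. G y * s y) = ?d d10 (\<lambda>y. gt y * GH y)"
    by (subst mat_deriv_cong[OF directional_d10 y]) (simp_all add: adjoint_eq)
  then have "?d d10 G * ?c (s y) + ?c (G y) * ?E (ds y) = ?c (gt y) * ?d d10 GH"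
    unfolding leib[OF directional_d10 smooth(1,7)] leib[OF directional_d10 smooth(6,3)] antiholo0 by simp
  then have "?c (Gi y) * (?d d10 G * ?c (s y) + ?c (G y) * ?E (ds y)) = ?c (Gi y) * (?c (gt y) * ?d d10 GH)"
    by simp
  then have 1: "?E (conn y) * ?c (s y) + ?E (ds y) = ?c (Gi y) * (?c (gt y) * ?d d10 GH)"
    by (simp add: conn distrib_left mult.assoc)
      (simp add: mult.assoc[symmetric] GiG fsmat_of_one_left[OF dcar[OF smooth(7)]])
  have "?c (Gi y) * (?c (gt y) * ?c (GH y)) = ?c (Gi y) * (?c (G y) * ?c (s y))"
    by (simp only: fsmat_of_mult[OF mc[OF c(6)] mc[OF c(3)], symmetric] mat_const_mult[OF c(6,3), symmetric]
      fsmat_of_mult[OF mc[OF c(1)] mc[OF c(7)], symmetric] mat_const_mult[OF c(1,7), symmetric] adjoint_eq[OF y])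
  also have "\<dots> = ?c (s y)"
    by (simp add: mult.assoc[symmetric] GiG fsmat_of_one_left[OF mc[OF c(7)]])
  finally have 2: "?c (Gi y) * (?c (gt y) * ?c (GH y)) = ?c (s y)" .
  have "?c (s y) * ?E (conn_quot y) = ?c (Gi y) * (?c (gt y) * (?c (GH y) * (?c (GHi y) * ?d d10 GH)))"
    by (simp only: 2[symmetric] conn_quot mult.assoc)
  also have "?c (GH y) * (?c (GHi y) * ?d d10 GH) = ?d d10 GH"
    by (simp add: mult.assoc[symmetric] GHGHi fsmat_of_one_left[OF dcar[OF smooth(3)]])
  finally show "?E (ds y) + ?E (conn y) * ?c (s y) = ?c (s y) * ?E (conn_quot y)"
    using 1 by (simp add: add.commute)
qed

lemma (in hermitian_quotient) gauss_equations:
  assumes y: "y \<in> W"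
  shows "fsmat_of (sff y) * fsmat_of (mat_const (s y)) = 0"
    and "fsmat_of (sff y) * fsmat_of (sff y) = 0"
    and "fsmat_of (mat_const (g y)) * fsmat_of (sff y) = fsmat_of (mat_const (g y)) * fsmat_of (conn y) -
      fsmat_of (dg y) - fsmat_of (conn_quot y) * fsmat_of (mat_const (g y))"
    and "fsmat_of (mat_const (g y)) * (fsmat_of (sff y) * fsmat_of (sff_adj y)) * fsmat_of (mat_const (s y)) =
      - ((fsmat_of (mat_const (g y)) * fsmat_of (conn y) - fsmat_of (dg y)) * fsmat_of (bs y))"
proof -
  let ?E = "fsmat_of :: (complex ^ 'n) altform Matrix.mat \<Rightarrow> _"
  let ?c = "\<lambda>M. ?E (mat_const M)"
  note c = carriers[OF y] and mc = mat_const_carrier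
  have dcar: "mat_deriv (ext_d c) (\<lambda>y. mat_const (f y)) y \<in> carrier_mat m k" if "smooth_fn_mat c W m k f" for f m k
    unfolding mat_deriv_ext_d using mat_deriv_const_carrier[OF that y] by (auto intro: add_carrier_mat)
  have E_cov: "?E (cov_deriv c conn (\<lambda>y. mat_const (f y)) y) = ?E (mat_deriv (ext_d c) (\<lambda>y. mat_const (f y)) y) + ?E (conn y) * ?c (f y)"
    if "smooth_fn_mat c W r r f" for f
    unfolding cov_deriv_def
    by (simp only: fsmat_of_add[OF dcar[OF that] mult_carrier_mat[OF c(10) mc[OF smooth_fn_mat_carrier[OF that y]]]]
      fsmat_of_mult[OF c(10) mc[OF smooth_fn_mat_carrier[OF that y]]])
  have cov_car: "cov_deriv c conn (\<lambda>y. mat_const (f y)) y \<in> carrier_mat r r" if "smooth_fn_mat c W r r f" for f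
    unfolding cov_deriv_def using dcar[OF that] c(10) smooth_fn_mat_carrier[OF that y]
    by (intro add_carrier_mat mult_carrier_mat[of _ r r]) auto
  have sff: "?E (sff y) = ?c (proj_perp y) * (?E (mat_deriv (ext_d c) (\<lambda>y. mat_const (proj_sub y)) y) + ?E (conn y) * ?c (proj_sub y))"
    unfolding sff_def by (simp only: fsmat_of_mult[OF mc[OF c(8)] cov_car[OF smooth_proj(2)]] E_cov[OF smooth_proj(2)])
  have sff_adj: "?E (sff_adj y) = - (?c (proj_sub y) * (?E (mat_deriv (ext_d c) (\<lambda>y. mat_const (proj_perp y)) y) + ?E (conn y) * ?c (proj_perp y)))"
    unfolding sff_adj_def by (simp only: fsmat_of_uminus fsmat_of_mult[OF mc[OF c(9)] cov_car[OF smooth_proj(1)]] E_cov[OF smooth_proj(1)])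
  note gauss = gauss_codazzi_algebra[where er = "?E (1\<^sub>m r)" and eq = "?E (1\<^sub>m q)",
    OF fsmat_of_one_left[OF c(10)] fsmat_of_one_right[OF c(10)] fsmat_of_one_left[OF c(13)]
      fsmat_of_one_right[OF mc[OF c(5)]] fsmat_of_one_left[OF c(14)] fsmat_of_one_left[OF c(11)]
      fsmat_of_one_right[OF c(12)] fsmat_of_one_right[OF c(13)] fsmat_of_one_right[OF mc[OF c(7)]]
      fsmat_of_one_left[OF mc[OF c(7)]] fsmat_of_one_left[OF mc[OF c(5)]]
      fsmat_units(1)[OF y] first_order(1-3)[OF y] fsmat_units(2,3)[OF y] first_order(4,5)[OF y] sff sff_adj]
  show "?E (sff y) * ?c (s y) = 0" by (rule gauss(1))
  show "?E (sff y) * ?E (sff y) = 0" by (rule gauss(2))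
  show "?c (g y) * ?E (sff y) = ?c (g y) * ?E (conn y) - ?E (dg y) - ?E (conn_quot y) * ?c (g y)" by (rule gauss(3))
  show "?c (g y) * (?E (sff y) * ?E (sff_adj y)) * ?c (s y) = - ((?c (g y) * ?E (conn y) - ?E (dg y)) * ?E (bs y))"
    by (rule gauss(5))
qed

lemma mat_deriv_smooth_carrier:
  assumes "smooth_mat c W m n M" "y \<in> W"
  shows "mat_deriv D M y \<in> carrier_mat m n"
  using smooth_mat_carrier[OF assms] by (auto simp: mat_deriv_def)

lemma (in chart_region) smooth_mat_smult:
  assumes M: "smooth_mat c W m n M"
  shows "smooth_mat c W m n (\<lambda>y. form_const a \<cdot>\<^sub>m M y)"
  unfolding smooth_mat_def
proof (intro conjI ballI allI impI)
  show "form_const a \<cdot>\<^sub>m M y \<in> carrier_mat m n" if "y \<in> W" for y using smooth_mat_carrier[OF M that] by simp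
  fix i j assume ij: "i < m" "j < n"
  show "smooth_form_on c W (\<lambda>y. (form_const a \<cdot>\<^sub>m M y) $$ (i, j))"
    using smooth_form_on_const_mult[OF smooth_fn_on_const smooth_mat_entry[OF M ij], of a]
    by (rule smooth_form_on_cong[THEN iffD1, rotated]) (use ij smooth_mat_dims[OF M] in auto)
qed

lemma (in chart_region) mat_deriv_smult:
  assumes \<delta>: "directional \<delta>" and M: "smooth_mat c W m n M" and y: "y \<in> W"
  shows "mat_deriv (alt_deriv \<delta> c) (\<lambda>y. form_const a \<cdot>\<^sub>m M y) y = form_const a \<cdot>\<^sub>m mat_deriv (alt_deriv \<delta> c) M y"
proof (rule eq_matI)
  fix i j assume "i < dim_row (form_const a \<cdot>\<^sub>m mat_deriv (alt_deriv \<delta> c) M y)"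
    "j < dim_col (form_const a \<cdot>\<^sub>m mat_deriv (alt_deriv \<delta> c) M y)"
  then have ij: "i < m" "j < n" using smooth_mat_carrier[OF M y] by (auto simp: mat_deriv_def)
  have "alt_deriv \<delta> c (\<lambda>y. (form_const a \<cdot>\<^sub>m M y) $$ (i, j)) y = alt_deriv \<delta> c (\<lambda>y. form_const a * M y $$ (i, j)) y"
    by (rule alt_deriv_cong[OF \<delta> y]) (use ij smooth_mat_dims[OF M] in auto)
  also have "\<dots> = form_const a * alt_deriv \<delta> c (\<lambda>y. M y $$ (i, j)) y"
    using alt_deriv_const_mult[OF \<delta> smooth_fn_on_const smooth_mat_entry[OF M ij] y, of a]
    by (simp add: alt_deriv_const[OF \<delta> y])
  finally show "mat_deriv (alt_deriv \<delta> c) (\<lambda>y. form_const a \<cdot>\<^sub>m M y) y $$ (i, j) =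
      (form_const a \<cdot>\<^sub>m mat_deriv (alt_deriv \<delta> c) M y) $$ (i, j)"
    using ij smooth_mat_carrier[OF M y] by (auto simp: mat_deriv_def)
qed (auto simp: mat_deriv_def)

text \<open>The derivatives of the first-order identities. The first equation, \<open>\<partial>\<theta> + \<theta> \<theta> = 0\<close>, says that the curvature has
  no \<open>(2,0)\<close>-part; it results from applying \<open>\<partial>\<close> to \<open>G \<theta> = \<partial>G\<close>.\<close>

lemma (in hermitian_quotient) second_order:
  assumes y: "y \<in> W"
  defines "b \<equiv> mat_deriv (alt_deriv d01 c)" and "d \<equiv> mat_deriv (alt_deriv d10 c)"
  shows "fsmat_of (d conn y) + fsmat_of (conn y) * fsmat_of (conn y) = 0"
    and "fsmat_of (b ds y) + (fsmat_of (b conn y) * fsmat_of (mat_const (s y)) - fsmat_of (conn y) * fsmat_of (bs y)) =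
      fsmat_of (bs y) * fsmat_of (conn_quot y) + fsmat_of (mat_const (s y)) * fsmat_of (b conn_quot y)"
    and "fsmat_of (dg y) * fsmat_of (bs y) + fsmat_of (mat_const (g y)) * fsmat_of (d bs y) = 0"
    and "fsmat_of (b ds y) = - fsmat_of (d bs y)"
    and "(fsmat_of (d sff y) + fsmat_of (b sff y)) * fsmat_of (mat_const (s y)) -
      fsmat_of (sff y) * (fsmat_of (ds y) + fsmat_of (bs y)) = 0"
proof -
  let ?E = "fsmat_of :: (complex ^ 'n) altform Matrix.mat \<Rightarrow> _"
  let ?c = "\<lambda>M. ?E (mat_const M)"
  note c = carriers[OF y] and mc = mat_const_carrier and dir = directional_d10 directional_d01
  note cm = smooth_mat_of_fn_mat and dcar = mat_deriv_const_carrier[OF _ y]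
  have mcar: "mat_deriv (alt_deriv \<delta> c) M y \<in> carrier_mat m k" if "smooth_mat c W m k M" for \<delta> M m k
    by (rule mat_deriv_smooth_carrier[OF that y])
  have left: "?E (mat_deriv (alt_deriv \<delta> c) (\<lambda>y. mat_const (f y) * M y) y) =
      ?E (mat_deriv (alt_deriv \<delta> c) (\<lambda>y. mat_const (f y)) y) * ?E (M y) + ?c (f y) * ?E (mat_deriv (alt_deriv \<delta> c) M y)"
    if \<delta>: "directional \<delta>" and f: "smooth_fn_mat c W m k f" and M: "smooth_mat c W k l M" for \<delta> f M m k l
    by (simp only: mat_deriv_const_mult[OF \<delta> f M y]
      fsmat_of_add[OF mult_carrier_mat[OF dcar[OF f] smooth_mat_carrier[OF M y]] mult_carrier_mat[OF smooth_fn_mat_carrier[OF f y, THEN mc] mcar[OF M]]]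
      fsmat_of_mult[OF dcar[OF f] smooth_mat_carrier[OF M y]] fsmat_of_mult[OF smooth_fn_mat_carrier[OF f y, THEN mc] mcar[OF M]])
  have right: "?E (mat_deriv (alt_deriv \<delta> c) (\<lambda>y. M y * mat_const (f y)) y) =
      ?E (mat_deriv (alt_deriv \<delta> c) M y) * ?c (f y) - ?E (M y) * ?E (mat_deriv (alt_deriv \<delta> c) (\<lambda>y. mat_const (f y)) y)"
    if \<delta>: "directional \<delta>" and M: "smooth_mat c W m k M" and f: "smooth_fn_mat c W k l f"
      and hom: "\<And>i j. i < m \<Longrightarrow> j < k \<Longrightarrow> homogeneous 1 (M y $$ (i, j))" for \<delta> f M m k l
    by (simp only: mat_deriv_mult_const[OF \<delta> M f y hom]
      fsmat_of_diff[OF mult_carrier_mat[OF mcar[OF M] smooth_fn_mat_carrier[OF f y, THEN mc]] mult_carrier_mat[OF smooth_mat_carrier[OF M y] dcar[OF f]]]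
      fsmat_of_mult[OF mcar[OF M] smooth_fn_mat_carrier[OF f y, THEN mc]] fsmat_of_mult[OF smooth_mat_carrier[OF M y] dcar[OF f]])
  have E0: "?E (mat_deriv (alt_deriv \<delta> c) M y) = 0" if "directional \<delta>" "\<And>y. y \<in> W \<Longrightarrow> M y = 0\<^sub>m m k" for \<delta> M m k
    by (simp add: mat_deriv_const[OF that(1) y that(2) zero_carrier_mat] fsmat_of_zero)
  show "?E (d conn y) + ?E (conn y) * ?E (conn y) = 0"
  proof -
    have Gconn: "mat_const (G y) * conn y = d (\<lambda>y. mat_const (G y)) y" if y: "y \<in> W" for y
    proof -
      note c = carriers[OF y]
      have dc: "mat_deriv (alt_deriv d10 c) (\<lambda>y. mat_const (G y)) y \<in> carrier_mat r r"
        by (rule mat_deriv_const_carrier[OF smooth(1) y])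
      have "mat_const (G y) * conn y = (mat_const (G y) * mat_const (Gi y)) * mat_deriv (alt_deriv d10 c) (\<lambda>y. mat_const (G y)) y"
        unfolding conn_def by (rule assoc_mult_mat[symmetric, OF mc[OF c(1)] mc[OF c(2)] dc])
      then show ?thesis
        using dc by (simp add: mat_const_mult[OF c(1,2), symmetric] inverse[OF y] mat_const_one d_def)
    qed
    have "d (d (\<lambda>y. mat_const (G y))) y = 0\<^sub>m r r"
      unfolding d_def using smooth_mat_deriv[OF dir(1) cm[OF smooth(1)]]
      by (intro altform_mat_minus_eq_self[OF mat_deriv_mat_deriv[OF dir(1) dir(1) smooth(1) y]] mcar)
    then have "?E (d (\<lambda>y. mat_const (G y) * conn y) y) = 0"
      unfolding d_def by (subst mat_deriv_cong[OF dir(1) y Gconn]) (simp_all add: d_def fsmat_of_zero)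
    then have "?E (d (\<lambda>y. mat_const (G y)) y) * ?E (conn y) + ?c (G y) * ?E (d conn y) = 0"
      unfolding d_def by (simp only: left[OF dir(1) smooth(1) smooth_mats(1)])
    then have "?c (Gi y) * (?E (d (\<lambda>y. mat_const (G y)) y) * ?E (conn y) + ?c (G y) * ?E (d conn y)) = 0" by simp
    moreover have "?c (Gi y) * ?E (d (\<lambda>y. mat_const (G y)) y) = ?E (conn y)"
      unfolding conn_def d_def by (rule fsmat_of_mult[symmetric, OF mc[OF c(2)] dcar[OF smooth(1)]])
    moreover have "?c (Gi y) * ?c (G y) = ?E (1\<^sub>m r)"
      by (simp only: fsmat_of_mult[OF mc[OF c(2)] mc[OF c(1)], symmetric] mat_const_mult[OF c(2,1), symmetric] inverse[OF y] mat_const_one)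
    ultimately show ?thesis
      unfolding d_def using fsmat_of_one_left[OF mcar[OF smooth_mats(1), of d10]]
      by (simp add: distrib_left mult.assoc[symmetric] add.commute)
  qed
  show "?E (b ds y) + (?E (b conn y) * ?c (s y) - ?E (conn y) * ?E (bs y)) = ?E (bs y) * ?E (conn_quot y) + ?c (s y) * ?E (b conn_quot y)"
  proof -
    have eq: "ds y + conn y * mat_const (s y) = mat_const (s y) * conn_quot y" if y: "y \<in> W" for y
    proof (rule fsmat_of_inject)
      note c = carriers[OF y]
      show "ds y + conn y * mat_const (s y) \<in> carrier_mat r q" "mat_const (s y) * conn_quot y \<in> carrier_mat r q"
        by (intro add_carrier_mat mult_carrier_mat[OF c(10) mc[OF c(7)]], rule mult_carrier_mat[OF mc[OF c(7)] c(11)])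
      show "?E (ds y + conn y * mat_const (s y)) = ?E (mat_const (s y) * conn_quot y)"
        by (simp only: fsmat_of_add[OF c(12) mult_carrier_mat[OF c(10) mc[OF c(7)]]] fsmat_of_mult[OF c(10) mc[OF c(7)]]
          fsmat_of_mult[OF mc[OF c(7)] c(11)] first_order(1)[OF y])
    qed
    have "?E (b (\<lambda>y. ds y + conn y * mat_const (s y)) y) = ?E (b (\<lambda>y. mat_const (s y) * conn_quot y) y)"
      unfolding b_def by (subst mat_deriv_cong[OF dir(2) y eq]) simp_all
    moreover have "b (\<lambda>y. ds y + conn y * mat_const (s y)) y = b ds y + b (\<lambda>y. conn y * mat_const (s y)) y"
      unfolding b_def by (rule mat_deriv_add[OF dir(2) smooth_mats(3) smooth_mat_mult_const[OF smooth_mats(1) smooth(7)] y])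
    ultimately show ?thesis
      unfolding b_def
      by (simp only: left[OF dir(2) smooth(7) smooth_mats(2)] right[OF dir(2) smooth_mats(1) smooth(7) homogeneous_conn[OF y]]
        fsmat_of_add[OF mcar[OF smooth_mats(3)] mcar[OF smooth_mat_mult_const[OF smooth_mats(1) smooth(7)]]])
  qed
  show "?E (dg y) * ?E (bs y) + ?c (g y) * ?E (d bs y) = 0"
  proof -
    have "mat_const (g y) * bs y = 0\<^sub>m q q" if y: "y \<in> W" for y
    proof (rule fsmat_of_inject)
      note c = carriers[OF y]
      show "mat_const (g y) * bs y \<in> carrier_mat q q" by (rule mult_carrier_mat[OF mc[OF c(5)] c(13)])
      show "?E (mat_const (g y) * bs y) = ?E (0\<^sub>m q q)"
        by (simp only: fsmat_of_mult[OF mc[OF c(5)] c(13)] first_order(2)[OF y] fsmat_of_zero)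
    qed simp
    then have "?E (mat_deriv (alt_deriv d10 c) (\<lambda>y. mat_const (g y) * bs y) y) = 0" by (rule E0[OF dir(1)])
    then show ?thesis
      unfolding d_def by (simp only: left[OF dir(1) smooth(5) smooth_mats(4)])
  qed
  show "?E (b ds y) = - ?E (d bs y)"
    unfolding b_def d_def by (simp only: mat_deriv_mat_deriv[OF dir(2,1) smooth(7) y] fsmat_of_uminus)
  show "(?E (d sff y) + ?E (b sff y)) * ?c (s y) - ?E (sff y) * (?E (ds y) + ?E (bs y)) = 0"
  proof -
    have zero: "sff y * mat_const (s y) = 0\<^sub>m r q" if y: "y \<in> W" for y
    proof (rule fsmat_of_inject)
      note c = carriers[OF y]
      show "sff y * mat_const (s y) \<in> carrier_mat r q" by (rule mult_carrier_mat[OF c(15) mc[OF c(7)]])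
      show "?E (sff y * mat_const (s y)) = ?E (0\<^sub>m r q)"
        by (simp only: fsmat_of_mult[OF c(15) mc[OF c(7)]] gauss_equations(1)[OF y] fsmat_of_zero)
    qed simp
    have E_zero: "?E (mat_deriv (alt_deriv \<delta> c) (\<lambda>y. sff y * mat_const (s y)) y) = 0" if "directional \<delta>" for \<delta>
      by (rule E0[OF that zero])
    have "?E (d sff y) * ?c (s y) - ?E (sff y) * ?E (ds y) = 0" "?E (b sff y) * ?c (s y) - ?E (sff y) * ?E (bs y) = 0"
      unfolding d_def b_def
      using E_zero[OF dir(1)] E_zero[OF dir(2)]
      by (simp_all only: right[OF _ smooth_mats(6) smooth(7) homogeneous_sff(1)[OF y]] dir)
    then show ?thesis by (simp add: distrib_left distrib_right)
  qed
qed

text \<open>With respect to the \<open>C\<^sup>\<infinity>\<close> splitting the connection has off-diagonal blocks \<open>u A\<close> and \<open>- A\<^sup>*\<close>, so the block of its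
  curvature on the quotient is \<open>\<Theta>\<^sub>H - u A \<and> A\<^sup>*\<close>.\<close>

theorem (in hermitian_quotient) curvature_of_deformed_connection:
  assumes y: "y \<in> W"
  shows "mat_const (g y) * conn_curv c (\<lambda>y. conn y + form_const (of_real (u - 1)) \<cdot>\<^sub>m sff y) y * mat_const (s y) =
    mat_deriv (alt_deriv d01 c) conn_quot y - form_const (of_real u) \<cdot>\<^sub>m
      (mat_const (g y) * (sff y * sff_adj y) * mat_const (s y))"
proof -
  let ?E = "fsmat_of :: (complex ^ 'n) altform Matrix.mat \<Rightarrow> _"
  let ?c = "\<lambda>M. ?E (mat_const M)" and ?v = "form_const (of_real (u - 1)) :: (complex ^ 'n) altform"
  let ?b = "mat_deriv (alt_deriv d01 c)" and ?d = "mat_deriv (alt_deriv d10 c)"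
  let ?\<theta> = "\<lambda>y. conn y + ?v \<cdot>\<^sub>m sff y"
  note c = carriers[OF y] and mc = mat_const_carrier and dir = directional_d10 directional_d01
  have mcar: "mat_deriv (alt_deriv \<delta> c) M y \<in> carrier_mat m k" if "smooth_mat c W m k M" for \<delta> M m k
    by (rule mat_deriv_smooth_carrier[OF that y])
  have sv: "smooth_mat c W r r (\<lambda>y. ?v \<cdot>\<^sub>m sff y)" by (rule smooth_mat_smult[OF smooth_mats(6)])
  have s\<theta>: "smooth_mat c W r r ?\<theta>" by (rule smooth_mat_add[OF smooth_mats(1) sv])
  have \<theta>car: "?\<theta> y \<in> carrier_mat r r" by (rule smooth_mat_carrier[OF s\<theta> y])
  have E\<theta>: "?E (?\<theta> y) = ?E (conn y) + (u - 1) *\<^sub>R ?E (sff y)"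
    by (simp only: fsmat_of_add[OF c(10) smooth_mat_carrier[OF sv y]] fsmat_of_smult)
  have Ed: "?E (mat_deriv (alt_deriv \<delta> c) ?\<theta> y) = ?E (mat_deriv (alt_deriv \<delta> c) conn y) + (u - 1) *\<^sub>R ?E (mat_deriv (alt_deriv \<delta> c) sff y)"
    if \<delta>: "directional \<delta>" for \<delta>
    by (simp only: mat_deriv_add[OF \<delta> smooth_mats(1) sv y] mat_deriv_smult[OF \<delta> smooth_mats(6) y]
      fsmat_of_add[OF mcar[OF smooth_mats(1)] smult_carrier_mat[OF mcar[OF smooth_mats(6)]]] fsmat_of_smult)
  have curv_car: "conn_curv c ?\<theta> y \<in> carrier_mat r r"
    unfolding conn_curv_def by (rule add_carrier_mat, rule mult_carrier_mat[OF \<theta>car \<theta>car])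
  have Ecurv: "?E (conn_curv c ?\<theta> y) = ?E (?d conn y) + ?E (?b conn y) + (u - 1) *\<^sub>R (?E (?d sff y) + ?E (?b sff y)) +
      (?E (conn y) + (u - 1) *\<^sub>R ?E (sff y)) * (?E (conn y) + (u - 1) *\<^sub>R ?E (sff y))"
    unfolding conn_curv_def mat_deriv_ext_d
    by (simp only: fsmat_of_add[OF add_carrier_mat[OF mcar[OF s\<theta>]] mult_carrier_mat[OF \<theta>car \<theta>car]]
      fsmat_of_add[OF mcar[OF s\<theta>] mcar[OF s\<theta>]] fsmat_of_mult[OF \<theta>car \<theta>car] E\<theta> Ed[OF dir(1)] Ed[OF dir(2)]
      scaleR_add_right add.assoc add.left_commute)
  let ?Q = "mat_const (g y) * (sff y * sff_adj y) * mat_const (s y)"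
  have AA: "sff y * sff_adj y \<in> carrier_mat r r" by (rule mult_carrier_mat[OF c(15,16)])
  have Qcar: "?Q \<in> carrier_mat q q"
    by (rule mult_carrier_mat[OF mult_carrier_mat[OF mc[OF c(5)] AA] mc[OF c(7)]])
  have EQ: "?E ?Q = - ((?c (g y) * ?E (conn y) - ?E (dg y)) * ?E (bs y))"
    by (simp only: fsmat_of_mult[OF mult_carrier_mat[OF mc[OF c(5)] AA] mc[OF c(7)]]
      fsmat_of_mult[OF mc[OF c(5)] AA] fsmat_of_mult[OF c(15,16)] gauss_equations(4)[OF y])
  show ?thesis
  proof (rule fsmat_of_inject)
    show "mat_const (g y) * conn_curv c ?\<theta> y * mat_const (s y) \<in> carrier_mat q q"
      by (rule mult_carrier_mat[OF mult_carrier_mat[OF mc[OF c(5)] curv_car] mc[OF c(7)]])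
    show "?b conn_quot y - form_const (of_real u) \<cdot>\<^sub>m ?Q \<in> carrier_mat q q"
      by (rule minus_carrier_mat[OF smult_carrier_mat[OF Qcar]])
    have "?E (mat_const (g y) * conn_curv c ?\<theta> y * mat_const (s y)) = ?E (?b conn_quot y) - ((u - 1) + 1) *\<^sub>R ?E ?Q"
      unfolding fsmat_of_mult[OF mult_carrier_mat[OF mc[OF c(5)] curv_car] mc[OF c(7)]] fsmat_of_mult[OF mc[OF c(5)] curv_car] Ecurv
      by (rule curvature_algebra[OF fsmat_of_one_left[OF mcar[OF smooth_mats(2)]] fsmat_units(1)[OF y] first_order(1,2)[OF y]
        second_order(1-5)[OF y] gauss_equations(1-3)[OF y] EQ])
    then show "?E (mat_const (g y) * conn_curv c ?\<theta> y * mat_const (s y)) = ?E (?b conn_quot y - form_const (of_real u) \<cdot>\<^sub>m ?Q)"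
      by (simp only: fsmat_of_diff[OF mcar[OF smooth_mats(2)] smult_carrier_mat[OF Qcar]] fsmat_of_smult diff_add_cancel)
  qed
qed

section \<open>Hermitian linear algebra\<close>

lemma mat_eq_if_mult_vec_eq:
  fixes A B :: "'a::comm_semiring_1 Matrix.mat"
  assumes A: "A \<in> carrier_mat m n" and B: "B \<in> carrier_mat m n"
    and eq: "\<And>v. v \<in> carrier_vec n \<Longrightarrow> A *\<^sub>v v = B *\<^sub>v v"
  shows "A = B"
proof (rule eq_matI)
  fix i j assume ij: "i < dim_row B" "j < dim_col B"
  have "(A *\<^sub>v unit_vec n j) $ i = (B *\<^sub>v unit_vec n j) $ i" by (simp add: eq)
  then show "A $$ (i, j) = B $$ (i, j)" using A B ij by simp
qed (use A B in auto)

definition conj_transpose :: "complex Matrix.mat \<Rightarrow> complex Matrix.mat" where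
  "conj_transpose A = Matrix.mat (dim_col A) (dim_row A) (\<lambda>(i, j). cnj (A $$ (j, i)))"

lemma conj_transpose_carrier: "A \<in> carrier_mat m n \<Longrightarrow> conj_transpose A \<in> carrier_mat n m"
  by (auto simp: conj_transpose_def)

lemma cscalar_prod_conj_transpose:
  assumes A: "A \<in> carrier_mat m n" and v: "v \<in> carrier_vec n" and w: "w \<in> carrier_vec m"
  shows "(conj_transpose A *\<^sub>v w) \<bullet>c v = w \<bullet>c (A *\<^sub>v v)"
proof -
  have "(conj_transpose A *\<^sub>v w) \<bullet>c v = (\<Sum>i<n. \<Sum>j<m. cnj (A $$ (j, i)) * w $ j * cnj (v $ i))"
    using A v w by (simp add: conj_transpose_def scalar_prod_def atLeast0LessThan sum_distrib_right)
  also have "\<dots> = (\<Sum>j<m. \<Sum>i<n. cnj (A $$ (j, i)) * w $ j * cnj (v $ i))" by (rule sum.swap)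
  also have "\<dots> = w \<bullet>c (A *\<^sub>v v)"
    using A v w by (simp add: scalar_prod_def atLeast0LessThan sum_distrib_left mult_ac)
  finally show ?thesis .
qed

lemma cscalar_prod_unit_vec:
  "i < n \<Longrightarrow> v \<in> carrier_vec n \<Longrightarrow> v \<bullet>c unit_vec n i = v $ i" for v :: "complex Matrix.vec"
proof -
  have "conjugate (unit_vec n i) = (unit_vec n i :: complex Matrix.vec)"
    by (rule eq_vecI) (auto simp: unit_vec_def)
  then show "i < n \<Longrightarrow> v \<in> carrier_vec n \<Longrightarrow> v \<bullet>c unit_vec n i = v $ i" by simp
qed

lemma vec_eq_if_diff_zero:
  fixes v w :: "'a::ab_group_add Matrix.vec"
  assumes v: "v \<in> carrier_vec n" and w: "w \<in> carrier_vec n" and eq: "v - w = 0\<^sub>v n"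
  shows "v = w"
proof (rule eq_vecI)
  fix i assume i: "i < dim_vec w"
  have "(v - w) $ i = 0\<^sub>v n $ i" by (simp add: eq)
  then show "v $ i = w $ i" using i v w by simp
qed (use v w in auto)

lemma pos_def_imp_det_nonzero:
  fixes A :: "complex Matrix.mat"
  assumes A: "A \<in> carrier_mat n n"
    and pos: "\<And>v. v \<in> carrier_vec n \<Longrightarrow> v \<noteq> 0\<^sub>v n \<Longrightarrow> (A *\<^sub>v v) \<bullet>c v \<noteq> 0"
  shows "Determinant.det A \<noteq> 0"
proof
  assume "Determinant.det A = 0"
  then obtain v where v: "v \<in> carrier_vec n" "v \<noteq> 0\<^sub>v n" "A *\<^sub>v v = 0\<^sub>v n"
    using det_0_iff_vec_prod_zero_field[OF A] by blast
  then have "(A *\<^sub>v v) \<bullet>c v = 0" by simp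
  then show False using pos[OF v(1,2)] by blast
qed

lemma mat_inverse_det_nonzero:
  fixes A :: "complex Matrix.mat"
  assumes A: "A \<in> carrier_mat n n" and det: "Determinant.det A \<noteq> 0"
  shows "the (mat_inverse A) \<in> carrier_mat n n" "the (mat_inverse A) * A = 1\<^sub>m n" "A * the (mat_inverse A) = 1\<^sub>m n"
proof -
  have "mat_inverse A \<noteq> None"
    using det_non_zero_imp_unit[OF A det, where b = "()"] mat_inverse(1)[OF A, where b = "()"] by blast
  then obtain B where "mat_inverse A = Some B" by blast
  then show "the (mat_inverse A) \<in> carrier_mat n n" "the (mat_inverse A) * A = 1\<^sub>m n" "A * the (mat_inverse A) = 1\<^sub>m n"
    using mat_inverse(2)[OF A] by auto
qed

text \<open>If \<open>g\<close> is onto and the Hermitian form \<open>GH\<close> is the one that \<open>G\<close> induces on the quotient by the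
  kernel of \<open>g\<close>, then \<open>GH\<close> is inverse to \<open>g G\<^sup>-\<^sup>1 g\<^sup>*\<close>: the vectors \<open>G\<^sup>-\<^sup>1 g\<^sup>* w\<close> form the orthogonal complement
  of the kernel.\<close>

lemma quotient_metric_section:
  fixes G Gi GH g :: "complex Matrix.mat"
  assumes G: "G \<in> carrier_mat r r" and Gi: "Gi \<in> carrier_mat r r" and GGi: "G * Gi = 1\<^sub>m r"
    and GH: "GH \<in> carrier_mat q q" and g: "g \<in> carrier_mat q r"
    and pos: "\<And>v. v \<in> carrier_vec r \<Longrightarrow> v \<noteq> 0\<^sub>v r \<Longrightarrow> (G *\<^sub>v v) \<bullet>c v \<noteq> 0"
    and onto: "\<And>w. w \<in> carrier_vec q \<Longrightarrow> \<exists>v\<in>carrier_vec r. g *\<^sub>v v = w"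
    and iso: "\<And>v v'. v \<in> carrier_vec r \<Longrightarrow> v' \<in> carrier_vec r \<Longrightarrow>
      (\<And>k. k \<in> carrier_vec r \<Longrightarrow> g *\<^sub>v k = 0\<^sub>v q \<Longrightarrow> (G *\<^sub>v v) \<bullet>c k = 0) \<Longrightarrow>
      (\<And>k. k \<in> carrier_vec r \<Longrightarrow> g *\<^sub>v k = 0\<^sub>v q \<Longrightarrow> (G *\<^sub>v v') \<bullet>c k = 0) \<Longrightarrow>
      (GH *\<^sub>v (g *\<^sub>v v)) \<bullet>c (g *\<^sub>v v') = (G *\<^sub>v v) \<bullet>c v'"
  shows "g * (Gi * conj_transpose g * GH) = 1\<^sub>m q"
proof -
  let ?gt = "conj_transpose g"
  define K where "K = Gi * ?gt"
  define R where "R = g * K"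
  have gt: "?gt \<in> carrier_mat r q" by (rule conj_transpose_carrier[OF g])
  have K: "K \<in> carrier_mat r q" using Gi gt by (simp add: K_def)
  have R: "R \<in> carrier_mat q q" using g K by (simp add: R_def)
  have GK: "G *\<^sub>v (K *\<^sub>v w) = ?gt *\<^sub>v w" if w: "w \<in> carrier_vec q" for w
  proof -
    have "G *\<^sub>v (K *\<^sub>v w) = (G * K) *\<^sub>v w" by (rule assoc_mult_mat_vec[OF G K w, symmetric])
    also have "G * K = (G * Gi) * ?gt" unfolding K_def by (rule assoc_mult_mat[OF G Gi gt, symmetric])
    finally show ?thesis using gt by (simp add: GGi)
  qed
  have Kw: "K *\<^sub>v w \<in> carrier_vec r" if "w \<in> carrier_vec q" for w using K that by simp
  have Rw: "R *\<^sub>v w = g *\<^sub>v (K *\<^sub>v w)" if "w \<in> carrier_vec q" for w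
    unfolding R_def by (rule assoc_mult_mat_vec[OF g K that])
  have GKc: "(G *\<^sub>v (K *\<^sub>v w)) \<bullet>c k = w \<bullet>c (g *\<^sub>v k)" if "w \<in> carrier_vec q" "k \<in> carrier_vec r" for w k
    unfolding GK[OF that(1)] by (rule cscalar_prod_conj_transpose[OF g that(2,1)])
  have form: "(GH *\<^sub>v (R *\<^sub>v w)) \<bullet>c (R *\<^sub>v w') = w \<bullet>c (R *\<^sub>v w')" if w: "w \<in> carrier_vec q" "w' \<in> carrier_vec q" for w w'
    unfolding Rw[OF w(1)] Rw[OF w(2)]
    by (subst iso[OF Kw[OF w(1)] Kw[OF w(2)]]) (simp_all add: GKc w Kw)
  have "Determinant.det R \<noteq> 0"
  proof
    assume "Determinant.det R = 0"
    then obtain w where w: "w \<in> carrier_vec q" "w \<noteq> 0\<^sub>v q" "R *\<^sub>v w = 0\<^sub>v q"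
      using det_0_iff_vec_prod_zero_field[OF R] by blast
    have "(G *\<^sub>v (K *\<^sub>v w)) \<bullet>c (K *\<^sub>v w) = w \<bullet>c (R *\<^sub>v w)" by (simp add: GKc[OF w(1) Kw[OF w(1)]] Rw[OF w(1)])
    also have "\<dots> = 0" using w by simp
    finally have K0: "K *\<^sub>v w = 0\<^sub>v r" using pos[OF Kw[OF w(1)]] by blast
    obtain v where v: "v \<in> carrier_vec r" "g *\<^sub>v v = w" using onto[OF w(1)] by blast
    have "G *\<^sub>v 0\<^sub>v r = 0\<^sub>v r" using G by auto
    then have "w \<bullet>c w = 0" using GKc[OF w(1) v(1)] v K0 by simp
    then show False using w by simp
  qed
  then obtain S where S: "S \<in> carrier_mat q q" "R * S = 1\<^sub>m q"
    using mat_inverse_det_nonzero[OF R] by blast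
  have "GH * R = 1\<^sub>m q"
  proof (rule mat_eq_if_mult_vec_eq)
    fix w :: "complex Matrix.vec" assume w: "w \<in> carrier_vec q"
    define d where "d = (GH * R) *\<^sub>v w - w"
    have GHR: "(GH * R) *\<^sub>v w = GH *\<^sub>v (R *\<^sub>v w)" by (rule assoc_mult_mat_vec[OF GH R w])
    have GHRw: "GH *\<^sub>v (R *\<^sub>v w) \<in> carrier_vec q" using GH R w by simp
    have d: "d \<in> carrier_vec q" using GHRw w by (simp add: d_def GHR)
    have Sd: "S *\<^sub>v d \<in> carrier_vec q" using S d by simp
    have "R *\<^sub>v (S *\<^sub>v d) = (R * S) *\<^sub>v d" by (rule assoc_mult_mat_vec[OF R S(1) d, symmetric])
    then have "R *\<^sub>v (S *\<^sub>v d) = d" using d by (simp add: S)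
    then have "(GH *\<^sub>v (R *\<^sub>v w)) \<bullet>c d = w \<bullet>c d" using form[OF w Sd] by simp
    then have "d \<bullet>c d = 0"
      using minus_scalar_prod_distrib[OF GHRw w, of "conjugate d"] d by (simp add: d_def GHR)
    then have "d = 0\<^sub>v q" using d by simp
    then have "GH *\<^sub>v (R *\<^sub>v w) = w"
      unfolding d_def GHR by (rule vec_eq_if_diff_zero[OF GHRw w])
    then show "(GH * R) *\<^sub>v w = 1\<^sub>m q *\<^sub>v w" using w by (simp only: GHR one_mult_mat_vec)
  qed (use GH R in auto)
  then have "R * GH = 1\<^sub>m q" by (rule mat_mult_left_right_inverse[OF GH R])
  moreover have "g * (Gi * ?gt * GH) = R * GH"
    unfolding R_def K_def using assoc_mult_mat[OF g K GH] by (simp add: K_def)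
  ultimately show ?thesis by simp
qed

section \<open>Bundles in local trivializations\<close>

lemma triv_at_in:
  assumes "holo_bundle \<A> B"
  shows "triv_at B x \<in> vb_trivs B" "x \<in> fst (triv_at B x)"
proof -
  have "\<exists>T. T \<in> vb_trivs B \<and> x \<in> fst T" using assms unfolding holo_bundle_def by blast
  then have "triv_at B x \<in> vb_trivs B \<and> x \<in> fst (triv_at B x)"
    unfolding triv_at_def by (rule someI_ex)
  then show "triv_at B x \<in> vb_trivs B" "x \<in> fst (triv_at B x)" by simp_all
qed

lemma trivD:
  assumes "holo_bundle \<A> B" "T \<in> vb_trivs B"
  shows "open (fst T)" and "y \<in> fst T \<Longrightarrow> bij_betw (snd T) (fiber B y) (carrier_vec (vb_rank B))"
  using assms unfolding holo_bundle_def by (cases T; fastforce)+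

lemma triv_coord:
  assumes "holo_bundle \<A> B" "T \<in> vb_trivs B" "y \<in> fst T"
  shows "e \<in> fiber B y \<Longrightarrow> snd T e \<in> carrier_vec (vb_rank B)"
    and "v \<in> carrier_vec (vb_rank B) \<Longrightarrow> \<exists>e\<in>fiber B y. snd T e = v"
    and "e \<in> fiber B y \<Longrightarrow> e' \<in> fiber B y \<Longrightarrow> snd T e = snd T e' \<Longrightarrow> e = e'"
proof -
  note b = trivD(2)[OF assms]
  show "e \<in> fiber B y \<Longrightarrow> snd T e \<in> carrier_vec (vb_rank B)" using b bij_betwE by blast
  show "v \<in> carrier_vec (vb_rank B) \<Longrightarrow> \<exists>e\<in>fiber B y. snd T e = v"
  proof -
    assume "v \<in> carrier_vec (vb_rank B)"
    then have "v \<in> snd T ` fiber B y" using b by (simp add: bij_betw_def)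
    then show ?thesis by blast
  qed
  show "e \<in> fiber B y \<Longrightarrow> e' \<in> fiber B y \<Longrightarrow> snd T e = snd T e' \<Longrightarrow> e = e'"
    using b by (auto simp: bij_betw_def inj_on_def)
qed

lemma frame_coord:
  assumes "holo_bundle \<A> B" "T \<in> vb_trivs B" "y \<in> fst T" "j < vb_rank B"
  shows "frame B T y j \<in> fiber B y" "snd T (frame B T y j) = unit_vec (vb_rank B) j"
proof -
  note b = trivD(2)[OF assms(1-3)]
  have u: "unit_vec (vb_rank B) j \<in> snd T ` fiber B y" using b by (simp add: bij_betw_def)
  show "frame B T y j \<in> fiber B y"
    unfolding frame_def by (rule the_inv_into_into[OF bij_betw_imp_inj_on[OF b] u]) simp
  show "snd T (frame B T y j) = unit_vec (vb_rank B) j"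
    unfolding frame_def by (rule f_the_inv_into_f[OF bij_betw_imp_inj_on[OF b] u])
qed

lemma fiber_zero_iff:
  assumes B: "holo_bundle \<A> B" "T \<in> vb_trivs B" "vb_proj B e \<in> fst T"
  shows "fiber_zero B e \<longleftrightarrow> snd T e = 0\<^sub>v (vb_rank B)"
proof
  assume "fiber_zero B e"
  then show "snd T e = 0\<^sub>v (vb_rank B)" using B unfolding fiber_zero_def by (cases T) auto
next
  assume zero: "snd T e = 0\<^sub>v (vb_rank B)"
  have "\<sigma> e = 0\<^sub>v (vb_rank B)" if V: "(V, \<sigma>) \<in> vb_trivs B" "vb_proj B e \<in> V" for V \<sigma>
  proof -
    obtain U \<tau> where T: "T = (U, \<tau>)" by (cases T)
    have "\<exists>g. holo_mat \<A> (U \<inter> V) (vb_rank B) (vb_rank B) g \<and>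
        (\<forall>e. vb_proj B e \<in> U \<inter> V \<longrightarrow> \<sigma> e = g (vb_proj B e) *\<^sub>v \<tau> e)"
      using B(1,2) V(1) unfolding holo_bundle_def T by fastforce
    then obtain g where g: "holo_mat \<A> (U \<inter> V) (vb_rank B) (vb_rank B) g"
      "\<sigma> e = g (vb_proj B e) *\<^sub>v \<tau> e" using B(3) V(2) unfolding T by auto
    have "g (vb_proj B e) \<in> carrier_mat (vb_rank B) (vb_rank B)"
      using g(1) B(3) V(2) unfolding holo_mat_def T by auto
    then show ?thesis using g(2) zero unfolding T by auto
  qed
  then show "fiber_zero B e" unfolding fiber_zero_def by auto
qed

lemma hermitian_gram:
  assumes B: "holo_bundle \<A> B" "T \<in> vb_trivs B" and h: "hermitian_metric \<A> B h"
  obtains G where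
    "\<And>i j. i < vb_rank B \<Longrightarrow> j < vb_rank B \<Longrightarrow> smooth_fun \<A> (fst T) (\<lambda>y. G y $$ (i, j))"
    "\<And>y. y \<in> fst T \<Longrightarrow> gram B h T y = G y"
    "\<And>y e e'. y \<in> fst T \<Longrightarrow> e \<in> fiber B y \<Longrightarrow> e' \<in> fiber B y \<Longrightarrow> h e e' = (G y *\<^sub>v snd T e) \<bullet>c snd T e'"
proof -
  obtain U \<tau> where T: "T = (U, \<tau>)" by (cases T)
  obtain G where car: "\<And>y. y \<in> fst T \<Longrightarrow> G y \<in> carrier_mat (vb_rank B) (vb_rank B)"
    and sm: "\<And>i j. i < vb_rank B \<Longrightarrow> j < vb_rank B \<Longrightarrow> smooth_fun \<A> (fst T) (\<lambda>y. G y $$ (i, j))"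
    and form: "\<And>y e e'. y \<in> fst T \<Longrightarrow> e \<in> fiber B y \<Longrightarrow> e' \<in> fiber B y \<Longrightarrow> h e e' = (G y *\<^sub>v snd T e) \<bullet>c snd T e'"
    using h[unfolded hermitian_metric_def, THEN conjunct1, THEN bspec, OF B(2), unfolded T split]
    unfolding T fst_conv snd_conv by blast
  have "gram B h T y = G y" if y: "y \<in> fst T" for y
  proof (rule eq_matI)
    fix i j assume "i < dim_row (G y)" "j < dim_col (G y)"
    then have ij: "i < vb_rank B" "j < vb_rank B" using car[OF y] by auto
    note f = frame_coord[OF B y]
    have "h (frame B T y j) (frame B T y i) = (G y *\<^sub>v unit_vec (vb_rank B) j) \<bullet>c unit_vec (vb_rank B) i"
      using form[OF y f(1)[OF ij(2)] f(1)[OF ij(1)]] f(2)[OF ij(1)] f(2)[OF ij(2)] by simp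
    also have "\<dots> = G y $$ (i, j)"
      using car[OF y] ij by (subst cscalar_prod_unit_vec) auto
    finally show "gram B h T y $$ (i, j) = G y $$ (i, j)" using ij by (simp add: gram_def)
  qed (use car[OF y] in \<open>auto simp: gram_def\<close>)
  then show thesis using that[OF sm _ form] by blast
qed

lemma gram_carrier: "gram B h T y \<in> carrier_mat (vb_rank B) (vb_rank B)"
  by (simp add: gram_def)

lemma gram_form:
  assumes "holo_bundle \<A> B" "T \<in> vb_trivs B" "hermitian_metric \<A> B h" "y \<in> fst T" "e \<in> fiber B y" "e' \<in> fiber B y"
  shows "h e e' = (gram B h T y *\<^sub>v snd T e) \<bullet>c snd T e'"
  by (rule hermitian_gram[OF assms(1-3)]) (simp add: assms(4-6))

lemma gram_pos:
  assumes B: "holo_bundle \<A> B" "T \<in> vb_trivs B" and h: "hermitian_metric \<A> B h" and y: "y \<in> fst T"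
    and v: "v \<in> carrier_vec (vb_rank B)" "v \<noteq> 0\<^sub>v (vb_rank B)"
  shows "(gram B h T y *\<^sub>v v) \<bullet>c v \<noteq> 0"
proof -
  obtain e where e: "e \<in> fiber B y" "snd T e = v" using triv_coord(2)[OF B y v(1)] by blast
  have "\<not> fiber_zero B e" using fiber_zero_iff[OF B, of e] e y v(2) by (simp add: fiber_def)
  then have "Re (h e e) > 0" using h unfolding hermitian_metric_def by blast
  then show ?thesis using gram_form[OF B h y e(1) e(1)] e(2) by auto
qed

lemma hermitian_symmetric:
  assumes "hermitian_metric \<A> B h" "e \<in> fiber B y" "e' \<in> fiber B y"
  shows "h e' e = cnj (h e e')"
  using assms(1)[unfolded hermitian_metric_def, THEN conjunct2, THEN conjunct1, rule_format, of e e'] assms(2,3)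
  by (simp add: fiber_def)

lemma chart_regionI:
  assumes M: "complex_manifold \<A>" and c: "c \<in> \<A>" and W: "open W" "W \<subseteq> fst c"
  shows "chart_region c W"
proof
  obtain U \<phi> where cU: "c = (U, \<phi>)" by (cases c)
  have U: "open U" "open (\<phi> ` U)" "homeomorphism U (\<phi> ` U) \<phi> (inv_into U \<phi>)"
    using M c unfolding complex_manifold_def cU by fastforce+
  show "inj_on (snd c) (fst c)"
    unfolding cU using homeomorphism_apply1[OF U(3)] by (auto intro: inj_on_inverseI)
  show "W \<subseteq> fst c" by (rule W)
  have "openin (top_of_set U) W" using W unfolding cU by (simp add: openin_open_eq[OF U(1)])
  then have "openin (top_of_set (\<phi> ` U)) (\<phi> ` W)" by (rule homeomorphism_imp_open_map[OF U(3)])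
  then show "open (snd c ` W)" using U(2) unfolding cU by (simp add: openin_open_eq)
qed

lemma smooth_fun_imp_smooth_fn_on:
  assumes "smooth_fun \<A> V f" "c \<in> \<A>" "W \<subseteq> V" "W \<subseteq> fst c"
  shows "smooth_fn_on c W f"
proof -
  have "smooth_on (snd c ` (V \<inter> fst c)) (in_chart c f)" using assms(1,2) by (auto simp: smooth_fun_def)
  then show ?thesis unfolding smooth_fn_on_def by (rule smooth_on_subset) (use assms in auto)
qed

lemma (in chart_region) holo_fun_on:
  assumes "holo_fun \<A> V f" "c \<in> \<A>" "W \<subseteq> V"
  shows "holo_on (snd c ` W) (in_chart c f)"
proof -
  have "holo_on (snd c ` (V \<inter> fst c)) (in_chart c f)" using assms(1,2) by (auto simp: holo_fun_def)
  then show ?thesis using assms(3) W_sub unfolding holo_on_def by blast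
qed

lemma (in chart_region) smooth_fn_on_holo:
  "holo_on (snd c ` W) (in_chart c f) \<Longrightarrow> smooth_fn_on c W f"
  unfolding smooth_fn_on_def by (rule holo_on_imp_smooth_on[OF open_W])

lemma (in chart_region) delbar_holo:
  assumes f: "holo_on (snd c ` W) (in_chart c f)" and y: "y \<in> W"
  shows "alt_deriv d01 c (\<lambda>y. form_const (f y)) y = 0"
proof (rule altform_eqI)
  fix vs
  have "d01 (in_chart c f) (snd c y) v = 0" for v
    by (simp add: d01_def holo_onD(2)[OF f imageI[OF y]])
  then show "form_app (alt_deriv d01 c (\<lambda>y. form_const (f y)) y) vs = form_app 0 vs"
    by (simp add: form_app_alt_deriv_form_const[OF directional_d01 smooth_fn_on_holo[OF f] y] form_app_simps)
qed

lemma (in chart_region) del_cnj_holo: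
  assumes f: "holo_on (snd c ` W) (in_chart c f)" and y: "y \<in> W"
  shows "alt_deriv d10 c (\<lambda>y. form_const (cnj (f y))) y = 0"
proof (rule altform_eqI)
  fix vs
  have "((\<lambda>z. cnj (in_chart c f z)) has_derivative (\<lambda>v. cnj (frechet_derivative (in_chart c f) (at (snd c y)) v))) (at (snd c y))"
    by (rule bounded_linear.has_derivative[OF bounded_linear_cnj holo_onD(1)[OF f imageI[OF y]]])
  note D = frechet_derivative_at[OF this, symmetric]
  have "d10 (\<lambda>z. cnj (in_chart c f z)) (snd c y) v = 0" for v
    by (simp add: d10_def D holo_onD(2)[OF f imageI[OF y]])
  moreover have "in_chart c (\<lambda>y. cnj (f y)) = (\<lambda>z. cnj (in_chart c f z))" by (simp add: in_chart_def fun_eq_iff)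
  ultimately show "form_app (alt_deriv d10 c (\<lambda>y. form_const (cnj (f y))) y) vs = form_app 0 vs"
    by (simp add: form_app_alt_deriv_form_const[OF directional_d10 smooth_fn_on_cnj[OF smooth_fn_on_holo[OF f]] y] form_app_simps)
qed

lemma (in chart_region) smooth_fn_on_det:
  assumes "smooth_fn_mat c W n n M"
  shows "smooth_fn_on c W (\<lambda>y. Determinant.det (M y))"
proof -
  have "smooth_fn_on c W (\<lambda>y. \<Sum>p | p permutes {0..<n}. signof p * (\<Prod>i = 0..<n. M y $$ (i, p i)))"
    by (intro smooth_fn_on_sum smooth_fn_on_mult smooth_fn_on_const smooth_fn_on_prod smooth_fn_mat_entry[OF assms])
      (auto dest: permutes_in_image)
  then show ?thesis
    by (rule smooth_fn_on_cong[THEN iffD1, rotated]) (simp only: det_def'[OF smooth_fn_mat_carrier[OF assms]])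
qed

text \<open>By Cramer's rule.\<close>

lemma (in chart_region) smooth_fn_mat_inverse:
  assumes M: "smooth_fn_mat c W n n M" and det: "\<And>y. y \<in> W \<Longrightarrow> Determinant.det (M y) \<noteq> 0"
  shows "smooth_fn_mat c W n n (\<lambda>y. the (mat_inverse (M y)))"
  unfolding smooth_fn_mat_def
proof (intro conjI ballI allI impI)
  note inv = mat_inverse_det_nonzero[OF smooth_fn_mat_carrier[OF M] det]
  show "the (mat_inverse (M y)) \<in> carrier_mat n n" if "y \<in> W" for y by (rule inv(1)[OF that that])
  fix i j assume ij: "i < n" "j < n"
  have del: "smooth_fn_mat c W (n - 1) (n - 1) (\<lambda>y. mat_delete (M y) j i)"
    unfolding smooth_fn_mat_def
  proof (intro conjI ballI allI impI)
    show "mat_delete (M y) j i \<in> carrier_mat (n - 1) (n - 1)" if "y \<in> W" for y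
      by (rule mat_delete_carrier[OF smooth_fn_mat_carrier[OF M that]])
    fix k l assume kl: "k < n - 1" "l < n - 1"
    have "smooth_fn_on c W (\<lambda>y. M y $$ (if k < j then k else Suc k, if l < i then l else Suc l))"
      by (rule smooth_fn_mat_entry[OF M]) (use kl in auto)
    then show "smooth_fn_on c W (\<lambda>y. mat_delete (M y) j i $$ (k, l))"
      by (rule smooth_fn_on_cong[THEN iffD1, rotated]) (use kl smooth_fn_mat_dims[OF M] in \<open>simp add: mat_delete_def\<close>)
  qed
  have "smooth_fn_on c W (\<lambda>y. inverse (Determinant.det (M y)) * ((-1) ^ (j + i) * Determinant.det (mat_delete (M y) j i)))"
    by (intro smooth_fn_on_mult smooth_fn_on_inverse smooth_fn_on_const smooth_fn_on_det[OF M] smooth_fn_on_det[OF del] det)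
  moreover have "the (mat_inverse (M y)) $$ (i, j) =
      inverse (Determinant.det (M y)) * ((-1) ^ (j + i) * Determinant.det (mat_delete (M y) j i))" if y: "y \<in> W" for y
  proof -
    note car = smooth_fn_mat_carrier[OF M y] and inv = inv[OF y y]
    note adj = adj_mat[OF car]
    have "the (mat_inverse (M y)) * (M y * adj_mat (M y)) = adj_mat (M y)"
      using assoc_mult_mat[OF inv(1) car adj(1)] inv(2) adj(1) by simp
    then have "Determinant.det (M y) \<cdot>\<^sub>m the (mat_inverse (M y)) = adj_mat (M y)"
      using inv(1) by (simp add: adj(2) mult_smult_distrib[OF inv(1) one_carrier_mat])
    then have "(Determinant.det (M y) \<cdot>\<^sub>m the (mat_inverse (M y))) $$ (i, j) = adj_mat (M y) $$ (i, j)" by simp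
    then have "Determinant.det (M y) * the (mat_inverse (M y)) $$ (i, j) = cofactor (M y) j i"
      using inv(1) car ij by (simp add: adj_mat_def)
    then show ?thesis using det[OF y] by (simp add: cofactor_def field_simps)
  qed
  ultimately show "smooth_fn_on c W (\<lambda>y. the (mat_inverse (M y)) $$ (i, j))"
    using smooth_fn_on_cong by (metis (no_types, lifting))
qed

section \<open>Hermitian exact sequences in local trivializations\<close>

text \<open>An exact sequence with the induced metric on \<open>H\<close>, together with trivializations in which \<open>gm\<close> is the matrix of
  \<open>p\<close>. The subbundle enters as the family \<open>S\<close> of the kernels of \<open>p\<close>.\<close>

locale hermitian_sequence =
  fixes \<A> :: "('x::{t2_space, second_countable_topology}, 'n::finite) chart set"
    and E :: "('x, 'e) vbundle" and H :: "('x, 'q) vbundle"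
    and p :: "'e \<Rightarrow> 'q" and S :: "'x \<Rightarrow> 'e set"
    and h :: "'e \<Rightarrow> 'e \<Rightarrow> complex" and h' :: "'q \<Rightarrow> 'q \<Rightarrow> complex"
    and c :: "('x, 'n) chart" and T :: "('x, 'e) triv" and T' :: "('x, 'q) triv"
    and gm :: "'x \<Rightarrow> complex Matrix.mat"
  assumes manifold: "complex_manifold \<A>" and chart: "c \<in> \<A>"
    and E: "holo_bundle \<A> E" "T \<in> vb_trivs E" and H: "holo_bundle \<A> H" "T' \<in> vb_trivs H"
    and metrics: "hermitian_metric \<A> E h" "hermitian_metric \<A> H h'"
    and proj_p: "\<And>e. vb_proj H (p e) = vb_proj E e" and surj_p: "surj p"
    and S: "\<And>y. S y = {e \<in> fiber E y. fiber_zero H (p e)}"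
    and isometry: "\<And>y a b. a \<in> perp E h S y \<Longrightarrow> b \<in> perp E h S y \<Longrightarrow> h' (p a) (p b) = h a b"
    and gm: "holo_mat \<A> (fst T \<inter> fst T') (vb_rank H) (vb_rank E) gm"
      "\<And>e. vb_proj E e \<in> fst T \<inter> fst T' \<Longrightarrow> snd T' (p e) = gm (vb_proj E e) *\<^sub>v snd T e"
begin

definition W :: "'x set" where "W = fst c \<inter> fst T \<inter> fst T'"

abbreviation "r \<equiv> vb_rank E"
abbreviation "q \<equiv> vb_rank H"
abbreviation "G \<equiv> gram E h T"
abbreviation "G' \<equiv> gram H h' T'"

text \<open>The matrix of the adjoint of \<open>p\<close>, as \<open>fiber_adjoint_coord\<close> shows.\<close>

definition sm :: "'x \<Rightarrow> complex Matrix.mat" where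
  "sm y = the (mat_inverse (G y)) * conj_transpose (gm y) * G' y"

lemma W_D: "y \<in> W \<Longrightarrow> y \<in> fst c" "y \<in> W \<Longrightarrow> y \<in> fst T" "y \<in> W \<Longrightarrow> y \<in> fst T'"
  by (auto simp: W_def)

lemma gm_carrier: "y \<in> W \<Longrightarrow> gm y \<in> carrier_mat q r"
  using gm(1) by (auto simp: holo_mat_def W_def)

lemma p_coord: "y \<in> W \<Longrightarrow> e \<in> fiber E y \<Longrightarrow> snd T' (p e) = gm y *\<^sub>v snd T e"
  using gm(2)[of e] by (auto simp: W_def fiber_def)

lemma p_fiber: "e \<in> fiber E y \<Longrightarrow> p e \<in> fiber H y"
  by (simp add: fiber_def proj_p)

lemma S_coord: "y \<in> W \<Longrightarrow> e \<in> S y \<longleftrightarrow> e \<in> fiber E y \<and> gm y *\<^sub>v snd T e = 0\<^sub>v q"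
  using fiber_zero_iff[OF H, of "p e"] p_coord[of y e] by (auto simp: S fiber_def proj_p dest: W_D)

lemma perp_coord:
  assumes y: "y \<in> W" and e: "e \<in> fiber E y"
  shows "e \<in> perp E h S y \<longleftrightarrow> (\<forall>k\<in>carrier_vec r. gm y *\<^sub>v k = 0\<^sub>v q \<longrightarrow> (G y *\<^sub>v snd T e) \<bullet>c k = 0)"
proof
  assume perp: "e \<in> perp E h S y"
  show "\<forall>k\<in>carrier_vec r. gm y *\<^sub>v k = 0\<^sub>v q \<longrightarrow> (G y *\<^sub>v snd T e) \<bullet>c k = 0"
  proof (intro ballI impI)
    fix k assume k: "k \<in> carrier_vec r" "gm y *\<^sub>v k = 0\<^sub>v q"
    obtain f where f: "f \<in> fiber E y" "snd T f = k" using triv_coord(2)[OF E W_D(2)[OF y] k(1)] by blast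
    then have "h e f = 0" using perp k S_coord[OF y] by (auto simp: perp_def)
    then show "(G y *\<^sub>v snd T e) \<bullet>c k = 0" using gram_form[OF E metrics(1) W_D(2)[OF y] e f(1)] f(2) by simp
  qed
next
  assume *: "\<forall>k\<in>carrier_vec r. gm y *\<^sub>v k = 0\<^sub>v q \<longrightarrow> (G y *\<^sub>v snd T e) \<bullet>c k = 0"
  have "h e f = 0" if "f \<in> S y" for f
    using that * gram_form[OF E metrics(1) W_D(2)[OF y] e, of f] triv_coord(1)[OF E W_D(2)[OF y], of f] S_coord[OF y] by auto
  then show "e \<in> perp E h S y" using e by (simp add: perp_def)
qed

lemma G_inverse:
  assumes "y \<in> W"
  shows "the (mat_inverse (G y)) \<in> carrier_mat r r" "the (mat_inverse (G y)) * G y = 1\<^sub>m r" "G y * the (mat_inverse (G y)) = 1\<^sub>m r"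
    "Determinant.det (G y) \<noteq> 0"
proof -
  show det: "Determinant.det (G y) \<noteq> 0"
    by (rule pos_def_imp_det_nonzero[OF gram_carrier gram_pos[OF E metrics(1) W_D(2)[OF assms]]])
  show "the (mat_inverse (G y)) \<in> carrier_mat r r" "the (mat_inverse (G y)) * G y = 1\<^sub>m r" "G y * the (mat_inverse (G y)) = 1\<^sub>m r"
    by (rule mat_inverse_det_nonzero[OF gram_carrier det])+
qed

lemma G'_inverse:
  assumes "y \<in> W"
  shows "the (mat_inverse (G' y)) \<in> carrier_mat q q" "the (mat_inverse (G' y)) * G' y = 1\<^sub>m q" "G' y * the (mat_inverse (G' y)) = 1\<^sub>m q"
    "Determinant.det (G' y) \<noteq> 0"
proof -
  show det: "Determinant.det (G' y) \<noteq> 0"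
    by (rule pos_def_imp_det_nonzero[OF gram_carrier gram_pos[OF H metrics(2) W_D(3)[OF assms]]])
  show "the (mat_inverse (G' y)) \<in> carrier_mat q q" "the (mat_inverse (G' y)) * G' y = 1\<^sub>m q" "G' y * the (mat_inverse (G' y)) = 1\<^sub>m q"
    by (rule mat_inverse_det_nonzero[OF gram_carrier det])+
qed

lemma gm_onto:
  assumes y: "y \<in> W" and w: "w \<in> carrier_vec q"
  shows "\<exists>v\<in>carrier_vec r. gm y *\<^sub>v v = w"
proof -
  obtain f where f: "f \<in> fiber H y" "snd T' f = w" using triv_coord(2)[OF H W_D(3)[OF y] w] by blast
  obtain e where "f = p e" using surjD[OF surj_p] by blast
  then have e: "e \<in> fiber E y" "p e = f" using f proj_p[of e] by (auto simp: fiber_def)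
  then show ?thesis using p_coord[OF y e(1)] f(2) triv_coord(1)[OF E W_D(2)[OF y] e(1)] by auto
qed

lemma sm_carrier: "y \<in> W \<Longrightarrow> sm y \<in> carrier_mat r q"
  unfolding sm_def
  by (rule mult_carrier_mat[OF mult_carrier_mat[OF G_inverse(1) conj_transpose_carrier[OF gm_carrier]] gram_carrier])

text \<open>This is where the isometry between \<open>H\<close> and the orthogonal complement of the kernel enters.\<close>

lemma gm_sm:
  assumes y: "y \<in> W"
  shows "gm y * sm y = 1\<^sub>m q"
  unfolding sm_def
proof (rule quotient_metric_section[OF gram_carrier G_inverse(1,3)[OF y] gram_carrier gm_carrier[OF y]
      gram_pos[OF E metrics(1) W_D(2)[OF y]] gm_onto[OF y]])
  fix v v' assume v: "v \<in> carrier_vec r" "v' \<in> carrier_vec r"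
    and perp: "\<And>k. k \<in> carrier_vec r \<Longrightarrow> gm y *\<^sub>v k = 0\<^sub>v q \<Longrightarrow> (G y *\<^sub>v v) \<bullet>c k = 0"
      "\<And>k. k \<in> carrier_vec r \<Longrightarrow> gm y *\<^sub>v k = 0\<^sub>v q \<Longrightarrow> (G y *\<^sub>v v') \<bullet>c k = 0"
  obtain e where e: "e \<in> fiber E y" "snd T e = v" using triv_coord(2)[OF E W_D(2)[OF y] v(1)] by blast
  obtain e' where e': "e' \<in> fiber E y" "snd T e' = v'" using triv_coord(2)[OF E W_D(2)[OF y] v(2)] by blast
  have "h' (p e) (p e') = h e e'"
    by (rule isometry) (use perp_coord[OF y e(1)] perp_coord[OF y e'(1)] perp e(2) e'(2) in blast)+
  then show "(G' y *\<^sub>v (gm y *\<^sub>v v)) \<bullet>c (gm y *\<^sub>v v') = (G y *\<^sub>v v) \<bullet>c v'"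
    using gram_form[OF E metrics(1) W_D(2)[OF y] e(1) e'(1)]
      gram_form[OF H metrics(2) W_D(3)[OF y] p_fiber[OF e(1)] p_fiber[OF e'(1)]]
      p_coord[OF y e(1)] p_coord[OF y e'(1)] e(2) e'(2) by simp
qed

lemma G_sm: assumes y: "y \<in> W" shows "G y * sm y = conj_transpose (gm y) * G' y"
proof -
  note c = gram_carrier[of E h T y] G_inverse(1)[OF y] conj_transpose_carrier[OF gm_carrier[OF y]] gram_carrier[of H h' T' y]
  have "G y * sm y = G y * (the (mat_inverse (G y)) * (conj_transpose (gm y) * G' y))"
    unfolding sm_def by (simp only: assoc_mult_mat[OF c(2-4)])
  also have "\<dots> = (G y * the (mat_inverse (G y))) * (conj_transpose (gm y) * G' y)"
    by (rule assoc_mult_mat[symmetric, OF c(1,2) mult_carrier_mat[OF c(3,4)]])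
  finally show ?thesis by (simp only: G_inverse(3)[OF y] left_mult_one_mat[OF mult_carrier_mat[OF c(3,4)]])
qed

end

sublocale hermitian_sequence \<subseteq> region: chart_region c W
proof (rule chart_regionI[OF manifold chart])
  have "open (fst c)" using manifold chart unfolding complex_manifold_def by (cases c) fastforce
  then show "open W" unfolding W_def using trivD(1)[OF E] trivD(1)[OF H] by (intro open_Int)
  show "W \<subseteq> fst c" by (auto simp: W_def)
qed

lemma (in hermitian_sequence) smooth_gram: "smooth_fn_mat c W r r G" "smooth_fn_mat c W q q G'"
proof -
  have *: "smooth_fn_mat c W (vb_rank B) (vb_rank B) (gram B k R)"
    if B: "holo_bundle \<A> B" "R \<in> vb_trivs B" "hermitian_metric \<A> B k" and sub: "W \<subseteq> fst R" for B :: "('x, 'z) vbundle" and k R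
  proof -
    obtain M where M: "\<And>i j. i < vb_rank B \<Longrightarrow> j < vb_rank B \<Longrightarrow> smooth_fun \<A> (fst R) (\<lambda>y. M y $$ (i, j))"
      "\<And>y. y \<in> fst R \<Longrightarrow> gram B k R y = M y"
      using hermitian_gram[OF B] by metis
    have "smooth_fn_on c W (\<lambda>y. gram B k R y $$ (i, j))" if "i < vb_rank B" "j < vb_rank B" for i j
      using smooth_fun_imp_smooth_fn_on[OF M(1)[OF that] chart sub region.W_sub]
      by (rule region.smooth_fn_on_cong[THEN iffD1, rotated]) (use M(2) sub in auto)
    then show ?thesis by (simp add: smooth_fn_mat_def gram_carrier)
  qed
  show "smooth_fn_mat c W r r G" "smooth_fn_mat c W q q G'"
    by (rule *[OF E metrics(1)], force dest: W_D, rule *[OF H metrics(2)], force dest: W_D)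
qed

lemma (in hermitian_sequence) holo_gm:
  assumes "i < q" "j < r"
  shows "holo_on (snd c ` W) (in_chart c (\<lambda>y. gm y $$ (i, j)))"
  by (rule region.holo_fun_on[OF _ chart, where V = "fst T \<inter> fst T'"])
    (use gm(1) assms in \<open>auto simp: holo_mat_def W_def\<close>)

sublocale hermitian_sequence \<subseteq> hermitian_quotient c W r q G "\<lambda>y. the (mat_inverse (G y))" G' "\<lambda>y. the (mat_inverse (G' y))"
  gm "\<lambda>y. conj_transpose (gm y)" sm
proof (unfold_locales)
  show G: "smooth_fn_mat c W r r G" "smooth_fn_mat c W q q G'" by (rule smooth_gram)+
  show Gi: "smooth_fn_mat c W r r (\<lambda>y. the (mat_inverse (G y)))" "smooth_fn_mat c W q q (\<lambda>y. the (mat_inverse (G' y)))"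
    by (rule region.smooth_fn_mat_inverse[OF G(1) G_inverse(4)], assumption)
      (rule region.smooth_fn_mat_inverse[OF G(2) G'_inverse(4)], assumption)
  show g: "smooth_fn_mat c W q r gm"
    unfolding smooth_fn_mat_def using gm_carrier region.smooth_fn_on_holo[OF holo_gm] by blast
  have ct: "conj_transpose (gm y) $$ (i, j) = cnj (gm y $$ (j, i))" if "y \<in> W" "i < r" "j < q" for y i j
    using gm_carrier[OF that(1)] that by (simp add: conj_transpose_def)
  show gt: "smooth_fn_mat c W r q (\<lambda>y. conj_transpose (gm y))"
    unfolding smooth_fn_mat_def
  proof (intro conjI ballI allI impI)
    show "conj_transpose (gm y) \<in> carrier_mat r q" if "y \<in> W" for y by (rule conj_transpose_carrier[OF gm_carrier[OF that]])
    fix i j assume ij: "i < r" "j < q"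
    show "smooth_fn_on c W (\<lambda>y. conj_transpose (gm y) $$ (i, j))"
      using region.smooth_fn_on_cnj[OF smooth_fn_mat_entry[OF g ij(2,1)]]
      by (rule region.smooth_fn_on_cong[THEN iffD1, rotated]) (simp add: ct ij)
  qed
  show "smooth_fn_mat c W r q sm"
    unfolding sm_def[abs_def] by (rule region.smooth_fn_mat_mult[OF region.smooth_fn_mat_mult[OF Gi(1) gt] G(2)])
  fix y assume y: "y \<in> W"
  show "the (mat_inverse (G y)) * G y = 1\<^sub>m r" "G y * the (mat_inverse (G y)) = 1\<^sub>m r" "G' y * the (mat_inverse (G' y)) = 1\<^sub>m q"
    "gm y * sm y = 1\<^sub>m q" "G y * sm y = conj_transpose (gm y) * G' y"
    by (rule G_inverse(2,3)[OF y] G'_inverse(3)[OF y] gm_sm[OF y] G_sm[OF y])+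
  show "mat_deriv (alt_deriv d01 c) (\<lambda>y. mat_const (gm y)) y = 0\<^sub>m q r"
  proof (rule eq_matI)
    fix i j assume "i < dim_row (0\<^sub>m q r :: (complex ^ 'n) altform Matrix.mat)" "j < dim_col (0\<^sub>m q r :: (complex ^ 'n) altform Matrix.mat)"
    then have ij: "i < q" "j < r" by auto
    have "alt_deriv d01 c (\<lambda>y. mat_const (gm y) $$ (i, j)) y = alt_deriv d01 c (\<lambda>y. form_const (gm y $$ (i, j))) y"
      by (rule region.alt_deriv_cong[OF directional_d01 y]) (use ij carrier_matD[OF gm_carrier] in auto)
    then show "mat_deriv (alt_deriv d01 c) (\<lambda>y. mat_const (gm y)) y $$ (i, j) = 0\<^sub>m q r $$ (i, j)"
      using region.delbar_holo[OF holo_gm[OF ij] y] ij gm_carrier[OF y] by (simp add: mat_deriv_def)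
  qed (use gm_carrier[OF y] in \<open>auto simp: mat_deriv_def\<close>)
  show "mat_deriv (alt_deriv d10 c) (\<lambda>y. mat_const (conj_transpose (gm y))) y = 0\<^sub>m r q"
  proof (rule eq_matI)
    note car = conj_transpose_carrier[OF gm_carrier]
    fix i j assume "i < dim_row (0\<^sub>m r q :: (complex ^ 'n) altform Matrix.mat)" "j < dim_col (0\<^sub>m r q :: (complex ^ 'n) altform Matrix.mat)"
    then have ij: "i < r" "j < q" by auto
    have "alt_deriv d10 c (\<lambda>y. mat_const (conj_transpose (gm y)) $$ (i, j)) y = alt_deriv d10 c (\<lambda>y. form_const (cnj (gm y $$ (j, i)))) y"
      by (rule region.alt_deriv_cong[OF directional_d10 y]) (use ij ct carrier_matD[OF car] in auto)
    then show "mat_deriv (alt_deriv d10 c) (\<lambda>y. mat_const (conj_transpose (gm y))) y $$ (i, j) = 0\<^sub>m r q $$ (i, j)"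
      using region.del_cnj_holo[OF holo_gm[OF ij(2,1)] y] ij car[OF y] by (simp add: mat_deriv_def)
  qed (use conj_transpose_carrier[OF gm_carrier[OF y]] in \<open>auto simp: mat_deriv_def\<close>)
qed

section \<open>Projections, adjoints and the second fundamental form\<close>

lemma hom_mat_eq:
  assumes B: "holo_bundle \<A> B" "T \<in> vb_trivs B" "y \<in> fst T" and M: "M \<in> carrier_mat (vb_rank C) (vb_rank B)"
    and f: "\<And>e. e \<in> fiber B y \<Longrightarrow> snd T' (f e) = M *\<^sub>v snd T e"
  shows "hom_mat B T C T' f y = mat_const M"
proof (rule eq_matI)
  fix i j assume "i < dim_row (mat_const M)" "j < dim_col (mat_const M)"
  then have ij: "i < vb_rank C" "j < vb_rank B" using M by auto
  have "snd T' (f (frame B T y j)) = M *\<^sub>v unit_vec (vb_rank B) j"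
    using f[OF frame_coord(1)[OF B ij(2)]] frame_coord(2)[OF B ij(2)] by simp
  then show "hom_mat B T C T' f y $$ (i, j) = mat_const M $$ (i, j)"
    using M ij by (simp add: hom_mat_def)
qed (use M in \<open>auto simp: hom_mat_def\<close>)


lemma (in hermitian_sequence) coord: "y \<in> W \<Longrightarrow> e \<in> fiber E y \<Longrightarrow> snd T e \<in> carrier_vec r"
  by (rule triv_coord(1)[OF E W_D(2)])

lemma (in hermitian_sequence) coord_onto: "y \<in> W \<Longrightarrow> v \<in> carrier_vec r \<Longrightarrow> \<exists>e\<in>fiber E y. snd T e = v"
  by (rule triv_coord(2)[OF E W_D(2)])

lemma (in hermitian_sequence) form_coord: "y \<in> W \<Longrightarrow> e \<in> fiber E y \<Longrightarrow> e' \<in> fiber E y \<Longrightarrow> h e e' = (G y *\<^sub>v snd T e) \<bullet>c snd T e'"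
  by (rule gram_form[OF E metrics(1) W_D(2)])

text \<open>The form is positive definite on the difference \<open>d\<close> of \<open>e\<close> and \<open>f\<close>.\<close>

lemma (in hermitian_sequence) eq_if_same_form:
  assumes y: "y \<in> W" and e: "e \<in> fiber E y" "f \<in> fiber E y" "d \<in> fiber E y"
    and d: "snd T d = snd T e - snd T f" and eq: "h e d = h f d"
  shows "e = f"
proof -
  note v = coord[OF y e(1)] coord[OF y e(2)] coord[OF y e(3)]
  have Gv: "G y *\<^sub>v snd T e \<in> carrier_vec r" "G y *\<^sub>v snd T f \<in> carrier_vec r"
    using v gram_carrier[of E h T y] by simp_all
  have "(G y *\<^sub>v snd T d) \<bullet>c snd T d = h e d - h f d"
    unfolding form_coord[OF y e(1,3)] form_coord[OF y e(2,3)]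
    using v Gv by (simp add: d mult_minus_distrib_mat_vec[OF gram_carrier v(1,2)]
      minus_scalar_prod_distrib[OF Gv, of "conjugate (snd T e - snd T f)"])
  then have "snd T d = 0\<^sub>v r" using gram_pos[OF E metrics(1) W_D(2)[OF y] v(3)] eq by auto
  then have "snd T e = snd T f" using vec_eq_if_diff_zero[OF v(1,2)] d by simp
  then show ?thesis by (rule triv_coord(3)[OF E W_D(2)[OF y] e(1,2)])
qed

text \<open>The fibres have a linear structure through trivializations only, so closure of \<open>V\<close> under differences is
  expressed in coordinates.\<close>

lemma (in hermitian_sequence) orth_proj_eqI:
  assumes y: "y \<in> W" and e: "e \<in> fiber E y" and sub: "V y \<subseteq> fiber E y"
    and diff: "\<And>a b. a \<in> V y \<Longrightarrow> b \<in> V y \<Longrightarrow> \<exists>d\<in>V y. snd T d = snd T a - snd T b"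
    and f: "f \<in> V y" "\<And>k. k \<in> V y \<Longrightarrow> h f k = h e k"
  shows "orth_proj E h V e = f"
proof -
  have y': "vb_proj E e = y" using e by (simp add: fiber_def)
  show ?thesis
    unfolding orth_proj_def y'
  proof (rule the_equality)
    show "f \<in> V y \<and> (\<forall>k\<in>V y. h f k = h e k)" using f by blast
    fix w assume w: "w \<in> V y \<and> (\<forall>k\<in>V y. h w k = h e k)"
    then obtain d where d: "d \<in> V y" "snd T d = snd T w - snd T f" using diff[of w f] f(1) by blast
    have "h w d = h f d" using w f(2)[OF d(1)] d(1) by simp
    then show "w = f" using sub w f(1) d(1) by (intro eq_if_same_form[OF y _ _ _ d(2)]) blast+
  qed
qed

lemma (in hermitian_sequence) proj_mult_vec:
  assumes y: "y \<in> W" and v: "v \<in> carrier_vec r"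
  shows "proj_perp y *\<^sub>v v = sm y *\<^sub>v (gm y *\<^sub>v v)" "proj_sub y *\<^sub>v v = v - proj_perp y *\<^sub>v v"
    "gm y *\<^sub>v (proj_perp y *\<^sub>v v) = gm y *\<^sub>v v" "gm y *\<^sub>v (proj_sub y *\<^sub>v v) = 0\<^sub>v q"
    "proj_perp y *\<^sub>v v \<in> carrier_vec r" "proj_sub y *\<^sub>v v \<in> carrier_vec r"
proof -
  note c = gm_carrier[OF y] sm_carrier[OF y]
  have gv: "gm y *\<^sub>v v \<in> carrier_vec q" using c v by simp
  show 1: "proj_perp y *\<^sub>v v = sm y *\<^sub>v (gm y *\<^sub>v v)"
    unfolding proj_perp_def by (rule assoc_mult_mat_vec[OF c(2,1) v])
  show 2: "proj_sub y *\<^sub>v v = v - proj_perp y *\<^sub>v v"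
    using minus_mult_distrib_mat_vec[OF one_carrier_mat carriers(8)[OF y] v] v
    by (simp add: proj_sub_def proj_perp_def)
  show 5: "proj_perp y *\<^sub>v v \<in> carrier_vec r" "proj_sub y *\<^sub>v v \<in> carrier_vec r"
    using carriers(8)[OF y] carriers(9)[OF y] v by simp_all
  have "gm y *\<^sub>v (sm y *\<^sub>v (gm y *\<^sub>v v)) = (gm y * sm y) *\<^sub>v (gm y *\<^sub>v v)"
    by (rule assoc_mult_mat_vec[OF c gv, symmetric])
  then show 3: "gm y *\<^sub>v (proj_perp y *\<^sub>v v) = gm y *\<^sub>v v" using gv by (simp add: 1 gm_sm[OF y])
  show "gm y *\<^sub>v (proj_sub y *\<^sub>v v) = 0\<^sub>v q"
    unfolding 2 mult_minus_distrib_mat_vec[OF c(1) v 5(1)] 3 using gv by simp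
qed

lemma (in hermitian_sequence) G_proj_perp:
  assumes y: "y \<in> W" and b: "b \<in> carrier_vec q" and k: "k \<in> carrier_vec r"
  shows "(G y *\<^sub>v (sm y *\<^sub>v b)) \<bullet>c k = (G' y *\<^sub>v b) \<bullet>c (gm y *\<^sub>v k)"
proof -
  note c = gm_carrier[OF y] sm_carrier[OF y]
  have "G y *\<^sub>v (sm y *\<^sub>v b) = (G y * sm y) *\<^sub>v b" by (rule assoc_mult_mat_vec[OF gram_carrier c(2) b, symmetric])
  also have "\<dots> = conj_transpose (gm y) *\<^sub>v (G' y *\<^sub>v b)"
    unfolding G_sm[OF y] by (rule assoc_mult_mat_vec[OF conj_transpose_carrier[OF c(1)] gram_carrier b])
  finally show ?thesis
    using cscalar_prod_conj_transpose[OF c(1) k, of "G' y *\<^sub>v b"] gram_carrier[of H h' T' y] b by simp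
qed

lemma (in hermitian_sequence) orth_proj_S:
  assumes y: "y \<in> W" and e: "e \<in> fiber E y"
  shows "snd T (orth_proj E h S e) = proj_sub y *\<^sub>v snd T e"
proof -
  note v = coord[OF y e] and pv = proj_mult_vec[OF y coord[OF y e]]
  obtain f where f: "f \<in> fiber E y" "snd T f = proj_sub y *\<^sub>v snd T e" using coord_onto[OF y pv(6)] by blast
  have "orth_proj E h S e = f"
  proof (rule orth_proj_eqI[OF y e])
    show "S y \<subseteq> fiber E y" by (auto simp: S)
    show "f \<in> S y" using S_coord[OF y] f pv(4) by simp
    show "\<exists>d\<in>S y. snd T d = snd T a - snd T b" if ab: "a \<in> S y" "b \<in> S y" for a b
    proof -
      have ab': "a \<in> fiber E y" "b \<in> fiber E y" "gm y *\<^sub>v snd T a = 0\<^sub>v q" "gm y *\<^sub>v snd T b = 0\<^sub>v q"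
        using ab S_coord[OF y] by auto
      note ca = coord[OF y ab'(1)] coord[OF y ab'(2)]
      obtain d where d: "d \<in> fiber E y" "snd T d = snd T a - snd T b"
        using coord_onto[OF y, of "snd T a - snd T b"] ca by auto
      have "gm y *\<^sub>v snd T d = 0\<^sub>v q"
        unfolding d(2) mult_minus_distrib_mat_vec[OF gm_carrier[OF y] ca] ab'(3,4) by simp
      then show ?thesis using d S_coord[OF y] by blast
    qed
    fix k assume "k \<in> S y"
    then have k: "k \<in> fiber E y" "gm y *\<^sub>v snd T k = 0\<^sub>v q" using S_coord[OF y] by auto
    note ck = coord[OF y k(1)]
    have gv: "gm y *\<^sub>v snd T e \<in> carrier_vec q" using gm_carrier[OF y] v by simp
    have "(G y *\<^sub>v (proj_perp y *\<^sub>v snd T e)) \<bullet>c snd T k = 0"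
      unfolding pv(1) G_proj_perp[OF y gv ck] k(2) using gram_carrier[of H h' T' y] gv by simp
    moreover have "G y *\<^sub>v snd T f = G y *\<^sub>v snd T e - G y *\<^sub>v (proj_perp y *\<^sub>v snd T e)"
      unfolding f(2) pv(2) by (rule mult_minus_distrib_mat_vec[OF gram_carrier v pv(5)])
    moreover have "G y *\<^sub>v snd T e \<in> carrier_vec r" "G y *\<^sub>v (proj_perp y *\<^sub>v snd T e) \<in> carrier_vec r"
      using gram_carrier[of E h T y] v pv(5) by simp_all
    ultimately show "h f k = h e k"
      unfolding form_coord[OF y f(1) k(1)] form_coord[OF y e k(1)]
      using minus_scalar_prod_distrib[of "G y *\<^sub>v snd T e" r _ "conjugate (snd T k)"] ck by simp
  qed
  then show ?thesis using f by simp
qed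

lemma (in hermitian_sequence) orth_proj_perp:
  assumes y: "y \<in> W" and e: "e \<in> fiber E y"
  shows "snd T (orth_proj E h (perp E h S) e) = proj_perp y *\<^sub>v snd T e"
proof -
  note v = coord[OF y e] and pv = proj_mult_vec[OF y coord[OF y e]]
  have gv: "gm y *\<^sub>v snd T e \<in> carrier_vec q" using gm_carrier[OF y] v by simp
  obtain f where f: "f \<in> fiber E y" "snd T f = proj_perp y *\<^sub>v snd T e" using coord_onto[OF y pv(5)] by blast
  have "orth_proj E h (perp E h S) e = f"
  proof (rule orth_proj_eqI[OF y e])
    show "perp E h S y \<subseteq> fiber E y" by (auto simp: perp_def)
    show "f \<in> perp E h S y"
      unfolding perp_coord[OF y f(1)] f(2) pv(1)
      using gram_carrier[of H h' T' y] gv by (auto simp: G_proj_perp[OF y gv])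
    show "\<exists>d\<in>perp E h S y. snd T d = snd T a - snd T b" if ab: "a \<in> perp E h S y" "b \<in> perp E h S y" for a b
    proof -
      have ab': "a \<in> fiber E y" "b \<in> fiber E y" using ab by (auto simp: perp_def)
      note ca = coord[OF y ab'(1)] coord[OF y ab'(2)]
      obtain d where d: "d \<in> fiber E y" "snd T d = snd T a - snd T b"
        using coord_onto[OF y, of "snd T a - snd T b"] ca by auto
      have "G y *\<^sub>v snd T a \<in> carrier_vec r" "G y *\<^sub>v snd T b \<in> carrier_vec r"
        using gram_carrier[of E h T y] ca by simp_all
      then have "(G y *\<^sub>v snd T d) \<bullet>c k = (G y *\<^sub>v snd T a) \<bullet>c k - (G y *\<^sub>v snd T b) \<bullet>c k" if "k \<in> carrier_vec r" for k
        unfolding d(2) mult_minus_distrib_mat_vec[OF gram_carrier ca]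
        using minus_scalar_prod_distrib[of _ r _ "conjugate k"] that by simp
      then have "d \<in> perp E h S y"
        using ab unfolding perp_coord[OF y d(1)] perp_coord[OF y ab'(1)] perp_coord[OF y ab'(2)] by auto
      then show ?thesis using d by blast
    qed
    fix k assume k: "k \<in> perp E h S y"
    then have kf: "k \<in> fiber E y" by (simp add: perp_def)
    note ck = coord[OF y kf]
    obtain d where d: "d \<in> fiber E y" "snd T d = proj_sub y *\<^sub>v snd T e" using coord_onto[OF y pv(6)] by blast
    have "d \<in> S y" using S_coord[OF y] d pv(4) by simp
    then have "h k d = 0" using k by (simp add: perp_def)
    then have "h d k = 0" using hermitian_symmetric[OF metrics(1) kf d(1)] by simp
    then have "(G y *\<^sub>v (proj_sub y *\<^sub>v snd T e)) \<bullet>c snd T k = 0" using form_coord[OF y d(1) kf] d(2) by simp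
    moreover have "G y *\<^sub>v (proj_sub y *\<^sub>v snd T e) = G y *\<^sub>v snd T e - G y *\<^sub>v snd T f"
      unfolding f(2) pv(2) by (rule mult_minus_distrib_mat_vec[OF gram_carrier v pv(5)])
    moreover have "G y *\<^sub>v snd T e \<in> carrier_vec r" "G y *\<^sub>v snd T f \<in> carrier_vec r"
      using gram_carrier[of E h T y] v pv(5) f(2) by simp_all
    ultimately show "h f k = h e k"
      unfolding form_coord[OF y f(1) kf] form_coord[OF y e kf]
      using minus_scalar_prod_distrib[of "G y *\<^sub>v snd T e" r _ "conjugate (snd T k)"] ck by simp
  qed
  then show ?thesis using f by simp
qed

lemma (in hermitian_sequence) fiber_adjoint_coord:
  assumes y: "y \<in> W" and b: "b \<in> fiber H y"
  shows "snd T (fiber_adjoint E h H h' p b) = sm y *\<^sub>v snd T' b"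
proof -
  have y': "vb_proj H b = y" using b by (simp add: fiber_def)
  have cb: "snd T' b \<in> carrier_vec q" by (rule triv_coord(1)[OF H W_D(3)[OF y] b])
  have "sm y *\<^sub>v snd T' b \<in> carrier_vec r" using sm_carrier[OF y] cb by simp
  then obtain f where f: "f \<in> fiber E y" "snd T f = sm y *\<^sub>v snd T' b" using coord_onto[OF y] by blast
  have form: "h f v = h' b (p v)" if v: "v \<in> fiber E y" for v
    using gram_form[OF H metrics(2) W_D(3)[OF y] b p_fiber[OF v]] G_proj_perp[OF y cb coord[OF y v]]
      form_coord[OF y f(1) v] p_coord[OF y v] f(2) by simp
  have "fiber_adjoint E h H h' p b = f"
    unfolding fiber_adjoint_def y'
  proof (rule the_equality)
    fix w assume w: "w \<in> fiber E y \<and> (\<forall>v\<in>fiber E y. h w v = h' b (p v))"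
    obtain d where d: "d \<in> fiber E y" "snd T d = snd T w - snd T f"
      using coord_onto[OF y, of "snd T w - snd T f"] coord[OF y f(1)] coord[OF y, of w] w by auto
    show "w = f" by (rule eq_if_same_form[OF y _ f(1) d]) (use w d form in auto)
  qed (use f form in auto)
  then show ?thesis using f by simp
qed

lemma (in hermitian_sequence) proj_mats:
  assumes y: "y \<in> W"
  shows "proj_mat E h T S y = mat_const (proj_sub y)" "proj_mat E h T (perp E h S) y = mat_const (proj_perp y)"
    "hom_mat E T H T' p y = mat_const (gm y)" "hom_mat H T' E T (fiber_adjoint E h H h' p) y = mat_const (sm y)"
  unfolding proj_mat_def
  by (rule hom_mat_eq[OF E W_D(2)[OF y] carriers(9)[OF y] orth_proj_S[OF y]], assumption,
    rule hom_mat_eq[OF E W_D(2)[OF y] carriers(8)[OF y] orth_proj_perp[OF y]], assumption,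
    rule hom_mat_eq[OF E W_D(2)[OF y] gm_carrier[OF y] p_coord[OF y]], assumption,
    rule hom_mat_eq[OF H W_D(3)[OF y] sm_carrier[OF y] fiber_adjoint_coord[OF y]], assumption)

lemma (in hermitian_sequence) chern_conn_eq: "chern_conn c E h T = conn" "chern_conn c H h' T' = conn_quot"
  by (simp_all add: fun_eq_iff chern_conn_def conn_def conn_quot_def del_def)

lemma (in hermitian_sequence) mat_deriv_ext_d_cong:
  "y \<in> W \<Longrightarrow> (\<And>y. y \<in> W \<Longrightarrow> M y = N y) \<Longrightarrow> mat_deriv (ext_d c) M y = mat_deriv (ext_d c) N y"
  unfolding mat_deriv_ext_d
  by (intro arg_cong2[of _ _ _ _ "(+)"] region.mat_deriv_cong directional_d10 directional_d01)

lemma (in hermitian_sequence) second_fund_eq: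
  assumes y: "y \<in> W"
  shows "second_fund c E h T S y = sff y" "second_fund_adj c E h T S y = sff_adj y"
    "second_fund_square c E h T S H h' T' p y = mat_const (gm y) * (sff y * sff_adj y) * mat_const (sm y)"
proof -
  have cov: "cov_deriv c conn M y = cov_deriv c conn N y" if eq: "\<And>y. y \<in> W \<Longrightarrow> M y = N y" for M N
  proof -
    have "mat_deriv (ext_d c) M y = mat_deriv (ext_d c) N y" by (rule mat_deriv_ext_d_cong[OF y eq])
    then show ?thesis by (simp only: cov_deriv_def eq[OF y])
  qed
  show 1: "second_fund c E h T S y = sff y"
    unfolding second_fund_def sff_def chern_conn_eq proj_mats(2)[OF y] by (subst cov[OF proj_mats(1)]) simp_all
  show 2: "second_fund_adj c E h T S y = sff_adj y"
    unfolding second_fund_adj_def sff_adj_def chern_conn_eq proj_mats(1)[OF y] by (subst cov[OF proj_mats(2)]) simp_all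
  show "second_fund_square c E h T S H h' T' p y = mat_const (gm y) * (sff y * sff_adj y) * mat_const (sm y)"
    by (simp only: second_fund_square_def 1 2 proj_mats(3,4)[OF y])
qed

lemma (in hermitian_sequence) curv_u_eq:
  assumes y: "y \<in> W"
  shows "curv_u u c E h T S y = conn_curv c (\<lambda>y. conn y + form_const (of_real (u - 1)) \<cdot>\<^sub>m sff y) y"
  unfolding curv_u_def conn_curv_def chern_conn_eq
  by (subst mat_deriv_ext_d_cong[OF y, of _ "\<lambda>y. conn y + form_const (of_real (u - 1)) \<cdot>\<^sub>m sff y"])
    (simp_all add: second_fund_eq y)

lemma (in hermitian_sequence) chern_curv_eq: "chern_curv c H h' T' y = mat_deriv (alt_deriv d01 c) conn_quot y"
  by (simp add: chern_curv_def delbar_def chern_conn_eq)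

theorem (in hermitian_sequence) curv_u_quotient:
  assumes y: "y \<in> W"
  shows "mat_const (gm y) * curv_u u c E h T S y * mat_const (sm y) =
    chern_curv c H h' T' y - form_const (of_real u) \<cdot>\<^sub>m second_fund_square c E h T S H h' T' p y"
  unfolding curv_u_eq[OF y] chern_curv_eq second_fund_eq(3)[OF y]
  by (rule curvature_of_deformed_connection[OF y])

lemma (in hermitian_sequence) curv_u_carrier: "y \<in> W \<Longrightarrow> curv_u u c E h T S y \<in> carrier_mat r r"
  using carriers(10)[of y] carriers(15)[of y]
  by (auto simp: curv_u_def conn_curv_def chern_conn_eq second_fund_eq intro!: add_carrier_mat mult_carrier_mat[of _ r r])

lemma (in hermitian_sequence) chern_curv_carrier: "y \<in> W \<Longrightarrow> chern_curv c H h' T' y \<in> carrier_mat q q"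
  unfolding chern_curv_eq by (rule mat_deriv_smooth_carrier[OF smooth_mats(2)])

lemma (in hermitian_sequence) homogeneous_chern_curv:
  assumes y: "y \<in> W" and ij: "i < q" "j < q"
  shows "homogeneous 2 (chern_curv c H h' T' y $$ (i, j))"
proof -
  have "homogeneous (Suc 1) (alt_deriv d01 c (\<lambda>y. conn_quot y $$ (i, j)) y)"
    by (rule region.homogeneous_alt_deriv[OF directional_d01 smooth_mat_entry[OF smooth_mats(2) ij] y homogeneous_conn_quot[OF _ ij]])
  then show ?thesis
    using carriers(11)[OF y] ij by (simp add: chern_curv_eq mat_deriv_def numeral_2_eq_2)
qed

section \<open>Line subbundles\<close>

lemma mat_trace_mult_commute:
  fixes A B :: "'a::comm_ring_1 Matrix.mat"
  assumes A: "A \<in> carrier_mat m n" and B: "B \<in> carrier_mat n m"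
  shows "mat_trace (A * B) = mat_trace (B * A)"
proof -
  have "mat_trace (A * B) = (\<Sum>i<m. \<Sum>j<n. A $$ (i, j) * B $$ (j, i))"
    using A B by (simp add: mat_trace_def index_mult_mat_sum[OF A B] del: index_mult_mat(1))
  also have "\<dots> = (\<Sum>j<n. \<Sum>i<m. B $$ (j, i) * A $$ (i, j))"
    by (subst sum.swap) (simp add: mult.commute)
  also have "\<dots> = mat_trace (B * A)"
    using A B by (simp add: mat_trace_def index_mult_mat_sum[OF B A] del: index_mult_mat(1))
  finally show ?thesis .
qed

text \<open>The columns of the projection onto the kernel of \<open>p\<close> are multiples of \<open>f0\<close>, which yields the factorization. The
  relation between the ranks follows by taking traces in \<open>1 = f \<phi> + s g\<close>.\<close>

lemma (in hermitian_sequence) line_splitting: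
  assumes y: "y \<in> W" and f0: "f0 \<in> carrier_vec r" "f0 \<noteq> 0\<^sub>v r" "gm y *\<^sub>v f0 = 0\<^sub>v q"
    and ker: "\<And>v. v \<in> carrier_vec r \<Longrightarrow> gm y *\<^sub>v v = 0\<^sub>v q \<Longrightarrow> \<exists>a. v = a \<cdot>\<^sub>v f0"
  obtains f \<phi> where "f \<in> carrier_mat r 1" "\<phi> \<in> carrier_mat 1 r" "f * \<phi> = proj_sub y"
    "\<phi> * f = 1\<^sub>m 1" "\<phi> * sm y = 0\<^sub>m 1 q" "gm y * f = 0\<^sub>m q 1" "r = Suc q"
proof -
  note c = gm_carrier[OF y] sm_carrier[OF y] and P = carriers(9)[OF y]
  obtain i0 where i0: "i0 < r" "f0 $ i0 \<noteq> 0"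
    using f0 by (metis carrier_vecD eq_vecI index_zero_vec)
  have "\<exists>a. col (proj_sub y) j = a \<cdot>\<^sub>v f0" if j: "j < r" for j
  proof -
    have "proj_sub y *\<^sub>v unit_vec r j = col (proj_sub y) j" using P j by (intro eq_vecI) auto
    then show ?thesis
      using ker[OF proj_mult_vec(6,4)[OF y unit_vec_carrier]] by metis
  qed
  then obtain a where a: "\<And>j. j < r \<Longrightarrow> col (proj_sub y) j = a j \<cdot>\<^sub>v f0" by metis
  define f where "f = Matrix.mat r 1 (\<lambda>(i, j). f0 $ i)"
  define \<phi> where "\<phi> = Matrix.mat 1 r (\<lambda>(i, j). a j)"
  have f: "f \<in> carrier_mat r 1" and \<phi>: "\<phi> \<in> carrier_mat 1 r" by (simp_all add: f_def \<phi>_def)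
  have f\<phi>: "f * \<phi> = proj_sub y"
  proof (rule eq_matI)
    fix i j assume "i < dim_row (proj_sub y)" "j < dim_col (proj_sub y)"
    then have ij: "i < r" "j < r" using P by auto
    have "proj_sub y $$ (i, j) = col (proj_sub y) j $ i" using P ij by simp
    then show "(f * \<phi>) $$ (i, j) = proj_sub y $$ (i, j)"
      using ij f0(1) by (simp add: a f_def \<phi>_def scalar_prod_def)
  qed (use f \<phi> P in auto)
  have gf: "gm y * f = 0\<^sub>m q 1"
  proof (rule eq_matI)
    fix i j assume "i < dim_row (0\<^sub>m q 1 :: complex Matrix.mat)" "j < dim_col (0\<^sub>m q 1 :: complex Matrix.mat)"
    then have ij: "i < q" "j = 0" by auto
    have "(gm y * f) $$ (i, j) = (gm y *\<^sub>v f0) $ i"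
      using ij c f0(1) by (simp add: f_def scalar_prod_def)
    then show "(gm y * f) $$ (i, j) = 0\<^sub>m q 1 $$ (i, j)" using ij by (simp add: f0(3))
  qed (use c f in auto)
  have cancel: "M = N" if "f * M = f * N" "M \<in> carrier_mat 1 k" "N \<in> carrier_mat 1 k" for M N k
  proof (rule eq_matI)
    fix i j assume "i < dim_row N" "j < dim_col N"
    then have ij: "i = 0" "j < k" using that by auto
    have "(f * M) $$ (i0, j) = (f * N) $$ (i0, j)" using that(1) by simp
    then have "f0 $ i0 * M $$ (0, j) = f0 $ i0 * N $$ (0, j)"
      using ij i0(1) that(2,3) by (simp add: f_def scalar_prod_def)
    then show "M $$ (i, j) = N $$ (i, j)" using i0(2) ij by simp
  qed (use that in auto)
  have Pf: "proj_sub y * f = f"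
  proof -
    have "proj_sub y * f = 1\<^sub>m r * f - (sm y * gm y) * f"
      unfolding proj_sub_def by (rule minus_mult_distrib_mat[OF one_carrier_mat mult_carrier_mat[OF c(2,1)] f])
    also have "(sm y * gm y) * f = 0\<^sub>m r 1"
      using assoc_mult_mat[OF c(2,1) f] c by (simp add: gf)
    finally show ?thesis using f by (auto intro!: eq_matI)
  qed
  have Ps: "proj_sub y * sm y = 0\<^sub>m r q"
  proof -
    have "proj_sub y * sm y = 1\<^sub>m r * sm y - (sm y * gm y) * sm y"
      unfolding proj_sub_def by (rule minus_mult_distrib_mat[OF one_carrier_mat mult_carrier_mat[OF c(2,1)] c(2)])
    also have "(sm y * gm y) * sm y = sm y"
      using assoc_mult_mat[OF c(2,1) c(2)] c by (simp add: gm_sm[OF y])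
    finally show ?thesis using c by (auto intro!: eq_matI)
  qed
  have \<phi>f: "\<phi> * f = 1\<^sub>m 1"
  proof (rule cancel)
    show "f * (\<phi> * f) = f * 1\<^sub>m 1" using assoc_mult_mat[OF f \<phi> f] f by (simp add: f\<phi> Pf)
  qed (use \<phi> f in auto)
  have \<phi>s: "\<phi> * sm y = 0\<^sub>m 1 q"
  proof (rule cancel)
    show "f * (\<phi> * sm y) = f * 0\<^sub>m 1 q" using assoc_mult_mat[OF f \<phi> c(2)] f by (simp add: f\<phi> Ps)
  qed (use \<phi> c in auto)
  have "mat_trace (proj_sub y) + mat_trace (sm y * gm y) = mat_trace (1\<^sub>m r :: complex Matrix.mat)"
    using c by (simp add: proj_sub_def mat_trace_def sum_subtractf)
  moreover have "mat_trace (proj_sub y) = 1"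
    using mat_trace_mult_commute[OF f \<phi>] by (simp add: f\<phi> \<phi>f mat_trace_def)
  moreover have "mat_trace (sm y * gm y) = of_nat q"
    using mat_trace_mult_commute[OF c(2,1)] by (simp add: gm_sm[OF y] mat_trace_def)
  moreover have "mat_trace (1\<^sub>m r :: complex Matrix.mat) = of_nat r" by (simp add: mat_trace_def)
  ultimately have "(of_nat (Suc q) :: complex) = of_nat r" by simp
  then have "r = Suc q" using of_nat_eq_iff by metis
  then show thesis using that[OF f \<phi> f\<phi> \<phi>f \<phi>s gf] by blast
qed

text \<open>Since \<open>A\<close> vanishes on the orthogonal complement, \<open>A = A P\<^sub>F = (A f) \<phi>\<close>, so that \<open>A \<and> A\<^sup>*\<close> is the product of the
  column \<open>g A f\<close> and the row \<open>\<phi> A\<^sup>* s\<close> of 1-forms.\<close>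

lemma (in hermitian_sequence) second_fund_square_rank_one:
  assumes y: "y \<in> W" and f: "f \<in> carrier_mat r 1" and \<phi>: "\<phi> \<in> carrier_mat 1 r" and f\<phi>: "f * \<phi> = proj_sub y"
  obtains a b where "\<And>i. i < q \<Longrightarrow> homogeneous 1 (a i)" "\<And>j. j < q \<Longrightarrow> homogeneous 1 (b j)"
    "\<And>i j. i < q \<Longrightarrow> j < q \<Longrightarrow> second_fund_square c E h T S H h' T' p y $$ (i, j) = a i * b j"
    "second_fund_square c E h T S H h' T' p y \<in> carrier_mat q q"
proof -
  note c = gm_carrier[OF y] sm_carrier[OF y] carriers(15)[OF y] carriers(16)[OF y] and mc = mat_const_carrier
  let ?E = "fsmat_of :: (complex ^ 'n) altform Matrix.mat \<Rightarrow> _"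
  define col where "col = mat_const (gm y) * sff y * mat_const f"
  define row where "row = mat_const \<phi> * sff_adj y * mat_const (sm y)"
  have gA: "mat_const (gm y) * sff y \<in> carrier_mat q r" and \<phi>A: "mat_const \<phi> * sff_adj y \<in> carrier_mat 1 r"
    by (rule mult_carrier_mat[OF mc[OF c(1)] c(3)], rule mult_carrier_mat[OF mc[OF \<phi>] c(4)])
  have col: "col \<in> carrier_mat q 1" and row: "row \<in> carrier_mat 1 q"
    unfolding col_def row_def by (rule mult_carrier_mat[OF gA mc[OF f]], rule mult_carrier_mat[OF \<phi>A mc[OF c(2)]])
  have AA: "sff y * sff_adj y \<in> carrier_mat r r" by (rule mult_carrier_mat[OF c(3,4)])
  have Q: "mat_const (gm y) * (sff y * sff_adj y) * mat_const (sm y) \<in> carrier_mat q q"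
    by (rule mult_carrier_mat[OF mult_carrier_mat[OF mc[OF c(1)] AA] mc[OF c(2)]])
  have one: "?E (1\<^sub>m r) = ?E (mat_const f) * ?E (mat_const \<phi>) + ?E (mat_const (sm y)) * ?E (mat_const (gm y))"
    using fsmat_units(3)[OF y]
    by (simp add: fsmat_of_mult[OF mc[OF f] mc[OF \<phi>], symmetric] mat_const_mult[OF f \<phi>, symmetric] f\<phi>)
  have A: "?E (sff y) = ?E (sff y) * (?E (mat_const f) * ?E (mat_const \<phi>))"
    using fsmat_of_one_right[OF c(3)] unfolding one
    by (simp add: distrib_left mult.assoc[of _ "?E (mat_const (sm y))", symmetric] gauss_equations(1)[OF y])
  have "mat_const (gm y) * (sff y * sff_adj y) * mat_const (sm y) = col * row"
  proof (rule fsmat_of_inject[OF Q mult_carrier_mat[OF col row]])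
    show "?E (mat_const (gm y) * (sff y * sff_adj y) * mat_const (sm y)) = ?E (col * row)"
      unfolding fsmat_of_mult[OF col row] unfolding col_def row_def fsmat_of_mult[OF gA mc[OF f]] fsmat_of_mult[OF \<phi>A mc[OF c(2)]]
        fsmat_of_mult[OF mult_carrier_mat[OF mc[OF c(1)] AA] mc[OF c(2)]] fsmat_of_mult[OF mc[OF c(1)] AA]
        fsmat_of_mult[OF c(3,4)] fsmat_of_mult[OF mc[OF c(1)] c(3)] fsmat_of_mult[OF mc[OF \<phi>] c(4)]
      by (subst A) (simp only: mult.assoc)
  qed
  then have eq: "second_fund_square c E h T S H h' T' p y = col * row" by (simp add: second_fund_eq(3)[OF y])
  show thesis
  proof (rule that)
    show "homogeneous 1 (col $$ (i, 0))" if "i < q" for i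
      unfolding col_def
      by (rule mat_one_form_mult_const[OF gA f mat_const_mult_one_form[OF c(1,3) homogeneous_sff(1)[OF y]] that]) simp_all
    show "homogeneous 1 (row $$ (0, j))" if "j < q" for j
      unfolding row_def
      by (rule mat_one_form_mult_const[OF \<phi>A c(2) mat_const_mult_one_form[OF \<phi> c(4) homogeneous_sff(2)[OF y]] _ that]) simp_all
    show "second_fund_square c E h T S H h' T' p y $$ (i, j) = col $$ (i, 0) * row $$ (0, j)" if "i < q" "j < q" for i j
      unfolding eq using index_mult_mat_sum[OF col row that] by simp
    show "second_fund_square c E h T S H h' T' p y \<in> carrier_mat q q"
      unfolding eq by (rule mult_carrier_mat[OF col row])
  qed
qed

section \<open>Even forms and nilpotence\<close>

lemma form_app_span_zero:
  assumes v: "v \<in> span (set ws)"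
  shows "form_app w (us @ v # ws @ xs) = 0"
proof -
  have swap: "form_app w (us @ a # b # xs) = - form_app w (us @ b # a # xs)" for us xs a b
  proof -
    note lin = alternating_linear[OF alternating_form_app[of w]] and rep = alternating_repeat[OF alternating_form_app[of w]]
    have "form_app w (us @ (a + b) # (a + b) # xs) = form_app w (us @ a # (a + b) # xs) + form_app w (us @ b # (a + b) # xs)"
      by (rule linear_add[OF lin])
    also have "\<dots> = (form_app w (us @ a # a # xs) + form_app w (us @ a # b # xs)) +
        (form_app w (us @ b # a # xs) + form_app w (us @ b # b # xs))"
      using linear_add[OF lin[of "us @ [a]" xs], of a b] linear_add[OF lin[of "us @ [b]" xs], of a b] by simp
    finally show ?thesis using rep by (simp add: eq_neg_iff_add_eq_0)
  qed
  have mem: "form_app w (us @ v # ws @ xs) = 0" if "v \<in> set ws" for us v ws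
    using that
  proof (induction ws arbitrary: us)
    case (Cons a ws)
    show ?case
    proof (cases "v = a")
      case True
      then show ?thesis using alternating_repeat[OF alternating_form_app] by simp
    next
      case False
      then have "form_app w ((us @ [a]) @ v # ws @ xs) = 0" using Cons by (intro Cons.IH) simp
      then show ?thesis using swap[of us v a "ws @ xs"] by simp
    qed
  qed simp
  show ?thesis
    using v
  proof (induction rule: span_induct)
    case base
    note L = alternating_linear[OF alternating_form_app[of w], of us "ws @ xs"]
    show ?case by (simp add: subspace_def linear_0[OF L] linear_add[OF L] linear_scale[OF L])
  next
    case (step v)
    then show ?case by (rule mem)
  qed
qed

text \<open>More vectors than the dimension are linearly dependent.\<close>

lemma form_app_large_zero:
  fixes w :: "'v::euclidean_space altform"
  assumes "length vs > DIM('v)"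
  shows "form_app w vs = 0"
proof (rule ccontr)
  assume nz: "form_app w vs \<noteq> 0"
  have "distinct xs \<and> independent (set xs)" if "vs = us @ xs" for us xs
    using that
  proof (induction xs arbitrary: us)
    case (Cons a xs)
    have IH: "distinct xs \<and> independent (set xs)" by (rule Cons.IH[of "us @ [a]"]) (use Cons.prems in simp)
    have "a \<notin> span (set xs)"
      using form_app_span_zero[of a xs w us "[]"] nz Cons.prems by auto
    then show ?case using IH span_base[of a "set xs"] by (auto simp: independent_insert)
  qed (simp add: independent_empty)
  then have "distinct vs \<and> independent (set vs)" by simp
  then show False
    using independent_card_le[of "set vs"] assms by (simp add: distinct_card)
qed

lemma form_app_of_even_simps:
  "form_app (of_even (a + b)) vs = form_app (of_even a) vs + form_app (of_even b) vs"
  "form_app (of_even (- a)) vs = - form_app (of_even a) vs"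
  "form_app (of_even (a - b)) vs = form_app (of_even a) vs - form_app (of_even b) vs"
  "form_app (of_even 0) vs = 0"
  "form_app (of_even (a * b)) vs = wedge (form_app (of_even a)) (form_app (of_even b)) vs"
  by (simp_all add: plus_evenform.rep_eq uminus_evenform.rep_eq minus_evenform.rep_eq zero_evenform.rep_eq
    times_evenform.rep_eq form_app_simps times_altform.rep_eq)

lemma form_app_of_even_sum: "form_app (of_even (\<Sum>i\<in>I. f i)) vs = (\<Sum>i\<in>I. form_app (of_even (f i)) vs)"
  by (induction I rule: infinite_finite_induct) (simp_all add: form_app_of_even_simps)

lemma evenform_eqI: "(\<And>vs. form_app (of_even a) vs = form_app (of_even b) vs) \<Longrightarrow> a = b"
  by (metis altform_eqI of_even_inject)

lemma form_app_even_part: "form_app (of_even (even_part w)) vs = (if even (length vs) then form_app w vs else 0)"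
  by (simp add: even_part.rep_eq form_even.rep_eq)

lemma even_part_add: "even_part (v + w) = even_part v + even_part w"
  and even_part_diff: "even_part (v - w) = even_part v - even_part w"
  and even_part_0 [simp]: "even_part 0 = 0"
  by (rule evenform_eqI; simp add: form_app_even_part form_app_of_even_simps form_app_simps)+

lemma even_part_sum: "even_part (\<Sum>i\<in>I. f i) = (\<Sum>i\<in>I. even_part (f i))"
  by (induction I rule: infinite_finite_induct) (simp_all add: even_part_add)

lemma form_app_even_const_mult:
  fixes w :: "'v::real_vector evenform"
  shows "form_app (of_even (even_const a * w)) vs = a * form_app (of_even w) vs"
proof -
  have "of_even (even_const a :: 'v evenform) = form_const a"
    by (rule altform_eqI) (simp add: even_const_def form_app_even_part form_app_simps)
  then show ?thesis by (simp add: times_evenform.rep_eq form_app_const_mult)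
qed

lemma even_part_const_mult: "even_part (form_const a * w) = even_const a * even_part w"
  by (rule evenform_eqI) (simp add: form_app_even_const_mult form_app_even_part form_app_const_mult)

lemma even_part_mult_const: "even_part (w * form_const a) = even_part w * even_const a"
  by (simp add: form_const_commute even_part_const_mult mult.commute)

lemma even_const_0 [simp]: "even_const 0 = 0" by (simp add: even_const_def)

lemma even_const_1 [simp]: "even_const 1 = 1"
proof (rule evenform_eqI)
  fix vs :: "'a list"
  have "form_app (1 :: 'a altform) vs = (if vs = [] then 1 else 0)"
    by (simp only: one_altform_def form_const.rep_eq)
  then show "form_app (of_even (even_const 1)) vs = form_app (of_even 1) vs"
    by (auto simp: even_const_def form_app_even_part one_evenform.rep_eq)
qed

lemma even_const_mult: "even_const (a * b) = even_const a * even_const b"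
  by (rule evenform_eqI) (simp add: form_app_even_const_mult, simp add: even_const_def form_app_even_part form_app_simps)

lemma even_const_add: "even_const (a + b) = even_const a + even_const b"
  by (simp add: even_const_def form_const_add even_part_add)

lemma even_const_minus: "even_const (- a) = - even_const a"
  using even_const_add[of a "- a"] by (simp add: eq_neg_iff_add_eq_0 add.commute)

interpretation even_const: comm_ring_hom even_const
  by unfold_locales (simp_all add: even_const_add even_const_mult)

lemma even_part_mult:
  fixes v w :: "'a::real_vector altform"
  assumes "homogeneous (2 * a) v" "homogeneous (2 * b) w"
  shows "even_part (v * w) = even_part v * even_part w"
proof -
  have *: "of_even (even_part u) = u" if "homogeneous (2 * k) u" for u :: "'a altform" and k
  proof (rule altform_eqI)
    fix vs :: "'a list"
    have "length vs \<noteq> 2 * k" if "odd (length vs)" using that by auto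
    then show "form_app (of_even (even_part u)) vs = form_app u vs"
      using \<open>homogeneous (2 * k) u\<close> by (simp add: form_app_even_part homogeneous_def)
  qed
  have "homogeneous (2 * (a + b)) (v * w)" using homogeneous_mult[OF assms] by (simp add: algebra_simps)
  from *[OF this] have "of_even (even_part (v * w)) = of_even (even_part v * even_part w)"
    by (simp only: *[OF assms(1)] *[OF assms(2)] times_evenform.rep_eq)
  then show ?thesis by (simp add: of_even_inject)
qed

text \<open>Even forms have no 2-torsion, as \<open>det_one_minus_anti_rank_one\<close> requires.\<close>

lemma evenform_double_zero:
  fixes x :: "'v::real_vector evenform"
  assumes "x + x = 0" shows "x = 0"
proof (rule evenform_eqI)
  fix vs
  have "form_app (of_even x) vs + form_app (of_even x) vs = 0"
    unfolding form_app_of_even_simps(1)[symmetric] assms by (rule form_app_of_even_simps(4))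
  then show "form_app (of_even x) vs = form_app (of_even 0) vs" by (simp add: form_app_of_even_simps)
qed

lemma evenform_poly_double_zero:
  fixes x :: "'v::real_vector evenform poly"
  assumes "x + x = 0" shows "x = 0"
proof (rule poly_eqI)
  fix n
  have "poly.coeff x n + poly.coeff x n = 0"
    unfolding coeff_add[symmetric] assms by (rule coeff_0)
  then show "poly.coeff x n = poly.coeff 0 n" using evenform_double_zero by (simp only: coeff_0)
qed

text \<open>The powers of the ideal of forms of positive degree, as a filtration of the even forms.\<close>

definition min_degree :: "nat \<Rightarrow> 'v::real_vector evenform \<Rightarrow> bool" where
  "min_degree k w \<longleftrightarrow> (\<forall>vs. length vs < k \<longrightarrow> form_app (of_even w) vs = 0)"

lemma wedge_min_degree:
  assumes "\<And>ws. length ws < a \<Longrightarrow> f ws = 0" "\<And>ws. length ws < b \<Longrightarrow> g ws = 0" "length vs < a + b"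
  shows "wedge f g vs = 0"
  using assms
proof (induction vs arbitrary: f g a b)
  case Nil
  then show ?case by (cases "a = 0") auto
next
  case (Cons v vs)
  have "wedge (\<lambda>ws. f (v # ws)) g vs = 0"
    using Cons.prems by (intro Cons.IH[of "a - 1" _ b]) (auto intro: Cons.prems(1))
  moreover have "wedge (\<lambda>ws. (-1) ^ length ws * f ws) (\<lambda>ws. g (v # ws)) vs = 0"
    using Cons.prems by (intro Cons.IH[of a _ "b - 1"]) auto
  ultimately show ?case by simp
qed

lemma min_degree_mult: "min_degree a v \<Longrightarrow> min_degree b w \<Longrightarrow> min_degree (a + b) (v * w)"
  unfolding min_degree_def form_app_of_even_simps using wedge_min_degree by blast

lemma min_degree_0 [simp]: "min_degree 0 w" and min_degree_zero [simp]: "min_degree k 0"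
  and min_degree_add: "min_degree k v \<Longrightarrow> min_degree k w \<Longrightarrow> min_degree k (v + w)"
  by (auto simp: min_degree_def form_app_of_even_simps)

lemma min_degree_uminus: "min_degree k w \<Longrightarrow> min_degree k (- w)"
  by (auto simp: min_degree_def form_app_of_even_simps)

lemma min_degree_sum: "(\<And>i. i \<in> I \<Longrightarrow> min_degree k (f i)) \<Longrightarrow> min_degree k (\<Sum>i\<in>I. f i)"
  by (induction I rule: infinite_finite_induct) (auto intro: min_degree_add)

lemma min_degree_mono: "min_degree a w \<Longrightarrow> b \<le> a \<Longrightarrow> min_degree b w"
  by (auto simp: min_degree_def)

lemma min_degree_large:
  fixes w :: "'v::euclidean_space evenform"
  assumes "min_degree k w" "DIM('v) < k"
  shows "w = 0"
proof (rule evenform_eqI)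
  fix vs
  show "form_app (of_even w) vs = form_app (of_even 0) vs"
  proof (cases "length vs < k")
    case True
    then show ?thesis using assms(1) by (simp add: min_degree_def form_app_of_even_simps)
  next
    case False
    then show ?thesis using assms(2) form_app_large_zero[of vs "of_even w"] by (simp add: form_app_of_even_simps)
  qed
qed

lemma min_degree_even_part: "homogeneous k w \<Longrightarrow> min_degree k (even_part w)"
  by (auto simp: min_degree_def homogeneous_def form_app_even_part)

definition poly_min_degree :: "nat \<Rightarrow> 'v::real_vector evenform poly \<Rightarrow> bool" where
  "poly_min_degree k p \<longleftrightarrow> (\<forall>i. min_degree k (poly.coeff p i))"

lemma poly_min_degree_0 [simp]: "poly_min_degree 0 p" and poly_min_degree_zero [simp]: "poly_min_degree k 0"
  and poly_min_degree_add: "poly_min_degree k p \<Longrightarrow> poly_min_degree k p' \<Longrightarrow> poly_min_degree k (p + p')"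
  and poly_min_degree_uminus: "poly_min_degree k p \<Longrightarrow> poly_min_degree k (- p)"
  and poly_min_degree_monom: "min_degree k w \<Longrightarrow> poly_min_degree k (Polynomial.monom w n)"
  by (auto simp: poly_min_degree_def intro: min_degree_add min_degree_uminus)

lemma poly_min_degree_mult: "poly_min_degree a p \<Longrightarrow> poly_min_degree b p' \<Longrightarrow> poly_min_degree (a + b) (p * p')"
  unfolding poly_min_degree_def coeff_mult by (auto intro!: min_degree_sum min_degree_mult)

lemma poly_min_degree_sum: "(\<And>i. i \<in> I \<Longrightarrow> poly_min_degree k (f i)) \<Longrightarrow> poly_min_degree k (\<Sum>i\<in>I. f i)"
  by (induction I rule: infinite_finite_induct) (auto intro: poly_min_degree_add)

lemma poly_min_degree_power: "poly_min_degree a p \<Longrightarrow> poly_min_degree (a * k) (p ^ k)"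
  by (induction k) (auto dest: poly_min_degree_mult)

lemma poly_min_degree_large:
  fixes p :: "'v::euclidean_space evenform poly"
  shows "poly_min_degree k p \<Longrightarrow> DIM('v) < k \<Longrightarrow> p = 0"
  unfolding poly_min_degree_def by (intro poly_eqI, simp only: coeff_0) (blast intro: min_degree_large)

lemma poly_min_degree_nilpotent:
  fixes p :: "'v::euclidean_space evenform poly"
  assumes "poly_min_degree 1 p"
  shows "p ^ Suc (DIM('v)) = 0"
  using poly_min_degree_power[OF assms, of "Suc (DIM('v))"] by (intro poly_min_degree_large[of "Suc (DIM('v))"]) simp_all

lemma mat_power_min_degree:
  fixes N :: "'v::real_vector evenform poly Matrix.mat"
  assumes N: "N \<in> carrier_mat n n" and deg: "\<And>i j. i < n \<Longrightarrow> j < n \<Longrightarrow> poly_min_degree 1 (N $$ (i, j))"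
  shows "i < n \<Longrightarrow> j < n \<Longrightarrow> poly_min_degree k ((N ^\<^sub>m k) $$ (i, j))"
proof (induction k arbitrary: i j)
  case (Suc k)
  have car: "N ^\<^sub>m k \<in> carrier_mat n n" using N by simp
  have "(N ^\<^sub>m Suc k) $$ (i, j) = (\<Sum>l<n. (N ^\<^sub>m k) $$ (i, l) * N $$ (l, j))"
    using index_mult_mat_sum[OF car N Suc.prems] by simp
  moreover have "poly_min_degree (k + 1) ((N ^\<^sub>m k) $$ (i, l) * N $$ (l, j))" if "l < n" for l
    using Suc.IH[OF Suc.prems(1) that] deg[OF that Suc.prems(2)] by (rule poly_min_degree_mult)
  ultimately show ?case by (auto intro!: poly_min_degree_sum)
qed simp

text \<open>The geometric series of a nilpotent matrix telescopes.\<close>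

lemma unip_inverse_inverse:
  fixes M :: "'a::comm_ring_1 Matrix.mat"
  assumes M: "M \<in> carrier_mat n n" and nil: "\<exists>m. (1\<^sub>m n - M) ^\<^sub>m m = 0\<^sub>m n n"
  shows "unip_inverse M \<in> carrier_mat n n" "M * unip_inverse M = 1\<^sub>m n"
proof -
  define N where "N = 1\<^sub>m n - M"
  have N: "N \<in> carrier_mat n n" using M by (simp add: N_def minus_carrier_mat)
  have Npow: "N ^\<^sub>m k \<in> carrier_mat n n" for k using N by simp
  define m where "m = (LEAST m. N ^\<^sub>m m = 0\<^sub>m n n)"
  have m: "N ^\<^sub>m m = 0\<^sub>m n n"
    unfolding m_def by (rule LeastI_ex) (use nil in \<open>simp only: N_def\<close>)
  define P where "P = (\<lambda>m. Matrix.mat n n (\<lambda>(i, j). \<Sum>k<m. (N ^\<^sub>m k) $$ (i, j)))"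
  have P: "P k \<in> carrier_mat n n" for k by (simp add: P_def)
  have inv: "unip_inverse M = P m"
    using carrier_matD(1)[OF M] by (simp only: unip_inverse_def Let_def P_def m_def N_def)
  show "unip_inverse M \<in> carrier_mat n n" by (simp add: inv P)
  have "P k - N * P k = 1\<^sub>m n - N ^\<^sub>m k" for k
  proof (induction k)
    case 0
    have P0: "P 0 = 0\<^sub>m n n" by (rule eq_matI) (auto simp: P_def)
    show ?case unfolding P0 using N by (auto intro!: eq_matI)
  next
    case (Suc k)
    have step: "P (Suc k) = P k + N ^\<^sub>m k"
    proof (rule eq_matI)
      fix i j assume "i < dim_row (P k + N ^\<^sub>m k)" "j < dim_col (P k + N ^\<^sub>m k)"
      then have "i < n" "j < n" using carrier_matD[OF Npow[of k]] by (simp_all only: index_add_mat)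
      then show "P (Suc k) $$ (i, j) = (P k + N ^\<^sub>m k) $$ (i, j)"
        using carrier_matD[OF Npow[of k]] by (simp only: P_def index_mat index_add_mat split sum.lessThan_Suc)
    qed (simp_all only: carrier_matD[OF P] carrier_matD[OF Npow] index_add_mat)
    have comm: "N * N ^\<^sub>m k = N ^\<^sub>m Suc k"
    proof (induction k)
      case (Suc k)
      have "N * (N ^\<^sub>m k * N) = (N * N ^\<^sub>m k) * N" by (rule assoc_mult_mat[symmetric, OF N Npow N])
      also have "\<dots> = N ^\<^sub>m Suc k * N" by (simp only: Suc)
      finally show ?case by (simp only: pow_mat.simps)
    qed (use N in simp)
    have NP: "N * P (Suc k) = N * P k + N ^\<^sub>m Suc k"
      by (simp only: step mult_add_distrib_mat[OF N P Npow] comm)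
    have telescope: "(A + X) - (B + Y) = 1\<^sub>m n - Y"
      if "A - B = 1\<^sub>m n - X" "A \<in> carrier_mat n n" "B \<in> carrier_mat n n" "X \<in> carrier_mat n n" "Y \<in> carrier_mat n n"
      for A B X Y :: "'a Matrix.mat"
    proof (rule eq_matI)
      fix i j assume "i < dim_row (1\<^sub>m n - Y)" "j < dim_col (1\<^sub>m n - Y)"
      then have ij: "i < n" "j < n" using that by auto
      have "(A - B) $$ (i, j) = (1\<^sub>m n - X) $$ (i, j)" by (simp only: that(1))
      then show "((A + X) - (B + Y)) $$ (i, j) = (1\<^sub>m n - Y) $$ (i, j)"
        using ij that(2-) by (simp add: algebra_simps)
    qed (use that in auto)
    show ?case
      unfolding NP unfolding step by (rule telescope[OF Suc P mult_carrier_mat[OF N P] Npow Npow])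
  qed
  from this[of m] have 1: "P m - N * P m = 1\<^sub>m n - 0\<^sub>m n n" by (simp only: m)
  have 2: "1\<^sub>m n - 0\<^sub>m n n = (1\<^sub>m n :: 'a Matrix.mat)" by (rule eq_matI) auto
  have "M = 1\<^sub>m n - N" using M by (intro eq_matI) (auto simp: N_def)
  then have "M * P m = (1\<^sub>m n - N) * P m" by (rule arg_cong)
  also have "\<dots> = 1\<^sub>m n * P m - N * P m" by (rule minus_mult_distrib_mat[OF one_carrier_mat N P])
  also have "\<dots> = 1\<^sub>m n" by (simp only: left_mult_one_mat[OF P] 1 2)
  finally have "M * P m = 1\<^sub>m n" .
  then show "M * unip_inverse M = 1\<^sub>m n" by (simp add: inv)
qed

section \<open>The determinant of the deformed curvature\<close>

definition homogeneous_even :: "nat \<Rightarrow> 'v::real_vector evenform \<Rightarrow> bool" where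
  "homogeneous_even k w \<longleftrightarrow> homogeneous k (of_even w)"

lemma homogeneous_even_mult: "homogeneous_even a v \<Longrightarrow> homogeneous_even b w \<Longrightarrow> homogeneous_even (a + b) (v * w)"
  by (simp add: homogeneous_even_def times_evenform.rep_eq homogeneous_mult)

lemma homogeneous_even_sum: "(\<And>i. i \<in> I \<Longrightarrow> homogeneous_even k (f i)) \<Longrightarrow> homogeneous_even k (\<Sum>i\<in>I. f i)"
  unfolding homogeneous_even_def homogeneous_def by (simp add: form_app_of_even_sum)

lemma homogeneous_even_1: "homogeneous_even 0 1"
proof -
  have "form_app (1 :: 'a altform) vs = (if vs = [] then 1 else 0)" for vs
    by (simp only: one_altform_def form_const.rep_eq)
  then show ?thesis by (simp add: homogeneous_even_def homogeneous_def one_evenform.rep_eq)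
qed

lemma homogeneous_even_uminus: "homogeneous_even k w \<Longrightarrow> homogeneous_even k (- w)"
  by (simp add: homogeneous_even_def uminus_evenform.rep_eq homogeneous_uminus)

lemma homogeneous_even_part: "homogeneous k w \<Longrightarrow> homogeneous_even k (even_part w)"
  by (auto simp: homogeneous_even_def homogeneous_def form_app_even_part)

lemma homogeneous_even_prod:
  "finite I \<Longrightarrow> (\<And>i. i \<in> I \<Longrightarrow> homogeneous_even d (f i)) \<Longrightarrow> homogeneous_even (d * card I) (\<Prod>i\<in>I. f i)"
  by (induction I rule: finite_induct) (auto simp: homogeneous_even_1 intro: homogeneous_even_mult)

lemma homogeneous_even_tr_ext_power:
  assumes M: "M \<in> carrier_mat n n" and hom: "\<And>i j. i < n \<Longrightarrow> j < n \<Longrightarrow> homogeneous_even d (M $$ (i, j))"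
  shows "homogeneous_even (d * k) (tr_ext_power k M)"
proof -
  have "homogeneous_even (d * k) (Determinant.det (submatrix M I I))" if I: "I \<subseteq> {..<n}" "card I = k" for I
  proof -
    have "homogeneous_even (d * card I) (signof p * (\<Prod>i\<in>I. M $$ (i, p i)))" if p: "p permutes I" for p
    proof -
      have "p i < n" if "i \<in> I" for i using permutes_in_image[OF p] that I(1) by blast
      then have "homogeneous_even (d * card I) (\<Prod>i\<in>I. M $$ (i, p i))"
        using I(1) finite_subset[OF I(1)] by (intro homogeneous_even_prod hom) auto
      then show ?thesis by (simp add: sign_def homogeneous_even_uminus)
    qed
    then show ?thesis
      unfolding det_principal_submatrix[OF M I(1)] using I(2) by (intro homogeneous_even_sum) auto
  qed
  then show ?thesis
    using M unfolding tr_ext_power_def by (intro homogeneous_even_sum) auto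
qed

lemma even_deg_homogeneous: "homogeneous_even k w \<Longrightarrow> even_deg j w = (if j = k then w else 0)"
  by (rule evenform_eqI) (auto simp: even_deg.rep_eq form_deg.rep_eq homogeneous_even_def homogeneous_def form_app_of_even_simps)

lemma even_deg_sum: "even_deg j (\<Sum>i\<in>I. f i) = (\<Sum>i\<in>I. even_deg j (f i))"
  by (rule evenform_eqI) (simp add: even_deg.rep_eq form_deg.rep_eq form_app_of_even_sum)

lemma t_mat_eq: "t_mat M = map_mat (\<lambda>a. Polynomial.monom a 1) (map_mat even_part M)"
  by (rule eq_matI) (auto simp: t_mat_def)

lemma t_mat_carrier: "M \<in> carrier_mat m n \<Longrightarrow> t_mat M \<in> carrier_mat m n"
  by (simp add: t_mat_def)

text \<open>The entries of the curvature have degree 2, so \<open>tr \<Lambda>\<^sup>k\<close> is the component of degree \<open>2 k\<close> of the total Chern form.\<close>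

lemma chern_poly_eq_det:
  fixes c :: "('x, 'n::finite) chart"
  assumes car: "chern_curv c B h (triv_at B x) x \<in> carrier_mat (vb_rank B) (vb_rank B)"
    and hom: "\<And>i j. i < vb_rank B \<Longrightarrow> j < vb_rank B \<Longrightarrow> homogeneous 2 (chern_curv c B h (triv_at B x) x $$ (i, j))"
  shows "chern_poly c B h x =
    Determinant.det (1\<^sub>m (vb_rank B) + t_mat (form_const chern_const \<cdot>\<^sub>m chern_curv c B h (triv_at B x) x))"
proof -
  let ?n = "vb_rank B"
  define X where "X = map_mat even_part (form_const chern_const \<cdot>\<^sub>m chern_curv c B h (triv_at B x) x)"
  have X: "X \<in> carrier_mat ?n ?n" using car by (simp add: X_def)
  have tr: "homogeneous_even (2 * k) (tr_ext_power k X)" for k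
    by (rule homogeneous_even_tr_ext_power[OF X])
      (use car in \<open>simp add: X_def homogeneous_even_part homogeneous_const_mult hom\<close>)
  have "chern_form k c B h x = tr_ext_power k X" if "k \<le> ?n" for k
  proof -
    have "chern_form k c B h x = (\<Sum>j\<le>?n. even_deg (2 * k) (tr_ext_power j X))"
      by (simp add: chern_form_def total_chern_def X_def[symmetric] det_one_plus[OF X] even_deg_sum)
    also have "\<dots> = (\<Sum>j\<le>?n. if j = k then tr_ext_power k X else 0)"
      by (rule sum.cong[OF refl]) (auto simp: even_deg_homogeneous[OF tr])
    finally show ?thesis using that by simp
  qed
  then have "poly.coeff (chern_poly c B h x) k = tr_ext_power k X" for k
    using tr_ext_power_large[OF X] by (cases "k \<le> ?n") (auto simp: chern_poly_def coeff_sum sum.delta')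
  then show ?thesis
    unfolding t_mat_eq X_def[symmetric] by (intro poly_eqI) (simp only: coeff_det_one_plus_t[OF X])
qed

lemma geometric_inverse:
  fixes d :: "'a::comm_ring_1"
  assumes "d * (1 - a) = e" "a ^ m = 0"
  shows "d = e * (\<Sum>j<m. a ^ j)"
proof -
  have "(1 - a) * (\<Sum>j<m. a ^ j) = 1"
    using one_diff_power_eq[of a m] assms(2) by simp
  then show ?thesis using assms(1) by (metis mult.assoc mult.right_neutral)
qed

text \<open>Exchanging the 1-forms \<open>b j\<close> and \<open>b l\<close> is a transposition of anticommuting factors.\<close>

lemma even_part_anti_rank_one:
  assumes a: "\<And>i. i < n \<Longrightarrow> homogeneous 1 (a i)" and b: "\<And>j. j < n \<Longrightarrow> homogeneous 1 (b j)"
    and lt: "i < n" "j < n" "k < n" "l < n"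
  shows "even_part (a i * b j) * even_part (a k * b l) = - (even_part (a i * b l) * even_part (a k * b j))"
proof -
  have ab: "homogeneous (2 * 1) (a i * b j)" if "i < n" "j < n" for i j
    using homogeneous_mult[OF a[OF that(1)] b[OF that(2)]] by (simp add: numeral_2_eq_2)
  note anti = one_forms_anticommute
  have "b j * a k * b l = - (a k * (b j * b l))" using anti[OF b[OF lt(2)] a[OF lt(3)]] by (simp add: mult.assoc)
  also have "\<dots> = a k * b l * b j" using anti[OF b[OF lt(2)] b[OF lt(4)]] by (simp add: mult.assoc)
  also have "\<dots> = - (b l * a k * b j)" using anti[OF a[OF lt(3)] b[OF lt(4)]] by simp
  finally have "b j * a k * b l = - (b l * a k * b j)" .
  then have "a i * (b j * a k * b l) = a i * - (b l * a k * b j)" by simp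
  then have "(a i * b j) * (a k * b l) = 0 - (a i * b l) * (a k * b j)" by (simp add: mult.assoc)
  then have "even_part ((a i * b j) * (a k * b l)) = even_part (0 - (a i * b l) * (a k * b j))" by simp
  then show ?thesis
    unfolding even_part_diff even_part_mult[OF ab[OF lt(1,2)] ab[OF lt(3,4)]] even_part_mult[OF ab[OF lt(1,4)] ab[OF lt(3,2)]]
    by simp
qed

text \<open>The matrix factors as \<open>M (1 - K)\<close> with \<open>K = u k M\<^sup>-\<^sup>1 t Q\<close>. As \<open>K\<close> is again a column times a row of anticommuting
  elements, \<open>det (1 - K) = 1 / (1 + tr K) = 1 / (1 + u \<sigma>)\<close>, which is expanded as a geometric series.\<close>

lemma det_deformation:
  fixes \<Theta> Q :: "'v::euclidean_space altform Matrix.mat" and k u :: complex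
  assumes \<Theta>: "\<Theta> \<in> carrier_mat n n" "\<And>i j. i < n \<Longrightarrow> j < n \<Longrightarrow> homogeneous 2 (\<Theta> $$ (i, j))"
    and Q: "Q \<in> carrier_mat n n" "\<And>i j. i < n \<Longrightarrow> j < n \<Longrightarrow> Q $$ (i, j) = a i * b j"
    and a: "\<And>i. i < n \<Longrightarrow> homogeneous 1 (a i)" and b: "\<And>j. j < n \<Longrightarrow> homogeneous 1 (b j)"
  defines "M \<equiv> 1\<^sub>m n + t_mat (form_const k \<cdot>\<^sub>m \<Theta>)"
  defines "\<sigma> \<equiv> Polynomial.smult (even_const k) (mat_trace (unip_inverse M * t_mat Q))"
  shows "\<sigma> ^ Suc (DIM('v)) = 0"
    and "\<sigma> ^ m = 0 \<Longrightarrow> Determinant.det (1\<^sub>m n + t_mat (form_const k \<cdot>\<^sub>m (\<Theta> - form_const u \<cdot>\<^sub>m Q))) =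
      Determinant.det M * (\<Sum>j<m. Polynomial.smult (even_const ((- u) ^ j)) (\<sigma> ^ j))"
proof -
  define N where "N = t_mat (form_const k \<cdot>\<^sub>m \<Theta>)"
  define T where "T = t_mat Q"
  have N: "N \<in> carrier_mat n n" and T: "T \<in> carrier_mat n n" using \<Theta>(1) Q(1) by (simp_all add: N_def T_def t_mat_carrier)
  have M: "M \<in> carrier_mat n n" unfolding M_def N_def[symmetric] using N by simp
  have degQ: "homogeneous 2 (Q $$ (i, j))" if "i < n" "j < n" for i j
    unfolding Q(2)[OF that] using homogeneous_mult[OF a[OF that(1)] b[OF that(2)]] by (simp add: numeral_2_eq_2)
  have degT: "poly_min_degree 1 (T $$ (i, j))" if "i < n" "j < n" for i j
    using that Q(1) min_degree_mono[OF min_degree_even_part[OF degQ[OF that]], of 1]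
    by (simp add: T_def t_mat_def poly_min_degree_monom)
  have "poly_min_degree 1 ((1\<^sub>m n - M) $$ (i, j))" if "i < n" "j < n" for i j
  proof -
    have "homogeneous 2 (form_const k * \<Theta> $$ (i, j))" by (rule homogeneous_const_mult[OF \<Theta>(2)[OF that]])
    then have "min_degree 1 (even_part (form_const k * \<Theta> $$ (i, j)))"
      using min_degree_mono[OF min_degree_even_part, of 2 _ 1] by simp
    then have "poly_min_degree 1 (- N $$ (i, j))"
      using that \<Theta>(1) by (simp add: N_def t_mat_def poly_min_degree_uminus poly_min_degree_monom)
    moreover have "(1\<^sub>m n - M) $$ (i, j) = - N $$ (i, j)" unfolding M_def N_def[symmetric] using N that by simp
    ultimately show ?thesis by simp
  qed
  moreover have IM: "1\<^sub>m n - M \<in> carrier_mat n n" by (rule minus_carrier_mat[OF M])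
  ultimately have "poly_min_degree (Suc (DIM('v))) (((1\<^sub>m n - M) ^\<^sub>m Suc (DIM('v))) $$ (i, j))" if "i < n" "j < n" for i j
    using that by (intro mat_power_min_degree[OF IM]) auto
  then have "((1\<^sub>m n - M) ^\<^sub>m Suc (DIM('v))) $$ (i, j) = 0" if "i < n" "j < n" for i j
    using that by (intro poly_min_degree_large[of "Suc (DIM('v))"]) auto
  moreover have "(1\<^sub>m n - M) ^\<^sub>m Suc (DIM('v)) \<in> carrier_mat n n" by (rule pow_carrier_mat[OF IM])
  ultimately have "(1\<^sub>m n - M) ^\<^sub>m Suc (DIM('v)) = 0\<^sub>m n n" by (intro eq_matI) (auto simp del: pow_mat.simps)
  then have nil: "\<exists>m. (1\<^sub>m n - M) ^\<^sub>m m = 0\<^sub>m n n" by blast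
  define B where "B = unip_inverse M"
  have B: "B \<in> carrier_mat n n" "M * B = 1\<^sub>m n" unfolding B_def by (rule unip_inverse_inverse[OF M nil])+
  have BT: "B * T \<in> carrier_mat n n" by (rule mult_carrier_mat[OF B(1) T])
  have \<sigma>: "\<sigma> = Polynomial.smult (even_const k) (mat_trace (B * T))" by (simp add: \<sigma>_def B_def T_def)
  have "poly_min_degree (0 + 1) (B $$ (i, l) * T $$ (l, j))" if "l < n" "j < n" for i j l
    by (rule poly_min_degree_mult[OF poly_min_degree_0 degT[OF that]])
  then have "poly_min_degree 1 ((B * T) $$ (i, j))" if "i < n" "j < n" for i j
    unfolding index_mult_mat_sum[OF B(1) T that] using that by (intro poly_min_degree_sum) auto
  then have "poly_min_degree 1 (mat_trace (B * T))"
    unfolding mat_trace_def using carrier_matD(1)[OF BT] by (intro poly_min_degree_sum) auto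
  then have "poly_min_degree (0 + 1) ([:even_const k:] * mat_trace (B * T))"
    by (intro poly_min_degree_mult poly_min_degree_0)
  then have "poly_min_degree 1 \<sigma>" by (simp add: \<sigma>)
  then show "\<sigma> ^ Suc (DIM('v)) = 0" by (rule poly_min_degree_nilpotent)
  assume nil_\<sigma>: "\<sigma> ^ m = 0"
  define s :: "'v evenform poly" where "s = [:even_const (k * u):]"
  define K :: "'v evenform poly Matrix.mat" where "K = s \<cdot>\<^sub>m (B * T)"
  have K: "K \<in> carrier_mat n n" using BT by (simp add: K_def)
  have relT: "T $$ (i, j) * T $$ (i', j') = - (T $$ (i, j') * T $$ (i', j))"
    if "i < n" "j < n" "i' < n" "j' < n" for i j i' j'
    using that Q(1) even_part_anti_rank_one[where a = a and b = b and n = n, OF a b that]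
    by (simp add: T_def t_mat_def mult_monom minus_monom Q(2))
  have relBT: "(B * T) $$ (i, j) * (B * T) $$ (i', j') = - ((B * T) $$ (i, j') * (B * T) $$ (i', j))"
    if "i < n" "j < n" "i' < n" "j' < n" for i j i' j'
    by (rule anti_rank_one_mult[OF B(1) T relT that])
  have relK: "K $$ (i, j) * K $$ (i', j') = - (K $$ (i, j') * K $$ (i', j))"
    if "i < n" "j < n" "i' < n" "j' < n" for i j i' j'
  proof -
    have "K $$ (i, j) * K $$ (i', j') = s * s * ((B * T) $$ (i, j) * (B * T) $$ (i', j'))"
      using B(1) T that by (simp add: K_def mult_ac del: index_mult_mat(1))
    also have "\<dots> = s * s * - ((B * T) $$ (i, j') * (B * T) $$ (i', j))" by (simp only: relBT[OF that])
    also have "\<dots> = - (K $$ (i, j') * K $$ (i', j))"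
      using B(1) T that by (simp add: K_def mult_ac del: index_mult_mat(1))
    finally show ?thesis .
  qed
  have traceK: "mat_trace K = Polynomial.smult (even_const u) \<sigma>"
  proof -
    have "mat_trace K = s * mat_trace (B * T)"
      using B(1) T by (simp add: K_def mat_trace_def sum_distrib_left del: index_mult_mat(1))
    then show ?thesis by (simp add: \<sigma> s_def even_const_mult mult.commute)
  qed
  have det: "Determinant.det (1\<^sub>m n - K) * (1 + Polynomial.smult (even_const u) \<sigma>) = 1"
    using det_one_minus_anti_rank_one[OF K evenform_poly_double_zero relK] by (simp add: traceK)
  have "1\<^sub>m n + t_mat (form_const k \<cdot>\<^sub>m (\<Theta> - form_const u \<cdot>\<^sub>m Q)) = M - s \<cdot>\<^sub>m T"
  proof (rule eq_matI)
    fix i j assume "i < dim_row (M - s \<cdot>\<^sub>m T)" "j < dim_col (M - s \<cdot>\<^sub>m T)"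
    then have ij: "i < n" "j < n" using T by auto
    have "even_part (form_const k * (\<Theta> $$ (i, j) - form_const u * Q $$ (i, j))) =
        even_part (form_const k * \<Theta> $$ (i, j)) - even_const (k * u) * even_part (Q $$ (i, j))"
      by (simp add: right_diff_distrib even_part_diff even_part_const_mult even_const_mult mult.assoc)
    then show "(1\<^sub>m n + t_mat (form_const k \<cdot>\<^sub>m (\<Theta> - form_const u \<cdot>\<^sub>m Q))) $$ (i, j) = (M - s \<cdot>\<^sub>m T) $$ (i, j)"
      using ij \<Theta>(1) Q(1) by (simp add: M_def T_def t_mat_def s_def smult_monom diff_monom[symmetric])
  qed (use T \<Theta>(1) Q(1) in \<open>auto simp: t_mat_def\<close>)
  also have "\<dots> = M * (1\<^sub>m n - K)"
  proof -
    have "M * (B * T) = T" using assoc_mult_mat[OF M B(1) T] T by (simp add: B(2))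
    then have "M * K = s \<cdot>\<^sub>m T" unfolding K_def mult_smult_distrib[OF M BT] by simp
    then show ?thesis using mult_minus_distrib_mat[OF M one_carrier_mat K] M by simp
  qed
  finally have "Determinant.det (1\<^sub>m n + t_mat (form_const k \<cdot>\<^sub>m (\<Theta> - form_const u \<cdot>\<^sub>m Q))) =
      Determinant.det M * Determinant.det (1\<^sub>m n - K)"
    by (simp only: det_mult[OF M minus_carrier_mat[OF K]])
  moreover define z where "z = Polynomial.smult (even_const (- u)) \<sigma>"
  have z_power: "z ^ j = Polynomial.smult (even_const ((- u) ^ j)) (\<sigma> ^ j)" for j
    by (simp add: z_def smult_power even_const.hom_power)
  have "Determinant.det (1\<^sub>m n - K) = 1 * (\<Sum>j<m. z ^ j)"
  proof (rule geometric_inverse)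
    show "Determinant.det (1\<^sub>m n - K) * (1 - z) = 1" using det by (simp add: z_def even_const_minus)
    show "z ^ m = 0" by (simp add: z_power nil_\<sigma>)
  qed
  ultimately show "Determinant.det (1\<^sub>m n + t_mat (form_const k \<cdot>\<^sub>m (\<Theta> - form_const u \<cdot>\<^sub>m Q))) =
      Determinant.det M * (\<Sum>j<m. Polynomial.smult (even_const ((- u) ^ j)) (\<sigma> ^ j))"
    by (simp add: z_power)
qed

text \<open>\<open>(- u)\<^sup>j / u\<close> has the integral \<open>(- 1)\<^sup>j / j\<close> for \<open>j > 0\<close>.\<close>

lemma integral_difference_quotient:
  fixes y :: "nat \<Rightarrow> complex"
  assumes "m > 0"
  shows "integral {0..1} (\<lambda>u. ((\<Sum>j<m. (- complex_of_real u) ^ j * y j) - (\<Sum>j<m. (- complex_of_real 0) ^ j * y j)) / of_real u) =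
    (\<Sum>j\<in>{1..<m}. (-1) ^ j / of_nat j * y j)"
proof -
  have split: "{..<m} = insert 0 {1..<m}" using assms by auto
  have "((\<lambda>u. \<Sum>j\<in>{1..<m}. (-1) ^ j * y j * complex_of_real u ^ (j - 1)) has_integral
      (\<Sum>j\<in>{1..<m}. (-1) ^ j * y j * (1 / of_nat j))) {0..1}"
  proof (intro has_integral_sum has_integral_mult_right)
    fix j assume j: "j \<in> {1..<m}"
    have "((\<lambda>u. complex_of_real u ^ (j - 1)) has_integral (complex_of_real 1 ^ j / of_nat j - complex_of_real 0 ^ j / of_nat j)) {0..1}"
    proof (rule fundamental_theorem_of_calculus)
      fix u :: real
      have "((\<lambda>z. z ^ j / of_nat j) has_field_derivative complex_of_real u ^ (j - 1)) (at (complex_of_real u))"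
        using j by (auto intro!: derivative_eq_intros)
      from has_vector_derivative_real_field[OF this]
      show "((\<lambda>u. complex_of_real u ^ j / of_nat j) has_vector_derivative complex_of_real u ^ (j - 1)) (at u within {0..1})" .
    qed simp
    then show "((\<lambda>u. complex_of_real u ^ (j - 1)) has_integral 1 / of_nat j) {0..1}" using j by (cases j) auto
  qed simp
  then have "((\<lambda>u. ((\<Sum>j<m. (- complex_of_real u) ^ j * y j) - (\<Sum>j<m. (- complex_of_real 0) ^ j * y j)) / of_real u) has_integral
      (\<Sum>j\<in>{1..<m}. (-1) ^ j * y j * (1 / of_nat j))) {0..1}"
  (* the quotient has the value 0 at u = 0 because x / 0 = 0, but a single point is negligible *)
  proof (rule has_integral_spike[OF negligible_sing[of 0], rotated])
    fix u :: real assume u: "u \<in> {0..1} - {0}"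
    have "(\<Sum>j<m. (- complex_of_real u) ^ j * y j) - (\<Sum>j<m. (- complex_of_real 0) ^ j * y j) =
        (\<Sum>j\<in>{1..<m}. (- complex_of_real u) ^ j * y j)"
    proof -
      have "(\<Sum>j<m. (- complex_of_real 0) ^ j * y j) = (\<Sum>j<m. if j = 0 then y 0 else 0)"
        by (intro sum.cong) auto
      also have "\<dots> = y 0" using assms by simp
      finally show ?thesis unfolding split by simp
    qed
    also have "\<dots> = (\<Sum>j\<in>{1..<m}. (-1) ^ j * y j * complex_of_real u ^ (j - 1)) * of_real u"
      unfolding sum_distrib_right
    proof (rule sum.cong[OF refl])
      fix j assume "j \<in> {1..<m}"
      then obtain i where "j = Suc i" by (cases j) auto
      then show "(- complex_of_real u) ^ j * y j = (-1) ^ j * y j * complex_of_real u ^ (j - 1) * of_real u"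
        using power_minus[of "complex_of_real u" i] by simp
    qed
    finally show "((\<Sum>j<m. (- complex_of_real u) ^ j * y j) - (\<Sum>j<m. (- complex_of_real 0) ^ j * y j)) / of_real u =
        (\<Sum>j\<in>{1..<m}. (-1) ^ j * y j * complex_of_real u ^ (j - 1))" using u by simp
  qed
  then have "integral {0..1} (\<lambda>u. ((\<Sum>j<m. (- complex_of_real u) ^ j * y j) - (\<Sum>j<m. (- complex_of_real 0) ^ j * y j)) / of_real u) =
      (\<Sum>j\<in>{1..<m}. (-1) ^ j * y j * (1 / of_nat j))" by (rule integral_unique)
  then show ?thesis by (simp add: mult_ac)
qed

section \<open>Bott-Chern forms of line subbundles\<close>

lemma map_even_part_const_mult:
  assumes "A \<in> carrier_mat m n" "B \<in> carrier_mat n k"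
  shows "map_mat even_part (mat_const A * B) = map_mat even_const A * map_mat even_part B"
proof (rule eq_matI)
  fix i j assume "i < dim_row (map_mat even_const A * map_mat even_part B)" "j < dim_col (map_mat even_const A * map_mat even_part B)"
  then have ij: "i < m" "j < k" using assms by auto
  show "map_mat even_part (mat_const A * B) $$ (i, j) = (map_mat even_const A * map_mat even_part B) $$ (i, j)"
    using assms ij
    by (simp add: index_mult_mat_sum[of _ m n _ k] even_part_sum even_part_const_mult del: index_mult_mat(1))
qed (use assms in auto)

lemma map_even_part_mult_const:
  assumes "A \<in> carrier_mat m n" "B \<in> carrier_mat n k"
  shows "map_mat even_part (A * mat_const B) = map_mat even_part A * map_mat even_const B"
proof (rule eq_matI)
  fix i j assume "i < dim_row (map_mat even_part A * map_mat even_const B)" "j < dim_col (map_mat even_part A * map_mat even_const B)"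
  then have ij: "i < m" "j < k" using assms by auto
  show "map_mat even_part (A * mat_const B) $$ (i, j) = (map_mat even_part A * map_mat even_const B) $$ (i, j)"
    using assms ij
    by (simp add: index_mult_mat_sum[of _ m n _ k] even_part_sum even_part_mult_const del: index_mult_mat(1))
qed (use assms in auto)

lemma map_even_part_smult: "map_mat even_part (form_const a \<cdot>\<^sub>m A) = even_const a \<cdot>\<^sub>m map_mat even_part A"
  by (rule eq_matI) (auto simp: even_part_const_mult)

text \<open>The block on \<open>H\<close> of the curvature of \<open>\<nabla>\<^sub>u\<close> is known from \<open>curv_u_quotient\<close>, and only this block survives in the
  coefficient of \<open>\<lambda>\<close>.\<close>

lemma (in hermitian_sequence) bott_chern_D_line:
  assumes y: "y \<in> W" and T: "T = triv_at E y"
    and f: "f \<in> carrier_mat r 1" and \<phi>: "\<phi> \<in> carrier_mat 1 r" and f\<phi>: "f * \<phi> = proj_sub y"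
    and inv: "\<phi> * f = 1\<^sub>m 1" "\<phi> * sm y = 0\<^sub>m 1 q" "gm y * f = 0\<^sub>m q 1" and rank: "r = Suc q"
  shows "bott_chern_D (Suc k) u c E h S y = poly.coeff (Determinant.det (1\<^sub>m q + t_mat (form_const chern_const \<cdot>\<^sub>m
    (chern_curv c H h' T' y - form_const (of_real u) \<cdot>\<^sub>m second_fund_square c E h T S H h' T' p y)))) k"
proof -
  let ?e = "map_mat even_const :: complex Matrix.mat \<Rightarrow> (complex ^ 'n) evenform Matrix.mat"
  let ?\<Theta> = "curv_u u c E h T S y"
  note c = f[unfolded rank] \<phi>[unfolded rank] gm_carrier[OF y, unfolded rank] sm_carrier[OF y, unfolded rank]
    curv_u_carrier[OF y, unfolded rank, of u]
  define X where "X = map_mat even_part (form_const chern_const \<cdot>\<^sub>m ?\<Theta>)"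
  have X: "X \<in> carrier_mat (Suc q) (Suc q)" using c(5) by (simp add: X_def)
  have e: "?e f \<in> carrier_mat (Suc q) 1" "?e (sm y) \<in> carrier_mat (Suc q) q"
    "?e \<phi> \<in> carrier_mat 1 (Suc q)" "?e (gm y) \<in> carrier_mat q (Suc q)" using c by simp_all
  have zero: "?e (0\<^sub>m m n) = 0\<^sub>m m n" for m n by (rule eq_matI) auto
  have einv: "?e \<phi> * ?e f = 1\<^sub>m 1" "?e \<phi> * ?e (sm y) = 0\<^sub>m 1 q" "?e (gm y) * ?e f = 0\<^sub>m q 1" "?e (gm y) * ?e (sm y) = 1\<^sub>m q"
    using inv gm_sm[OF y]
      even_const.mat_hom_mult[OF c(2,1)] even_const.mat_hom_mult[OF c(2,4)] even_const.mat_hom_mult[OF c(3,1)]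
      even_const.mat_hom_mult[OF c(3,4)] even_const.mat_hom_one zero
    by metis+
  have R: "map_mat even_part (proj_mat E h T S y) = ?e f * ?e \<phi>"
    unfolding even_const.mat_hom_mult[OF c(1,2), symmetric] f\<phi> proj_mats(1)[OF y]
    by (rule eq_matI) (simp_all add: even_const_def)
  have "bott_chern_D (Suc k) u c E h S y =
      poly.coeff (tr_ext_power (Suc k) (map_mat (\<lambda>a. [:a:]) X + map_mat (\<lambda>a. [:0, a:]) (?e f * ?e \<phi>))) 1"
  proof -
    have "map_mat (\<lambda>a. [:even_part a:]) A = map_mat (\<lambda>a. [:a:]) (map_mat even_part A)"
      "map_mat (\<lambda>a. [:0, even_part a:]) A = map_mat (\<lambda>a. [:0, a:]) (map_mat even_part A)"
      for A :: "(complex ^ 'n) altform Matrix.mat" by (intro eq_matI; simp)+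
    then show ?thesis unfolding R[symmetric] X_def bott_chern_D_def T[symmetric] by simp
  qed
  also have "\<dots> = tr_ext_power k (?e (gm y) * X * ?e (sm y))"
    by (rule coeff_tr_ext_power_line[OF X e(1,2,3,4) einv])
  also have "?e (gm y) * X * ?e (sm y) = map_mat even_part (form_const chern_const \<cdot>\<^sub>m
      (chern_curv c H h' T' y - form_const (of_real u) \<cdot>\<^sub>m second_fund_square c E h T S H h' T' p y))"
  proof -
    have Y: "map_mat even_part ?\<Theta> \<in> carrier_mat (Suc q) (Suc q)" using c(5) by simp
    have gY: "mat_const (gm y) * ?\<Theta> \<in> carrier_mat q (Suc q)" using c(3,5) by simp
    show ?thesis
      unfolding curv_u_quotient[OF y, symmetric] X_def map_even_part_smult
        map_even_part_mult_const[OF gY c(4)] map_even_part_const_mult[OF c(3,5)]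
        mult_smult_distrib[OF e(4) Y] mult_smult_assoc_mat[OF mult_carrier_mat[OF e(4) Y] e(2)] ..
  qed
  finally have "bott_chern_D (Suc k) u c E h S y = tr_ext_power k (map_mat even_part (form_const chern_const \<cdot>\<^sub>m
      (chern_curv c H h' T' y - form_const (of_real u) \<cdot>\<^sub>m second_fund_square c E h T S H h' T' p y)))" .
  moreover have "second_fund_square c E h T S H h' T' p y \<in> carrier_mat q q"
    by (intro carrier_matI) (simp_all add: second_fund_square_def hom_mat_def)
  then have "map_mat even_part (form_const chern_const \<cdot>\<^sub>m
      (chern_curv c H h' T' y - form_const (of_real u) \<cdot>\<^sub>m second_fund_square c E h T S H h' T' p y)) \<in> carrier_mat q q"
    by (simp add: minus_carrier_mat)
  ultimately show ?thesis unfolding t_mat_eq by (simp only: coeff_det_one_plus_t)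
qed

lemma (in hermitian_sequence) bott_chern_form_large:
  assumes y: "y \<in> W" and T: "T = triv_at E y" and k: "k > r"
  shows "bott_chern_form k E h S c y = 0"
proof -
  have "bott_chern_D k u c E h S y = 0" for u
  proof -
    have "map_mat (\<lambda>a. [:even_part a:]) (form_const chern_const \<cdot>\<^sub>m curv_u u c E h T S y) +
        map_mat (\<lambda>a. [:0, even_part a:]) (proj_mat E h T S y) \<in> carrier_mat r r"
      using curv_u_carrier[OF y, of u] by (simp add: proj_mat_def hom_mat_def)
    then show ?thesis unfolding bott_chern_D_def T[symmetric] by (simp only: tr_ext_power_large[OF _ k] coeff_0)
  qed
  then have "bott_chern_form k E h S c y = Abs_altform (\<lambda>vs. form_app 0 vs)"
    by (simp add: bott_chern_form_def zero_altform.rep_eq)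
  then show ?thesis by (simp add: form_app_inverse)
qed

text \<open>The same bound \<open>m\<close> is to cut off the geometric series whose integral is compared with the logarithm.\<close>

lemma unip_log_one_plus:
  fixes a :: "'v::real_vector evenform poly"
  assumes "a ^ n = 0"
  obtains m where "m > 0" "a ^ m = 0"
    "- unip_log (1 + a) = (\<Sum>j\<in>{1..<m}. Polynomial.smult (even_const ((-1) ^ j / of_nat j)) (a ^ j))"
proof
  define m where "m = (LEAST m. (- a) ^ m = 0)"
  have "(- a) ^ n = 0" using assms by (simp add: power_minus[of a n])
  then have m: "(- a) ^ m = 0" unfolding m_def by (rule LeastI)
  then show "a ^ m = 0" using power_minus[of "- a" m] by (simp only: m minus_minus mult_zero_right)
  show "m > 0" using m by (cases m) auto
  have "(-1 :: 'v evenform poly) ^ j = [:even_const ((-1) ^ j):]" for j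
    unfolding minus_one_power_iff by (simp add: even_const_minus one_pCons)
  then have "(- a) ^ j = Polynomial.smult (even_const ((-1) ^ j)) (a ^ j)" for j
    by (simp add: power_minus[of a j])
  then have "Polynomial.smult (even_const (1 / of_nat j)) ((- a) ^ j) = Polynomial.smult (even_const ((-1) ^ j / of_nat j)) (a ^ j)" for j
    by (simp only: smult_smult even_const_mult[symmetric]) (simp add: mult.commute)
  then show "- unip_log (1 + a) = (\<Sum>j\<in>{1..<m}. Polynomial.smult (even_const ((-1) ^ j / of_nat j)) (a ^ j))"
    by (simp add: unip_log_def m_def[symmetric])
qed

text \<open>The formula at a point: the integral over \<open>u\<close> of the geometric series in \<open>- u \<sigma>\<close> is the logarithmic series. The
  vector \<open>f0\<close> spans the fibre of the subbundle.\<close>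

theorem (in hermitian_sequence) bott_chern_poly_line:
  assumes y: "y \<in> W" and T: "T = triv_at E y" and T': "T' = triv_at H y"
    and f0: "f0 \<in> carrier_vec r" "f0 \<noteq> 0\<^sub>v r" "gm y *\<^sub>v f0 = 0\<^sub>v q"
    and ker: "\<And>v. v \<in> carrier_vec r \<Longrightarrow> gm y *\<^sub>v v = 0\<^sub>v q \<Longrightarrow> \<exists>a. v = a \<cdot>\<^sub>v f0"
  shows "poly.coeff (bott_chern_poly E h S c y) k = of_even (poly.coeff
    (- Polynomial.monom 1 1 * chern_poly c H h' y *
     unip_log (1 + Polynomial.smult (even_const chern_const) (mat_trace
       (unip_inverse (1\<^sub>m q + t_mat (form_const chern_const \<cdot>\<^sub>m chern_curv c H h' T' y)) *
        t_mat (second_fund_square c E h T S H h' T' p y))))) k)"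
proof -
  let ?\<Theta> = "chern_curv c H h' T' y" and ?Q = "second_fund_square c E h T S H h' T' p y"
  define C where "C = chern_poly c H h' y"
  define \<sigma> where "\<sigma> = Polynomial.smult (even_const chern_const) (mat_trace
       (unip_inverse (1\<^sub>m q + t_mat (form_const chern_const \<cdot>\<^sub>m ?\<Theta>)) * t_mat ?Q))"
  obtain f \<phi> where f: "f \<in> carrier_mat r 1" and \<phi>: "\<phi> \<in> carrier_mat 1 r" and f\<phi>: "f * \<phi> = proj_sub y"
    and inv: "\<phi> * f = 1\<^sub>m 1" "\<phi> * sm y = 0\<^sub>m 1 q" "gm y * f = 0\<^sub>m q 1" and rank: "r = Suc q"
    by (rule line_splitting[OF y f0 ker])
  obtain a b where ab: "\<And>i. i < q \<Longrightarrow> homogeneous 1 (a i)" "\<And>j. j < q \<Longrightarrow> homogeneous 1 (b j)"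
    and Q: "\<And>i j. i < q \<Longrightarrow> j < q \<Longrightarrow> ?Q $$ (i, j) = a i * b j" "?Q \<in> carrier_mat q q"
  proof (rule second_fund_square_rank_one[OF y f \<phi> f\<phi>])
    fix a b
    assume *: "\<And>i. i < q \<Longrightarrow> homogeneous 1 (a i)" "\<And>j. j < q \<Longrightarrow> homogeneous 1 (b j)"
      "\<And>i j. i < q \<Longrightarrow> j < q \<Longrightarrow> ?Q $$ (i, j) = a i * b j" "?Q \<in> carrier_mat q q"
    show thesis by (rule that[of a b]; fact *)
  qed
  note deform = det_deformation[where a = a and b = b and k = chern_const and n = q and \<Theta> = ?\<Theta> and Q = ?Q]
  have nilpotent: "\<sigma> ^ Suc (DIM(complex ^ 'n)) = 0"
    unfolding \<sigma>_def by (rule deform(1); fact chern_curv_carrier[OF y] homogeneous_chern_curv[OF y] Q ab)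
  have det: "Determinant.det (1\<^sub>m q + t_mat (form_const chern_const \<cdot>\<^sub>m (?\<Theta> - form_const u \<cdot>\<^sub>m ?Q))) =
      Determinant.det (1\<^sub>m q + t_mat (form_const chern_const \<cdot>\<^sub>m ?\<Theta>)) *
      (\<Sum>j<m. Polynomial.smult (even_const ((- u) ^ j)) (\<sigma> ^ j))" if "\<sigma> ^ m = 0" for u m
    unfolding \<sigma>_def
    by (rule deform(2); fact chern_curv_carrier[OF y] homogeneous_chern_curv[OF y] Q ab that[unfolded \<sigma>_def])
  have C: "C = Determinant.det (1\<^sub>m q + t_mat (form_const chern_const \<cdot>\<^sub>m ?\<Theta>))"
    unfolding C_def T' by (rule chern_poly_eq_det) (use chern_curv_carrier[OF y] homogeneous_chern_curv[OF y] in \<open>simp_all add: T'\<close>)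
  obtain m where m: "m > 0" "\<sigma> ^ m = 0"
    and log: "- unip_log (1 + \<sigma>) = (\<Sum>j\<in>{1..<m}. Polynomial.smult (even_const ((-1) ^ j / of_nat j)) (\<sigma> ^ j))"
    by (rule unip_log_one_plus[OF nilpotent])
  let ?Y = "\<lambda>k j vs. form_app (of_even (poly.coeff (C * \<sigma> ^ j) k)) vs"
  have D: "form_app (of_even (bott_chern_D (Suc k) u c E h S y)) vs = (\<Sum>j<m. (- complex_of_real u) ^ j * ?Y k j vs)" for k u vs
  proof -
    have "bott_chern_D (Suc k) u c E h S y =
        poly.coeff (C * (\<Sum>j<m. Polynomial.smult (even_const ((- complex_of_real u) ^ j)) (\<sigma> ^ j))) k"
      unfolding bott_chern_D_line[OF y T f \<phi> f\<phi> inv rank] det[OF m(2)] C by (rule refl)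
    also have "\<dots> = (\<Sum>j<m. even_const ((- complex_of_real u) ^ j) * poly.coeff (C * \<sigma> ^ j) k)"
      by (simp only: sum_distrib_left mult_smult_right coeff_sum coeff_smult)
    finally show ?thesis by (simp only: form_app_of_even_sum form_app_even_const_mult)
  qed
  define R where "R = - Polynomial.monom 1 1 * C * unip_log (1 + \<sigma>)"
  have R: "R = Polynomial.monom 1 1 * (C * (\<Sum>j\<in>{1..<m}. Polynomial.smult (even_const ((-1) ^ j / of_nat j)) (\<sigma> ^ j)))"
    unfolding log[symmetric] by (simp add: R_def mult.assoc)
  have coeff_Suc: "bott_chern_form (Suc k) E h S c y = of_even (poly.coeff R (Suc k))" for k
  proof -
    have "poly.coeff R (Suc k) = (\<Sum>j\<in>{1..<m}. even_const ((-1) ^ j / of_nat j) * poly.coeff (C * \<sigma> ^ j) k)"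
      unfolding R coeff_monom_mult by (simp add: sum_distrib_left coeff_sum )
    then have "form_app (of_even (poly.coeff R (Suc k))) vs = (\<Sum>j\<in>{1..<m}. (-1) ^ j / of_nat j * ?Y k j vs)" for vs
      by (simp only: form_app_of_even_sum form_app_even_const_mult)
    then have "bott_chern_form (Suc k) E h S c y = Abs_altform (form_app (of_even (poly.coeff R (Suc k))))"
      unfolding bott_chern_form_def D integral_difference_quotient[OF m(1)]
      by (intro arg_cong[where f = Abs_altform] ext) (rule sym)
    then show ?thesis by (simp add: form_app_inverse)
  qed
  have "poly.coeff (bott_chern_poly E h S c y) k = of_even (poly.coeff R k)"
  proof (cases k)
    case 0
    then show ?thesis by (simp add: bott_chern_poly_def coeff_sum R coeff_monom_mult zero_evenform.rep_eq)
  next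
    case (Suc l)
    have "poly.coeff (bott_chern_poly E h S c y) k = (if k \<le> r then bott_chern_form k E h S c y else 0)"
      using Suc by (simp add: bott_chern_poly_def coeff_sum sum.delta)
    also have "\<dots> = bott_chern_form k E h S c y" using bott_chern_form_large[OF y T, of k] by simp
    finally show ?thesis using coeff_Suc[of l] Suc by simp
  qed
  then show ?thesis by (simp only: R_def C_def \<sigma>_def)
qed

lemma bc_equal_pointwise:
  fixes \<A> :: "('x, 'n::finite) chart set"
  assumes "\<And>c x. c \<in> \<A> \<Longrightarrow> x \<in> fst c \<Longrightarrow> v c x = w c x"
  shows "bc_equal \<A> v w"
proof -
  have app0: "form_app 0 vs = 0" for vs :: "(complex ^ 'n) list" by (simp add: zero_altform.rep_eq)
  have chart0: "in_chart c (\<lambda>_. 0 :: complex) = (\<lambda>_. 0)" for c :: "('x, 'n) chart" by (simp add: in_chart_def fun_eq_iff)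
  have "smooth_form \<A> k l (\<lambda>_ _. 0)" for k l
    unfolding smooth_form_def bidegree_def by (auto simp: span_zero app0 chart0)
  moreover have "del c (\<lambda>_. 0) x = 0" "delbar c (\<lambda>_. 0) x = 0" for c :: "('x, 'n) chart" and x
  proof -
    have "frechet_derivative (\<lambda>_. 0) (at z) v = (0 :: complex)" for z v :: "complex ^ 'n"
      by (simp add: frechet_derivative_const)
    then show "del c (\<lambda>_. 0) x = 0" "delbar c (\<lambda>_. 0) x = 0"
      by (simp_all add: del_def delbar_def alt_deriv_def in_chart_def app0 d10_def d01_def zero_altform_def map_fun_def)
  qed
  ultimately show ?thesis
    unfolding bc_equal_def by (intro exI[of _ "\<lambda>_ _ _. 0"]) (use assms in auto)
qed

lemma holo_bundle_mapE:
  assumes "holo_bundle_map \<A> B C f" "T \<in> vb_trivs B" "T' \<in> vb_trivs C"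
  obtains g where "holo_mat \<A> (fst T \<inter> fst T') (vb_rank C) (vb_rank B) g"
    "\<And>e. vb_proj B e \<in> fst T \<inter> fst T' \<Longrightarrow> snd T' (f e) = g (vb_proj B e) *\<^sub>v snd T e"
proof -
  obtain U \<tau> V \<sigma> where TT: "T = (U, \<tau>)" "T' = (V, \<sigma>)" by (cases T; cases T') blast
  have "\<exists>g. holo_mat \<A> (U \<inter> V) (vb_rank C) (vb_rank B) g \<and>
      (\<forall>e. vb_proj B e \<in> U \<inter> V \<longrightarrow> \<sigma> (f e) = g (vb_proj B e) *\<^sub>v \<tau> e)"
    using assms unfolding holo_bundle_map_def TT by (auto dest!: bspec)
  then show ?thesis using that unfolding TT by auto
qed

theorem proposition3:
  fixes \<A> :: "('x::{t2_space, second_countable_topology}, 'n::finite) chart set"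
    and F :: "('x, 'f) vbundle" and E :: "('x, 'e) vbundle" and H :: "('x, 'q) vbundle"
    and i :: "'f \<Rightarrow> 'e" and p :: "'e \<Rightarrow> 'q"
    and h\<^sub>F :: "'f \<Rightarrow> 'f \<Rightarrow> complex" and h :: "'e \<Rightarrow> 'e \<Rightarrow> complex" and h\<^sub>H :: "'q \<Rightarrow> 'q \<Rightarrow> complex"
  assumes "complex_manifold \<A>"
    and "holo_bundle \<A> F" and "holo_bundle \<A> E" and "holo_bundle \<A> H"
    and "short_exact \<A> F E H i p"
    and "hermitian_metric \<A> F h\<^sub>F" and "hermitian_metric \<A> E h" and "hermitian_metric \<A> H h\<^sub>H"
    and "\<forall>x. \<forall>a\<in>fiber F x. \<forall>b\<in>fiber F x. h\<^sub>F a b = h (i a) (i b)"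
    and "\<forall>x. \<forall>a\<in>perp E h (image_bundle F i) x. \<forall>b\<in>perp E h (image_bundle F i) x.
           h\<^sub>H (p a) (p b) = h a b"
    and "vb_rank F = 1"
  shows "\<forall>k. bc_equal \<A>
    (\<lambda>c x. poly.coeff (bott_chern_poly E h (image_bundle F i) c x) k)
    (\<lambda>c x. of_even (poly.coeff
      (- Polynomial.monom 1 1 * chern_poly c H h\<^sub>H x *
       unip_log (1 + Polynomial.smult (even_const chern_const) (mat_trace
         (unip_inverse (1\<^sub>m (vb_rank H) +
            t_mat (form_const chern_const \<cdot>\<^sub>m chern_curv c H h\<^sub>H (triv_at H x) x)) *
          t_mat (second_fund_square c E h (triv_at E x) (image_bundle F i)
                   H h\<^sub>H (triv_at H x) p x))))) k))"
proof (intro allI bc_equal_pointwise)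
  fix k :: nat and c :: "('x, 'n) chart" and x :: 'x
  assume c: "c \<in> \<A>" and x: "x \<in> fst c"
  note manifold = assms(1) and F = assms(2) and holo_E = assms(3) and holo_H = assms(4)
  note exact = assms(5)[unfolded short_exact_def]
  define T where "T = triv_at E x"
  define T' where "T' = triv_at H x"
  define T\<^sub>F where "T\<^sub>F = triv_at F x"
  have T: "T \<in> vb_trivs E" "x \<in> fst T" and T': "T' \<in> vb_trivs H" "x \<in> fst T'" and T\<^sub>F: "T\<^sub>F \<in> vb_trivs F" "x \<in> fst T\<^sub>F"
    unfolding T_def T'_def T\<^sub>F_def by (rule triv_at_in[OF holo_E] triv_at_in[OF holo_H] triv_at_in[OF F])+
  have proj_i: "vb_proj E (i f) = vb_proj F f" for f using exact by (simp add: holo_bundle_map_def)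
  have proj_p: "vb_proj H (p e) = vb_proj E e" for e using exact by (simp add: holo_bundle_map_def)
  obtain gm where gm: "holo_mat \<A> (fst T \<inter> fst T') (vb_rank H) (vb_rank E) gm"
      "\<And>e. vb_proj E e \<in> fst T \<inter> fst T' \<Longrightarrow> snd T' (p e) = gm (vb_proj E e) *\<^sub>v snd T e"
    using holo_bundle_mapE[OF _ T(1) T'(1)] exact by blast
  obtain gi where "holo_mat \<A> (fst T\<^sub>F \<inter> fst T) (vb_rank E) (vb_rank F) gi"
      "\<And>f. vb_proj F f \<in> fst T\<^sub>F \<inter> fst T \<Longrightarrow> snd T (i f) = gi (vb_proj F f) *\<^sub>v snd T\<^sub>F f"
    using holo_bundle_mapE[OF _ T\<^sub>F(1) T(1)] exact by blast
  then have gi: "gi x \<in> carrier_mat (vb_rank E) 1" "\<And>f. f \<in> fiber F x \<Longrightarrow> snd T (i f) = gi x *\<^sub>v snd T\<^sub>F f"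
    using T T\<^sub>F assms(11) by (simp_all add: holo_mat_def fiber_def)
  let ?S = "image_bundle F i"
  have S: "?S y = {e \<in> fiber E y. fiber_zero H (p e)}" for y
    using exact proj_i by (auto simp: image_bundle_def fiber_def)
  interpret hermitian_sequence \<A> E H p ?S h h\<^sub>H c T T' gm
    by unfold_locales (use manifold c holo_E holo_H T T' assms(7,8,10) proj_p exact S gm in blast)+
  have xW: "x \<in> W" using x T T' by (simp add: W_def)
  (* F has rank one, so the image of its frame vector spans the kernel of p *)
  define f where "f = frame F T\<^sub>F x 0"
  have f: "f \<in> fiber F x" "snd T\<^sub>F f = unit_vec 1 0"
    using frame_coord[OF F T\<^sub>F, of 0] assms(11) by (simp_all add: f_def)
  define f0 where "f0 = snd T (i f)"
  have S_x: "i f' \<in> ?S x" if "f' \<in> fiber F x" for f' using that by (simp add: image_bundle_def)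
  have f0: "f0 \<in> carrier_vec r" "gm x *\<^sub>v f0 = 0\<^sub>v q"
    using S_x[OF f(1)] S_coord[OF xW] triv_coord(1)[OF holo_E T, of "i f"] by (auto simp: f0_def)
  have span: "\<exists>a. v = a \<cdot>\<^sub>v f0" if v: "v \<in> carrier_vec r" "gm x *\<^sub>v v = 0\<^sub>v q" for v
  proof -
    obtain e where e: "e \<in> fiber E x" "snd T e = v" using triv_coord(2)[OF holo_E T v(1)] by blast
    then have "e \<in> ?S x" using S_coord[OF xW] v(2) by simp
    then obtain f' where f': "f' \<in> fiber F x" "e = i f'" by (auto simp: image_bundle_def)
    have "snd T\<^sub>F f' \<in> carrier_vec 1" using triv_coord(1)[OF F T\<^sub>F f'(1)] assms(11) by simp
    then have "snd T\<^sub>F f' = (snd T\<^sub>F f' $ 0) \<cdot>\<^sub>v snd T\<^sub>F f" unfolding f(2) by (intro eq_vecI) auto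
    then have "v = gi x *\<^sub>v ((snd T\<^sub>F f' $ 0) \<cdot>\<^sub>v snd T\<^sub>F f)" using e(2) f' gi(2) by metis
    also have "\<dots> = (snd T\<^sub>F f' $ 0) \<cdot>\<^sub>v f0"
      unfolding f0_def gi(2)[OF f(1)] by (rule mult_mat_vec[OF gi(1)]) (simp add: f(2))
    finally show ?thesis by blast
  qed
  have "f0 \<noteq> 0\<^sub>v r"
  proof
    assume zero: "f0 = 0\<^sub>v r"
    obtain f' where f': "f' \<in> fiber F x" "snd T\<^sub>F f' = 0\<^sub>v 1" using triv_coord(2)[OF F T\<^sub>F, of "0\<^sub>v 1"] assms(11) by auto
    have "gi x *\<^sub>v 0\<^sub>v 1 = 0\<^sub>v r" using gi(1) by (intro eq_vecI) auto
    then have "snd T (i f') = 0\<^sub>v r" unfolding gi(2)[OF f'(1)] f'(2) .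
    then have "i f' = i f"
      using zero triv_coord(3)[OF holo_E T, of "i f'" "i f"] f(1) f'(1) proj_i by (simp add: f0_def fiber_def)
    then have "f' = f" using exact by (simp add: inj_eq)
    then have "unit_vec 1 0 = (0\<^sub>v 1 :: complex Matrix.vec)" using f(2) f'(2) by simp
    then have "unit_vec 1 0 $ 0 = (0\<^sub>v 1 :: complex Matrix.vec) $ 0" by (rule arg_cong)
    then show False by simp
  qed
  from bott_chern_poly_line[OF xW T_def T'_def f0(1) this f0(2) span, of k]
  show "poly.coeff (bott_chern_poly E h (image_bundle F i) c x) k = of_even (poly.coeff
      (- Polynomial.monom 1 1 * chern_poly c H h\<^sub>H x *
       unip_log (1 + Polynomial.smult (even_const chern_const) (mat_trace
         (unip_inverse (1\<^sub>m (vb_rank H) +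
            t_mat (form_const chern_const \<cdot>\<^sub>m chern_curv c H h\<^sub>H (triv_at H x) x)) *
          t_mat (second_fund_square c E h (triv_at E x) (image_bundle F i)
                   H h\<^sub>H (triv_at H x) p x))))) k)"
    unfolding T_def T'_def .
qed

end
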